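(* Let $G$ be a higher-rank Sol-type group with a left-invariant Riemannian metric $g$ splitting $G$ perpendicularly, let $d$ be the distance induced by $g$, and let $\rho_g$ be the box-geodesic distance associated to $g$. There is a constant $C$ such that $|d(x,y)-\rho_g(x,y)|\le C$ for all $x,y\in G$.
   Context: Higher-rank Sol-type group: $G=\mathbf{N}\rtimes\mathbb{R}^k$ with $k\ge2$, $\mathbf{N}=\prod_{i=1}^n\mathbf{N}_i$, where each $\mathbf{N}_i$ is a simply connected nilpotent Lie group with Lie algebra $\mathfrak{n}_i$, $D_i$ is a derivation of $\mathfrak{n}_i$ all of whose eigenvalues have positive real part (normalized so that the smallest real part of an eigenvalue of $D_i$ is $1$), $\alpha_i:\mathbb{R}^k\to\mathbb{R}$ is a nonzero linear map (a root), and $v\in\mathbb{R}^k$ acts on $\mathbf{N}_i$ by conjugation through the automorphism with differential $e^{\alpha_i(v)D_i}$. The quotient map by $\mathbf{N}$ is $\pi:G\to\mathbb{R}^k$. A left-invariant Riemannian metric $g$ splits $G$ perpendicularly if there is a Lie group homomorphism $s_g:\mathbb{R}^k\to G$ with $\pi\circ s_g=\mathrm{id}$ (the perpendicular splitting) whose image has tangent space at the identity $g$-orthogonal to the Lie algebra of $\mathbf{N}$. Write elements of $G$ as $(h,v)=h\,s_g(v)$, $h\in\mathbf{N}$, $v\in\mathbb{R}^k$, and let $D_i$ be the derivation for this semidirect decomposition, i.e. conjugation by $s_g(v)$ acts on $\mathfrak{n}_i$ by $e^{\alpha_i(v)D_i}$. Half-spaces: let $d_i$ be the path metric on $\mathbf{N}_i$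 induced by $g$. For $x,y\in G$ write $x^{-1}y=(\prod_i h_i,v)$ with $h_i\in\mathbf{N}_i$. Let $H_i\in[-\infty,\infty)$ be the smallest number such that $d_i(e,e^{-HD_i}(h_i))\le1$ for all $H\ge H_i$ (here $e^{-HD_i}$ denotes the automorphism of $\mathbf{N}_i$ with this differential; $H_i=-\infty$ if $h_i=e$). The $i$-th half-space associated to $x,y$ is $\{v\in\mathbb{R}^k:\alpha_i(v)\ge H_i\}$. A (piecewise smooth) path $\gamma$ from $x$ to $y$ is half-space visiting (HSV) if for each $i$ the path $\pi(x^{-1}\gamma)$ meets the $i$-th half-space associated to $x,y$. It is a box path if its derivative is tangent to left cosets of $s_g(\mathbb{R}^k)$ everywhere except on at most $n+1$ subintervals, along each of which its derivative is tangent to a coset of a different one of the $\mathbf{N}_i$. The box-geodesic distance is $\rho_g(x,y)=\inf\ell_g(\gamma)$ over all half-space visiting box paths $\gamma$ from $x$ to $y$, where $\ell_g$ is $g$-length. *)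

theory Defs
  imports "HOL-Analysis.Analysis" "HOL-Algebra.Coset" "HOL-Algebra.Generated_Groups"
begin

section \<open>Smooth maps and smooth manifolds\<close>

text \<open>Used for open sets only: all iterated directional derivatives up to the given
  order exist and are continuous.\<close>

primrec Ck_on :: "nat \<Rightarrow> 'a::real_normed_vector set \<Rightarrow> ('a \<Rightarrow> 'b::real_normed_vector) \<Rightarrow> bool" where
  "Ck_on 0 S f \<longleftrightarrow> continuous_on S f"
| "Ck_on (Suc k) S f \<longleftrightarrow>
     (\<forall>x\<in>S. f differentiable (at x)) \<and> (\<forall>v. Ck_on k S (\<lambda>x. frechet_derivative f (at x) v))"

definition smooth_on :: "'a::real_normed_vector set \<Rightarrow> ('a \<Rightarrow> 'b::real_normed_vector) \<Rightarrow> bool" where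
  "smooth_on S f \<longleftrightarrow> (\<forall>k. Ck_on k S f)"

text \<open>A chart is a pair of its domain and its coordinate map; values of the coordinate map
  outside the domain are irrelevant.\<close>

type_synonym ('g, 'e) chart = "'g set \<times> ('g \<Rightarrow> 'e)"
type_synonym ('g, 'e) atlas = "('g, 'e) chart set"

definition chart_inv :: "('g, 'e) chart \<Rightarrow> 'e \<Rightarrow> 'g" where
  "chart_inv c = inv_into (fst c) (snd c)"

definition is_chart :: "('g::topological_space, 'e::euclidean_space) chart \<Rightarrow> bool" where
  "is_chart c \<longleftrightarrow> open (fst c) \<and> open (snd c ` fst c) \<and>
     homeomorphism (fst c) (snd c ` fst c) (snd c) (chart_inv c)"

definition smooth_atlas :: "('g::topological_space, 'e::euclidean_space) atlas \<Rightarrow> bool" where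
  "smooth_atlas A \<longleftrightarrow> (\<forall>c\<in>A. is_chart c) \<and> (\<Union>c\<in>A. fst c) = UNIV \<and>
     (\<forall>c\<in>A. \<forall>d\<in>A. smooth_on (snd c ` (fst c \<inter> fst d)) (snd d \<circ> chart_inv c))"

definition euclid_atlas :: "('a::euclidean_space, 'a) atlas" where
  "euclid_atlas = {(UNIV, \<lambda>x. x)}"

definition prod_atlas :: "('g, 'e) atlas \<Rightarrow> ('h, 'f) atlas \<Rightarrow> ('g \<times> 'h, 'e \<times> 'f) atlas" where
  "prod_atlas A B = {(fst c \<times> fst d, map_prod (snd c) (snd d)) |c d. c \<in> A \<and> d \<in> B}"

text \<open>Smoothness of a map on an arbitrary subset \<open>S\<close> of a manifold: near each point of \<open>S\<close>
  it is, in charts, the restriction of a smooth map defined on an open set.\<close>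

definition smooth_map_on ::
  "('g, 'e::euclidean_space) atlas \<Rightarrow> ('h, 'f::euclidean_space) atlas \<Rightarrow> 'g set \<Rightarrow> ('g \<Rightarrow> 'h) \<Rightarrow> bool" where
  "smooth_map_on A B S f \<longleftrightarrow>
     (\<forall>x\<in>S. \<exists>c\<in>A. \<exists>d\<in>B. \<exists>W F. x \<in> fst c \<and> f x \<in> fst d \<and>
        open W \<and> snd c x \<in> W \<and> smooth_on W F \<and>
        (\<forall>y\<in>fst c \<inter> S. snd c y \<in> W \<longrightarrow> f y \<in> fst d \<and> snd d (f y) = F (snd c y)))"

text \<open>The tangent space at \<open>x\<close> is the model space \<open>'e\<close>, identified with it by one preferred
  chart \<open>chart_at A x\<close> around \<open>x\<close>. Velocities, differentials and metrics are all expressed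
  through these identifications.\<close>

definition chart_at :: "('g, 'e) atlas \<Rightarrow> 'g \<Rightarrow> ('g, 'e) chart" where
  "chart_at A x = (SOME c. c \<in> A \<and> x \<in> fst c)"

definition velocity :: "('g, 'e::euclidean_space) atlas \<Rightarrow> (real \<Rightarrow> 'g) \<Rightarrow> real \<Rightarrow> 'e" where
  "velocity A \<gamma> t = vector_derivative (snd (chart_at A (\<gamma> t)) \<circ> \<gamma>) (at t)"

definition differential ::
  "('g, 'e::euclidean_space) atlas \<Rightarrow> ('h, 'f::euclidean_space) atlas \<Rightarrow> ('g \<Rightarrow> 'h) \<Rightarrow> 'g \<Rightarrow> 'e \<Rightarrow> 'f" where
  "differential A B f x =
     frechet_derivative (snd (chart_at B (f x)) \<circ> f \<circ> chart_inv (chart_at A x))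
       (at (snd (chart_at A x) x))"

definition curve_in :: "('g, 'e::euclidean_space) atlas \<Rightarrow> 'g set \<Rightarrow> 'g \<Rightarrow> (real \<Rightarrow> 'g) \<Rightarrow> bool" where
  "curve_in A S x \<gamma> \<longleftrightarrow> smooth_map_on euclid_atlas A UNIV \<gamma> \<and> range \<gamma> \<subseteq> S \<and> \<gamma> 0 = x"

definition tangent_space :: "('g, 'e::euclidean_space) atlas \<Rightarrow> 'g set \<Rightarrow> 'g \<Rightarrow> 'e set" where
  "tangent_space A S x = {velocity A \<gamma> 0 |\<gamma>. curve_in A S x \<gamma>}"

text \<open>Slice charts; \<open>insert c A\<close> being an atlas says that \<open>c\<close> belongs to the maximal atlas.\<close>

definition embedded_submanifold :: "('g::topological_space, 'e::euclidean_space) atlas \<Rightarrow> 'g set \<Rightarrow> bool" where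
  "embedded_submanifold A S \<longleftrightarrow>
     (\<forall>x\<in>S. \<exists>c W. smooth_atlas (insert c A) \<and> x \<in> fst c \<and> subspace W \<and>
        snd c ` (fst c \<inter> S) = snd c ` fst c \<inter> W)"


section \<open>Lie groups\<close>

definition lie_group ::
  "'g::{t2_space, second_countable_topology} monoid \<Rightarrow> ('g, 'e::euclidean_space) atlas \<Rightarrow> bool" where
  "lie_group G A \<longleftrightarrow> group G \<and> carrier G = UNIV \<and> smooth_atlas A \<and>
     smooth_map_on (prod_atlas A A) A UNIV (\<lambda>(x, y). x \<otimes>\<^bsub>G\<^esub> y) \<and>
     smooth_map_on A A UNIV (\<lambda>x. inv\<^bsub>G\<^esub> x)"

definition lie_subgroup :: "'g::topological_space monoid \<Rightarrow> ('g, 'e::euclidean_space) atlas \<Rightarrow> 'g set \<Rightarrow> bool" where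
  "lie_subgroup G A H \<longleftrightarrow> subgroup H G \<and> embedded_submanifold A H"

definition lie_algebra :: "'g monoid \<Rightarrow> ('g, 'e::euclidean_space) atlas \<Rightarrow> 'g set \<Rightarrow> 'e set" where
  "lie_algebra G A H = tangent_space A H \<one>\<^bsub>G\<^esub>"

definition Ad :: "'g monoid \<Rightarrow> ('g, 'e::euclidean_space) atlas \<Rightarrow> 'g \<Rightarrow> 'e \<Rightarrow> 'e" where
  "Ad G A x = differential A A (\<lambda>y. x \<otimes>\<^bsub>G\<^esub> y \<otimes>\<^bsub>G\<^esub> inv\<^bsub>G\<^esub> x) \<one>\<^bsub>G\<^esub>"

text \<open>\<open>[X, Y] = ad X Y\<close>, with \<open>ad\<close> the differential of \<open>Ad\<close> at the identity.\<close>

definition lie_bracket :: "'g monoid \<Rightarrow> ('g, 'e::euclidean_space) atlas \<Rightarrow> 'e \<Rightarrow> 'e \<Rightarrow> 'e" where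
  "lie_bracket G A X Y = differential A euclid_atlas (\<lambda>x. Ad G A x Y) \<one>\<^bsub>G\<^esub> X"

primrec lower_central :: "'g monoid \<Rightarrow> nat \<Rightarrow> 'g set" where
  "lower_central K 0 = carrier K"
| "lower_central K (Suc c) = generate K
     {x \<otimes>\<^bsub>K\<^esub> y \<otimes>\<^bsub>K\<^esub> inv\<^bsub>K\<^esub> x \<otimes>\<^bsub>K\<^esub> inv\<^bsub>K\<^esub> y |x y. x \<in> carrier K \<and> y \<in> lower_central K c}"

definition nilpotent_group :: "'g monoid \<Rightarrow> bool" where
  "nilpotent_group K \<longleftrightarrow> (\<exists>c. lower_central K c = {\<one>\<^bsub>K\<^esub>})"

definition vector_group_hom ::
  "'g monoid \<Rightarrow> ('g, 'e::euclidean_space) atlas \<Rightarrow> ('v::euclidean_space \<Rightarrow> 'g) \<Rightarrow> bool" where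
  "vector_group_hom G A s \<longleftrightarrow> smooth_map_on euclid_atlas A UNIV s \<and> (\<forall>v w. s (v + w) = s v \<otimes>\<^bsub>G\<^esub> s w)"

definition derivation_on ::
  "'g monoid \<Rightarrow> ('g, 'e::euclidean_space) atlas \<Rightarrow> 'e set \<Rightarrow> ('e \<Rightarrow> 'e) \<Rightarrow> bool" where
  "derivation_on G A V D \<longleftrightarrow>
     (\<forall>X\<in>V. D X \<in> V) \<and>
     (\<forall>X\<in>V. \<forall>Y\<in>V. D (X + Y) = D X + D Y) \<and>
     (\<forall>r. \<forall>X\<in>V. D (r *\<^sub>R X) = r *\<^sub>R D X) \<and>
     (\<forall>X\<in>V. \<forall>Y\<in>V. D (lie_bracket G A X Y) = lie_bracket G A (D X) Y + lie_bracket G A X (D Y))"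

definition exp_op :: "real \<Rightarrow> ('e::euclidean_space \<Rightarrow> 'e) \<Rightarrow> 'e \<Rightarrow> 'e" where
  "exp_op t D X = (\<Sum>m. (t ^ m / fact m) *\<^sub>R (D ^^ m) X)"

text \<open>Complex eigenvalues of the complexification: \<open>D (u + i w) = z (u + i w)\<close> with
  \<open>u + i w \<noteq> 0\<close>, split into real and imaginary parts.\<close>

definition eigenvalue_on :: "'e::euclidean_space set \<Rightarrow> ('e \<Rightarrow> 'e) \<Rightarrow> complex \<Rightarrow> bool" where
  "eigenvalue_on V D z \<longleftrightarrow> (\<exists>u\<in>V. \<exists>w\<in>V. (u, w) \<noteq> (0, 0) \<and>
     D u = Re z *\<^sub>R u - Im z *\<^sub>R w \<and> D w = Im z *\<^sub>R u + Re z *\<^sub>R w)"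

text \<open>\<open>\<phi>\<close> is an automorphism of the Lie group \<open>H\<close> whose differential at the identity is \<open>L\<close>.\<close>

definition lie_automorphism ::
  "'g monoid \<Rightarrow> ('g, 'e::euclidean_space) atlas \<Rightarrow> 'g set \<Rightarrow> ('e \<Rightarrow> 'e) \<Rightarrow> ('g \<Rightarrow> 'g) \<Rightarrow> bool" where
  "lie_automorphism G A H L \<phi> \<longleftrightarrow>
     \<phi> \<in> iso (G\<lparr>carrier := H\<rparr>) (G\<lparr>carrier := H\<rparr>) \<and>
     smooth_map_on A A H \<phi> \<and> smooth_map_on A A H (inv_into H \<phi>) \<and>
     (\<forall>\<gamma>. curve_in A H \<one>\<^bsub>G\<^esub> \<gamma> \<longrightarrow> velocity A (\<phi> \<circ> \<gamma>) 0 = L (velocity A \<gamma> 0))"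

definition aut_of :: "'g monoid \<Rightarrow> ('g, 'e::euclidean_space) atlas \<Rightarrow> 'g set \<Rightarrow> ('e \<Rightarrow> 'e) \<Rightarrow> 'g \<Rightarrow> 'g" where
  "aut_of G A H L = (THE \<phi>. \<phi> \<in> extensional H \<and> lie_automorphism G A H L \<phi>)"


section \<open>Riemannian metrics and lengths\<close>

text \<open>\<open>g x\<close> is the inner product on the tangent space at \<open>x\<close>; its coefficients in any chart
  of the atlas are smooth.\<close>

definition riemannian_metric :: "('g, 'e::euclidean_space) atlas \<Rightarrow> ('g \<Rightarrow> 'e \<Rightarrow> 'e \<Rightarrow> real) \<Rightarrow> bool" where
  "riemannian_metric A g \<longleftrightarrow>
     (\<forall>x. bilinear (g x) \<and> (\<forall>u w. g x u w = g x w u) \<and> (\<forall>u. u \<noteq> 0 \<longrightarrow> 0 < g x u u)) \<and>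
     (\<forall>c\<in>A. \<forall>u w. smooth_on (snd c ` fst c)
        (\<lambda>p. g (chart_inv c p) (differential euclid_atlas A (chart_inv c) p u)
                               (differential euclid_atlas A (chart_inv c) p w)))"

definition left_invariant_metric ::
  "'g monoid \<Rightarrow> ('g, 'e::euclidean_space) atlas \<Rightarrow> ('g \<Rightarrow> 'e \<Rightarrow> 'e \<Rightarrow> real) \<Rightarrow> bool" where
  "left_invariant_metric G A g \<longleftrightarrow> riemannian_metric A g \<and>
     (\<forall>a x u w. g (a \<otimes>\<^bsub>G\<^esub> x) (differential A A (\<lambda>y. a \<otimes>\<^bsub>G\<^esub> y) x u)
                               (differential A A (\<lambda>y. a \<otimes>\<^bsub>G\<^esub> y) x w) = g x u w)"

definition curve_length :: "('g, 'e::euclidean_space) atlas \<Rightarrow> ('g \<Rightarrow> 'e \<Rightarrow> 'e \<Rightarrow> real) \<Rightarrow> (real \<Rightarrow> 'g) \<Rightarrow> real" where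
  "curve_length A g \<gamma> =
     integral {0..1} (\<lambda>t. sqrt (g (\<gamma> t) (velocity A \<gamma> t) (velocity A \<gamma> t)))"

text \<open>Paths are parametrized by \<open>[0,1]\<close>; \<open>F\<close> contains the breakpoints, and on each closed
  interval between breakpoints the path extends smoothly across the end points.\<close>

definition piecewise_smooth ::
  "('g::topological_space, 'e::euclidean_space) atlas \<Rightarrow> real set \<Rightarrow> (real \<Rightarrow> 'g) \<Rightarrow> bool" where
  "piecewise_smooth A F \<gamma> \<longleftrightarrow> finite F \<and> path \<gamma> \<and>
     (\<forall>a b. 0 \<le> a \<and> a < b \<and> b \<le> 1 \<and> {a<..<b} \<inter> F = {} \<longrightarrow> smooth_map_on euclid_atlas A {a..b} \<gamma>)"

text \<open>Path metric induced by \<open>g\<close> on \<open>S\<close>: paths are confined to \<open>S\<close>.\<close>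

definition path_dist ::
  "('g::topological_space, 'e::euclidean_space) atlas \<Rightarrow> ('g \<Rightarrow> 'e \<Rightarrow> 'e \<Rightarrow> real) \<Rightarrow> 'g set \<Rightarrow> 'g \<Rightarrow> 'g \<Rightarrow> real" where
  "path_dist A g S x y = Inf {curve_length A g \<gamma> |\<gamma> F. piecewise_smooth A F \<gamma> \<and>
     path_image \<gamma> \<subseteq> S \<and> pathstart \<gamma> = x \<and> pathfinish \<gamma> = y}"

definition riem_dist ::
  "('g::topological_space, 'e::euclidean_space) atlas \<Rightarrow> ('g \<Rightarrow> 'e \<Rightarrow> 'e \<Rightarrow> real) \<Rightarrow> 'g \<Rightarrow> 'g \<Rightarrow> real" where
  "riem_dist A g = path_dist A g UNIV"


section \<open>Higher-rank Sol-type groups\<close>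

text \<open>The factors are \<open>N 0, \<dots>, N (n - 1)\<close>, all inside \<open>G\<close>. The product of a family
  \<open>h 0, \<dots>, h (n - 1)\<close> is taken in this order (the factors will commute).\<close>

definition fam_prod :: "'g monoid \<Rightarrow> nat \<Rightarrow> (nat \<Rightarrow> 'g) \<Rightarrow> 'g" where
  "fam_prod G n h = foldr (\<lambda>i x. h i \<otimes>\<^bsub>G\<^esub> x) [0..<n] \<one>\<^bsub>G\<^esub>"

definition nil_subgroup :: "'g monoid \<Rightarrow> nat \<Rightarrow> (nat \<Rightarrow> 'g set) \<Rightarrow> 'g set" where
  "nil_subgroup G n N = fam_prod G n ` (\<Pi>\<^sub>E i\<in>{..<n}. N i)"

text \<open>\<open>z = (h 0 \<cdots> h (n - 1), v)\<close> in the coordinates given by the splitting \<open>s\<close>.\<close>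

definition has_coords ::
  "'g monoid \<Rightarrow> nat \<Rightarrow> (nat \<Rightarrow> 'g set) \<Rightarrow> ('v \<Rightarrow> 'g) \<Rightarrow> 'g \<Rightarrow> (nat \<Rightarrow> 'g) \<Rightarrow> 'v \<Rightarrow> bool" where
  "has_coords G n N s z h v \<longleftrightarrow> h \<in> (\<Pi>\<^sub>E i\<in>{..<n}. N i) \<and> z = fam_prod G n h \<otimes>\<^bsub>G\<^esub> s v"

definition nil_coord :: "'g monoid \<Rightarrow> nat \<Rightarrow> (nat \<Rightarrow> 'g set) \<Rightarrow> ('v \<Rightarrow> 'g) \<Rightarrow> 'g \<Rightarrow> nat \<Rightarrow> 'g" where
  "nil_coord G n N s z = (THE h. \<exists>v. has_coords G n N s z h v)"

definition quot_map :: "'g monoid \<Rightarrow> nat \<Rightarrow> (nat \<Rightarrow> 'g set) \<Rightarrow> ('v \<Rightarrow> 'g) \<Rightarrow> 'g \<Rightarrow> 'v" where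
  "quot_map G n N s z = (THE v. \<exists>h. has_coords G n N s z h v)"

text \<open>\<open>G\<close> is, as a group and as a manifold, the semidirect product of the product of the
  \<open>N i\<close> by \<open>s(\<real>\<^sup>k)\<close>; the smoothness of the coordinates says that the bijection between
  \<open>G\<close> and the product of the \<open>N i\<close> and \<open>\<real>\<^sup>k\<close> is a diffeomorphism.\<close>

definition semidirect_decomposition ::
  "'g::topological_space monoid \<Rightarrow> ('g, 'e::euclidean_space) atlas \<Rightarrow> nat \<Rightarrow> (nat \<Rightarrow> 'g set) \<Rightarrow>
   ('v::euclidean_space \<Rightarrow> 'g) \<Rightarrow> bool" where
  "semidirect_decomposition G A n N s \<longleftrightarrow>
     (\<forall>i<n. lie_subgroup G A (N i)) \<and>
     (\<forall>i<n. \<forall>j<n. i \<noteq> j \<longrightarrow> (\<forall>x\<in>N i. \<forall>y\<in>N j. x \<otimes>\<^bsub>G\<^esub> y = y \<otimes>\<^bsub>G\<^esub> x)) \<and>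
     vector_group_hom G A s \<and>
     (\<forall>i<n. \<forall>v. \<forall>x\<in>N i. s v \<otimes>\<^bsub>G\<^esub> x \<otimes>\<^bsub>G\<^esub> inv\<^bsub>G\<^esub> (s v) \<in> N i) \<and>
     (\<forall>z. \<exists>!p. has_coords G n N s z (fst p) (snd p)) \<and>
     (\<forall>i<n. smooth_map_on A A UNIV (\<lambda>z. nil_coord G n N s z i)) \<and>
     smooth_map_on A euclid_atlas UNIV (quot_map G n N s)"

definition sol_type_group ::
  "'g::{t2_space, second_countable_topology} monoid \<Rightarrow> ('g, 'e::euclidean_space) atlas \<Rightarrow> nat \<Rightarrow>
   (nat \<Rightarrow> 'g set) \<Rightarrow> (nat \<Rightarrow> 'e \<Rightarrow> 'e) \<Rightarrow> (nat \<Rightarrow> real^'k \<Rightarrow> real) \<Rightarrow> (real^'k \<Rightarrow> 'g) \<Rightarrow> bool" where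
  "sol_type_group G A n N D \<alpha> s \<longleftrightarrow>
     CARD('k) \<ge> 2 \<and> lie_group G A \<and> semidirect_decomposition G A n N s \<and>
     (\<forall>i<n. simply_connected (N i) \<and> nilpotent_group (G\<lparr>carrier := N i\<rparr>)) \<and>
     (\<forall>i<n. derivation_on G A (lie_algebra G A (N i)) (D i) \<and>
        (\<forall>z. eigenvalue_on (lie_algebra G A (N i)) (D i) z \<longrightarrow> 1 \<le> Re z) \<and>
        (\<exists>z. eigenvalue_on (lie_algebra G A (N i)) (D i) z \<and> Re z = 1)) \<and>
     (\<forall>i<n. linear (\<alpha> i) \<and> (\<exists>v. \<alpha> i v \<noteq> 0)) \<and>
     (\<forall>i<n. \<forall>v. \<forall>X\<in>lie_algebra G A (N i). Ad G A (s v) X = exp_op (\<alpha> i v) (D i) X)"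


section \<open>Perpendicular splittings and the box-geodesic distance\<close>

definition perpendicular_splitting ::
  "'g monoid \<Rightarrow> ('g, 'e::euclidean_space) atlas \<Rightarrow> nat \<Rightarrow> (nat \<Rightarrow> 'g set) \<Rightarrow> ('v::euclidean_space \<Rightarrow> 'g) \<Rightarrow>
   ('g \<Rightarrow> 'e \<Rightarrow> 'e \<Rightarrow> real) \<Rightarrow> ('v \<Rightarrow> 'g) \<Rightarrow> bool" where
  "perpendicular_splitting G A n N s g sg \<longleftrightarrow>
     vector_group_hom G A sg \<and> (\<forall>v. quot_map G n N s (sg v) = v) \<and>
     (\<forall>X\<in>tangent_space A (range sg) \<one>\<^bsub>G\<^esub>. \<forall>Y\<in>lie_algebra G A (nil_subgroup G n N).
        g \<one>\<^bsub>G\<^esub> X Y = 0)"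

text \<open>The derivation of the Lie algebra of \<open>N i\<close> belonging to the semidirect decomposition
  given by \<open>sg\<close>.\<close>

definition split_derivation ::
  "'g monoid \<Rightarrow> ('g, 'e::euclidean_space) atlas \<Rightarrow> (nat \<Rightarrow> 'g set) \<Rightarrow> (nat \<Rightarrow> 'v \<Rightarrow> real) \<Rightarrow>
   ('v \<Rightarrow> 'g) \<Rightarrow> nat \<Rightarrow> 'e \<Rightarrow> 'e" where
  "split_derivation G A N \<alpha> sg i =
     (THE D. D \<in> extensional (lie_algebra G A (N i)) \<and>
        derivation_on G A (lie_algebra G A (N i)) D \<and>
        (\<forall>v. \<forall>X\<in>lie_algebra G A (N i). Ad G A (sg v) X = exp_op (\<alpha> i v) D X))"

definition half_space_height ::
  "'g::topological_space monoid \<Rightarrow> ('g, 'e::euclidean_space) atlas \<Rightarrow> nat \<Rightarrow> (nat \<Rightarrow> 'g set) \<Rightarrow>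
   (nat \<Rightarrow> 'v \<Rightarrow> real) \<Rightarrow> ('g \<Rightarrow> 'e \<Rightarrow> 'e \<Rightarrow> real) \<Rightarrow> ('v \<Rightarrow> 'g) \<Rightarrow> nat \<Rightarrow> 'g \<Rightarrow> 'g \<Rightarrow> ereal" where
  "half_space_height G A n N \<alpha> g sg i x y =
     (LEAST H0. H0 < \<infinity> \<and>
        (\<forall>H::real. H0 \<le> ereal H \<longrightarrow>
           path_dist A g (N i) \<one>\<^bsub>G\<^esub>
             (aut_of G A (N i) (exp_op (- H) (split_derivation G A N \<alpha> sg i))
                (nil_coord G n N sg (inv\<^bsub>G\<^esub> x \<otimes>\<^bsub>G\<^esub> y) i)) \<le> 1))"

definition half_space ::
  "'g::topological_space monoid \<Rightarrow> ('g, 'e::euclidean_space) atlas \<Rightarrow> nat \<Rightarrow> (nat \<Rightarrow> 'g set) \<Rightarrow>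
   (nat \<Rightarrow> 'v \<Rightarrow> real) \<Rightarrow> ('g \<Rightarrow> 'e \<Rightarrow> 'e \<Rightarrow> real) \<Rightarrow> ('v \<Rightarrow> 'g) \<Rightarrow> nat \<Rightarrow> 'g \<Rightarrow> 'g \<Rightarrow> 'v set" where
  "half_space G A n N \<alpha> g sg i x y = {v. half_space_height G A n N \<alpha> g sg i x y \<le> ereal (\<alpha> i v)}"

text \<open>The projection to \<open>\<real>\<^sup>k\<close> is taken in the coordinates of \<open>sg\<close>; it is the same map for
  every splitting of the quotient map.\<close>

definition half_space_visiting ::
  "'g::topological_space monoid \<Rightarrow> ('g, 'e::euclidean_space) atlas \<Rightarrow> nat \<Rightarrow> (nat \<Rightarrow> 'g set) \<Rightarrow>
   (nat \<Rightarrow> 'v \<Rightarrow> real) \<Rightarrow> ('g \<Rightarrow> 'e \<Rightarrow> 'e \<Rightarrow> real) \<Rightarrow> ('v \<Rightarrow> 'g) \<Rightarrow> 'g \<Rightarrow> 'g \<Rightarrow> (real \<Rightarrow> 'g) \<Rightarrow> bool" where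
  "half_space_visiting G A n N \<alpha> g sg x y \<gamma> \<longleftrightarrow>
     (\<forall>i<n. \<exists>t\<in>{0..1}. quot_map G n N sg (inv\<^bsub>G\<^esub> x \<otimes>\<^bsub>G\<^esub> \<gamma> t) \<in> half_space G A n N \<alpha> g sg i x y)"

text \<open>\<open>J j\<close> is the \<open>j\<close>-th exceptional subinterval and \<open>N (c j)\<close> the factor along whose
  cosets the path moves there; tangency is required at the points where the path is smooth.\<close>

definition box_path ::
  "'g::topological_space monoid \<Rightarrow> ('g, 'e::euclidean_space) atlas \<Rightarrow> nat \<Rightarrow> (nat \<Rightarrow> 'g set) \<Rightarrow>
   ('v \<Rightarrow> 'g) \<Rightarrow> (real \<Rightarrow> 'g) \<Rightarrow> bool" where
  "box_path G A n N sg \<gamma> \<longleftrightarrow>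
     (\<exists>F. piecewise_smooth A F \<gamma> \<and>
       (\<exists>m\<le>n + 1. \<exists>(J :: nat \<Rightarrow> real set) (c :: nat \<Rightarrow> nat).
          inj_on c {..<m} \<and>
          (\<forall>j<m. is_interval (J j) \<and> J j \<subseteq> {0..1} \<and> c j < n \<and>
             (\<forall>t\<in>J j \<inter> {0<..<1} - F.
                velocity A \<gamma> t \<in> tangent_space A (\<gamma> t <#\<^bsub>G\<^esub> N (c j)) (\<gamma> t))) \<and>
          (\<forall>t\<in>{0<..<1} - F - (\<Union>j<m. J j).
             velocity A \<gamma> t \<in> tangent_space A (\<gamma> t <#\<^bsub>G\<^esub> range sg) (\<gamma> t))))"

definition box_geodesic_dist ::
  "'g::topological_space monoid \<Rightarrow> ('g, 'e::euclidean_space) atlas \<Rightarrow> nat \<Rightarrow> (nat \<Rightarrow> 'g set) \<Rightarrow>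
   (nat \<Rightarrow> 'v \<Rightarrow> real) \<Rightarrow> ('g \<Rightarrow> 'e \<Rightarrow> 'e \<Rightarrow> real) \<Rightarrow> ('v \<Rightarrow> 'g) \<Rightarrow> 'g \<Rightarrow> 'g \<Rightarrow> real" where
  "box_geodesic_dist G A n N \<alpha> g sg x y =
     Inf {curve_length A g \<gamma> |\<gamma>. box_path G A n N sg \<gamma> \<and> pathstart \<gamma> = x \<and> pathfinish \<gamma> = y \<and>
            half_space_visiting G A n N \<alpha> g sg x y \<gamma>}"

end

theory Submission
  imports Defs "HOL-Computational_Algebra.Fundamental_Theorem_Algebra"
begin

text \<open>In the coordinates of \<open>sg\<close>, a path in \<open>G\<close> is a path \<open>v\<close> in \<open>\<real>\<^sup>k\<close> together with paths \<open>h\<^sub>i\<close> in the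
  \<open>N i\<close>; a displacement in \<open>N i\<close> made at \<open>v\<close> contributes to the displacement seen from height
  \<open>H\<close> with a factor of order at most \<open>exp (- (H - \<alpha>\<^sub>i v) / 2)\<close>. So if \<open>v\<close> misses the \<open>i\<close>-th half-space, by
  the amount \<open>\<delta>(t)\<close> at time \<open>t\<close>, the speed \<open>w\<^sub>i\<close> in the direction of \<open>N i\<close> satisfies
  \<open>\<integral> exp (- \<delta> / 2) w\<^sub>i \<ge> const\<close>. On a time interval carrying a fixed part of this mass, either
  \<open>\<delta>\<close> is bounded somewhere, and a detour of bounded length visits the half-space, or there are times
  \<open>p < z\<close> with \<open>\<delta>(p), \<delta>(z) \<le> r\<close> and \<open>\<integral> w\<^sub>i\<close> over \<open>[p, z]\<close> a large multiple of \<open>r\<close>. By Minkowski's inequality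
  the path from \<open>p\<close> to \<open>z\<close> is then at least as long as the broken line through an apex at height \<open>r\<close> above
  the midpoint of \<open>v(p)\<close> and \<open>v(z)\<close>, so this detour costs nothing. Choosing disjoint intervals for the
  different factors gives a broken line through all half-spaces whose length exceeds that of the path by at
  most a constant. It lifts to a box path once a move of length at most \<open>2\<close> along each \<open>N i\<close> is
  inserted in its half-space.\<close>

section \<open>Smooth maps\<close>

text \<open>One inequality is immediate, since admissible box paths are among the paths that define
  the Riemannian distance. In the other, an additive error tolerates no multiplicative constant on
  the speed of \<open>v\<close>. Perpendicularity of the splitting gives the bound with coefficient
  exactly 1 there; the constant in front of the speed along \<open>N i\<close> may be small, as it
  only rescales the mass that a missed half-space forces. The intervals have to be disjoint because
  each detour is charged to the length of its own stretch of the path; hence the mass is cut into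
  portions, at least one per factor. The rate 1/2 in the exponentials, where the eigenvalues promise
  1, absorbs the polynomial factors of Jordan blocks without computing them. The eigenvalue bound is
  assumed for the derivation belonging to \<open>s\<close>, while heights and box paths use
  \<open>sg\<close>. The two derivations may differ, and even the fact that the kernel of
  \<open>\<alpha> i\<close> acts trivially through \<open>sg\<close> has to be proved.\<close>

lemma Ck_on_cong:
  assumes "open S" "\<And>x. x \<in> S \<Longrightarrow> f x = g x" "Ck_on k S f"
  shows "Ck_on k S g"
  using assms(2,3)
proof (induction k arbitrary: f g)
  case 0
  then show ?case by (simp cong: continuous_on_cong)
next
  case (Suc k)
  have d: "(g has_derivative frechet_derivative f (at x)) (at x)" if "x \<in> S" for x
    using Suc.prems that has_derivative_transform_within_open[OF _ assms(1) that]
    by (metis Ck_on.simps(2) frechet_derivative_works)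
  have e: "frechet_derivative g (at x) = frechet_derivative f (at x)" if "x \<in> S" for x
    by (rule frechet_derivative_at[OF d[OF that], symmetric])
  have "Ck_on k S (\<lambda>x. frechet_derivative g (at x) v)" for v
    by (rule Suc.IH[of "\<lambda>x. frechet_derivative f (at x) v"]) (use Suc.prems e in auto)
  then show ?case
    using d by (auto simp: differentiable_def)
qed

lemma Ck_on_subset: "Ck_on k S f \<Longrightarrow> T \<subseteq> S \<Longrightarrow> Ck_on k T f"
  by (induction k arbitrary: f) (auto intro: continuous_on_subset)

lemma Ck_on_SucD: "Ck_on (Suc k) S f \<Longrightarrow> Ck_on k S f"
proof (induction k arbitrary: f)
  case 0
  then show ?case
    by (auto intro!: continuous_at_imp_continuous_on differentiable_imp_continuous_within)
next
  case (Suc k)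
  then show ?case unfolding Ck_on.simps(2)[of "Suc k"] Ck_on.simps(2)[of k] by blast
qed

lemma Ck_on_continuous: "Ck_on k S f \<Longrightarrow> continuous_on S f"
proof (induction k)
  case (Suc k)
  then show ?case using Ck_on_SucD by blast
qed simp

lemma Ck_on_local:
  assumes "open S" "\<And>x. x \<in> S \<Longrightarrow> \<exists>W. open W \<and> x \<in> W \<and> Ck_on k W f"
  shows "Ck_on k S f"
  using assms(2)
proof (induction k arbitrary: f)
  case 0
  have "isCont f x" if x: "x \<in> S" for x
  proof -
    from 0[OF x] obtain W where "open W" "x \<in> W" "continuous_on W f" by auto
    then show ?thesis by (simp add: continuous_on_eq_continuous_at)
  qed
  then show ?case by (simp add: continuous_at_imp_continuous_on)
next
  case (Suc k)
  have 1: "f differentiable (at x)" if x: "x \<in> S" for x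
  proof -
    from Suc.prems[OF x] obtain W where "x \<in> W" "Ck_on (Suc k) W f" by blast
    then show ?thesis by (simp only: Ck_on.simps)
  qed
  have 2: "Ck_on k S (\<lambda>x. frechet_derivative f (at x) v)" for v
  proof (rule Suc.IH)
    fix x assume x: "x \<in> S"
    from Suc.prems[OF x] obtain W where W: "open W" "x \<in> W" "Ck_on (Suc k) W f" by blast
    then have "Ck_on k W (\<lambda>x. frechet_derivative f (at x) v)" by (simp only: Ck_on.simps)
    with W show "\<exists>W. open W \<and> x \<in> W \<and> Ck_on k W (\<lambda>x. frechet_derivative f (at x) v)" by blast
  qed
  show ?case using 1 2 by (simp only: Ck_on.simps) blast
qed

lemma Ck_on_const: "Ck_on k S (\<lambda>x. c)"
proof (induction k arbitrary: c)
  case (Suc k)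
  have "frechet_derivative (\<lambda>x. c) (at x) = (\<lambda>v. 0)" for x :: 'a
    by simp
  then show ?case using Suc by simp
qed simp

lemma Ck_on_linear: "bounded_linear f \<Longrightarrow> Ck_on k S f"
proof (cases k)
  case 0
  then show "bounded_linear f \<Longrightarrow> ?thesis"
    by (auto simp: linear_continuous_on)
next
  case (Suc m)
  assume f: "bounded_linear f"
  then have "frechet_derivative f (at x) = f" for x
    by (metis bounded_linear_imp_has_derivative frechet_derivative_at)
  then show ?thesis
    using Suc f by (auto simp: Ck_on_const bounded_linear_imp_differentiable)
qed

lemma frechet_derivative_bilinear:
  assumes "bounded_bilinear pr" "f differentiable (at x)" "g differentiable (at x)"
  shows "((\<lambda>x. pr (f x) (g x)) has_derivative
    (\<lambda>v. pr (f x) (frechet_derivative g (at x) v) + pr (frechet_derivative f (at x) v) (g x))) (at x)"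
  using assms(2,3) by (intro bounded_bilinear.FDERIV[OF assms(1)]) (simp_all add: frechet_derivative_works)

lemma Ck_on_add:
  assumes "open S"
  shows "Ck_on k S f \<Longrightarrow> Ck_on k S g \<Longrightarrow> Ck_on k S (\<lambda>x. f x + g x)"
proof (induction k arbitrary: f g)
  case 0 then show ?case by (simp add: continuous_on_add)
next
  case (Suc k)
  have *: "((\<lambda>x. f x + g x) has_derivative
    (\<lambda>v. frechet_derivative f (at x) v + frechet_derivative g (at x) v)) (at x)" if "x \<in> S" for x
    using Suc.prems that by (auto intro!: has_derivative_add simp: frechet_derivative_works[symmetric])
  have **: "frechet_derivative f (at x) v + frechet_derivative g (at x) v
      = frechet_derivative (\<lambda>x. f x + g x) (at x) v" if "x \<in> S" for x v
    by (rule fun_cong[OF frechet_derivative_at[OF *[OF that]]])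
  have "Ck_on k S (\<lambda>x. frechet_derivative (\<lambda>x. f x + g x) (at x) v)" for v
    by (rule Ck_on_cong[OF assms **]) (use Suc in auto)
  then show ?case using * by (auto simp: differentiable_def)
qed

lemma Ck_on_bilinear:
  assumes "open S" and p: "bounded_bilinear pr"
  shows "Ck_on k S f \<Longrightarrow> Ck_on k S g \<Longrightarrow> Ck_on k S (\<lambda>x. pr (f x) (g x))"
proof (induction k arbitrary: f g)
  case 0 then show ?case using bounded_bilinear.continuous_on[OF p] by simp
next
  case (Suc k)
  have *: "((\<lambda>x. pr (f x) (g x)) has_derivative
    (\<lambda>v. pr (f x) (frechet_derivative g (at x) v) + pr (frechet_derivative f (at x) v) (g x))) (at x)"
      if "x \<in> S" for x
    by (rule frechet_derivative_bilinear[OF p]) (use Suc.prems that in auto)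
  have **: "pr (f x) (frechet_derivative g (at x) v) + pr (frechet_derivative f (at x) v) (g x)
      = frechet_derivative (\<lambda>x. pr (f x) (g x)) (at x) v" if "x \<in> S" for x v
    by (rule fun_cong[OF frechet_derivative_at[OF *[OF that]]])
  have "Ck_on k S (\<lambda>x. pr (f x) (frechet_derivative g (at x) v) + pr (frechet_derivative f (at x) v) (g x))" for v
    by (rule Ck_on_add[OF assms(1) Suc.IH Suc.IH]) (use Suc.prems Ck_on_SucD in auto)
  then have "Ck_on k S (\<lambda>x. frechet_derivative (\<lambda>x. pr (f x) (g x)) (at x) v)" for v
    by (rule Ck_on_cong[OF assms(1) **, rotated]) auto
  then show ?case using * by (auto simp: differentiable_def)
qed

lemma Ck_on_sum:
  assumes "open S"
  shows "(\<And>i. i \<in> I \<Longrightarrow> Ck_on k S (f i)) \<Longrightarrow> Ck_on k S (\<lambda>x. \<Sum>i\<in>I. f i x)"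
  by (induction I rule: infinite_finite_induct) (auto intro: Ck_on_const Ck_on_add assms)

lemma Ck_on_linear_comp:
  assumes "open S" and p: "bounded_linear L"
  shows "Ck_on k S f \<Longrightarrow> Ck_on k S (\<lambda>x. L (f x))"
proof (induction k arbitrary: f)
  case 0 then show ?case using bounded_linear.continuous_on[OF p] by simp
next
  case (Suc k)
  have *: "((\<lambda>x. L (f x)) has_derivative (\<lambda>v. L (frechet_derivative f (at x) v))) (at x)" if "x \<in> S" for x
    by (rule bounded_linear.has_derivative[OF p]) (use Suc.prems that frechet_derivative_works in auto)
  have **: "L (frechet_derivative f (at x) v) = frechet_derivative (\<lambda>x. L (f x)) (at x) v"
    if "x \<in> S" for x v
    by (rule fun_cong[OF frechet_derivative_at[OF *[OF that]]])
  have "Ck_on k S (\<lambda>x. frechet_derivative (\<lambda>x. L (f x)) (at x) v)" for v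
    by (rule Ck_on_cong[OF assms(1) **]) (use Suc in auto)
  then show ?case using * by (auto simp: differentiable_def)
qed

text \<open>The chain rule differentiates \<open>f\<close> in a direction that varies with the
  point, while \<open>Ck_on\<close> controls fixed directions only. Expanding that direction in
  \<open>Basis\<close> gives a sum of products to which the induction hypothesis applies; hence the
  Euclidean middle space.\<close>

lemma Ck_on_compose:
  fixes f :: "'b::euclidean_space \<Rightarrow> 'c::real_normed_vector" and g :: "'a::real_normed_vector \<Rightarrow> 'b"
  assumes "open S" "open T"
  shows "Ck_on k S g \<Longrightarrow> Ck_on k T f \<Longrightarrow> g ` S \<subseteq> T \<Longrightarrow> Ck_on k S (\<lambda>x. f (g x))"
proof (induction k arbitrary: f)
  case 0 then show ?case using continuous_on_compose2 by auto
next
  case (Suc k)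
  have *: "((\<lambda>x. f (g x)) has_derivative
      (\<lambda>v. frechet_derivative f (at (g x)) (frechet_derivative g (at x) v))) (at x)" if "x \<in> S" for x
  proof -
    have "(g has_derivative frechet_derivative g (at x)) (at x)"
      "(f has_derivative frechet_derivative f (at (g x))) (at (g x))"
      using Suc.prems that unfolding frechet_derivative_works[symmetric] Ck_on.simps by blast+
    from diff_chain_at[OF this] show ?thesis by (simp only: o_def)
  qed
  have **: "(\<Sum>b\<in>Basis. (frechet_derivative g (at x) v \<bullet> b) *\<^sub>R frechet_derivative f (at (g x)) b)
     = frechet_derivative (\<lambda>x. f (g x)) (at x) v" if "x \<in> S" for x v
  proof -
    have l: "linear (frechet_derivative f (at (g x)))"
      by (rule linear_frechet_derivative) (use Suc.prems that in \<open>unfold Ck_on.simps, blast\<close>)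
    have "frechet_derivative f (at (g x)) (frechet_derivative g (at x) v) =
      frechet_derivative f (at (g x)) (\<Sum>b\<in>Basis. (frechet_derivative g (at x) v \<bullet> b) *\<^sub>R b)"
      by (simp add: euclidean_representation)
    then show ?thesis
      unfolding fun_cong[OF frechet_derivative_at[OF *[OF that]], symmetric]
      by (simp only: linear_sum[OF l] linear_scale[OF l])
  qed
  have "Ck_on k S (\<lambda>x. \<Sum>b\<in>Basis. (frechet_derivative g (at x) v \<bullet> b) *\<^sub>R frechet_derivative f (at (g x)) b)" for v
    by (intro Ck_on_sum[OF assms(1)] Ck_on_bilinear[OF assms(1) bounded_bilinear_scaleR]
        Ck_on_linear_comp[OF assms(1) bounded_linear_inner_left] Suc.IH)
      (use Suc.prems Ck_on_SucD[OF Suc.prems(1)] in auto)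
  then have "Ck_on k S (\<lambda>x. frechet_derivative (\<lambda>x. f (g x)) (at x) v)" for v
    by (rule Ck_on_cong[OF assms(1) **, rotated]) auto
  then show ?case using * by (auto simp: differentiable_def)
qed

lemma smooth_on_cong: "open S \<Longrightarrow> (\<And>x. x \<in> S \<Longrightarrow> f x = g x) \<Longrightarrow> smooth_on S f \<Longrightarrow> smooth_on S g"
  unfolding smooth_on_def using Ck_on_cong by blast

lemma smooth_on_subset: "smooth_on S f \<Longrightarrow> T \<subseteq> S \<Longrightarrow> smooth_on T f"
  unfolding smooth_on_def using Ck_on_subset by blast

lemma smooth_on_continuous: "smooth_on S f \<Longrightarrow> continuous_on S f"
  unfolding smooth_on_def using Ck_on_continuous by blast

lemma smooth_on_differentiable: "smooth_on S f \<Longrightarrow> x \<in> S \<Longrightarrow> f differentiable (at x)"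
  unfolding smooth_on_def by (metis Ck_on.simps(2))

lemma smooth_on_deriv: "smooth_on S f \<Longrightarrow> smooth_on S (\<lambda>x. frechet_derivative f (at x) v)"
  unfolding smooth_on_def by (metis Ck_on.simps(2))

lemma smooth_on_const: "smooth_on S (\<lambda>x. c)"
  unfolding smooth_on_def using Ck_on_const by blast

lemma smooth_on_linear: "bounded_linear f \<Longrightarrow> smooth_on S f"
  unfolding smooth_on_def using Ck_on_linear by blast

lemma smooth_on_id: "smooth_on S (\<lambda>x. x)"
  by (rule smooth_on_linear) (rule bounded_linear_ident)

lemma smooth_on_add: "open S \<Longrightarrow> smooth_on S f \<Longrightarrow> smooth_on S g \<Longrightarrow> smooth_on S (\<lambda>x. f x + g x)"
  unfolding smooth_on_def using Ck_on_add by blast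

lemma smooth_on_linear_comp: "open S \<Longrightarrow> bounded_linear L \<Longrightarrow> smooth_on S f \<Longrightarrow> smooth_on S (\<lambda>x. L (f x))"
  unfolding smooth_on_def using Ck_on_linear_comp by blast

lemma smooth_on_compose:
  fixes f :: "'b::euclidean_space \<Rightarrow> 'c::real_normed_vector" and g :: "'a::real_normed_vector \<Rightarrow> 'b"
  shows "open S \<Longrightarrow> open T \<Longrightarrow> smooth_on S g \<Longrightarrow> smooth_on T f \<Longrightarrow> g ` S \<subseteq> T \<Longrightarrow> smooth_on S (\<lambda>x. f (g x))"
  unfolding smooth_on_def using Ck_on_compose by blast

lemma smooth_on_Pair:
  assumes "open S" "smooth_on S f" "smooth_on S g"
  shows "smooth_on S (\<lambda>x. (f x, g x))"
proof -
  have "bounded_linear (\<lambda>y. (y, 0))" "bounded_linear (\<lambda>y. (0, y))"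
    by (intro bounded_linear_Pair bounded_linear_ident bounded_linear_zero)+
  then have "smooth_on S (\<lambda>x. (f x, 0) + (0, g x))"
    by (intro smooth_on_add[OF assms(1)] smooth_on_linear_comp[OF assms(1) _ assms(2)]
      smooth_on_linear_comp[OF assms(1) _ assms(3)])
  then show ?thesis by simp
qed

text \<open>Joint induction, since each function is the derivative of the other up to sign. The sine
  serves later to reparametrize curves.\<close>

lemma smooth_on_sin_cos: "smooth_on UNIV (sin :: real \<Rightarrow> real) \<and> smooth_on UNIV (cos :: real \<Rightarrow> real)"
proof -
  have "Ck_on k UNIV (sin :: real \<Rightarrow> real) \<and> Ck_on k UNIV (cos :: real \<Rightarrow> real)" for k
  proof (induction k)
    case 0
    then show ?case by (auto intro: continuous_intros)
  next
    case (Suc k)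
    have s: "(sin has_derivative (\<lambda>v. cos x * v)) (at x)" and c: "(cos has_derivative (\<lambda>v. - (sin x) * v)) (at x)"
      for x :: real
      by (auto intro!: derivative_eq_intros)
    have s': "frechet_derivative sin (at x) v = v * cos x" and c': "frechet_derivative cos (at x) v = - v * sin x"
      for x v :: real
      using fun_cong[OF frechet_derivative_at[OF s[of x]], of v] fun_cong[OF frechet_derivative_at[OF c[of x]], of v]
      by (metis mult.commute, metis mult.commute mult_minus_left mult_minus_right)
    have "Ck_on k UNIV (\<lambda>x. v * cos x)" "Ck_on k UNIV (\<lambda>x. - v * sin x)" for v :: real
      by (rule Ck_on_linear_comp[OF open_UNIV bounded_linear_mult_right], use Suc in blast)+
    moreover have "sin differentiable at x" "cos differentiable at x" for x :: real
      using s c unfolding differentiable_def by blast+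
    ultimately show ?case unfolding Ck_on.simps s' c' by blast
  qed
  then show ?thesis by (simp add: smooth_on_def)
qed

section \<open>Charts and smooth maps between manifolds\<close>

lemma chart_inv_left: "is_chart c \<Longrightarrow> x \<in> fst c \<Longrightarrow> chart_inv c (snd c x) = x"
  by (simp add: is_chart_def homeomorphism_def)

lemma chart_inv_right: "is_chart c \<Longrightarrow> p \<in> snd c ` fst c \<Longrightarrow> snd c (chart_inv c p) = p"
  by (auto simp: chart_inv_left)

lemma chart_inv_mem: "is_chart c \<Longrightarrow> p \<in> snd c ` fst c \<Longrightarrow> chart_inv c p \<in> fst c"
  by (auto simp: chart_inv_left)

lemma chart_inj: "is_chart c \<Longrightarrow> x \<in> fst c \<Longrightarrow> y \<in> fst c \<Longrightarrow> snd c x = snd c y \<Longrightarrow> x = y"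
  by (metis chart_inv_left)

lemma chart_open: "is_chart c \<Longrightarrow> open (fst c)"
  by (simp add: is_chart_def)

lemma chart_image_open:
  assumes "is_chart c" "open U" shows "open (snd c ` (fst c \<inter> U))"
proof -
  have "snd c ` (fst c \<inter> U) = snd c ` fst c \<inter> chart_inv c -` U"
    using assms(1) by (auto simp: chart_inv_left)
  moreover have "continuous_on (snd c ` fst c) (chart_inv c)" "open (snd c ` fst c)"
    using assms(1) by (auto simp: is_chart_def homeomorphism_def)
  ultimately show ?thesis
    using assms(2) by (simp add: continuous_open_preimage)
qed

lemma smooth_atlas_chart: "smooth_atlas A \<Longrightarrow> c \<in> A \<Longrightarrow> is_chart c"
  by (simp add: smooth_atlas_def)

lemma smooth_atlas_cover: "smooth_atlas A \<Longrightarrow> \<exists>c\<in>A. x \<in> fst c"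
  unfolding smooth_atlas_def by blast

lemma smooth_atlas_transition:
  "smooth_atlas A \<Longrightarrow> c \<in> A \<Longrightarrow> d \<in> A \<Longrightarrow> smooth_on (snd c ` (fst c \<inter> fst d)) (\<lambda>p. snd d (chart_inv c p))"
  by (simp add: smooth_atlas_def o_def)

lemma chart_at_in: "smooth_atlas A \<Longrightarrow> chart_at A x \<in> A" "smooth_atlas A \<Longrightarrow> x \<in> fst (chart_at A x)"
  using someI_ex[of "\<lambda>c. c \<in> A \<and> x \<in> fst c"] smooth_atlas_cover[of A x]
  unfolding chart_at_def by blast+

lemma smooth_atlas_euclid: "smooth_atlas (euclid_atlas :: ('a::euclidean_space, 'a) atlas)"
proof -
  have "chart_inv (UNIV, \<lambda>x::'a. x) = (\<lambda>x. x)"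
    unfolding chart_inv_def by (simp add: fun_eq_iff inv_into_f_f[of "\<lambda>x. x" UNIV, simplified])
  then show ?thesis
    by (simp add: smooth_atlas_def euclid_atlas_def is_chart_def homeomorphism_def smooth_on_id o_def)
qed

lemma chart_at_euclid: "chart_at euclid_atlas x = (UNIV, \<lambda>x. x)"
  unfolding chart_at_def by (rule some_equality) (auto simp: euclid_atlas_def)

text \<open>Smoothness in one given pair of charts, split off from the existential choice of charts
  in \<open>smooth_map_on\<close> so that source and target chart can be exchanged
  separately.\<close>

definition smooth_in ::
  "('g, 'e::euclidean_space) chart \<Rightarrow> ('h, 'f::euclidean_space) chart \<Rightarrow> 'g set \<Rightarrow> ('g \<Rightarrow> 'h) \<Rightarrow> 'g \<Rightarrow> bool" where
  "smooth_in c d S f x \<longleftrightarrow> (\<exists>W F. open W \<and> snd c x \<in> W \<and> smooth_on W F \<and>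
     (\<forall>y\<in>fst c \<inter> S. snd c y \<in> W \<longrightarrow> f y \<in> fst d \<and> snd d (f y) = F (snd c y)))"

lemma smooth_inI:
  "open W \<Longrightarrow> snd c x \<in> W \<Longrightarrow> smooth_on W F \<Longrightarrow>
   (\<And>y. y \<in> fst c \<Longrightarrow> y \<in> S \<Longrightarrow> snd c y \<in> W \<Longrightarrow> f y \<in> fst d \<and> snd d (f y) = F (snd c y)) \<Longrightarrow>
   smooth_in c d S f x"
  unfolding smooth_in_def by blast

lemma smooth_inE:
  assumes "smooth_in c d S f x"
  obtains W F where "open W" "snd c x \<in> W" "smooth_on W F"
    "\<And>y. y \<in> fst c \<Longrightarrow> y \<in> S \<Longrightarrow> snd c y \<in> W \<Longrightarrow> f y \<in> fst d \<and> snd d (f y) = F (snd c y)"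
  using assms unfolding smooth_in_def by blast

lemma smooth_map_on_alt:
  "smooth_map_on A B S f \<longleftrightarrow>
     (\<forall>x\<in>S. \<exists>c\<in>A. \<exists>d\<in>B. x \<in> fst c \<and> f x \<in> fst d \<and> smooth_in c d S f x)"
  unfolding smooth_map_on_def smooth_in_def by (simp only: ex_simps)

lemma smooth_in_source:
  assumes A: "smooth_atlas A" "c \<in> A" "c' \<in> A" and x: "x \<in> fst c" "x \<in> fst c'"
    and s: "smooth_in c d S f x"
  shows "smooth_in c' d S f x"
proof -
  obtain W F where W: "open W" "snd c x \<in> W" "smooth_on W F"
    "\<And>y. y \<in> fst c \<Longrightarrow> y \<in> S \<Longrightarrow> snd c y \<in> W \<Longrightarrow> f y \<in> fst d \<and> snd d (f y) = F (snd c y)"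
    using s unfolding smooth_in_def by blast
  have ch: "is_chart c" "is_chart c'" using A smooth_atlas_chart by blast+
  let ?U = "snd c' ` (fst c' \<inter> fst c)" and ?t = "\<lambda>p. snd c (chart_inv c' p)"
  have U: "open ?U" using ch by (intro chart_image_open chart_open)
  have t: "smooth_on ?U ?t" using smooth_atlas_transition[OF A(1) A(3) A(2)] .
  let ?W = "?U \<inter> ?t -` W"
  have oW: "open ?W" using U t W(1) smooth_on_continuous by (intro continuous_open_preimage) auto
  show ?thesis
  proof (rule smooth_inI[OF oW])
    show "snd c' x \<in> ?W" using x W ch by (auto simp: chart_inv_left)
    show "smooth_on ?W (\<lambda>p. F (?t p))"
      by (rule smooth_on_compose[OF oW W(1) _ W(3)]) (auto intro: smooth_on_subset[OF t])
  next
    fix y assume y: "y \<in> fst c'" "y \<in> S" "snd c' y \<in> ?W"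
    then obtain z where z: "z \<in> fst c'" "z \<in> fst c" "snd c' y = snd c' z" by blast
    then have yz: "y = z" using chart_inj[OF ch(2) y(1)] by blast
    have "snd c y \<in> W" using y(3) chart_inv_left[OF ch(2) y(1)] by simp
    then show "f y \<in> fst d \<and> snd d (f y) = F (?t (snd c' y))"
      using W(4)[of y] z yz y(2) chart_inv_left[OF ch(2) y(1)] by simp
  qed
qed

lemma smooth_in_target:
  assumes B: "smooth_atlas B" "d \<in> B" "d' \<in> B" and x: "x \<in> fst c" "x \<in> S" "f x \<in> fst d" "f x \<in> fst d'"
    and s: "smooth_in c d S f x"
  shows "smooth_in c d' S f x"
proof -
  obtain W F where W: "open W" "snd c x \<in> W" "smooth_on W F"
    "\<And>y. y \<in> fst c \<Longrightarrow> y \<in> S \<Longrightarrow> snd c y \<in> W \<Longrightarrow> f y \<in> fst d \<and> snd d (f y) = F (snd c y)"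
    using s unfolding smooth_in_def by blast
  have ch: "is_chart d" "is_chart d'" using B smooth_atlas_chart by blast+
  let ?U = "snd d ` (fst d \<inter> fst d')" and ?t = "\<lambda>p. snd d' (chart_inv d p)"
  have U: "open ?U" using ch by (intro chart_image_open chart_open)
  have t: "smooth_on ?U ?t" using smooth_atlas_transition[OF B(1) B(2) B(3)] .
  let ?W = "W \<inter> F -` ?U"
  have oW: "open ?W" using U W smooth_on_continuous by (intro continuous_open_preimage) auto
  show ?thesis
  proof (rule smooth_inI[OF oW])
    show "snd c x \<in> ?W" using x W(2) W(4)[of x] by (auto intro!: image_eqI[of _ _ "f x"])
    show "smooth_on ?W (\<lambda>p. ?t (F p))"
      by (rule smooth_on_compose[OF oW U _ t]) (auto intro: smooth_on_subset[OF W(3)])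
  next
    fix y assume y: "y \<in> fst c" "y \<in> S" "snd c y \<in> ?W"
    with W(4)[of y] have f: "f y \<in> fst d" "snd d (f y) = F (snd c y)" by blast+
    then obtain z where z: "z \<in> fst d'" "z \<in> fst d" "snd d (f y) = snd d z" using y by auto
    then have "f y = z" using chart_inj[OF ch(1) f(1)] by blast
    then show "f y \<in> fst d' \<and> snd d' (f y) = ?t (F (snd c y))"
      using z f y ch by (metis chart_inv_left)
  qed
qed

text \<open>Compatibility of the charts turns the existential choice in the definition into any
  prescribed pair: the source chart is exchanged first, then the target chart.\<close>

lemma smooth_map_onD:
  assumes "smooth_map_on A B S f" "smooth_atlas A" "smooth_atlas B" "x \<in> S"
    "c \<in> A" "x \<in> fst c" "d \<in> B" "f x \<in> fst d"
  shows "smooth_in c d S f x"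
proof -
  obtain c0 d0 where c0: "c0 \<in> A" "d0 \<in> B" "x \<in> fst c0" "f x \<in> fst d0" "smooth_in c0 d0 S f x"
    using assms(1,4) unfolding smooth_map_on_alt by blast
  have "smooth_in c d0 S f x" by (rule smooth_in_source[OF assms(2) c0(1) assms(5) c0(3) assms(6) c0(5)])
  then show ?thesis
    by (rule smooth_in_target[where f = f and x = x, OF assms(3) c0(2) assms(7) assms(6) assms(4) c0(4) assms(8)])
qed

lemma smooth_map_onI:
  assumes "smooth_atlas A" "smooth_atlas B"
    and "\<And>x. x \<in> S \<Longrightarrow> smooth_in (chart_at A x) (chart_at B (f x)) S f x"
  shows "smooth_map_on A B S f"
  unfolding smooth_map_on_alt
proof
  fix x assume "x \<in> S"
  from assms(3)[OF this] chart_at_in[OF assms(1), of x] chart_at_in[OF assms(2), of "f x"]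
  show "\<exists>c\<in>A. \<exists>d\<in>B. x \<in> fst c \<and> f x \<in> fst d \<and> smooth_in c d S f x"
    by (intro bexI conjI)
qed

lemma smooth_map_on_compose:
  assumes A: "smooth_atlas A" "smooth_atlas B" "smooth_atlas C"
    and f: "smooth_map_on A B S f" and g: "smooth_map_on B C T g" and sub: "f ` S \<subseteq> T"
  shows "smooth_map_on A C S (\<lambda>x. g (f x))"
proof (rule smooth_map_onI[OF A(1) A(3)])
  fix x assume x: "x \<in> S"
  let ?c = "chart_at A x" and ?d = "chart_at B (f x)" and ?e = "chart_at C (g (f x))"
  have "smooth_in ?c ?d S f x"
    by (rule smooth_map_onD[OF f A(1,2) x]) (use A chart_at_in in blast)+
  then obtain W F where W: "open W" "snd ?c x \<in> W" "smooth_on W F"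
    "\<And>y. y \<in> fst ?c \<Longrightarrow> y \<in> S \<Longrightarrow> snd ?c y \<in> W \<Longrightarrow> f y \<in> fst ?d \<and> snd ?d (f y) = F (snd ?c y)"
    unfolding smooth_in_def by blast
  have "smooth_in ?d ?e T g (f x)"
    by (rule smooth_map_onD[OF g A(2,3)]) (use x sub A chart_at_in in blast)+
  then obtain V H where V: "open V" "snd ?d (f x) \<in> V" "smooth_on V H"
    "\<And>y. y \<in> fst ?d \<Longrightarrow> y \<in> T \<Longrightarrow> snd ?d y \<in> V \<Longrightarrow> g y \<in> fst ?e \<and> snd ?e (g y) = H (snd ?d y)"
    unfolding smooth_in_def by blast
  have oW: "open (W \<inter> F -` V)" using W V smooth_on_continuous by (intro continuous_open_preimage) auto
  have xx: "snd ?d (f x) = F (snd ?c x)" using W(4)[of x] W(2) x A chart_at_in by blast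
  show "smooth_in ?c ?e S (\<lambda>x. g (f x)) x"
  proof (rule smooth_inI[OF oW])
    show "snd ?c x \<in> W \<inter> F -` V" using W(2) V(2) xx by auto
    show "smooth_on (W \<inter> F -` V) (\<lambda>p. H (F p))"
      by (rule smooth_on_compose[OF oW V(1) _ V(3)]) (auto intro: smooth_on_subset[OF W(3)])
  next
    fix y assume y: "y \<in> fst ?c" "y \<in> S" "snd ?c y \<in> W \<inter> F -` V"
    then show "g (f y) \<in> fst ?e \<and> snd ?e (g (f y)) = H (F (snd ?c y))"
      using W(4)[of y] V(4)[of "f y"] sub by auto
  qed
qed

lemma smooth_in_mono:
  assumes "smooth_in c d S f x" "T \<subseteq> S" "\<And>y. y \<in> T \<Longrightarrow> f y = g y"
  shows "smooth_in c d T g x"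
proof -
  obtain W F where W: "open W" "snd c x \<in> W" "smooth_on W F"
    "\<And>y. y \<in> fst c \<Longrightarrow> y \<in> S \<Longrightarrow> snd c y \<in> W \<Longrightarrow> f y \<in> fst d \<and> snd d (f y) = F (snd c y)"
    using assms(1) unfolding smooth_in_def by blast
  show ?thesis
  proof (rule smooth_inI[OF W(1-3)])
    fix y assume "y \<in> fst c" "y \<in> T" "snd c y \<in> W"
    with W(4)[of y] assms(2) assms(3)[of y]
    show "g y \<in> fst d \<and> snd d (g y) = F (snd c y)" by auto
  qed
qed

lemma smooth_map_on_mono:
  assumes "smooth_map_on A B S f" "T \<subseteq> S" "\<And>y. y \<in> T \<Longrightarrow> f y = g y"
  shows "smooth_map_on A B T g"
  unfolding smooth_map_on_alt
proof
  fix x assume x: "x \<in> T"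
  then obtain c d where "c \<in> A" "d \<in> B" "x \<in> fst c" "f x \<in> fst d" "smooth_in c d S f x"
    using assms(1,2) unfolding smooth_map_on_alt by blast
  moreover have "smooth_in c d T g x" by (rule smooth_in_mono[OF \<open>smooth_in c d S f x\<close> assms(2,3)])
  ultimately show "\<exists>c\<in>A. \<exists>d\<in>B. x \<in> fst c \<and> g x \<in> fst d \<and> smooth_in c d T g x"
    using assms(3)[OF x] by auto
qed

lemmas smooth_map_on_subset = smooth_map_on_mono[OF _ _ refl]
lemmas smooth_map_on_cong = smooth_map_on_mono[OF _ subset_refl]

lemma smooth_map_on_local:
  assumes A: "smooth_atlas A" "smooth_atlas B"
    and loc: "\<And>x. x \<in> S \<Longrightarrow> \<exists>U. open U \<and> x \<in> U \<and> smooth_map_on A B (S \<inter> U) f"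
  shows "smooth_map_on A B S f"
proof (rule smooth_map_onI[OF A])
  fix x assume x: "x \<in> S"
  let ?c = "chart_at A x" and ?d = "chart_at B (f x)"
  obtain U where U: "open U" "x \<in> U" "smooth_map_on A B (S \<inter> U) f" using loc[OF x] by blast
  have ch: "is_chart ?c" using A chart_at_in smooth_atlas_chart by blast
  have "smooth_in ?c ?d (S \<inter> U) f x"
    by (rule smooth_map_onD[OF U(3) A]) (use U x A chart_at_in in blast)+
  then obtain W F where W: "open W" "snd ?c x \<in> W" "smooth_on W F"
    "\<And>y. y \<in> fst ?c \<Longrightarrow> y \<in> S \<inter> U \<Longrightarrow> snd ?c y \<in> W \<Longrightarrow> f y \<in> fst ?d \<and> snd ?d (f y) = F (snd ?c y)"
    unfolding smooth_in_def by blast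
  show "smooth_in ?c ?d S f x"
  proof (rule smooth_inI)
    show "open (W \<inter> snd ?c ` (fst ?c \<inter> U))" using W chart_image_open[OF ch U(1)] by auto
    show "snd ?c x \<in> W \<inter> snd ?c ` (fst ?c \<inter> U)" using W U A chart_at_in by blast
    show "smooth_on (W \<inter> snd ?c ` (fst ?c \<inter> U)) F" by (rule smooth_on_subset[OF W(3)]) auto
  next
    fix y assume y: "y \<in> fst ?c" "y \<in> S" "snd ?c y \<in> W \<inter> snd ?c ` (fst ?c \<inter> U)"
    then have "y \<in> U" using chart_inj[OF ch] by blast
    then show "f y \<in> fst ?d \<and> snd ?d (f y) = F (snd ?c y)" using W(4)[of y] y by blast
  qed
qed

lemma smooth_map_on_const:
  assumes A: "smooth_atlas A" "smooth_atlas B" shows "smooth_map_on A B S (\<lambda>x. b)"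
proof (rule smooth_map_onI[OF A])
  fix x
  show "smooth_in (chart_at A x) (chart_at B b) S (\<lambda>x. b) x"
    by (rule smooth_inI[where W = UNIV and F = "\<lambda>_. snd (chart_at B b) b"])
      (use A(2) chart_at_in(2) in \<open>simp_all add: smooth_on_const\<close>)
qed

lemma smooth_map_on_ident:
  assumes A: "smooth_atlas A" shows "smooth_map_on A A S (\<lambda>x. x)"
proof (rule smooth_map_onI[OF A A])
  fix x
  let ?c = "chart_at A x"
  have ch: "is_chart ?c" using A chart_at_in smooth_atlas_chart by blast
  show "smooth_in ?c ?c S (\<lambda>x. x) x"
    by (rule smooth_inI[where W = UNIV and F = "\<lambda>x. x"]) (auto intro: smooth_on_id)
qed

lemma at_within_Int_open: "open V \<Longrightarrow> x \<in> V \<Longrightarrow> at x within (S \<inter> V) = at x within S"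
  by (rule at_within_nhd[of x V]) auto

lemma smooth_map_on_continuous:
  assumes A: "smooth_atlas A" "smooth_atlas B" and f: "smooth_map_on A B S f"
  shows "continuous_on S f"
  unfolding continuous_on_def
proof
  fix x assume x: "x \<in> S"
  let ?c = "chart_at A x" and ?d = "chart_at B (f x)"
  have ch: "is_chart ?c" "is_chart ?d" using A chart_at_in smooth_atlas_chart by blast+
  have xc: "x \<in> fst ?c" "f x \<in> fst ?d" using A chart_at_in by blast+
  have "smooth_in ?c ?d S f x"
    by (rule smooth_map_onD[OF f A x]) (use A chart_at_in in blast)+
  then obtain W F where W: "open W" "snd ?c x \<in> W" "smooth_on W F"
    "\<And>y. y \<in> fst ?c \<Longrightarrow> y \<in> S \<Longrightarrow> snd ?c y \<in> W \<Longrightarrow> f y \<in> fst ?d \<and> snd ?d (f y) = F (snd ?c y)"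
    unfolding smooth_in_def by blast
  have cc: "continuous_on (fst ?c) (snd ?c)" and cd: "continuous_on (snd ?d ` fst ?d) (chart_inv ?d)"
    using ch by (auto simp: is_chart_def homeomorphism_def)
  let ?V = "fst ?c \<inter> snd ?c -` W"
  have oV: "open ?V" using cc W(1) chart_open[OF ch(1)] by (intro continuous_open_preimage)
  have "continuous_on (S \<inter> ?V) (\<lambda>y. chart_inv ?d (F (snd ?c y)))"
  proof (rule continuous_on_compose2[OF cd], rule continuous_on_compose2[OF smooth_on_continuous[OF W(3)]])
    show "continuous_on (S \<inter> ?V) (snd ?c)" by (rule continuous_on_subset[OF cc]) blast
    show "(\<lambda>y. F (snd ?c y)) ` (S \<inter> ?V) \<subseteq> snd ?d ` fst ?d"
    proof
      fix p assume "p \<in> (\<lambda>y. F (snd ?c y)) ` (S \<inter> ?V)"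
      then obtain y where y: "y \<in> S" "y \<in> ?V" "p = F (snd ?c y)" by auto
      then have "f y \<in> fst ?d \<and> snd ?d (f y) = F (snd ?c y)" using W(4)[of y] by simp
      then show "p \<in> snd ?d ` fst ?d" unfolding y(3) by (metis imageI)
    qed
  qed auto
  then have "continuous_on (S \<inter> ?V) f"
  proof (rule continuous_on_eq)
    fix y assume "y \<in> S \<inter> ?V"
    then show "chart_inv ?d (F (snd ?c y)) = f y"
      using W(4)[of y] chart_inv_left[OF ch(2), of "f y"] by auto
  qed
  then have "(f \<longlongrightarrow> f x) (at x within (S \<inter> ?V))"
    using x xc W(2) by (simp add: continuous_on_def)
  then show "(f \<longlongrightarrow> f x) (at x within S)"
    using at_within_Int_open[OF oV, of x S] xc W(2) by simp
qed

text \<open>Made for composing the group multiplication with two smooth maps. The product chart is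
  split into its two factors, each treated in its own atlas.\<close>

lemma smooth_map_on_pair_compose:
  assumes A: "smooth_atlas A" "smooth_atlas B" "smooth_atlas C" "smooth_atlas E"
    and h: "smooth_map_on (prod_atlas B C) E UNIV h"
    and f: "smooth_map_on A B S f" and g: "smooth_map_on A C S g"
  shows "smooth_map_on A E S (\<lambda>x. h (f x, g x))"
  unfolding smooth_map_on_alt
proof
  fix x assume x: "x \<in> S"
  obtain p e where p: "p \<in> prod_atlas B C" "e \<in> E" "(f x, g x) \<in> fst p" "h (f x, g x) \<in> fst e"
    "smooth_in p e UNIV h (f x, g x)"
    using h unfolding smooth_map_on_alt by blast
  obtain b c where bc: "b \<in> B" "c \<in> C" "p = (fst b \<times> fst c, map_prod (snd b) (snd c))"
    using p(1) unfolding prod_atlas_def by blast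
  let ?a = "chart_at A x"
  have a: "?a \<in> A" "x \<in> fst ?a" using chart_at_in[OF A(1)] by auto
  have xb: "f x \<in> fst b" "g x \<in> fst c" using p(3) bc by auto
  obtain W H where W: "open W" "snd p (f x, g x) \<in> W" "smooth_on W H"
    "\<And>y. y \<in> fst p \<Longrightarrow> y \<in> UNIV \<Longrightarrow> snd p y \<in> W \<Longrightarrow> h y \<in> fst e \<and> snd e (h y) = H (snd p y)"
    by (rule smooth_inE[OF p(5)]) blast
  obtain U F where U: "open U" "snd ?a x \<in> U" "smooth_on U F"
    "\<And>y. y \<in> fst ?a \<Longrightarrow> y \<in> S \<Longrightarrow> snd ?a y \<in> U \<Longrightarrow> f y \<in> fst b \<and> snd b (f y) = F (snd ?a y)"
    by (rule smooth_inE[OF smooth_map_onD[OF f A(1,2) x a bc(1) xb(1)]]) blast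
  obtain V K where V: "open V" "snd ?a x \<in> V" "smooth_on V K"
    "\<And>y. y \<in> fst ?a \<Longrightarrow> y \<in> S \<Longrightarrow> snd ?a y \<in> V \<Longrightarrow> g y \<in> fst c \<and> snd c (g y) = K (snd ?a y)"
    by (rule smooth_inE[OF smooth_map_onD[OF g A(1,3) x a bc(2) xb(2)]]) blast
  have oUV: "open (U \<inter> V)" using U V by auto
  have FK: "smooth_on (U \<inter> V) (\<lambda>p. (F p, K p))"
    by (rule smooth_on_Pair[OF oUV smooth_on_subset[OF U(3)] smooth_on_subset[OF V(3)]]) auto
  let ?W = "(U \<inter> V) \<inter> (\<lambda>p. (F p, K p)) -` W"
  have oW: "open ?W" using smooth_on_continuous[OF FK] oUV W(1) by (rule continuous_open_preimage)
  have "smooth_in ?a e S (\<lambda>x. h (f x, g x)) x"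
  proof (rule smooth_inI[OF oW])
    show "snd ?a x \<in> ?W"
      using U(2) V(2) W(2) U(4)[OF a(2) x U(2)] V(4)[OF a(2) x V(2)] bc(3) by auto
    show "smooth_on ?W (\<lambda>p. H (F p, K p))"
      by (rule smooth_on_compose[OF oW W(1) _ W(3)]) (auto intro: smooth_on_subset[OF FK])
  next
    fix y assume y: "y \<in> fst ?a" "y \<in> S" "snd ?a y \<in> ?W"
    then have "f y \<in> fst b \<and> snd b (f y) = F (snd ?a y)" "g y \<in> fst c \<and> snd c (g y) = K (snd ?a y)"
      using U(4)[of y] V(4)[of y] by blast+
    then show "h (f y, g y) \<in> fst e \<and> snd e (h (f y, g y)) = H (F (snd ?a y), K (snd ?a y))"
      using W(4)[of "(f y, g y)"] y bc(3) by auto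
  qed
  then show "\<exists>c\<in>A. \<exists>d\<in>E. x \<in> fst c \<and> h (f x, g x) \<in> fst d \<and> smooth_in c d S (\<lambda>x. h (f x, g x)) x"
    using a p by blast
qed

lemma smooth_map_on_euclidI:
  assumes "open W" "smooth_on W f"
  shows "smooth_map_on euclid_atlas euclid_atlas W f"
  unfolding smooth_map_on_alt
proof
  fix x assume "x \<in> W"
  then have "smooth_in (UNIV, \<lambda>x. x) (UNIV, \<lambda>x. x) W f x"
    by (intro smooth_inI[OF assms(1) _ assms(2)]) auto
  then show "\<exists>c\<in>euclid_atlas. \<exists>d\<in>euclid_atlas. x \<in> fst c \<and> f x \<in> fst d \<and> smooth_in c d W f x"
    by (auto simp: euclid_atlas_def)
qed

lemma smooth_on_local:
  assumes "open S" "\<And>x. x \<in> S \<Longrightarrow> \<exists>W. open W \<and> x \<in> W \<and> smooth_on W f"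
  shows "smooth_on S f"
  unfolding smooth_on_def
proof (intro allI Ck_on_local[OF assms(1)])
  fix k x assume "x \<in> S"
  then show "\<exists>W. open W \<and> x \<in> W \<and> Ck_on k W f" using assms(2) unfolding smooth_on_def by blast
qed

lemma smooth_map_on_chart_coords:
  fixes f :: "'a::euclidean_space \<Rightarrow> 'g::topological_space"
  assumes A: "smooth_atlas A" and f: "smooth_map_on euclid_atlas A W f" and W: "open W"
    and x: "x \<in> W" "d \<in> A" "f x \<in> fst d"
  shows "\<exists>V. open V \<and> x \<in> V \<and> V \<subseteq> W \<and> f ` V \<subseteq> fst d \<and> smooth_on V (\<lambda>y. snd d (f y))"
proof -
  have "smooth_in (UNIV, \<lambda>x. x) d W f x"
    by (rule smooth_map_onD[OF f smooth_atlas_euclid A x(1) _ _ x(2,3)]) (auto simp: euclid_atlas_def)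
  then obtain U F where U: "open U" "x \<in> U" "smooth_on U F"
    "\<And>y. y \<in> W \<Longrightarrow> y \<in> U \<Longrightarrow> f y \<in> fst d \<and> snd d (f y) = F y"
    by (rule smooth_inE) auto
  have "smooth_on (U \<inter> W) (\<lambda>y. snd d (f y))"
    by (rule smooth_on_cong[OF _ _ smooth_on_subset[OF U(3)]]) (use U W in auto)
  then show ?thesis using U W x(1) by (intro exI[of _ "U \<inter> W"]) auto
qed

lemma smooth_map_on_chart:
  assumes A: "smooth_atlas A" "c \<in> A"
  shows "smooth_map_on A euclid_atlas (fst c) (snd c)"
  unfolding smooth_map_on_alt
proof
  fix x assume x: "x \<in> fst c"
  have "smooth_in c (UNIV, \<lambda>x. x) (fst c) (snd c) x"
    by (rule smooth_inI[where W = UNIV and F = "\<lambda>x. x"]) (auto intro: smooth_on_id)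
  then show "\<exists>c'\<in>A. \<exists>d\<in>euclid_atlas. x \<in> fst c' \<and> snd c x \<in> fst d \<and> smooth_in c' d (fst c) (snd c) x"
    using A x by (auto simp: euclid_atlas_def)
qed

lemma smooth_map_on_chart_inv:
  assumes A: "smooth_atlas A" "c \<in> A"
  shows "smooth_map_on euclid_atlas A (snd c ` fst c) (chart_inv c)"
  unfolding smooth_map_on_alt
proof
  have ch: "is_chart c" by (rule smooth_atlas_chart[OF A])
  fix x assume x: "x \<in> snd c ` fst c"
  have "smooth_in (UNIV, \<lambda>x. x) c (snd c ` fst c) (chart_inv c) x"
    by (rule smooth_inI[where W = UNIV and F = "\<lambda>x. x"])
      (auto intro: smooth_on_id chart_inv_mem[OF ch] simp: chart_inv_left[OF ch])
  then show "\<exists>c'\<in>euclid_atlas. \<exists>d\<in>A. x \<in> fst c' \<and> chart_inv c x \<in> fst d \<and>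
      smooth_in c' d (snd c ` fst c) (chart_inv c) x"
    using A chart_inv_mem[OF ch x] by (auto simp: euclid_atlas_def)
qed

text \<open>On a closed interval, smoothness means that local extensions exist in coordinates.
  Cutting the domain down to where the extension stays in the image of the chart makes it a map into
  the manifold. This controls a path up to its breakpoints.\<close>

lemma smooth_map_on_real_extend:
  fixes \<gamma> :: "'a::euclidean_space \<Rightarrow> 'g::topological_space"
  assumes A: "smooth_atlas A" and f: "smooth_map_on euclid_atlas A S \<gamma>" and x: "x \<in> S"
  shows "\<exists>W \<gamma>'. open W \<and> x \<in> W \<and> smooth_map_on euclid_atlas A W \<gamma>' \<and> (\<forall>y\<in>S \<inter> W. \<gamma>' y = \<gamma> y)"
proof -
  let ?d = "chart_at A (\<gamma> x)"
  have d: "?d \<in> A" "\<gamma> x \<in> fst ?d" using chart_at_in[OF A] by auto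
  have ch: "is_chart ?d" by (rule smooth_atlas_chart[OF A d(1)])
  have "smooth_in (UNIV, \<lambda>x. x) ?d S \<gamma> x"
    by (rule smooth_map_onD[OF f smooth_atlas_euclid A x _ _ d]) (auto simp: euclid_atlas_def)
  then obtain U F where U: "open U" "x \<in> U" "smooth_on U F"
    "\<And>y. y \<in> S \<Longrightarrow> y \<in> U \<Longrightarrow> \<gamma> y \<in> fst ?d \<and> snd ?d (\<gamma> y) = F y"
    by (rule smooth_inE) auto
  have oi: "open (snd ?d ` fst ?d)" using ch by (simp add: is_chart_def)
  let ?W = "U \<inter> F -` (snd ?d ` fst ?d)"
  have oW: "open ?W" using smooth_on_continuous[OF U(3)] U(1) oi by (rule continuous_open_preimage)
  have FW: "smooth_map_on euclid_atlas euclid_atlas ?W F"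
    by (rule smooth_map_on_euclidI[OF oW smooth_on_subset[OF U(3)]]) auto
  have "smooth_map_on euclid_atlas A ?W (\<lambda>y. chart_inv ?d (F y))"
    by (rule smooth_map_on_compose[OF smooth_atlas_euclid smooth_atlas_euclid A FW smooth_map_on_chart_inv[OF A d(1)]]) auto
  moreover have "x \<in> ?W" using U(2) U(4)[OF x U(2)] by force
  moreover have "\<forall>y\<in>S \<inter> ?W. chart_inv ?d (F y) = \<gamma> y"
  proof
    fix y assume "y \<in> S \<inter> ?W"
    then show "chart_inv ?d (F y) = \<gamma> y"
      using U(4)[of y] chart_inv_left[OF ch, of "\<gamma> y"] by auto
  qed
  ultimately show ?thesis using oW by blast
qed

section \<open>Velocities of curves\<close>

definition smooth_near :: "('g, 'e::euclidean_space) atlas \<Rightarrow> ('a::euclidean_space \<Rightarrow> 'g) \<Rightarrow> 'a \<Rightarrow> bool" where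
  "smooth_near A \<gamma> t \<longleftrightarrow> (\<exists>W. open W \<and> t \<in> W \<and> smooth_map_on euclid_atlas A W \<gamma>)"

lemma smooth_nearI: "smooth_map_on euclid_atlas A W \<gamma> \<Longrightarrow> open W \<Longrightarrow> t \<in> W \<Longrightarrow> smooth_near A \<gamma> t"
  unfolding smooth_near_def by blast

lemma smooth_near_cong:
  assumes "smooth_near A \<gamma> t" "open U" "t \<in> U" "\<And>s. s \<in> U \<Longrightarrow> \<gamma> s = \<gamma>' s"
  shows "smooth_near A \<gamma>' t"
proof -
  obtain W where W: "open W" "t \<in> W" "smooth_map_on euclid_atlas A W \<gamma>"
    using assms(1) unfolding smooth_near_def by blast
  have "smooth_map_on euclid_atlas A (W \<inter> U) \<gamma>'"
    by (rule smooth_map_on_mono[OF W(3)]) (use assms(4) in auto)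
  then show ?thesis by (rule smooth_nearI) (use W assms in auto)
qed

lemma smooth_near_compose_on:
  assumes A: "smooth_atlas A" "smooth_atlas B" and f: "smooth_map_on A B S f" and g: "smooth_near A \<gamma> t"
    and U: "open U" "t \<in> U" "\<gamma> ` U \<subseteq> S"
  shows "smooth_near B (\<lambda>s. f (\<gamma> s)) t"
proof -
  obtain W where W: "open W" "t \<in> W" "smooth_map_on euclid_atlas A W \<gamma>"
    using g unfolding smooth_near_def by blast
  have "smooth_map_on euclid_atlas B (W \<inter> U) (\<lambda>s. f (\<gamma> s))"
    by (rule smooth_map_on_compose[OF smooth_atlas_euclid A smooth_map_on_subset[OF W(3)] f]) (use U in auto)
  then show ?thesis by (rule smooth_nearI) (use W U in auto)
qed

lemmas smooth_near_compose = smooth_near_compose_on[where S = UNIV and U = UNIV, simplified]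

lemma smooth_near_reparam:
  assumes A: "smooth_atlas A" and g: "smooth_near A \<gamma> (f t)" and f: "smooth_on W f" "open W" "t \<in> W"
  shows "smooth_near A (\<lambda>s. \<gamma> (f s)) t"
proof -
  obtain V where V: "open V" "f t \<in> V" "smooth_map_on euclid_atlas A V \<gamma>"
    using g unfolding smooth_near_def by blast
  have o: "open (W \<inter> f -` V)" using smooth_on_continuous[OF f(1)] f(2) V(1) by (rule continuous_open_preimage)
  have "smooth_map_on euclid_atlas A (W \<inter> f -` V) (\<lambda>s. \<gamma> (f s))"
    by (rule smooth_map_on_compose[OF smooth_atlas_euclid smooth_atlas_euclid A
        smooth_map_on_euclidI[OF o smooth_on_subset[OF f(1)]] V(3)]) auto
  then show ?thesis by (rule smooth_nearI) (use o f V in auto)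
qed

lemma smooth_near_chart_coords:
  assumes A: "smooth_atlas A" and g: "smooth_near A \<gamma> t" and U: "open U" "t \<in> U" and c: "c \<in> A" "\<gamma> t \<in> fst c"
  obtains V where "open V" "t \<in> V" "V \<subseteq> U" "\<gamma> ` V \<subseteq> fst c" "smooth_on V (\<lambda>s. snd c (\<gamma> s))"
proof -
  obtain W where W: "open W" "t \<in> W" "smooth_map_on euclid_atlas A W \<gamma>"
    using g unfolding smooth_near_def by blast
  have "smooth_map_on euclid_atlas A (W \<inter> U) \<gamma>" by (rule smooth_map_on_subset[OF W(3)]) auto
  from smooth_map_on_chart_coords[OF A this _ _ c] W U that show ?thesis by (metis IntI le_inf_iff open_Int)
qed

lemma smooth_near_differentiable:
  assumes A: "smooth_atlas A" and g: "smooth_near A \<gamma> t" and c: "c \<in> A" "\<gamma> t \<in> fst c"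
  shows "(\<lambda>s. snd c (\<gamma> s)) differentiable (at t)"
  by (rule smooth_near_chart_coords[OF A g open_UNIV UNIV_I c]) (rule smooth_on_differentiable)

lemma has_velocity:
  assumes "smooth_atlas A" "smooth_near A \<gamma> t"
  shows "((\<lambda>s. snd (chart_at A (\<gamma> t)) (\<gamma> s)) has_vector_derivative velocity A \<gamma> t) (at t)"
  unfolding velocity_def o_def
  using smooth_near_differentiable[OF assms] chart_at_in[OF assms(1)] vector_derivative_works by blast

lemma velocity_eqI:
  assumes "((\<lambda>s. snd (chart_at A (\<gamma> t)) (\<gamma> s)) has_vector_derivative v) (at t)"
  shows "velocity A \<gamma> t = v"
  unfolding velocity_def o_def by (rule vector_derivative_at[OF assms])

lemma velocity_cong:
  assumes "open U" "t \<in> U" "\<And>s. s \<in> U \<Longrightarrow> \<gamma> s = \<gamma>' s"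
  shows "velocity A \<gamma> t = velocity A \<gamma>' t"
proof -
  have e: "\<gamma> t = \<gamma>' t" using assms by auto
  have "(snd (chart_at A (\<gamma>' t)) \<circ> \<gamma> has_vector_derivative v) (at t) \<longleftrightarrow>
    (snd (chart_at A (\<gamma>' t)) \<circ> \<gamma>' has_vector_derivative v) (at t)" for v
    using has_vector_derivative_transform_within_open[OF _ assms(1,2)] assms(3)
    by (metis (no_types, lifting) comp_apply)
  then show ?thesis unfolding velocity_def vector_derivative_def e by simp
qed

lemma velocity_euclid: "velocity euclid_atlas \<gamma> t = vector_derivative \<gamma> (at t)"
  by (simp add: velocity_def chart_at_euclid o_def)

lemma velocity_const: "velocity A (\<lambda>s. x) t = 0"
  by (rule velocity_eqI) simp

lemma smooth_near_const: "smooth_atlas A \<Longrightarrow> smooth_near A (\<lambda>s. x) t"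
  by (rule smooth_nearI[OF smooth_map_on_const[OF smooth_atlas_euclid] open_UNIV UNIV_I])

lemma velocity_reparam:
  fixes f :: "real \<Rightarrow> real"
  assumes A: "smooth_atlas A" and g: "smooth_near A \<gamma> (f t)" and f: "(f has_real_derivative f') (at t)"
  shows "velocity A (\<lambda>s. \<gamma> (f s)) t = f' *\<^sub>R velocity A \<gamma> (f t)"
proof (rule velocity_eqI)
  have "(f has_vector_derivative f') (at t)" using f by (simp add: has_real_derivative_iff_has_vector_derivative)
  from vector_diff_chain_at[OF this has_velocity[OF A g]]
  show "((\<lambda>s. snd (chart_at A (\<gamma> (f t))) (\<gamma> (f s))) has_vector_derivative f' *\<^sub>R velocity A \<gamma> (f t)) (at t)"
    by (simp add: o_def)
qed

lemma differential_has_derivative: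
  assumes A: "smooth_atlas A" "smooth_atlas B" and f: "smooth_map_on A B UNIV f"
  shows "((\<lambda>p. snd (chart_at B (f x)) (f (chart_inv (chart_at A x) p))) has_derivative differential A B f x)
    (at (snd (chart_at A x) x))"
proof -
  let ?c = "chart_at A x" and ?d = "chart_at B (f x)"
  have c: "?c \<in> A" "x \<in> fst ?c" and d: "?d \<in> B" "f x \<in> fst ?d" using chart_at_in A by blast+
  have ch: "is_chart ?c" using smooth_atlas_chart[OF A(1) c(1)] .
  have x: "chart_inv ?c (snd ?c x) = x" by (rule chart_inv_left[OF ch c(2)])
  have "smooth_near B (\<lambda>p. f (chart_inv ?c p)) (snd ?c x)"
    by (rule smooth_nearI[OF smooth_map_on_compose[OF smooth_atlas_euclid A smooth_map_on_chart_inv[OF A(1) c(1)] f]])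
      (use ch c in \<open>auto simp: is_chart_def\<close>)
  from smooth_near_differentiable[OF A(2) this d(1)] d(2)
  show ?thesis unfolding differential_def o_def x by (simp add: frechet_derivative_works)
qed

lemma differential_linear:
  "smooth_atlas A \<Longrightarrow> smooth_atlas B \<Longrightarrow> smooth_map_on A B UNIV f \<Longrightarrow> linear (differential A B f x)"
  using differential_has_derivative has_derivative_linear by blast

lemma velocity_compose:
  assumes A: "smooth_atlas A" "smooth_atlas B" and f: "smooth_map_on A B UNIV f" and g: "smooth_near A \<gamma> t"
  shows "velocity B (\<lambda>s. f (\<gamma> s)) t = differential A B f (\<gamma> t) (velocity A \<gamma> t)"
proof (rule velocity_eqI)
  let ?c = "chart_at A (\<gamma> t)" and ?d = "chart_at B (f (\<gamma> t))"
  have c: "?c \<in> A" "\<gamma> t \<in> fst ?c" using chart_at_in A by blast+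
  have ch: "is_chart ?c" using smooth_atlas_chart[OF A(1) c(1)] .
  obtain V where V: "open V" "t \<in> V" "\<gamma> ` V \<subseteq> fst ?c"
    by (rule smooth_near_chart_coords[OF A(1) g open_UNIV UNIV_I c])
  have "((\<lambda>s. snd ?d (f (chart_inv ?c (snd ?c (\<gamma> s))))) has_vector_derivative
      differential A B f (\<gamma> t) (velocity A \<gamma> t)) (at t)"
    using diff_chain_at[OF has_velocity[OF A(1) g, unfolded has_vector_derivative_def] differential_has_derivative[OF A f]]
      linear_scale[OF differential_linear[OF A f]]
    by (simp add: o_def has_vector_derivative_def)
  then show "((\<lambda>s. snd ?d (f (\<gamma> s))) has_vector_derivative differential A B f (\<gamma> t) (velocity A \<gamma> t)) (at t)"
    by (rule has_vector_derivative_transform_within_open[OF _ V(1,2)])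
      (use V(3) chart_inv_left[OF ch] in auto)
qed

text \<open>\<open>tangent_space\<close> admits only curves that stay in \<open>S\<close> on the
  whole line. The substitution \<open>t + \<epsilon> * sin (s / \<epsilon>)\<close> folds the line
  into the interval of radius \<open>\<epsilon>\<close> about \<open>t\<close> and has derivative 1
  at 0, so it keeps the velocity.\<close>

lemma velocity_in_tangent_ex:
  fixes \<kappa> :: "real \<Rightarrow> 'g::topological_space"
  assumes A: "smooth_atlas A" and k: "smooth_near A \<kappa> t" and U: "open U" "t \<in> U" "\<kappa> ` U \<subseteq> S"
  obtains \<epsilon> where "\<epsilon> > 0" "curve_in A S (\<kappa> t) (\<lambda>s. \<kappa> (t + \<epsilon> * sin (s / \<epsilon>)))"
proof -
  obtain W where W: "open W" "t \<in> W" "smooth_map_on euclid_atlas A W \<kappa>"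
    using k unfolding smooth_near_def by blast
  obtain \<epsilon> where e: "\<epsilon> > 0" "cball t \<epsilon> \<subseteq> W \<inter> U"
    using W U open_contains_cball[of "W \<inter> U"] by (meson IntI open_Int)
  let ?f = "\<lambda>s. t + \<epsilon> * sin (s / \<epsilon>)"
  have m: "?f s \<in> W \<inter> U" for s
    using e abs_sin_le_one[of "s / \<epsilon>"] by (auto intro!: subsetD[OF e(2)] simp: dist_real_def abs_mult)
  have l: "smooth_on UNIV (\<lambda>s. s / \<epsilon>)" using smooth_on_linear[OF bounded_linear_divide] .
  have s: "smooth_on UNIV (\<lambda>s. sin (s / \<epsilon>))"
    by (rule smooth_on_compose[OF open_UNIV open_UNIV l]) (use smooth_on_sin_cos in auto)
  have "smooth_on UNIV ?f"
    by (rule smooth_on_add[OF open_UNIV smooth_on_const smooth_on_linear_comp[OF open_UNIV bounded_linear_mult_right s]])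
  then have "smooth_map_on euclid_atlas A UNIV (\<lambda>s. \<kappa> (?f s))"
    by (intro smooth_map_on_compose[OF smooth_atlas_euclid smooth_atlas_euclid A _ W(3)] smooth_map_on_euclidI)
      (use m in auto)
  then have "curve_in A S (\<kappa> t) (\<lambda>s. \<kappa> (?f s))" using m U(3) by (auto simp: curve_in_def)
  with e that show ?thesis by blast
qed

lemma velocity_sin_reparam:
  assumes A: "smooth_atlas A" and k: "smooth_near A \<kappa> t" and "\<epsilon> > 0"
  shows "velocity A (\<lambda>s. \<kappa> (t + \<epsilon> * sin (s / \<epsilon>))) 0 = velocity A \<kappa> t"
proof -
  have "((\<lambda>s. t + \<epsilon> * sin (s / \<epsilon>)) has_real_derivative 1) (at 0)"
    using assms(3) by (auto intro!: derivative_eq_intros)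
  from velocity_reparam[OF A _ this] k show ?thesis by simp
qed

lemma velocity_in_tangent:
  assumes A: "smooth_atlas A" and k: "smooth_near A \<kappa> t" and U: "open U" "t \<in> U" "\<kappa> ` U \<subseteq> S"
  shows "velocity A \<kappa> t \<in> tangent_space A S (\<kappa> t)"
  using velocity_in_tangent_ex[OF assms] velocity_sin_reparam[OF A k] unfolding tangent_space_def
  by (smt (verit, ccfv_SIG) mem_Collect_eq)

lemma curve_in_smooth_near: "curve_in A S x \<gamma> \<Longrightarrow> smooth_near A \<gamma> t"
  unfolding curve_in_def smooth_near_def by blast

lemma tangent_vector_ex:
  assumes A: "smooth_atlas A" obtains \<gamma> where "curve_in A UNIV x \<gamma>" "velocity A \<gamma> 0 = X"
proof -
  let ?c = "chart_at A x"
  have c: "?c \<in> A" "x \<in> fst ?c" using chart_at_in A by blast+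
  have ch: "is_chart ?c" using smooth_atlas_chart[OF A c(1)] .
  have x: "chart_inv ?c (snd ?c x) = x" by (rule chart_inv_left[OF ch c(2)])
  let ?l = "\<lambda>s::real. snd ?c x + s *\<^sub>R X"
  have l: "smooth_on UNIV ?l"
    by (rule smooth_on_add[OF open_UNIV smooth_on_const smooth_on_linear[OF bounded_linear_scaleR_left]])
  have oi: "open (snd ?c ` fst ?c)" using ch by (simp add: is_chart_def)
  have n: "smooth_near A (chart_inv ?c) (?l 0)"
    by (rule smooth_nearI[OF smooth_map_on_chart_inv[OF A c(1)] oi]) (use c in auto)
  have k: "smooth_near A (\<lambda>s. chart_inv ?c (?l s)) 0"
    by (rule smooth_near_reparam[where f = ?l, OF A n l open_UNIV UNIV_I])
  have o: "open (UNIV \<inter> ?l -` (snd ?c ` fst ?c))"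
    using smooth_on_continuous[OF l] open_UNIV oi by (rule continuous_open_preimage)
  have v: "velocity A (\<lambda>s. chart_inv ?c (?l s)) 0 = X"
  proof (rule velocity_eqI)
    have "(?l has_vector_derivative X) (at 0)"
      by (auto intro!: derivative_eq_intros)
    then have "((\<lambda>s. snd ?c (chart_inv ?c (?l s))) has_vector_derivative X) (at 0)"
      by (rule has_vector_derivative_transform_within_open[OF _ o]) (use c chart_inv_right[OF ch] in auto)
    then show "((\<lambda>s. snd (chart_at A (chart_inv ?c (?l 0))) (chart_inv ?c (?l s))) has_vector_derivative X) (at 0)"
      by (simp add: x)
  qed
  obtain \<epsilon> where "\<epsilon> > 0" "curve_in A UNIV (chart_inv ?c (?l 0)) (\<lambda>s. chart_inv ?c (?l (0 + \<epsilon> * sin (s / \<epsilon>))))"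
    by (rule velocity_in_tangent_ex[OF A k open_UNIV UNIV_I subset_UNIV])
  with velocity_sin_reparam[OF A k] v that show ?thesis by (simp add: x)
qed

text \<open>The product rule in disguise: for a product of two curves, each depending on its own
  variable, it splits the velocity along the diagonal into the two partial velocities.\<close>

lemma velocity_diag:
  fixes \<Psi> :: "real \<times> real \<Rightarrow> 'g::topological_space"
  assumes A: "smooth_atlas A" and P: "smooth_near A \<Psi> (t, t)"
  shows "velocity A (\<lambda>s. \<Psi> (s, s)) t = velocity A (\<lambda>s. \<Psi> (s, t)) t + velocity A (\<lambda>s. \<Psi> (t, s)) t"
proof -
  let ?c = "chart_at A (\<Psi> (t, t))"
  let ?f = "\<lambda>z. snd ?c (\<Psi> z)"
  let ?D = "frechet_derivative ?f (at (t, t))"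
  have "?f differentiable (at (t, t))" using smooth_near_differentiable[OF A P] chart_at_in A by blast
  then have D: "(?f has_derivative ?D) (at (t, t))" by (simp add: frechet_derivative_works)
  then have lD: "linear ?D" by (rule has_derivative_linear)
  have *: "((\<lambda>s. ?f (h s)) has_vector_derivative ?D h') (at t)"
    if "(h has_vector_derivative h') (at t)" "h t = (t, t)" for h h'
    using diff_chain_at[OF that(1)[unfolded has_vector_derivative_def], of ?f ?D] D that(2) linear_scale[OF lD]
    by (simp add: o_def has_vector_derivative_def)
  have d: "((\<lambda>s. (s, s)) has_vector_derivative (1, 1)) (at t)"
    "((\<lambda>s. (s, t)) has_vector_derivative (1, 0)) (at t)"
    "((\<lambda>s. (t, s)) has_vector_derivative (0, 1)) (at t)"
    by (auto intro!: has_vector_derivative_Pair has_vector_derivative_id has_vector_derivative_const)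
  have "?D (1, 1) = ?D (1, 0) + ?D (0, 1)" using linear_add[OF lD, of "(1,0)" "(0,1)"] by simp
  moreover have "velocity A (\<lambda>s. \<Psi> (s, s)) t = ?D (1, 1)" "velocity A (\<lambda>s. \<Psi> (s, t)) t = ?D (1, 0)"
    "velocity A (\<lambda>s. \<Psi> (t, s)) t = ?D (0, 1)"
    by (rule velocity_eqI; rule *; (rule d refl))+
  ultimately show ?thesis by simp
qed

text \<open>All curves of the family start at the same point \<open>x0\<close>, so a single chart
  computes all their velocities, and these are a partial derivative of a smooth function.\<close>

lemma velocity_param_smooth:
  fixes \<Psi> :: "'a::euclidean_space \<times> real \<Rightarrow> 'g::topological_space"
  assumes A: "smooth_atlas A" and W: "open W" "smooth_map_on euclid_atlas A W \<Psi>"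
    and P: "open P" "\<And>p. p \<in> P \<Longrightarrow> (p, 0) \<in> W \<and> \<Psi> (p, 0) = x0"
  shows "smooth_on P (\<lambda>p. velocity A (\<lambda>r. \<Psi> (p, r)) 0)"
proof (rule smooth_on_local[OF P(1)])
  fix p assume p: "p \<in> P"
  let ?c = "chart_at A x0"
  let ?f = "\<lambda>z. snd ?c (\<Psi> z)"
  have c: "?c \<in> A" "\<Psi> (p, 0) \<in> fst ?c" using chart_at_in A P(2)[OF p] by auto
  obtain V where V: "open V" "(p, 0) \<in> V" "V \<subseteq> W" "smooth_on V ?f"
    using smooth_map_on_chart_coords[OF A W(2,1) _ c] P(2)[OF p] by blast
  let ?i = "\<lambda>q. (q, 0::real)"
  have i: "bounded_linear ?i" by (intro bounded_linear_Pair bounded_linear_ident bounded_linear_zero)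
  let ?Q = "P \<inter> ?i -` V"
  have oQ: "open ?Q"
    using linear_continuous_on[OF i] P(1) V(1) by (rule continuous_open_preimage)
  have 1: "smooth_on ?Q (\<lambda>q. frechet_derivative ?f (at (q, 0)) (0, 1))"
    by (rule smooth_on_compose[OF oQ V(1) smooth_on_linear[OF i] smooth_on_deriv[OF V(4)]]) auto
  have 2: "frechet_derivative ?f (at (q, 0)) (0, 1) = velocity A (\<lambda>r. \<Psi> (q, r)) 0" if q: "q \<in> ?Q" for q
  proof (rule velocity_eqI[symmetric])
    have D: "(?f has_derivative frechet_derivative ?f (at (q, 0))) (at (q, 0))"
      using smooth_on_differentiable[OF V(4)] q by (auto simp: frechet_derivative_works)
    then have lD: "linear (frechet_derivative ?f (at (q, 0)))" by (rule has_derivative_linear)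
    have h: "((\<lambda>r. (q, r)) has_vector_derivative (0, 1)) (at 0)"
      by (auto intro!: has_vector_derivative_Pair has_vector_derivative_id has_vector_derivative_const)
    have "((\<lambda>r. ?f (q, r)) has_vector_derivative frechet_derivative ?f (at (q, 0)) (0, 1)) (at 0)"
      using diff_chain_at[OF h[unfolded has_vector_derivative_def] D] linear_scale[OF lD, symmetric]
      by (simp add: o_def has_vector_derivative_def)
    then show "((\<lambda>r. snd (chart_at A (\<Psi> (q, 0))) (\<Psi> (q, r))) has_vector_derivative
      frechet_derivative ?f (at (q, 0)) (0, 1)) (at 0)"
      using P(2) q by simp
  qed
  have "smooth_on ?Q (\<lambda>p. velocity A (\<lambda>r. \<Psi> (p, r)) 0)"
    by (rule smooth_on_cong[OF oQ 2 1])
  moreover have "p \<in> ?Q" using p V(2) by simp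
  ultimately show "\<exists>W. open W \<and> p \<in> W \<and> smooth_on W (\<lambda>p. velocity A (\<lambda>r. \<Psi> (p, r)) 0)"
    using oQ by blast
qed

text \<open>A velocity is read off in the preferred chart of its own point, and this chart may jump
  along the curve. Vanishing of the velocity can be moved to any other chart.\<close>

lemma chart_derivative_zero:
  fixes \<gamma> :: "real \<Rightarrow> 'g::topological_space"
  assumes A: "smooth_atlas A" and g: "smooth_near A \<gamma> t" and v: "velocity A \<gamma> t = 0"
    and c: "c \<in> A" "\<gamma> t \<in> fst c"
  shows "((\<lambda>s. snd c (\<gamma> s)) has_vector_derivative 0) (at t)"
proof -
  let ?d = "chart_at A (\<gamma> t)"
  have d: "?d \<in> A" "\<gamma> t \<in> fst ?d" using chart_at_in A by blast+
  have ch: "is_chart ?d" using smooth_atlas_chart[OF A d(1)] .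
  obtain V where V: "open V" "t \<in> V" "\<gamma> ` V \<subseteq> fst ?d"
    by (rule smooth_near_chart_coords[OF A g open_UNIV UNIV_I d])
  let ?T = "\<lambda>p. snd c (chart_inv ?d p)"
  have "?T differentiable (at (snd ?d (\<gamma> t)))"
    by (rule smooth_on_differentiable[OF smooth_atlas_transition[OF A d(1) c(1)]]) (use c d in auto)
  then have T: "(?T has_derivative frechet_derivative ?T (at (snd ?d (\<gamma> t)))) (at (snd ?d (\<gamma> t)))"
    by (simp add: frechet_derivative_works)
  have "((\<lambda>s. ?T (snd ?d (\<gamma> s))) has_vector_derivative 0) (at t)"
    using diff_chain_at[OF has_velocity[OF A g, unfolded v has_vector_derivative_def] T]
      linear_0[OF has_derivative_linear[OF T]]
    by (simp add: o_def has_vector_derivative_def)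
  then show ?thesis
    by (rule has_vector_derivative_transform_within_open[OF _ V(1,2)])
      (use V(3) chart_inv_left[OF ch] in auto)
qed

text \<open>Near each time one fixed chart is valid, and there the coordinates have derivative zero
  off a finite set, where continuity helps out. This gives local constancy; connectedness of the
  interval does the rest.\<close>

lemma velocity_zero_imp_constant:
  fixes \<gamma> :: "real \<Rightarrow> 'g::topological_space"
  assumes A: "smooth_atlas A" and cont: "continuous_on {a..b} \<gamma>" and F: "finite F" and ab: "a \<le> b"
    and v: "\<And>t. t \<in> {a<..<b} - F \<Longrightarrow> smooth_near A \<gamma> t \<and> velocity A \<gamma> t = 0"
  shows "\<gamma> b = \<gamma> a"
proof -
  have "\<forall>t\<in>{a..b}. eventually (\<lambda>s. \<gamma> t = \<gamma> s) (at t within {a..b})"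
  proof
    fix t assume t: "t \<in> {a..b}"
    let ?c = "chart_at A (\<gamma> t)"
    have c: "?c \<in> A" "\<gamma> t \<in> fst ?c" using chart_at_in A by blast+
    have ch: "is_chart ?c" using smooth_atlas_chart[OF A c(1)] .
    have "eventually (\<lambda>s. \<gamma> s \<in> fst ?c) (at t within {a..b})"
      using topological_tendstoD[OF bspec[OF cont[unfolded continuous_on_def] t] chart_open[OF ch] c(2)] .
    then obtain \<delta> where \<delta>: "\<delta> > 0" "\<And>s. s \<in> {a..b} \<Longrightarrow> \<bar>s - t\<bar> < \<delta> \<Longrightarrow> \<gamma> s \<in> fst ?c"
      unfolding eventually_at using c(2) by (metis dist_real_def)
    have "\<gamma> t = \<gamma> s" if s: "s \<in> {a..b}" "\<bar>s - t\<bar> < \<delta>" for s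
    proof -
      let ?l = "min s t" and ?u = "max s t"
      have sub: "r \<in> {a..b} \<and> \<gamma> r \<in> fst ?c" if "r \<in> {?l..?u}" for r
      proof -
        have "r \<in> {a..b}" "\<bar>r - t\<bar> < \<delta>" using that s t by auto
        then show ?thesis using \<delta>(2) by blast
      qed
      have "continuous_on {?l..?u} (\<lambda>r. snd ?c (\<gamma> r))"
      proof (rule continuous_on_compose2[of "fst ?c"])
        show "continuous_on (fst ?c) (snd ?c)" using ch by (simp add: is_chart_def homeomorphism_def)
        show "continuous_on {?l..?u} \<gamma>" by (rule continuous_on_subset[OF cont]) (use sub in blast)
      qed (use sub in blast)
      moreover have "((\<lambda>r. snd ?c (\<gamma> r)) has_derivative (\<lambda>h. 0)) (at r within {?l..?u})"
        if r: "r \<in> {?l..?u} - (F \<union> {s, t})" for r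
      proof -
        have "r \<in> {a<..<b} - F" using r s t by (auto simp: min_def max_def split: if_splits)
        with v have "smooth_near A \<gamma> r" "velocity A \<gamma> r = 0" by auto
        from chart_derivative_zero[OF A this c(1)] sub[of r] r
        show ?thesis by (auto simp: has_vector_derivative_def intro: has_derivative_at_withinI)
      qed
      ultimately have "snd ?c (\<gamma> s) = snd ?c (\<gamma> t)"
        using has_derivative_zero_unique_strong_interval[of "F \<union> {s, t}" ?l ?u "\<lambda>r. snd ?c (\<gamma> r)" _ s]
          has_derivative_zero_unique_strong_interval[of "F \<union> {s, t}" ?l ?u "\<lambda>r. snd ?c (\<gamma> r)" _ t] F
        by (metis (no_types, lifting) atLeastAtMost_iff finite.emptyI finite_Un finite_insert max.cobounded1 max.cobounded2 min.cobounded1 min.cobounded2)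
      then show ?thesis using chart_inj[OF ch] sub[of s] sub[of t] by auto
    qed
    then show "eventually (\<lambda>s. \<gamma> t = \<gamma> s) (at t within {a..b})"
      unfolding eventually_at dist_real_def using \<delta>(1) by blast
  qed
  from connected_local_const[OF _ _ _ this, of a b] ab show ?thesis by auto
qed

text \<open>The component of \<open>f\<close> orthogonal to \<open>V\<close> is constantly zero,
  hence so is that of its derivative.\<close>

lemma derivative_in_subspace:
  fixes f :: "real \<Rightarrow> 'a::euclidean_space"
  assumes V: "subspace V" and f: "\<And>s. f s \<in> V" "(f has_vector_derivative f') (at t)"
  shows "f' \<in> V"
proof -
  obtain p z where pz: "p \<in> span V" "\<And>w. w \<in> span V \<Longrightarrow> orthogonal z w" "f' = p + z"
    using orthogonal_subspace_decomp_exists[of V f'] by metis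
  have "((\<lambda>s. f s \<bullet> z) has_vector_derivative f' \<bullet> z) (at t)"
    by (rule bounded_linear.has_vector_derivative[OF bounded_linear_inner_left f(2)])
  moreover have "f s \<bullet> z = 0" for s
    using pz(2)[OF span_base[OF f(1)]] by (simp add: orthogonal_def inner_commute)
  ultimately have "f' \<bullet> z = 0" using vector_derivative_at by fastforce
  moreover have "p \<bullet> z = 0" using pz(1,2) by (simp add: orthogonal_def inner_commute)
  ultimately have "z = 0" by (simp add: pz(3) inner_add_left)
  then show ?thesis using pz(1,3) V by (metis add.right_neutral span_eq_iff)
qed

section \<open>Lie groups\<close>

locale lie_group_atlas =
  fixes G :: "'g::{t2_space, second_countable_topology} monoid" (structure)
    and A :: "('g, 'e::euclidean_space) atlas"
  assumes lie_group: "lie_group G A"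
begin

lemma atlas: "smooth_atlas A" using lie_group by (simp add: lie_group_def)

lemma carrier_UNIV [simp]: "carrier G = UNIV" using lie_group by (simp add: lie_group_def)

end

sublocale lie_group_atlas \<subseteq> group G
  using lie_group by (simp add: lie_group_def)

context lie_group_atlas
begin

lemma inv_cancel_left [simp]: "inv x \<otimes> (x \<otimes> y) = y" "x \<otimes> (inv x \<otimes> y) = y"
  by (simp_all add: m_assoc[symmetric])

lemmas grp = m_assoc inv_mult_group

lemma smooth_mult:
  assumes "smooth_atlas B" "smooth_map_on B A S f" "smooth_map_on B A S h"
  shows "smooth_map_on B A S (\<lambda>x. f x \<otimes> h x)"
proof -
  have "smooth_map_on (prod_atlas A A) A UNIV (\<lambda>(x, y). x \<otimes> y)" using lie_group by (simp add: lie_group_def)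
  from smooth_map_on_pair_compose[OF assms(1) atlas atlas atlas this assms(2,3)] show ?thesis by simp
qed

lemma smooth_inv:
  assumes "smooth_atlas B" "smooth_map_on B A S f"
  shows "smooth_map_on B A S (\<lambda>x. inv (f x))"
proof -
  have "smooth_map_on A A UNIV (\<lambda>x. inv x)" using lie_group by (simp add: lie_group_def)
  from smooth_map_on_compose[OF assms(1) atlas atlas assms(2) this] show ?thesis by simp
qed

lemma smooth_lmult: "smooth_map_on A A UNIV (\<lambda>x. a \<otimes> x)"
  by (rule smooth_mult[OF atlas smooth_map_on_const[OF atlas atlas] smooth_map_on_ident[OF atlas]])

lemma smooth_rmult: "smooth_map_on A A UNIV (\<lambda>x. x \<otimes> a)"
  by (rule smooth_mult[OF atlas smooth_map_on_ident[OF atlas] smooth_map_on_const[OF atlas atlas]])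

lemma smooth_conj: "smooth_map_on A A UNIV (\<lambda>x. a \<otimes> x \<otimes> inv a)"
  by (rule smooth_mult[OF atlas smooth_lmult smooth_map_on_const[OF atlas atlas]])

lemma near_mult:
  assumes "smooth_near A f t" "smooth_near A h t" shows "smooth_near A (\<lambda>s. f s \<otimes> h s) t"
proof -
  obtain U V where U: "open U" "t \<in> U" "smooth_map_on euclid_atlas A U f"
    and V: "open V" "t \<in> V" "smooth_map_on euclid_atlas A V h"
    using assms unfolding smooth_near_def by blast
  have "smooth_map_on euclid_atlas A (U \<inter> V) (\<lambda>s. f s \<otimes> h s)"
    by (rule smooth_mult[OF smooth_atlas_euclid smooth_map_on_subset[OF U(3)] smooth_map_on_subset[OF V(3)]]) auto
  then show ?thesis by (rule smooth_nearI) (use U V in auto)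
qed

lemma near_const: "smooth_near A (\<lambda>s. x) t"
  by (rule smooth_near_const[OF atlas])

lemma near_inv: "smooth_near A f t \<Longrightarrow> smooth_near A (\<lambda>s. inv (f s)) t"
  unfolding smooth_near_def using smooth_inv[OF smooth_atlas_euclid] by blast

lemmas near_lmult = near_mult[OF near_const]
lemmas near_rmult = near_mult[OF _ near_const]
lemmas near_conj = near_rmult[OF near_lmult]

lemma Ad_velocity:
  assumes "smooth_near A \<gamma> t" "\<gamma> t = \<one>"
  shows "velocity A (\<lambda>s. x \<otimes> \<gamma> s \<otimes> inv x) t = Ad G A x (velocity A \<gamma> t)"
  using velocity_compose[OF atlas atlas smooth_conj[of x] assms(1)] assms(2) by (simp add: Ad_def)

lemma Ad_linear: "linear (Ad G A x)"
  unfolding Ad_def by (rule differential_linear[OF atlas atlas smooth_conj])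

lemmas Ad_add = linear_add[OF Ad_linear] and Ad_scale = linear_scale[OF Ad_linear]
  and Ad_0 = linear_0[OF Ad_linear] and Ad_diff = linear_diff[OF Ad_linear]

lemma Ad_mult: "Ad G A (x \<otimes> y) X = Ad G A x (Ad G A y X)"
proof -
  obtain \<gamma> where g: "curve_in A UNIV \<one> \<gamma>" "velocity A \<gamma> 0 = X" by (rule tangent_vector_ex[OF atlas])
  have n: "smooth_near A \<gamma> 0" "\<gamma> 0 = \<one>" using g(1) curve_in_smooth_near[OF g(1)] by (auto simp: curve_in_def)
  have "Ad G A x (Ad G A y X) = velocity A (\<lambda>s. x \<otimes> (y \<otimes> \<gamma> s \<otimes> inv y) \<otimes> inv x) 0"
    using n g by (subst Ad_velocity) (auto simp: Ad_velocity intro!: near_conj)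
  also have "\<dots> = velocity A (\<lambda>s. (x \<otimes> y) \<otimes> \<gamma> s \<otimes> inv (x \<otimes> y)) 0" by (simp add: grp)
  also have "\<dots> = Ad G A (x \<otimes> y) X" using n g by (simp only: Ad_velocity)
  finally show ?thesis by simp
qed

lemma Ad_one: "Ad G A \<one> X = X"
proof -
  obtain \<gamma> where g: "curve_in A UNIV \<one> \<gamma>" "velocity A \<gamma> 0 = X" by (rule tangent_vector_ex[OF atlas])
  then show ?thesis using Ad_velocity[OF curve_in_smooth_near[OF g(1)], of 0 \<one>] by (simp add: curve_in_def)
qed

lemma Ad_inv: "Ad G A (inv x) (Ad G A x X) = X" "Ad G A x (Ad G A (inv x) X) = X"
  by (simp_all add: Ad_mult[symmetric] Ad_one)

lemma velocity_mult_one: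
  assumes a: "smooth_near A a t" "a t = \<one>" and b: "smooth_near A b t" "b t = \<one>"
  shows "velocity A (\<lambda>s. a s \<otimes> b s) t = velocity A a t + velocity A b t"
proof -
  have "smooth_near A (\<lambda>z. a (fst z)) (t, t)" "smooth_near A (\<lambda>z. b (snd z)) (t, t)"
    by (rule smooth_near_reparam[OF atlas _ smooth_on_linear[OF bounded_linear_fst] open_UNIV UNIV_I], use a in simp,
      rule smooth_near_reparam[OF atlas _ smooth_on_linear[OF bounded_linear_snd] open_UNIV UNIV_I], use b in simp)
  from velocity_diag[OF atlas near_mult[OF this]] show ?thesis using a b by simp
qed

lemma velocity_inv_one:
  assumes a: "smooth_near A a t" "a t = \<one>"
  shows "velocity A (\<lambda>s. inv (a s)) t = - velocity A a t"
proof -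
  have "velocity A (\<lambda>s. a s \<otimes> inv (a s)) t = velocity A a t + velocity A (\<lambda>s. inv (a s)) t"
    by (rule velocity_mult_one) (use a near_inv in auto)
  then show ?thesis by (simp add: velocity_const eq_neg_iff_add_eq_0 add.commute)
qed

text \<open>The left logarithmic derivative: the velocity translated back to the identity. It takes
  values in one fixed vector space, and for a left-invariant metric its norm at the identity is the
  speed.\<close>

definition lvel :: "(real \<Rightarrow> 'g) \<Rightarrow> real \<Rightarrow> 'e" where
  "lvel \<gamma> t = velocity A (\<lambda>s. inv (\<gamma> t) \<otimes> \<gamma> s) t"

lemma lvel_cong: "open U \<Longrightarrow> t \<in> U \<Longrightarrow> (\<And>s. s \<in> U \<Longrightarrow> \<gamma> s = \<gamma>' s) \<Longrightarrow> lvel \<gamma> t = lvel \<gamma>' t"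
  unfolding lvel_def by (rule velocity_cong) auto

lemma lvel_lmult: "lvel (\<lambda>s. a \<otimes> \<gamma> s) t = lvel \<gamma> t"
  by (simp add: lvel_def grp)

lemma velocity_lvel:
  assumes "smooth_near A \<gamma> t"
  shows "velocity A \<gamma> t = differential A A (\<lambda>x. \<gamma> t \<otimes> x) \<one> (lvel \<gamma> t)"
  using velocity_compose[OF atlas atlas smooth_lmult[of "\<gamma> t"] near_lmult[OF assms, of "inv (\<gamma> t)"]]
  by (simp add: lvel_def)

lemma velocity_zero: "smooth_near A \<gamma> t \<Longrightarrow> lvel \<gamma> t = 0 \<Longrightarrow> velocity A \<gamma> t = 0"
  using linear_0[OF differential_linear[OF atlas atlas smooth_lmult]] by (simp add: velocity_lvel)

lemma lvel_reparam:
  assumes "smooth_near A \<gamma> (f t)" "(f has_real_derivative f') (at t)"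
  shows "lvel (\<lambda>s. \<gamma> (f s)) t = f' *\<^sub>R lvel \<gamma> (f t)"
  unfolding lvel_def by (rule velocity_reparam[OF atlas near_lmult[OF assms(1)] assms(2)])

lemma lvel_conj:
  assumes "smooth_near A \<gamma> t"
  shows "lvel (\<lambda>s. x \<otimes> \<gamma> s \<otimes> inv x) t = Ad G A x (lvel \<gamma> t)"
proof -
  have "lvel (\<lambda>s. x \<otimes> \<gamma> s \<otimes> inv x) t = velocity A (\<lambda>s. x \<otimes> (inv (\<gamma> t) \<otimes> \<gamma> s) \<otimes> inv x) t"
    by (simp add: lvel_def grp)
  then show ?thesis using Ad_velocity[OF near_lmult[OF assms, of "inv (\<gamma> t)"]] by (simp add: lvel_def)
qed

text \<open>The curves \<open>inv (\<gamma> t) \<otimes> \<gamma> (t + r)\<close> in the variable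
  \<open>r\<close> form a smooth family in \<open>t\<close>, all starting at the identity, so
  \<open>velocity_param_smooth\<close> applies.\<close>

lemma lvel_smooth:
  assumes "open W" "smooth_map_on euclid_atlas A W \<gamma>"
  shows "smooth_on W (lvel \<gamma>)"
proof -
  let ?p = "\<lambda>z. fst z + snd z :: real"
  have p: "bounded_linear ?p" by (intro bounded_linear_add bounded_linear_fst bounded_linear_snd)
  let ?W = "fst -` W \<inter> ?p -` W"
  have o: "open (fst -` W :: (real \<times> real) set)" "open (?p -` W)"
    using assms(1) by (intro open_vimage continuous_intros; simp)+
  have oW: "open ?W" using o by blast
  have f: "smooth_map_on euclid_atlas A ?W (\<lambda>z. \<gamma> (fst z))"
    by (rule smooth_map_on_compose[OF smooth_atlas_euclid smooth_atlas_euclid atlas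
        smooth_map_on_euclidI[OF oW smooth_on_linear[OF bounded_linear_fst]] assms(2)]) auto
  have s: "smooth_map_on euclid_atlas A ?W (\<lambda>z. \<gamma> (?p z))"
    by (rule smooth_map_on_compose[OF smooth_atlas_euclid smooth_atlas_euclid atlas
        smooth_map_on_euclidI[OF oW smooth_on_linear[OF p]] assms(2)]) auto
  have "smooth_on W (\<lambda>t. velocity A (\<lambda>r. (\<lambda>z. inv (\<gamma> (fst z)) \<otimes> \<gamma> (?p z)) (t, r)) 0)"
    by (rule velocity_param_smooth[where ?x0.0 = \<one>, OF atlas oW smooth_mult[OF smooth_atlas_euclid smooth_inv[OF smooth_atlas_euclid f] s]
        assms(1)]) auto
  then show ?thesis
  proof (rule smooth_on_cong[OF assms(1), rotated])
    fix t assume t: "t \<in> W"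
    have n: "smooth_near A (\<lambda>s. inv (\<gamma> t) \<otimes> \<gamma> s) (t + 0)"
      using near_lmult smooth_nearI[OF assms(2,1) t] by simp
    have "((\<lambda>r. t + r) has_real_derivative 1) (at 0)" by (auto intro!: derivative_eq_intros)
    from velocity_reparam[OF atlas n this]
    show "velocity A (\<lambda>r. (\<lambda>z. inv (\<gamma> (fst z)) \<otimes> \<gamma> (?p z)) (t, r)) 0 = lvel \<gamma> t"
      by (simp add: lvel_def)
  qed
qed

lemma lvel_zero_imp_constant:
  assumes "continuous_on {a..b} \<gamma>" "finite F" "a \<le> b"
    and "\<And>t. t \<in> {a<..<b} - F \<Longrightarrow> smooth_near A \<gamma> t \<and> lvel \<gamma> t = 0"
  shows "\<gamma> b = \<gamma> a"
  by (rule velocity_zero_imp_constant[OF atlas assms(1-3)]) (use assms(4) velocity_zero in blast)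

section \<open>Lie algebras of subgroups and smoothness of the adjoint representation\<close>

abbreviation "Lie \<equiv> lie_algebra G A"

lemma lie_algebraI:
  assumes "smooth_near A \<gamma> t" "\<gamma> t = \<one>" "open U" "t \<in> U" "\<gamma> ` U \<subseteq> H"
  shows "velocity A \<gamma> t \<in> Lie H"
  unfolding lie_algebra_def using velocity_in_tangent[OF atlas assms(1,3,4,5)] assms(2) by simp

lemma lie_algebraE:
  assumes "X \<in> Lie H"
  obtains \<gamma> where "curve_in A H \<one> \<gamma>" "velocity A \<gamma> 0 = X" "smooth_near A \<gamma> 0" "\<gamma> 0 = \<one>" "range \<gamma> \<subseteq> H"
proof -
  obtain \<gamma> where g: "curve_in A H \<one> \<gamma>" "X = velocity A \<gamma> 0"
    using assms unfolding lie_algebra_def tangent_space_def by blast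
  show ?thesis
    by (rule that[OF g(1) g(2)[symmetric] curve_in_smooth_near[OF g(1)]]) (use g(1) in \<open>auto simp: curve_in_def\<close>)
qed

lemma lie_algebra_subspace:
  assumes "subgroup H G" shows "subspace (Lie H)"
  unfolding subspace_def
proof (intro conjI ballI allI)
  show "0 \<in> Lie H"
    using lie_algebraI[OF near_const[of \<one> 0] _ open_UNIV UNIV_I, of H] subgroup.one_closed[OF assms]
    by (simp add: velocity_const)
next
  fix X Y assume "X \<in> Lie H" "Y \<in> Lie H"
  obtain a where a: "velocity A a 0 = X" "smooth_near A a 0" "a 0 = \<one>" "range a \<subseteq> H"
    by (rule lie_algebraE[OF \<open>X \<in> Lie H\<close>])
  obtain b where b: "velocity A b 0 = Y" "smooth_near A b 0" "b 0 = \<one>" "range b \<subseteq> H"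
    by (rule lie_algebraE[OF \<open>Y \<in> Lie H\<close>])
  have "velocity A (\<lambda>s. a s \<otimes> b s) 0 \<in> Lie H"
    by (rule lie_algebraI[OF near_mult[OF a(2) b(2)] _ open_UNIV UNIV_I])
      (use a b subgroup.m_closed[OF assms] in auto)
  then show "X + Y \<in> Lie H" using velocity_mult_one[OF a(2,3) b(2,3)] a b by simp
next
  fix r X assume "X \<in> Lie H"
  obtain a where a: "velocity A a 0 = X" "smooth_near A a 0" "a 0 = \<one>" "range a \<subseteq> H"
    by (rule lie_algebraE[OF \<open>X \<in> Lie H\<close>])
  have n: "smooth_near A (\<lambda>s. a (r * s)) 0"
    by (rule smooth_near_reparam[OF atlas _ smooth_on_linear[OF bounded_linear_mult_right] open_UNIV UNIV_I])
      (use a in simp)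
  have "velocity A (\<lambda>s. a (r * s)) 0 \<in> Lie H"
    by (rule lie_algebraI[OF n _ open_UNIV UNIV_I]) (use a in auto)
  moreover have "((\<lambda>s. r * s) has_real_derivative r) (at 0)" by (auto intro!: derivative_eq_intros)
  ultimately show "r *\<^sub>R X \<in> Lie H"
    using velocity_reparam[OF atlas, of a "\<lambda>s. r * s" 0 r] a by simp
qed

lemma lvel_in_lie_algebra:
  assumes "subgroup H G" "smooth_near A \<gamma> t" "open U" "t \<in> U" "\<gamma> ` U \<subseteq> H"
  shows "lvel \<gamma> t \<in> Lie H"
  unfolding lvel_def
  by (rule lie_algebraI[OF near_lmult[OF assms(2)] _ assms(3,4)])
    (use assms subgroup.m_closed[OF assms(1)] subgroup.m_inv_closed[OF assms(1)] in \<open>auto simp: image_subset_iff\<close>)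

lemma Ad_lie_algebra:
  assumes "\<And>y. y \<in> H \<Longrightarrow> x \<otimes> y \<otimes> inv x \<in> K" "X \<in> Lie H"
  shows "Ad G A x X \<in> Lie K"
proof -
  obtain a where a: "velocity A a 0 = X" "smooth_near A a 0" "a 0 = \<one>" "range a \<subseteq> H"
    by (rule lie_algebraE[OF assms(2)])
  have "velocity A (\<lambda>s. x \<otimes> a s \<otimes> inv x) 0 \<in> Lie K"
    by (rule lie_algebraI[OF near_conj[OF a(2)] _ open_UNIV UNIV_I]) (use a assms in auto)
  then show ?thesis using Ad_velocity[OF a(2,3), of x] a(1) by simp
qed

text \<open>A conjugate of a curve through the identity passes through the identity again, whatever
  the conjugating element; so \<open>Ad\<close> is a family of velocities at one common
  point.\<close>

lemma Ad_smooth: "smooth_map_on A euclid_atlas UNIV (\<lambda>x. Ad G A x Y)"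
proof (rule smooth_map_on_local[OF atlas smooth_atlas_euclid])
  fix x :: 'g
  obtain y where y: "curve_in A UNIV \<one> y" "velocity A y 0 = Y" by (rule tangent_vector_ex[OF atlas])
  have y1: "y 0 = \<one>" "smooth_map_on euclid_atlas A UNIV y" using y by (auto simp: curve_in_def)
  let ?c = "chart_at A x"
  have c: "?c \<in> A" "x \<in> fst ?c" using chart_at_in atlas by blast+
  have ch: "is_chart ?c" using smooth_atlas_chart[OF atlas c(1)] .
  let ?P = "snd ?c ` fst ?c"
  have oP: "open ?P" using ch by (simp add: is_chart_def)
  let ?W = "?P \<times> (UNIV :: real set)"
  have oW: "open ?W" using oP by (simp add: open_Times)
  have 1: "smooth_map_on euclid_atlas A ?W (\<lambda>z. chart_inv ?c (fst z))"
    by (rule smooth_map_on_compose[OF smooth_atlas_euclid smooth_atlas_euclid atlas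
        smooth_map_on_euclidI[OF oW smooth_on_linear[OF bounded_linear_fst]] smooth_map_on_chart_inv[OF atlas c(1)]]) auto
  have 2: "smooth_map_on euclid_atlas A ?W (\<lambda>z. y (snd z))"
    by (rule smooth_map_on_compose[OF smooth_atlas_euclid smooth_atlas_euclid atlas
        smooth_map_on_euclidI[OF oW smooth_on_linear[OF bounded_linear_snd]] y1(2)]) auto
  let ?\<Psi> = "\<lambda>z. chart_inv ?c (fst z) \<otimes> y (snd z) \<otimes> inv (chart_inv ?c (fst z))"
  have 3: "smooth_map_on euclid_atlas A ?W ?\<Psi>"
    by (rule smooth_mult[OF smooth_atlas_euclid smooth_mult[OF smooth_atlas_euclid 1 2] smooth_inv[OF smooth_atlas_euclid 1]])
  have "smooth_on ?P (\<lambda>p. velocity A (\<lambda>r. ?\<Psi> (p, r)) 0)"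
    by (rule velocity_param_smooth[where ?x0.0 = \<one>, OF atlas oW 3 oP]) (auto simp: y1)
  moreover have "velocity A (\<lambda>r. ?\<Psi> (p, r)) 0 = Ad G A (chart_inv ?c p) Y" for p
    using Ad_velocity[OF curve_in_smooth_near[OF y(1)], of 0 "chart_inv ?c p"] y y1 by simp
  ultimately have "smooth_map_on euclid_atlas euclid_atlas ?P (\<lambda>p. Ad G A (chart_inv ?c p) Y)"
    using smooth_map_on_euclidI[OF oP] by simp
  from smooth_map_on_compose[OF atlas smooth_atlas_euclid smooth_atlas_euclid smooth_map_on_chart[OF atlas c(1)] this]
  have "smooth_map_on A euclid_atlas (fst ?c) (\<lambda>x. Ad G A (chart_inv ?c (snd ?c x)) Y)" by simp
  then have "smooth_map_on A euclid_atlas (fst ?c) (\<lambda>x. Ad G A x Y)"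
    by (rule smooth_map_on_cong) (simp add: chart_inv_left[OF ch])
  then show "\<exists>U. open U \<and> x \<in> U \<and> smooth_map_on A euclid_atlas (UNIV \<inter> U) (\<lambda>x. Ad G A x Y)"
    using c chart_open[OF ch] by (intro exI[of _ "fst ?c"]) simp
qed

section \<open>The Lie bracket as derivative of the adjoint representation\<close>

lemma Ad_curve_derivative:
  assumes g: "smooth_near A \<gamma> t" "\<gamma> t = \<one>"
  shows "((\<lambda>s. Ad G A (\<gamma> s) Y) has_vector_derivative lie_bracket G A (velocity A \<gamma> t) Y) (at t)"
proof -
  have "smooth_near euclid_atlas (\<lambda>s. Ad G A (\<gamma> s) Y) t"
    by (rule smooth_near_compose[OF atlas smooth_atlas_euclid Ad_smooth g(1)])
  from has_velocity[OF smooth_atlas_euclid this]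
  have "((\<lambda>s. Ad G A (\<gamma> s) Y) has_vector_derivative velocity euclid_atlas (\<lambda>s. Ad G A (\<gamma> s) Y) t) (at t)"
    by (simp add: chart_at_euclid)
  then show ?thesis
    using velocity_compose[OF atlas smooth_atlas_euclid Ad_smooth[of Y] g(1)] g(2) by (simp add: lie_bracket_def)
qed

lemma bracket_add_left: "lie_bracket G A (X + X') Y = lie_bracket G A X Y + lie_bracket G A X' Y"
  and bracket_scale_left: "lie_bracket G A (r *\<^sub>R X) Y = r *\<^sub>R lie_bracket G A X Y"
  using differential_linear[OF atlas smooth_atlas_euclid Ad_smooth[of Y], of \<one>]
  by (simp_all add: lie_bracket_def linear_add linear_scale)

lemma bracket_eqI:
  assumes "((\<lambda>s. Ad G A (\<gamma> s) Y) has_vector_derivative Z) (at 0)" "curve_in A UNIV \<one> \<gamma>" "velocity A \<gamma> 0 = X"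
  shows "lie_bracket G A X Y = Z"
  using vector_derivative_unique_at[OF Ad_curve_derivative[OF curve_in_smooth_near[OF assms(2)], of 0 Y] assms(1)]
    assms(2,3) by (simp add: curve_in_def)

lemma bracket_add_right: "lie_bracket G A X (Y + Y') = lie_bracket G A X Y + lie_bracket G A X Y'"
  and bracket_scale_right: "lie_bracket G A X (r *\<^sub>R Y) = r *\<^sub>R lie_bracket G A X Y"
proof -
  obtain \<gamma> where g: "curve_in A UNIV \<one> \<gamma>" "velocity A \<gamma> 0 = X" by (rule tangent_vector_ex[OF atlas])
  have d: "((\<lambda>s. Ad G A (\<gamma> s) Z) has_vector_derivative lie_bracket G A X Z) (at 0)" for Z
    using Ad_curve_derivative[OF curve_in_smooth_near[OF g(1)], of 0 Z] g by (simp add: curve_in_def)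
  show "lie_bracket G A X (Y + Y') = lie_bracket G A X Y + lie_bracket G A X Y'"
    by (rule bracket_eqI[OF _ g]) (unfold Ad_add, intro has_vector_derivative_add d)
  show "lie_bracket G A X (r *\<^sub>R Y) = r *\<^sub>R lie_bracket G A X Y"
    by (rule bracket_eqI[OF _ g])
      (unfold Ad_scale, rule bounded_linear.has_vector_derivative[OF bounded_linear_scaleR_right d])
qed

lemma bracket_bilinear: "bounded_bilinear (lie_bracket G A)"
  unfolding bilinear_conv_bounded_bilinear[symmetric] bilinear_def
  by (auto intro!: linearI simp: bracket_add_left bracket_add_right bracket_scale_left bracket_scale_right)

text \<open>Both sides are the derivative at 0 of \<open>Ad x\<close> after
  \<open>Ad (\<gamma> s)\<close>, which equals \<open>Ad\<close> of the conjugate of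
  \<open>\<gamma> s\<close> by \<open>x\<close>, after \<open>Ad x\<close>.\<close>

lemma Ad_bracket: "Ad G A x (lie_bracket G A X Y) = lie_bracket G A (Ad G A x X) (Ad G A x Y)"
proof -
  obtain \<gamma> where g: "curve_in A UNIV \<one> \<gamma>" "velocity A \<gamma> 0 = X" by (rule tangent_vector_ex[OF atlas])
  have n: "smooth_near A \<gamma> 0" "\<gamma> 0 = \<one>" using g(1) curve_in_smooth_near[OF g(1)] by (auto simp: curve_in_def)
  have bl: "bounded_linear (Ad G A x)" using Ad_linear linear_conv_bounded_linear by blast
  have "((\<lambda>s. Ad G A x (Ad G A (\<gamma> s) Y)) has_vector_derivative Ad G A x (lie_bracket G A X Y)) (at 0)"
    using bounded_linear.has_vector_derivative[OF bl Ad_curve_derivative[OF n, of Y]] g by simp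
  moreover have "Ad G A x (Ad G A (\<gamma> s) Y) = Ad G A (x \<otimes> \<gamma> s \<otimes> inv x) (Ad G A x Y)" for s
    by (simp add: Ad_mult[symmetric] grp)
  ultimately have 1: "((\<lambda>s. Ad G A (x \<otimes> \<gamma> s \<otimes> inv x) (Ad G A x Y)) has_vector_derivative Ad G A x (lie_bracket G A X Y)) (at 0)"
    by simp
  have 2: "((\<lambda>s. Ad G A (x \<otimes> \<gamma> s \<otimes> inv x) (Ad G A x Y)) has_vector_derivative
      lie_bracket G A (Ad G A x X) (Ad G A x Y)) (at 0)"
    using Ad_curve_derivative[OF near_conj[OF n(1)], of x "inv x" "Ad G A x Y"] n Ad_velocity[OF n, of x] g by simp
  show ?thesis by (rule vector_derivative_unique_at[OF 1 2])
qed

end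

section \<open>Decay of linear flows\<close>

text \<open>A pair \<open>(u, w)\<close> stands for u + i w in the complexification; this is its
  complex scalar multiplication, and \<open>cshift L z\<close> below is L - z.\<close>

definition cscale :: "complex \<Rightarrow> 'e::real_vector \<times> 'e \<Rightarrow> 'e \<times> 'e" where
  "cscale c p = (Re c *\<^sub>R fst p - Im c *\<^sub>R snd p, Im c *\<^sub>R fst p + Re c *\<^sub>R snd p)"

definition cshift :: "('e::real_vector \<Rightarrow> 'e) \<Rightarrow> complex \<Rightarrow> 'e \<times> 'e \<Rightarrow> 'e \<times> 'e" where
  "cshift L z p = map_prod L L p - cscale z p"

lemma cscale_add_left: "cscale (a + b) p = cscale a p + cscale b p"
  and cscale_add_right: "cscale a (p + q) = cscale a p + cscale a q"
  and cscale_minus: "cscale (- a) p = - cscale a p"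
  and cscale_mult: "cscale (a * b) p = cscale a (cscale b p)"
  and cscale_0: "cscale 0 p = 0" and cscale_zero: "cscale a 0 = 0"
  and cscale_1: "cscale 1 p = p"
  and cscale_of_real: "cscale (complex_of_real r) p = r *\<^sub>R p"
  by (simp_all add: cscale_def prod_eq_iff algebra_simps)

lemma cscale_sum_right: "cscale a (\<Sum>i\<in>I. f i) = (\<Sum>i\<in>I. cscale a (f i))"
  by (induction I rule: infinite_finite_induct) (simp_all add: cscale_zero cscale_add_right)

lemma eigenvalue_on_cshift:
  "eigenvalue_on V L z \<longleftrightarrow> (\<exists>p\<in>V \<times> V. p \<noteq> 0 \<and> cshift L z p = 0)"
  unfolding eigenvalue_on_def cshift_def cscale_def by (auto simp: prod_eq_iff algebra_simps)

section \<open>Annihilating polynomials in place of the Jordan normal form\<close>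

context
  fixes L :: "'e::euclidean_space \<Rightarrow> 'e"
  assumes L: "linear L"
begin

lemma map_prod_linear: "linear (map_prod L L)"
  by (rule linearI) (auto simp: linear_add[OF L] linear_scale[OF L])

lemma map_prod_cscale: "map_prod L L (cscale c p) = cscale c (map_prod L L p)"
  by (simp add: cscale_def prod_eq_iff linear_add[OF L] linear_diff[OF L] linear_scale[OF L])

lemma cshift_linear: "linear (cshift L z)"
  unfolding cshift_def
  by (rule linearI) (auto simp: cscale_def linear_add[OF L] linear_scale[OF L] algebra_simps)

definition poly_act :: "complex poly \<Rightarrow> 'e \<times> 'e \<Rightarrow> 'e \<times> 'e" where
  "poly_act q p = (\<Sum>i\<le>degree q. cscale (coeff q i) ((map_prod L L ^^ i) p))"

lemma poly_act_bound:
  assumes "degree q \<le> n"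
  shows "poly_act q p = (\<Sum>i\<le>n. cscale (coeff q i) ((map_prod L L ^^ i) p))"
  unfolding poly_act_def
  by (rule sum.mono_neutral_left) (use assms in \<open>auto simp: coeff_eq_0 cscale_0\<close>)

lemma poly_act_root:
  "poly_act ([:- z, 1:] * q) p = cshift L z (poly_act q p)"
proof -
  let ?D = "\<lambda>i. (map_prod L L ^^ i) p"
  have deg: "degree ([:- z, 1:] * q) \<le> Suc (degree q)"
    using degree_mult_le[of "[:- z, 1:]" q] by simp
  have c: "coeff ([:- z, 1:] * q) i = coeff (pCons 0 q) i + (- z) * coeff q i" for i
    by simp
  have "poly_act ([:- z, 1:] * q) p = (\<Sum>i\<le>Suc (degree q). cscale (coeff (pCons 0 q) i) (?D i))
      + (\<Sum>i\<le>Suc (degree q). cscale (- z * coeff q i) (?D i))"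
    unfolding poly_act_bound[OF deg] c cscale_add_left sum.distrib ..
  also have "(\<Sum>i\<le>Suc (degree q). cscale (coeff (pCons 0 q) i) (?D i))
      = (\<Sum>i\<le>degree q. cscale (coeff q i) (map_prod L L (?D i)))"
    by (subst sum.atMost_Suc_shift) (simp add: cscale_0)
  also have "\<dots> = map_prod L L (poly_act q p)"
    unfolding poly_act_def linear_sum[OF map_prod_linear] map_prod_cscale ..
  also have "(\<Sum>i\<le>Suc (degree q). cscale (- z * coeff q i) (?D i)) = - cscale z (poly_act q p)"
    unfolding poly_act_bound[OF le_SucI[OF order_refl], of q] cscale_sum_right sum_negf[symmetric] cscale_mult
      cscale_minus ..
  finally show ?thesis by (simp add: cshift_def)
qed

lemma poly_act_cshift: "poly_act q (cshift L z p) = cshift L z (poly_act q p)"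
proof -
  have "(map_prod L L ^^ i) (cshift L z p) = cshift L z ((map_prod L L ^^ i) p)" for i
    by (induction i) (simp_all add: cshift_def linear_diff[OF map_prod_linear] map_prod_cscale)
  moreover have "cscale c (cshift L z y) = cshift L z (cscale c y)" for c y
    by (simp add: cshift_def cscale_def prod_eq_iff linear_add[OF L] linear_diff[OF L] linear_scale[OF L] algebra_simps)
  ultimately show ?thesis
    unfolding poly_act_def by (simp add: linear_sum[OF cshift_linear])
qed

lemma annihilating_poly_ex: "\<exists>q. q \<noteq> 0 \<and> poly_act q p = 0"
proof -
  let ?D = "\<lambda>i. (map_prod L L ^^ i) p" and ?n = "DIM('e \<times> 'e)"
  have "\<exists>c. (\<exists>i\<le>?n. c i \<noteq> 0) \<and> (\<Sum>i\<le>?n. c i *\<^sub>R ?D i) = 0"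
  proof (cases "inj_on ?D {..?n}")
    case True
    have "card (?D ` {..?n}) = Suc ?n" using True by (simp add: card_image)
    then have "dependent (?D ` {..?n})" using independent_bound by fastforce
    then obtain u where u: "\<exists>v\<in>?D ` {..?n}. u v \<noteq> 0" "(\<Sum>v\<in>?D ` {..?n}. u v *\<^sub>R v) = 0"
      using dependent_finite[of "?D ` {..?n}"] by auto
    then have "(\<Sum>i\<le>?n. u (?D i) *\<^sub>R ?D i) = 0" by (simp only: sum.reindex[OF True] o_def)
    with u(1) show ?thesis by (intro exI[of _ "\<lambda>i. u (?D i)"]) auto
  next
    \<comment> \<open>Coinciding iterates collapse the image set, so that its linear dependence says
      nothing about the indices; their difference is itself the required relation.\<close>
    case False
    then obtain i j where ij: "i \<le> ?n" "j \<le> ?n" "i \<noteq> j" "?D i = ?D j" by (auto simp: inj_on_def)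
    let ?c = "\<lambda>k. (if k = i then 1 else 0) - (if k = j then 1 else 0) :: real"
    have "(\<Sum>k\<le>?n. ?c k *\<^sub>R ?D k) = (\<Sum>k\<le>?n. if k = i then ?D k else 0) - (\<Sum>k\<le>?n. if k = j then ?D k else 0)"
      unfolding sum_subtractf[symmetric] by (intro sum.cong) (auto simp: algebra_simps)
    also have "\<dots> = 0" using ij by simp
    finally show ?thesis using ij by (intro exI[of _ ?c]) auto
  qed
  then obtain c where c: "\<exists>i\<le>?n. c i \<noteq> 0" "(\<Sum>i\<le>?n. c i *\<^sub>R ?D i) = 0" by blast
  define q where "q = (\<Sum>i\<le>?n. monom (complex_of_real (c i)) i)"
  have cq: "coeff q i = (if i \<le> ?n then complex_of_real (c i) else 0)" for i
    unfolding q_def by (simp add: coeff_sum if_distrib[of "\<lambda>x. coeff x _"] sum.If_cases)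
  have "q \<noteq> 0" using c(1) cq by (metis coeff_0 of_real_eq_0_iff)
  moreover have "degree q \<le> ?n" by (rule degree_le) (simp add: cq)
  then have "poly_act q p = (\<Sum>i\<le>?n. c i *\<^sub>R ?D i)"
    by (simp add: poly_act_bound cq cscale_of_real)
  ultimately show ?thesis using c(2) by auto
qed

text \<open>An annihilating polynomial is split into linear factors. A root with real part below 1
  is not an eigenvalue on \<open>V\<close>, so its factor is injective on the complexification of
  \<open>V\<close> and can be cancelled.\<close>

lemma annihilating_list_ex:
  assumes V: "subspace V" "\<And>x. x \<in> V \<Longrightarrow> L x \<in> V"
    and ev: "\<And>z. eigenvalue_on V L z \<Longrightarrow> 1 \<le> Re z" and p: "p \<in> V \<times> V"
  shows "\<exists>zs. (\<forall>z\<in>set zs. 1 \<le> Re z) \<and> fold (cshift L) zs p = 0"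
proof -
  have VV: "subspace (V \<times> V)" by (intro subspace_Times V(1))
  have mV: "map_prod L L y \<in> V \<times> V" if "y \<in> V \<times> V" for y using V(2) that by auto
  have cV: "cscale c y \<in> V \<times> V" if "y \<in> V \<times> V" for c y
    using that V(1) by (auto simp: cscale_def intro!: subspace_add subspace_diff subspace_scale)
  have aV: "poly_act q y \<in> V \<times> V" if y: "y \<in> V \<times> V" for q y
  proof -
    have "(map_prod L L ^^ i) y \<in> V \<times> V" for i by (induction i) (use y mV in auto)
    then show ?thesis unfolding poly_act_def by (intro subspace_sum[OF VV] cV)
  qed
  have "\<exists>zs. (\<forall>z\<in>set zs. 1 \<le> Re z) \<and> fold (cshift L) zs y = 0"
    if "q \<noteq> 0" "poly_act q y = 0" "y \<in> V \<times> V" for q y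
    using that
  proof (induction "degree q" arbitrary: q y)
    case 0
    then obtain a where a: "q = [:a:]" "a \<noteq> 0" using degree_eq_zeroE by (metis pCons_0_0)
    then have "cscale (inverse a) (cscale a y) = 0" using 0 by (simp add: poly_act_def cscale_zero)
    then have "y = 0" using a by (simp add: cscale_mult[symmetric] cscale_1)
    then show ?case by (intro exI[of _ "[]"]) simp
  next
    case (Suc n)
    obtain z where "poly q z = 0"
      using fundamental_theorem_of_algebra[of q] Suc.hyps(2) by (metis constant_degree nat.distinct(1))
    then obtain r where r: "q = [:- z, 1:] * r" by (auto simp: poly_eq_0_iff_dvd)
    have r0: "r \<noteq> 0" using r Suc.prems by auto
    have "degree ([:- z, 1:] * r) = degree [:- z, 1:] + degree r" by (rule degree_mult_eq) (use r0 in auto)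
    then have dr: "n = degree r" using Suc.hyps(2) unfolding r[symmetric] by simp
    have ann: "cshift L z (poly_act r y) = 0" using Suc.prems(2) r poly_act_root by simp
    show ?case
    proof (cases "1 \<le> Re z")
      case True
      have "cshift L z y \<in> V \<times> V"
        unfolding cshift_def by (intro subspace_diff[OF VV] mV cV Suc.prems)
      then obtain zs where "\<forall>z\<in>set zs. 1 \<le> Re z" "fold (cshift L) zs (cshift L z y) = 0"
        using Suc.hyps(1)[OF dr r0, of "cshift L z y"] ann by (auto simp: poly_act_cshift)
      then show ?thesis using True by (intro exI[of _ "z # zs"]) simp
    next
      case False
      then have "\<not> eigenvalue_on V L z" using ev by blast
      then have r: "poly_act r y = 0"
        using aV[OF Suc.prems(3), of r] ann unfolding eigenvalue_on_cshift by metis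
      show ?thesis by (rule Suc.hyps(1)[OF dr r0 r Suc.prems(3)])
    qed
  qed
  with annihilating_poly_ex[of p] p show ?thesis by blast
qed

end

text \<open>\<open>M\<close> and \<open>L\<close> agree on the graded pieces of the flag. A product
  of factors that kills \<open>p\<close> when formed with \<open>L\<close> therefore, when formed
  with \<open>M\<close>, moves \<open>p\<close> one step down the flag, and the lists for all steps
  are concatenated.\<close>

lemma annihilating_list_flag:
  fixes L M :: "'e::euclidean_space \<Rightarrow> 'e" and U :: "nat \<Rightarrow> 'e set"
  assumes L: "linear L" and M: "linear M"
    and U: "\<And>j. subspace (U j)" "U 0 = {0}" "\<And>j x. x \<in> U j \<Longrightarrow> L x \<in> U j" "\<And>j x. x \<in> U j \<Longrightarrow> M x \<in> U j"
      "\<And>j x. x \<in> U (Suc j) \<Longrightarrow> M x - L x \<in> U j"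
    and ev: "\<And>j z. eigenvalue_on (U j) L z \<Longrightarrow> 1 \<le> Re z" and p: "p \<in> U j \<times> U j"
  shows "\<exists>zs. (\<forall>z\<in>set zs. 1 \<le> Re z) \<and> fold (cshift M) zs p = 0"
  using p
proof (induction j arbitrary: p)
  case 0
  then show ?case using U(2) by (intro exI[of _ "[]"]) (simp add: zero_prod_def)
next
  case (Suc j)
  let ?V = "U (Suc j) \<times> U (Suc j)" and ?W = "U j \<times> U j"
  have sub: "subspace ?V" "subspace ?W" by (intro subspace_Times U(1))+
  obtain zs where zs: "\<forall>z\<in>set zs. 1 \<le> Re z" "fold (cshift L) zs p = 0"
    using annihilating_list_ex[of L "U (Suc j)" p] L U(1,3) ev Suc.prems by blast
  have cs: "cscale c y \<in> U i \<times> U i" if "y \<in> U i \<times> U i" for c y i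
    using that U(1)[of i] by (auto simp: cscale_def intro!: subspace_add subspace_diff subspace_scale)
  \<comment> \<open>Two starting points that agree modulo \<open>?W\<close>, because after the first
    factor the two products already differ.\<close>
  have *: "fold (cshift M) zs x - fold (cshift L) zs y \<in> ?W" if "x \<in> ?V" "y \<in> ?V" "x - y \<in> ?W" for x y
    using that
  proof (induction zs arbitrary: x y)
    case Nil
    then show ?case by simp
  next
    case (Cons z zs)
    have "cshift M z x - cshift L z y = (map_prod M M (x - y) - cscale z (x - y)) + (map_prod M M y - map_prod L L y)"
      by (simp add: cshift_def cscale_def prod_eq_iff linear_diff[OF M] algebra_simps)
    also have "\<dots> \<in> ?W"
      by (rule subspace_add[OF sub(2) subspace_diff[OF sub(2) _ cs[OF Cons.prems(3)]]])
        (use Cons.prems U in auto)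
    finally have 1: "cshift M z x - cshift L z y \<in> ?W" .
    have 2: "cshift M z x \<in> ?V" "cshift L z y \<in> ?V"
      unfolding cshift_def by (rule subspace_diff[OF sub(1) _ cs]; use Cons.prems U in auto)+
    show ?case using Cons.IH[OF 2 1] by simp
  qed
  have "fold (cshift M) zs p \<in> ?W"
    using *[OF Suc.prems Suc.prems] zs(2) subspace_0[OF sub(2)] by simp
  from Suc.IH[OF this] obtain zs' where "\<forall>z\<in>set zs'. 1 \<le> Re z" "fold (cshift M) zs' (fold (cshift M) zs p) = 0" by blast
  then show ?case using zs(1) by (intro exI[of _ "zs @ zs'"]) auto
qed

section \<open>The operator exponential and its generator\<close>

lemma exp_op_cong:
  assumes "\<And>Y. Y \<in> V \<Longrightarrow> D Y = L Y" "\<And>Y. Y \<in> V \<Longrightarrow> L Y \<in> V" "X \<in> V"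
  shows "exp_op t D X = exp_op t L X"
proof -
  have "(L ^^ m) X \<in> V \<and> (D ^^ m) X = (L ^^ m) X" for m
    by (induction m) (use assms in auto)
  then show ?thesis by (simp add: exp_op_def)
qed

lemma funpow_norm_le:
  fixes M :: "'e::real_normed_vector \<Rightarrow> 'e"
  assumes "\<And>x. norm (M x) \<le> norm x * K" "0 \<le> K"
  shows "norm ((M ^^ m) X) \<le> K ^ m * norm X"
proof (induction m)
  case (Suc m)
  have "norm ((M ^^ Suc m) X) \<le> norm ((M ^^ m) X) * K" using assms(1)[of "(M ^^ m) X"] by simp
  also have "\<dots> \<le> K ^ m * norm X * K" using Suc assms(2) by (intro mult_right_mono) auto
  finally show ?case by (simp add: mult_ac)
qed simp

text \<open>Paired with \<open>b\<close>, the exponential is a real power series in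
  \<open>t\<close>, to be differentiated term by term; the constant term of the derivative survives
  at 0.\<close>

lemma exp_op_inner_derivative_0:
  fixes M :: "'e::euclidean_space \<Rightarrow> 'e"
  assumes M: "linear M"
  shows "((\<lambda>t. exp_op t M X \<bullet> b) has_real_derivative M X \<bullet> b) (at 0)"
proof -
  obtain K where K: "0 \<le> K" "\<And>x. norm (M x) \<le> norm x * K"
    using bounded_linear.nonneg_bounded M linear_conv_bounded_linear by blast
  have s: "summable (\<lambda>m. (t ^ m / fact m) *\<^sub>R (M ^^ m) X)" for t
  proof (rule summable_comparison_test')
    show "summable (\<lambda>m. norm X * ((\<bar>t\<bar> * K) ^ m / fact m))"
      using summable_exp[of "\<bar>t\<bar> * K"] by (intro summable_mult) (simp add: field_simps)
    fix m :: nat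
    have "norm ((t ^ m / fact m) *\<^sub>R (M ^^ m) X) \<le> (\<bar>t\<bar> ^ m / fact m) * (K ^ m * norm X)"
      using funpow_norm_le[OF K(2,1), of m X] by (simp add: power_abs mult_left_mono divide_right_mono)
    then show "norm ((t ^ m / fact m) *\<^sub>R (M ^^ m) X) \<le> norm X * ((\<bar>t\<bar> * K) ^ m / fact m)"
      by (simp add: power_mult_distrib mult_ac)
  qed
  let ?c = "\<lambda>m. ((M ^^ m) X \<bullet> b) / fact m"
  have e: "exp_op t M X \<bullet> b = (\<Sum>m. ?c m * t ^ m)" and c: "summable (\<lambda>m. ?c m * t ^ m)" for t
    using bounded_linear.suminf[OF bounded_linear_inner_left s[of t], of b]
      bounded_linear.summable[OF bounded_linear_inner_left s[of t], of b]
    by (simp_all add: exp_op_def mult_ac)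
  have "((\<lambda>t. \<Sum>m. ?c m * t ^ m) has_real_derivative (\<Sum>m. diffs ?c m * 0 ^ m)) (at 0)"
    by (rule termdiffs_strong_converges_everywhere[OF c])
  moreover have "(\<Sum>m. diffs ?c m * 0 ^ m) = M X \<bullet> b"
    by (subst suminf_finite[of "{0}"]) (auto simp: diffs_def)
  ultimately show ?thesis by (simp only: e)
qed

text \<open>The derivative at 0 of the exponential recovers the generator. The maps are linear on
  \<open>V\<close> only, so they are first replaced by linear maps of the whole space, built on an
  orthonormal basis of \<open>V\<close>.\<close>

lemma exp_op_injective:
  fixes D1 D2 :: "'e::euclidean_space \<Rightarrow> 'e"
  assumes V: "subspace V"
    and D1: "\<And>X. X \<in> V \<Longrightarrow> D1 X \<in> V" "\<And>X Y. X \<in> V \<Longrightarrow> Y \<in> V \<Longrightarrow> D1 (X + Y) = D1 X + D1 Y"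
      "\<And>r X. X \<in> V \<Longrightarrow> D1 (r *\<^sub>R X) = r *\<^sub>R D1 X"
    and D2: "\<And>X. X \<in> V \<Longrightarrow> D2 X \<in> V" "\<And>X Y. X \<in> V \<Longrightarrow> Y \<in> V \<Longrightarrow> D2 (X + Y) = D2 X + D2 Y"
      "\<And>r X. X \<in> V \<Longrightarrow> D2 (r *\<^sub>R X) = r *\<^sub>R D2 X"
    and X: "X \<in> V" and e: "\<And>t. exp_op t D1 X = exp_op t D2 X"
  shows "D1 X = D2 X"
proof -
  obtain Bs where Bs: "Bs \<subseteq> V" "pairwise orthogonal Bs" "\<And>x. x \<in> Bs \<Longrightarrow> norm x = 1" "independent Bs" "span Bs = V"
    using orthonormal_basis_subspace[OF V] by metis
  have fin: "finite Bs" using Bs(4) independent_imp_finite by blast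
  have ext: "\<exists>M. linear M \<and> (\<forall>Y\<in>V. M Y = D Y)"
    if D: "\<And>X Y. X \<in> V \<Longrightarrow> Y \<in> V \<Longrightarrow> D (X + Y) = D X + D Y" "\<And>r X. X \<in> V \<Longrightarrow> D (r *\<^sub>R X) = r *\<^sub>R D X"
    for D :: "'e \<Rightarrow> 'e"
  proof (intro exI[of _ "\<lambda>x. \<Sum>b\<in>Bs. (x \<bullet> b) *\<^sub>R D b"] conjI ballI)
    show "linear (\<lambda>x. \<Sum>b\<in>Bs. (x \<bullet> b) *\<^sub>R D b)"
      by (rule linearI) (simp_all add: inner_add_left scaleR_add_left sum.distrib scaleR_sum_right)
    fix Y assume Y: "Y \<in> V"
    have D0: "D 0 = 0" using D(2)[of 0 0] subspace_0[OF V] by simp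
    have "D (\<Sum>b\<in>I. (Y \<bullet> b) *\<^sub>R b) = (\<Sum>b\<in>I. (Y \<bullet> b) *\<^sub>R D b)" if "finite I" "I \<subseteq> V" for I
      using that
    proof (induction I)
      case (insert b I)
      have "(\<Sum>b\<in>I. (Y \<bullet> b) *\<^sub>R b) \<in> V"
        using insert by (intro subspace_sum[OF V] subspace_scale[OF V]) auto
      then show ?case using insert D V by (simp add: subspace_scale)
    qed (simp add: D0)
    from this[OF fin Bs(1)] show "(\<Sum>b\<in>Bs. (Y \<bullet> b) *\<^sub>R D b) = D Y"
      using orthonormal_basis_expand[of Bs Y] Bs Y fin by (simp add: inner_commute)
  qed
  obtain M1 where M1: "linear M1" "\<And>Y. Y \<in> V \<Longrightarrow> M1 Y = D1 Y" using ext[of D1] D1(2,3) by blast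
  obtain M2 where M2: "linear M2" "\<And>Y. Y \<in> V \<Longrightarrow> M2 Y = D2 Y" using ext[of D2] D2(2,3) by blast
  have "exp_op t M1 X = exp_op t M2 X" for t
    using exp_op_cong[of V M1 D1 X t] exp_op_cong[of V M2 D2 X t] M1(2) M2(2) D1(1) D2(1) X e by simp
  then have "(\<lambda>t. exp_op t M1 X \<bullet> b) = (\<lambda>t. exp_op t M2 X \<bullet> b)" for b by simp
  then have "M1 X \<bullet> b = M2 X \<bullet> b" for b
    by (metis exp_op_inner_derivative_0[OF M1(1)] exp_op_inner_derivative_0[OF M2(1)] DERIV_unique)
  then have "M1 X = M2 X" by (rule euclidean_eqI)
  then show ?thesis using M1 M2 X by simp
qed

text \<open>The one-parameter group generated by \<open>M\<close>, described by its differential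
  equation and by commuting with \<open>M\<close>; to be instantiated by \<open>Ad\<close> along a
  line in the image of a splitting.\<close>

locale linear_flow =
  fixes B :: "real \<Rightarrow> 'e::euclidean_space \<Rightarrow> 'e" and M :: "'e \<Rightarrow> 'e"
  assumes B_linear: "linear (B t)" and M_linear: "linear M"
    and B_0: "B 0 X = X" and B_M: "B t (M X) = M (B t X)"
    and B_deriv: "((\<lambda>s. B s X) has_vector_derivative M (B t X)) (at t)"
begin

lemma B_continuous: "continuous_on S (\<lambda>t. B t X)"
  using B_deriv by (intro continuous_at_imp_continuous_on ballI) (rule has_vector_derivative_continuous)

lemma B_funpow: "B t ((M ^^ m) X) = (M ^^ m) (B t X)"
  by (induction m) (simp_all add: B_M)

text \<open>Taylor's formula for each coordinate: the derivatives of the orbit of \<open>X\<close>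
  are the orbits of the vectors \<open>(M ^^ m) X\<close>. Boundedness of the orbit on a compact
  interval gives a remainder of order \<open>(\<bar>t\<bar> * K) ^ n / fact n\<close>.\<close>

lemma flow_exp_op: "exp_op t M X = B t X"
proof -
  obtain K where K: "0 \<le> K" "\<And>x. norm (M x) \<le> norm x * K"
    using bounded_linear.nonneg_bounded M_linear linear_conv_bounded_linear by blast
  have "compact ((\<lambda>s. B s X) ` {- \<bar>t\<bar>..\<bar>t\<bar>})"
    by (rule compact_continuous_image[OF B_continuous]) simp
  then obtain R where R: "\<And>s. \<bar>s\<bar> \<le> \<bar>t\<bar> \<Longrightarrow> norm (B s X) \<le> R"
    using compact_imp_bounded[of "(\<lambda>s. B s X) ` {- \<bar>t\<bar>..\<bar>t\<bar>}"] unfolding bounded_iff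
    by (metis abs_le_iff atLeastAtMost_iff imageI minus_le_iff)
  let ?S = "\<lambda>n. \<Sum>m<n. (t ^ m / fact m) *\<^sub>R (M ^^ m) X"
  have "?S \<longlonglongrightarrow> B t X"
    unfolding tendsto_componentwise_iff[of ?S]
  proof
    fix b :: 'e assume b: "b \<in> Basis"
    have le: "\<bar>?S n \<bullet> b - B t X \<bullet> b\<bar> \<le> R * ((\<bar>t\<bar> * K) ^ n / fact n)" for n
    proof -
      have "\<exists>s. \<bar>s\<bar> \<le> \<bar>t\<bar> \<and> B t X \<bullet> b = (\<Sum>m<n. (B 0 ((M ^^ m) X) \<bullet> b) / fact m * t ^ m) +
          (B s ((M ^^ n) X) \<bullet> b) / fact n * t ^ n"
      proof (rule Maclaurin_all_le[of "\<lambda>m s. B s ((M ^^ m) X) \<bullet> b" "\<lambda>s. B s X \<bullet> b" t n])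
        show "\<forall>m s. ((\<lambda>s. B s ((M ^^ m) X) \<bullet> b) has_real_derivative B s ((M ^^ Suc m) X) \<bullet> b) (at s)"
          using bounded_linear.has_vector_derivative[OF bounded_linear_inner_left B_deriv]
          by (simp add: has_real_derivative_iff_has_vector_derivative B_M)
      qed simp
      then obtain s where s: "\<bar>s\<bar> \<le> \<bar>t\<bar>"
        "B t X \<bullet> b = ?S n \<bullet> b + (B s ((M ^^ n) X) \<bullet> b) / fact n * t ^ n"
        by (auto simp: B_0 inner_sum_left mult_ac)
      have "\<bar>?S n \<bullet> b - B t X \<bullet> b\<bar> = \<bar>B s ((M ^^ n) X) \<bullet> b\<bar> / fact n * \<bar>t\<bar> ^ n"
        using s(2) by (simp add: abs_mult power_abs)
      also have "\<bar>B s ((M ^^ n) X) \<bullet> b\<bar> \<le> norm (B s ((M ^^ n) X))" using b by (rule Basis_le_norm)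
      also have "\<dots> \<le> K ^ n * R"
        unfolding B_funpow
        by (rule order_trans[OF funpow_norm_le[OF K(2,1)]]) (use R[OF s(1)] K in \<open>auto intro: mult_left_mono\<close>)
      finally show ?thesis by (simp add: power_mult_distrib divide_right_mono mult_right_mono mult_ac)
    qed
    have "(\<lambda>n. R * ((\<bar>t\<bar> * K) ^ n / fact n)) \<longlonglongrightarrow> 0"
      using summable_LIMSEQ_zero[OF summable_exp[of "\<bar>t\<bar> * K"]]
      by (intro tendsto_mult_right_zero) (simp add: field_simps)
    then have "(\<lambda>n. ?S n \<bullet> b - B t X \<bullet> b) \<longlonglongrightarrow> 0"
      by (rule Lim_null_comparison[rotated]) (use le in auto)
    then show "(\<lambda>n. ?S n \<bullet> b) \<longlonglongrightarrow> B t X \<bullet> b" by (simp add: LIM_zero_iff)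
  qed
  then show ?thesis
    unfolding exp_op_def by (simp add: sums_def[symmetric] sums_unique[symmetric])
qed

text \<open>Induction on the factors, with (M - z) p as the next vector. The squared norm N of the
  backward orbit satisfies N' = -2 (Re z) N up to a coupling with that vector, whose decay is
  already known; the terms with Im z cancel. Spending part of the rate 2 on the coupling leaves rate
  1 at every step, so repeated factors do no harm.\<close>

lemma flow_decay_pair:
  assumes "\<forall>z\<in>set zs. 1 \<le> Re z" "fold (cshift M) zs p = 0"
  shows "\<exists>C\<ge>0. \<forall>t\<ge>0. (norm (B (- t) (fst p)))\<^sup>2 + (norm (B (- t) (snd p)))\<^sup>2 \<le> C * exp (- t)"
  using assms
proof (induction zs arbitrary: p)
  case Nil
  then have "p = 0" by simp
  then show ?case by (intro exI[of _ 0]) (simp add: linear_0[OF B_linear])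
next
  case (Cons z zs)
  obtain u w u' w' where p: "p = (u, w)" and p': "cshift M z p = (u', w')" by fastforce
  obtain C where C: "C \<ge> 0" "\<And>t. t \<ge> 0 \<Longrightarrow> (norm (B (- t) u'))\<^sup>2 + (norm (B (- t) w'))\<^sup>2 \<le> C * exp (- t)"
    using Cons.IH[of "cshift M z p"] Cons.prems p' by auto
  have Mu: "M u = Re z *\<^sub>R u - Im z *\<^sub>R w + u'" and Mw: "M w = Im z *\<^sub>R u + Re z *\<^sub>R w + w'"
    using p p' by (auto simp: cshift_def cscale_def algebra_simps)
  let ?U = "\<lambda>t. B (- t) u" and ?W = "\<lambda>t. B (- t) w" and ?U' = "\<lambda>t. B (- t) u'" and ?W' = "\<lambda>t. B (- t) w'"
  have dB: "((\<lambda>t. B (- t) x) has_vector_derivative - B (- t) (M x)) (at t)" for x t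
  proof -
    have "((\<lambda>t. - t) has_vector_derivative (- 1 :: real)) (at t)" by (auto intro!: derivative_eq_intros)
    from vector_diff_chain_at[OF this B_deriv] show ?thesis by (simp add: o_def B_M)
  qed
  let ?N = "\<lambda>t. ?U t \<bullet> ?U t + ?W t \<bullet> ?W t"
  let ?N' = "\<lambda>t. - (2 * Re z * ?N t) - 2 * (?U t \<bullet> ?U' t + ?W t \<bullet> ?W' t)"
  have dN: "(?N has_real_derivative ?N' t) (at t)" for t
  proof -
    have "(?N has_vector_derivative (?U t \<bullet> (- B (- t) (M u)) + (- B (- t) (M u)) \<bullet> ?U t)
       + (?W t \<bullet> (- B (- t) (M w)) + (- B (- t) (M w)) \<bullet> ?W t)) (at t)"
      by (intro has_vector_derivative_add bounded_bilinear.has_vector_derivative[OF bounded_bilinear_inner] dB)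
    moreover have "(?U t \<bullet> (- B (- t) (M u)) + (- B (- t) (M u)) \<bullet> ?U t)
       + (?W t \<bullet> (- B (- t) (M w)) + (- B (- t) (M w)) \<bullet> ?W t) = ?N' t"
      unfolding Mu Mw
      by (simp add: linear_add[OF B_linear] linear_diff[OF B_linear] linear_scale[OF B_linear]
          inner_add_left inner_add_right inner_diff_left inner_diff_right inner_commute algebra_simps)
    ultimately show ?thesis by (simp add: has_real_derivative_iff_has_vector_derivative)
  qed
  have N0: "?N t \<ge> 0" for t by simp
  have N': "3/2 * ?N t + ?N' t \<le> 2 * C * exp (- t)" if "t \<ge> 0" for t
  proof -
    \<comment> \<open>Young's inequality, weighted so that the coupling costs only 1/2 of the rate 2
      and leaves 3/2, still above the rate 1 of the right-hand side.\<close>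
    have *: "- 2 * (a \<bullet> b) \<le> 1/2 * (a \<bullet> a) + 2 * (b \<bullet> b)" for a b :: 'e
      using inner_ge_zero[of "a /\<^sub>R 2 + b"]
      by (simp add: inner_add_left inner_add_right inner_commute algebra_simps)
    have "2 * ?N t \<le> 2 * Re z * ?N t"
      using Cons.prems(1) N0[of t] by (intro mult_right_mono) auto
    moreover have "2 * (?U' t \<bullet> ?U' t + ?W' t \<bullet> ?W' t) \<le> 2 * C * exp (- t)"
      using C(2)[OF that] by (simp add: power2_norm_eq_inner)
    ultimately show ?thesis using *[of "?U t" "?U' t"] *[of "?W t" "?W' t"] by argo
  qed
  \<comment> \<open>The integrating factor for the rate 3/2. The subtracted term has derivative
    \<open>2 * C * exp (t / 2)\<close>, which is the right-hand side after multiplication by that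
    factor, so \<open>?\<chi>\<close> does not increase.\<close>
  let ?\<chi> = "\<lambda>t. exp (3/2 * t) * ?N t - 4 * C * exp (t / 2)"
  have d\<chi>: "(?\<chi> has_real_derivative (exp (3/2 * t) * (3/2 * ?N t + ?N' t) - 2 * C * exp (t / 2))) (at t)" for t
  proof -
    have "((\<lambda>t. exp (3/2 * t) * f t - 4 * C * exp (t / 2)) has_real_derivative
        (exp (3/2 * t) * (3/2 * f t + f') - 2 * C * exp (t / 2))) (at t)"
      if "(f has_real_derivative f') (at t)" for f f'
      using that by (auto intro!: derivative_eq_intros simp: algebra_simps)
    from this[OF dN] show ?thesis .
  qed
  have "?N t \<le> (?N 0 + 4 * C) * exp (- t)" if t: "t \<ge> 0" for t
  proof -
    have "?\<chi> t \<le> ?\<chi> 0"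
    proof (rule DERIV_nonpos_imp_nonincreasing[OF t])
      fix s :: real assume s: "0 \<le> s" "s \<le> t"
      have "exp (3/2 * s) * (3/2 * ?N s + ?N' s) \<le> exp (3/2 * s) * (2 * C * exp (- s))"
        by (rule mult_left_mono[OF N'[OF s(1)]]) simp
      also have "\<dots> = 2 * C * exp (s / 2)"
        by (simp add: exp_add[symmetric] mult.commute mult.left_commute)
      finally show "\<exists>y. (?\<chi> has_real_derivative y) (at s) \<and> y \<le> 0"
        using d\<chi>[of s] by (intro exI conjI) auto
    qed
    then have "exp (3/2 * t) * ?N t \<le> (?N 0 - 4 * C) + 4 * C * exp (t / 2)" by simp
    also have "\<dots> \<le> ?N 0 * exp (t / 2) + 4 * C * exp (t / 2)"
      using C(1) mult_left_mono[of 1 "exp (t / 2)" "?N 0"] t N0[of 0] by auto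
    finally have "exp (- (3/2 * t)) * (exp (3/2 * t) * ?N t) \<le> exp (- (3/2 * t)) * ((?N 0 + 4 * C) * exp (t / 2))"
      by (intro mult_left_mono) (simp_all add: algebra_simps)
    moreover have "exp (- (3/2 * t)) * (exp (3/2 * t) * ?N t) = ?N t"
      by (simp add: mult.assoc[symmetric] exp_add[symmetric])
    moreover have "exp (- (3/2 * t)) * ((?N 0 + 4 * C) * exp (t / 2)) = (?N 0 + 4 * C) * exp (- t)"
      by (simp add: mult.left_commute[of "exp _"] exp_add[symmetric])
    ultimately show ?thesis by argo
  qed
  then show ?case
    using C(1) N0[of 0] by (intro exI[of _ "?N 0 + 4 * C"]) (auto simp: p power2_norm_eq_inner)
qed

text \<open>The bound for squared norms becomes one for norms with half the exponent; an orthonormal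
  basis makes the constant uniform over \<open>V\<close>.\<close>

lemma flow_decay:
  assumes V: "subspace V"
    and ann: "\<And>p. p \<in> V \<times> V \<Longrightarrow> \<exists>zs. (\<forall>z\<in>set zs. 1 \<le> Re z) \<and> fold (cshift M) zs p = 0"
  shows "\<exists>C\<ge>0. \<forall>X\<in>V. \<forall>t\<ge>0. norm (B (- t) X) \<le> C * exp (- (t / 2)) * norm X"
proof -
  obtain Bs where Bs: "Bs \<subseteq> V" "pairwise orthogonal Bs" "\<And>x. x \<in> Bs \<Longrightarrow> norm x = 1" "independent Bs" "span Bs = V"
    using orthonormal_basis_subspace[OF V] by metis
  have fin: "finite Bs" using Bs(4) independent_imp_finite by blast
  have "\<exists>C\<ge>0. \<forall>t\<ge>0. norm (B (- t) b) \<le> C * exp (- (t / 2))" if b: "b \<in> Bs" for b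
  proof -
    have "(b, 0) \<in> V \<times> V" using b Bs(1) subspace_0[OF V] by auto
    then obtain C where C: "C \<ge> 0" "\<And>t. t \<ge> 0 \<Longrightarrow> (norm (B (- t) b))\<^sup>2 + (norm (B (- t) 0))\<^sup>2 \<le> C * exp (- t)"
      using ann flow_decay_pair by (metis fst_conv snd_conv)
    have "norm (B (- t) b) \<le> sqrt C * exp (- (t / 2))" if "t \<ge> 0" for t
    proof (rule power2_le_imp_le)
      have "(norm (B (- t) b))\<^sup>2 \<le> C * exp (- t)" using C(2)[OF that] by (smt (verit) zero_le_power2)
      also have "\<dots> = (sqrt C * exp (- (t / 2)))\<^sup>2"
        using C(1) by (simp add: power_mult_distrib exp_double[symmetric])
      finally show "(norm (B (- t) b))\<^sup>2 \<le> (sqrt C * exp (- (t / 2)))\<^sup>2" .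
    qed (use C in auto)
    then show ?thesis using C(1) by (intro exI[of _ "sqrt C"]) auto
  qed
  then obtain c where c: "\<And>b. b \<in> Bs \<Longrightarrow> c b \<ge> 0 \<and> (\<forall>t\<ge>0. norm (B (- t) b) \<le> c b * exp (- (t / 2)))" by metis
  have "norm (B (- t) X) \<le> sum c Bs * exp (- (t / 2)) * norm X" if X: "X \<in> V" and t: "t \<ge> 0" for X t
  proof -
    have "X = (\<Sum>b\<in>Bs. (X \<bullet> b) *\<^sub>R b)"
      using orthonormal_basis_expand[of Bs X] Bs X fin by (simp add: inner_commute)
    then have "B (- t) X = (\<Sum>b\<in>Bs. (X \<bullet> b) *\<^sub>R B (- t) b)"
      using linear_sum[OF B_linear] linear_scale[OF B_linear] by (metis (no_types, lifting) sum.cong)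
    also have "norm \<dots> \<le> (\<Sum>b\<in>Bs. norm X * (c b * exp (- (t / 2))))"
    proof (rule sum_norm_le)
      fix b assume b: "b \<in> Bs"
      have "\<bar>X \<bullet> b\<bar> \<le> norm X" using Cauchy_Schwarz_ineq2[of X b] Bs(3)[OF b] by simp
      then show "norm ((X \<bullet> b) *\<^sub>R B (- t) b) \<le> norm X * (c b * exp (- (t / 2)))"
        using c[OF b] t by (simp add: mult_mono)
    qed
    also have "\<dots> = sum c Bs * exp (- (t / 2)) * norm X"
      by (simp add: sum_distrib_right sum_distrib_left mult.commute)
    finally show ?thesis .
  qed
  moreover have "sum c Bs \<ge> 0" using c by (simp add: sum_nonneg)
  ultimately show ?thesis by blast
qed

end

section \<open>Polygons and detours in Euclidean space\<close>

text \<open>Semidefiniteness covers both the metric at the identity and its pullback along the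
  differential of a splitting, without a discussion of kernels.\<close>

locale psd_form =
  fixes b :: "'v::euclidean_space \<Rightarrow> 'v \<Rightarrow> real"
  assumes b_bilinear: "bilinear b" and b_sym: "b x y = b y x" and b_nonneg: "0 \<le> b x x"
begin

definition nrm :: "'v \<Rightarrow> real" where "nrm x = sqrt (b x x)"

lemmas b_simps = bilinear_ladd[OF b_bilinear] bilinear_radd[OF b_bilinear] bilinear_lsub[OF b_bilinear]
  bilinear_rsub[OF b_bilinear] bilinear_lmul[OF b_bilinear] bilinear_rmul[OF b_bilinear]
  bilinear_lneg[OF b_bilinear] bilinear_rneg[OF b_bilinear] bilinear_lzero[OF b_bilinear] bilinear_rzero[OF b_bilinear]

lemma nrm_nonneg: "0 \<le> nrm x" and nrm_sq: "(nrm x)\<^sup>2 = b x x" and nrm_0 [simp]: "nrm 0 = 0"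
  using b_nonneg by (simp_all add: nrm_def b_simps)

lemma nrm_scale: "nrm (r *\<^sub>R x) = \<bar>r\<bar> * nrm x"
  by (simp add: nrm_def b_simps real_sqrt_mult)

lemma nrm_minus: "nrm (- x) = nrm x"
  by (simp add: nrm_def b_simps)

lemma b_le_nrm: "b x y \<le> nrm x * nrm y"
proof (cases "nrm y = 0")
  case False
  then have y: "b y y > 0" using b_nonneg[of y] by (auto simp: nrm_def less_le)
  let ?r = "b x y / b y y"
  have "0 \<le> b (x - ?r *\<^sub>R y) (x - ?r *\<^sub>R y)" by (rule b_nonneg)
  also have "\<dots> = b x x - (b x y)\<^sup>2 / b y y"
    using y by (simp add: b_simps b_sym[of y x] power2_eq_square field_simps)
  finally have "(b x y)\<^sup>2 \<le> b x x * b y y" using y by (simp add: field_simps)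
  then have "sqrt ((b x y)\<^sup>2) \<le> sqrt (b x x * b y y)" by (rule real_sqrt_le_mono)
  then show ?thesis by (simp add: nrm_def real_sqrt_mult)
next
  case True
  then have y: "b y y = 0" by (simp add: nrm_def)
  show ?thesis
  proof (rule ccontr)
    assume "\<not> ?thesis"
    then have p: "b x y > 0" using True by simp
    \<comment> \<open>With \<open>b y y = 0\<close> the form at \<open>x - r *\<^sub>R y\<close> is
      affine in \<open>r\<close>; this \<open>r\<close> makes it -1.\<close>
    let ?r = "(b x x + 1) / (2 * b x y)"
    have "b (x - ?r *\<^sub>R y) (x - ?r *\<^sub>R y) = b x x - 2 * ?r * b x y"
      by (simp add: b_simps b_sym[of y x] y)
    also have "\<dots> = - 1" using p by (simp add: field_simps)
    finally show False using b_nonneg[of "x - ?r *\<^sub>R y"] by simp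
  qed
qed

lemma nrm_triangle: "nrm (x + y) \<le> nrm x + nrm y"
proof (rule power2_le_imp_le)
  show "(nrm (x + y))\<^sup>2 \<le> (nrm x + nrm y)\<^sup>2"
    using b_le_nrm[of x y] by (simp add: nrm_sq power2_sum b_simps b_sym[of y x])
qed (simp add: nrm_nonneg)

lemma nrm_triangle3: "nrm (x - z) \<le> nrm (x - y) + nrm (y - z)"
  using nrm_triangle[of "x - y" "y - z"] by simp

text \<open>The parallelogram law. Here \<open>x\<close> will be half a chord and \<open>y\<close>
  the elevation of an apex over its midpoint, so that the left side is the length of the
  roof.\<close>

lemma nrm_apex: "nrm (x + y) + nrm (x - y) \<le> 2 * sqrt (b x x + b y y)"
proof -
  have "(nrm (x + y) + nrm (x - y))\<^sup>2 \<le> 2 * ((nrm (x + y))\<^sup>2 + (nrm (x - y))\<^sup>2)"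
    using zero_le_power2[of "nrm (x + y) - nrm (x - y)"] by (simp add: power2_eq_square algebra_simps)
  also have "\<dots> = 4 * (b x x + b y y)" by (simp add: nrm_sq b_simps)
  finally have "sqrt ((nrm (x + y) + nrm (x - y))\<^sup>2) \<le> sqrt (4 * (b x x + b y y))" by (rule real_sqrt_le_mono)
  moreover have "sqrt (4 * (b x x + b y y)) = 2 * sqrt (b x x + b y y)"
    unfolding real_sqrt_mult by simp
  ultimately show ?thesis using nrm_nonneg[of "x + y"] nrm_nonneg[of "x - y"] by simp
qed

primrec plen :: "'v \<Rightarrow> 'v list \<Rightarrow> 'v \<Rightarrow> real" where
  "plen x [] y = nrm (y - x)"
| "plen x (z # zs) y = nrm (z - x) + plen z zs y"

lemma plen_triangle: "plen x zs y \<le> nrm (x' - x) + plen x' zs y"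
  using nrm_triangle3[of y x x'] nrm_triangle3[of "hd zs" x x'] by (cases zs) auto

end

text \<open>A path in the group reduced to its projection \<open>v\<close> and its full speed
  \<open>sp\<close>; the excess of \<open>sp\<close> over the norm of \<open>v'\<close> leaves room
  for motion in the nilpotent directions.\<close>

locale speed_path = psd_form b for b :: "'v::euclidean_space \<Rightarrow> 'v \<Rightarrow> real" +
  fixes F :: "real set" and v v' :: "real \<Rightarrow> 'v" and sp :: "real \<Rightarrow> real"
  assumes F: "finite F" and v_cont: "continuous_on {0..1} v"
    and v_deriv: "\<And>t. t \<in> {0<..<1} - F \<Longrightarrow> (v has_vector_derivative v' t) (at t)"
    and sp_int: "sp integrable_on {0..1}" and sp_ge: "\<And>t. t \<in> {0..1} \<Longrightarrow> nrm (v' t) \<le> sp t"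
begin

lemma sp_nonneg: "t \<in> {0..1} \<Longrightarrow> 0 \<le> sp t"
  using sp_ge nrm_nonneg order_trans by blast

lemma sp_int_sub: "0 \<le> p \<Longrightarrow> z \<le> 1 \<Longrightarrow> sp integrable_on {p..z}"
  by (rule integrable_subinterval_real[OF sp_int]) auto

lemma sp_integral_nonneg: "0 \<le> p \<Longrightarrow> z \<le> 1 \<Longrightarrow> 0 \<le> integral {p..z} sp"
  by (rule integral_nonneg[OF sp_int_sub]) (auto intro!: sp_nonneg)

text \<open>Apart from the final division, the curve with components \<open>v\<close> and the
  integral of \<open>w\<close> is paired with its own total displacement, and Cauchy-Schwarz is
  applied at each time. Displacement and speed enter with coefficient 1, which is what makes detours
  free of charge.\<close>

lemma minkowski:
  assumes pz: "0 \<le> p" "p \<le> z" "z \<le> 1" and w: "w integrable_on {0..1}"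
    and ge: "\<And>t. t \<in> {0..1} \<Longrightarrow> b (v' t) (v' t) + (w t)\<^sup>2 \<le> (sp t)\<^sup>2"
  shows "sqrt (b (v z - v p) (v z - v p) + (integral {p..z} w)\<^sup>2) \<le> integral {p..z} sp"
proof -
  let ?x = "v z - v p" and ?Y = "integral {p..z} w"
  let ?R = "sqrt (b ?x ?x + ?Y\<^sup>2)"
  have R0: "0 \<le> ?R" and R2: "?R\<^sup>2 = b ?x ?x + ?Y\<^sup>2" using b_nonneg[of ?x] by simp_all
  have "(v' has_integral v z - v p) {p..z}"
    by (rule fundamental_theorem_of_calculus_interior_strong[OF F pz(2)])
      (use pz in \<open>auto intro!: v_deriv continuous_on_subset[OF v_cont]\<close>)
  from has_integral_linear[OF this, of "b ?x"]
  have "((\<lambda>t. b ?x (v' t)) has_integral b ?x ?x) {p..z}"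
    using b_bilinear by (auto simp: bilinear_def linear_conv_bounded_linear o_def)
  moreover have wi: "w integrable_on {p..z}" by (rule integrable_subinterval_real[OF w]) (use pz in auto)
  then have "((\<lambda>t. ?Y * w t) has_integral ?Y * ?Y) {p..z}"
    by (intro has_integral_mult_right integrable_integral)
  ultimately have "((\<lambda>t. b ?x (v' t) + ?Y * w t) has_integral b ?x ?x + ?Y * ?Y) {p..z}"
    by (rule has_integral_add)
  moreover have "((\<lambda>t. ?R * sp t) has_integral ?R * integral {p..z} sp) {p..z}"
    by (intro has_integral_mult_right integrable_integral sp_int_sub pz)
  ultimately have "b ?x ?x + ?Y * ?Y \<le> ?R * integral {p..z} sp"
  proof (rule has_integral_le)
    fix t assume "t \<in> {p..z}"
    then have t: "t \<in> {0..1}" using pz by auto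
    have "(nrm ?x * nrm (v' t) + \<bar>?Y\<bar> * \<bar>w t\<bar>)\<^sup>2 \<le> ((nrm ?x)\<^sup>2 + \<bar>?Y\<bar>\<^sup>2) * ((nrm (v' t))\<^sup>2 + \<bar>w t\<bar>\<^sup>2)"
      using zero_le_power2[of "nrm ?x * \<bar>w t\<bar> - \<bar>?Y\<bar> * nrm (v' t)"]
      by (simp add: power2_eq_square algebra_simps)
    also have "\<dots> \<le> ?R\<^sup>2 * (sp t)\<^sup>2"
      unfolding R2 nrm_sq power2_abs using ge[OF t] b_nonneg[of ?x] by (intro mult_left_mono) auto
    finally have "nrm ?x * nrm (v' t) + \<bar>?Y\<bar> * \<bar>w t\<bar> \<le> ?R * sp t"
      unfolding power_mult_distrib[symmetric]
      by (rule power2_le_imp_le) (use R0 sp_nonneg[OF t] in simp)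
    moreover have "?Y * w t \<le> \<bar>?Y\<bar> * \<bar>w t\<bar>" by (metis abs_ge_self abs_mult)
    ultimately show "b ?x (v' t) + ?Y * w t \<le> ?R * sp t" using b_le_nrm[of ?x "v' t"] by linarith
  qed
  then have "?R * ?R \<le> ?R * integral {p..z} sp" using R2 by (simp add: power2_eq_square)
  then show "?R \<le> integral {p..z} sp"
  proof (cases "?R = 0")
    case True
    then show ?thesis using sp_integral_nonneg[OF pz(1,3)] by linarith
  next
    case False
    then have "0 < ?R" using R0 by linarith
    with \<open>?R * ?R \<le> ?R * integral {p..z} sp\<close> show ?thesis by (rule mult_left_le_imp_le)
  qed
qed

lemma nrm_chord:
  assumes "0 \<le> p" "p \<le> z" "z \<le> 1" shows "nrm (v z - v p) \<le> integral {p..z} sp"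
proof -
  have "b (v' t) (v' t) + ((\<lambda>_. 0) t)\<^sup>2 \<le> (sp t)\<^sup>2" if "t \<in> {0..1}" for t :: real
    using power_mono[OF sp_ge[OF that] nrm_nonneg, of 2] by (simp add: nrm_sq)
  from minkowski[OF assms integrable_0 this] show ?thesis by (simp add: nrm_def)
qed

text \<open>The detour through the apex over the midpoint of \<open>v p\<close> and \<open>v z\<close> is no longer than the path
  itself: the component \<open>w\<close> of the speed transverse to \<open>v\<close> pays for it.\<close>

lemma apex_detour:
  assumes pz: "0 \<le> p" "p \<le> z" "z \<le> 1" and w: "w integrable_on {0..1}"
    and ge: "\<And>t. t \<in> {0..1} \<Longrightarrow> b (v' t) (v' t) + (w t)\<^sup>2 \<le> (sp t)\<^sup>2"
    and a: "linear a" "a u = 1" "nrm u \<le> \<kappa>"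
    and h: "h - a (v p) \<le> r" "h - a (v z) \<le> r" "0 \<le> r" and big: "2 * \<kappa> * r \<le> integral {p..z} w"
  shows "\<exists>q. h \<le> a q \<and> nrm (q - v p) + nrm (v z - q) \<le> integral {p..z} sp"
proof (intro exI conjI)
  let ?x = "(1/2) *\<^sub>R (v z - v p)" and ?q = "(1/2) *\<^sub>R (v p + v z) + r *\<^sub>R u"
  have "a ?q = (a (v p) + a (v z)) / 2 + r" using a by (simp add: linear_add[OF a(1)] linear_scale[OF a(1)])
  moreover have "2 * h \<le> a (v p) + a (v z) + 2 * r" using h by linarith
  ultimately show "h \<le> a ?q" by (simp only: field_simps)
  have q: "?q - v p = ?x + r *\<^sub>R u" "v z - ?q = ?x - r *\<^sub>R u"
    by (rule euclidean_eqI; simp add: inner_add_left inner_diff_left field_simps)+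
  have k: "0 \<le> \<kappa>" using a(3) nrm_nonneg order_trans by blast
  have "nrm (?q - v p) + nrm (v z - ?q) \<le> 2 * sqrt (b ?x ?x + b (r *\<^sub>R u) (r *\<^sub>R u))"
    unfolding q by (rule nrm_apex)
  also have "\<dots> = sqrt (b (v z - v p) (v z - v p) + (2 * nrm u * r)\<^sup>2)"
  proof -
    have "4 * (b ?x ?x + b (r *\<^sub>R u) (r *\<^sub>R u)) = b (v z - v p) (v z - v p) + (2 * nrm u * r)\<^sup>2"
      by (simp add: bilinear_lmul[OF b_bilinear] bilinear_rmul[OF b_bilinear] power_mult_distrib nrm_sq[symmetric, of u] power2_eq_square)
    then show ?thesis using real_sqrt_mult[of 4 "b ?x ?x + b (r *\<^sub>R u) (r *\<^sub>R u)"] by simp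
  qed
  also have "\<dots> \<le> sqrt (b (v z - v p) (v z - v p) + (integral {p..z} w)\<^sup>2)"
  proof -
    have "2 * nrm u * r \<le> 2 * \<kappa> * r" using a(3) h(3) by (simp add: mult_right_mono)
    then have "2 * nrm u * r \<le> integral {p..z} w" using big by simp
    then have "(2 * nrm u * r)\<^sup>2 \<le> (integral {p..z} w)\<^sup>2"
      by (intro power_mono) (use h(3) nrm_nonneg[of u] in auto)
    then show ?thesis by simp
  qed
  also have "\<dots> \<le> integral {p..z} sp" by (rule minkowski[OF pz w ge])
  finally show "nrm (?q - v p) + nrm (v z - ?q) \<le> integral {p..z} sp" .
qed

lemma detour_extend:
  assumes "0 \<le> p" "p \<le> p'" "p' \<le> z'" "z' \<le> z" "z \<le> 1"
    and "nrm (q - v p') + nrm (v z' - q) \<le> integral {p'..z'} sp + K"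
  shows "nrm (q - v p) + nrm (v z - q) \<le> integral {p..z} sp + K"
proof -
  have "integral {p..z} sp = integral {p..p'} sp + integral {p'..z} sp"
    by (rule Henstock_Kurzweil_Integration.integral_combine[symmetric]) (use assms sp_int_sub in auto)
  moreover have "integral {p'..z} sp = integral {p'..z'} sp + integral {z'..z} sp"
    by (rule Henstock_Kurzweil_Integration.integral_combine[symmetric]) (use assms sp_int_sub in auto)
  moreover have "nrm (v p' - v p) \<le> integral {p..p'} sp" "nrm (v z - v z') \<le> integral {z'..z} sp"
    by (rule nrm_chord; use assms in linarith)+
  ultimately show ?thesis
    using nrm_triangle3[of q "v p" "v p'"] nrm_triangle3[of "v z" q "v z'"] assms(6) by linarith
qed

end

text \<open>The expression is the bound on the mass that arises in \<open>segment_detour\<close>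
  when the depth never falls below \<open>r\<close>. The threshold follows from
  \<open>exp (- (r / 4)) \<le> 4 / r\<close>.\<close>

lemma exp_threshold:
  fixes \<kappa> c :: real assumes "c > 0" "\<kappa> \<ge> 0"
  shows "\<exists>C\<ge>0. \<forall>r\<ge>C. 8 * \<kappa> * (exp (- (r / 4)) / (1 - exp (- (1/4)))) < c"
proof -
  let ?e = "1 - exp (- (1/4)) :: real"
  have e: "?e > 0" by simp
  let ?C = "32 * \<kappa> / (?e * c) + 1"
  have C: "?C > 0" using e assms by (intro add_nonneg_pos) auto
  have "8 * \<kappa> * (exp (- (r / 4)) / ?e) < c" if r: "r \<ge> ?C" for r
  proof -
    have r0: "r > 0" using r C by linarith
    have "exp (- (r / 4)) \<le> 4 / r"
      using exp_ge_add_one_self[of "r / 4"] r0 by (simp add: exp_minus field_simps)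
    then have "8 * \<kappa> * (exp (- (r / 4)) / ?e) \<le> 8 * \<kappa> * ((4 / r) / ?e)"
      using assms e by (intro mult_left_mono divide_right_mono) auto
    also have "\<dots> < c"
    proof -
      have "32 * \<kappa> / (?e * c) < r" using r by simp
      then have "32 * \<kappa> < r * (?e * c)" using e assms by (simp add: pos_divide_less_eq)
      then show ?thesis using r0 e by (simp add: divide_simps mult_ac)
    qed
    finally show ?thesis .
  qed
  then show ?thesis using C by (intro exI[of _ ?C]) auto
qed

context speed_path
begin

text \<open>Write depth for \<open>h - a (v t)\<close>. If the depth reaches \<open>C\<close> or
  less, a trip from the shallowest point to the half-space and back costs at most
  \<open>2 * \<kappa> * C\<close>. Otherwise some pair of times of depth at most \<open>r\<close>
  must enclose transverse motion of at least \<open>2 * \<kappa> * r\<close>, and the apex over the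
  chord costs nothing: if there were no such pair, summing over layers of depth would bound the
  weighted mass by less than \<open>c\<close>.\<close>

lemma segment_detour:
  assumes pz: "0 \<le> p" "p \<le> z" "z \<le> 1" and w: "w integrable_on {0..1}" "\<And>t. t \<in> {0..1} \<Longrightarrow> 0 \<le> w t"
    and ge: "\<And>t. t \<in> {0..1} \<Longrightarrow> b (v' t) (v' t) + (w t)\<^sup>2 \<le> (sp t)\<^sup>2"
    and a: "linear a" "a u = 1" "nrm u \<le> \<kappa>"
    and below: "\<And>t. t \<in> {0..1} \<Longrightarrow> a (v t) < h"
    and e: "(\<lambda>t. exp (- ((h - a (v t)) / 2)) * w t) integrable_on {0..1}"
      "c \<le> integral {p..z} (\<lambda>t. exp (- ((h - a (v t)) / 2)) * w t)"
    and C: "0 \<le> C" "\<And>r. r \<ge> C \<Longrightarrow> 8 * \<kappa> * (exp (- (r / 4)) / (1 - exp (- (1/4)))) < c"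
  shows "\<exists>q. h \<le> a q \<and> nrm (q - v p) + nrm (v z - q) \<le> integral {p..z} sp + 2 * \<kappa> * C"
proof -
  have k: "0 \<le> \<kappa>" using a(3) nrm_nonneg order_trans by blast
  let ?d = "\<lambda>t. h - a (v t)"
  have bl: "bounded_linear a" using a(1) linear_conv_bounded_linear by blast
  have cd: "continuous_on {p..z} ?d"
    by (intro continuous_intros bounded_linear.continuous_on[OF bl] continuous_on_subset[OF v_cont]) (use pz in auto)
  obtain t0 where t0: "t0 \<in> {p..z}" "\<And>t. t \<in> {p..z} \<Longrightarrow> ?d t0 \<le> ?d t"
    using continuous_attains_inf[OF compact_Icc _ cd] pz(2) by auto
  obtain t1 where t1: "t1 \<in> {p..z}" "\<And>t. t \<in> {p..z} \<Longrightarrow> ?d t \<le> ?d t1"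
    using continuous_attains_sup[OF compact_Icc _ cd] pz(2) by auto
  let ?rmin = "?d t0"
  have r0: "0 < ?rmin" using below[of t0] t0 pz by auto
  show ?thesis
  proof (cases "?rmin \<le> C")
    case True
    let ?q = "v t0 + ?rmin *\<^sub>R u"
    have "nrm (?q - v t0) + nrm (v t0 - ?q) \<le> integral {t0..t0} sp + 2 * \<kappa> * C"
    proof -
      have "?rmin * nrm u \<le> C * \<kappa>" using True r0 a(3) C(1) nrm_nonneg by (intro mult_mono) auto
      then show ?thesis using r0 nrm_scale[of ?rmin u] nrm_minus[of "?rmin *\<^sub>R u"] by (simp add: mult_ac)
    qed
    from detour_extend[OF pz(1) _ order_refl _ pz(3) this] t0
    have "nrm (?q - v p) + nrm (v z - ?q) \<le> integral {p..z} sp + 2 * \<kappa> * C" by auto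
    moreover have "h \<le> a ?q" using a by (simp add: linear_add[OF a(1)] linear_scale[OF a(1)])
    ultimately show ?thesis by blast
  next
    case False
    have "\<exists>r p' z'. p \<le> p' \<and> p' \<le> z' \<and> z' \<le> z \<and> ?d p' \<le> r \<and> ?d z' \<le> r \<and> 2 * \<kappa> * r \<le> integral {p'..z'} w"
    proof (rule ccontr)
      assume none: "\<not> ?thesis"
      let ?r = "\<lambda>j::nat. ?rmin + real j + 1"
      \<comment> \<open>Being at depth at most \<open>?r j\<close> need not define an interval of
        times; \<open>P j\<close> and \<open>Z j\<close> below are the first and last such time, so
        the window between them covers \<open>E j\<close>.\<close>
      define E where "E j = {t \<in> {p..z}. ?d t \<le> ?r j}" for j
      have "\<exists>p' z'. p' \<in> E j \<and> z' \<in> E j \<and> (\<forall>t\<in>E j. p' \<le> t \<and> t \<le> z')" for j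
      proof -
        have "closed ({p..z} \<inter> ?d -` {..?r j})"
          by (rule continuous_closed_preimage[OF cd]) auto
        moreover have "{p..z} \<inter> ?d -` {..?r j} = E j" by (auto simp: E_def)
        ultimately have "closed (E j)" by simp
        moreover have "bounded (E j)" by (rule bounded_subset[of "{p..z}"]) (auto simp: E_def)
        ultimately have "compact (E j)" by (simp add: compact_eq_bounded_closed)
        moreover have "E j \<noteq> {}" using t0(1) by (auto simp: E_def)
        ultimately show ?thesis using compact_attains_inf[of "E j"] compact_attains_sup[of "E j"] by meson
      qed
      then obtain P Z where PE: "\<And>j. P j \<in> E j" "\<And>j. Z j \<in> E j" "\<And>j t. t \<in> E j \<Longrightarrow> P j \<le> t \<and> t \<le> Z j"
        by metis
      have PZ: "p \<le> P j \<and> P j \<le> Z j \<and> Z j \<le> z \<and> ?d (P j) \<le> ?r j \<and> ?d (Z j) \<le> ?r j" for j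
        using PE(1)[of j] PE(2)[of j] PE(3)[OF PE(1), of j] unfolding E_def by auto
      have small: "integral {P j..Z j} w < 2 * \<kappa> * ?r j" for j
      proof (rule ccontr)
        assume "\<not> ?thesis"
        then have "2 * \<kappa> * ?r j \<le> integral {P j..Z j} w" by simp
        with none PZ[of j] show False by blast
      qed
      \<comment> \<open>The depth is bounded on \<open>{p..z}\<close>, hence finitely many layers
        suffice.\<close>
      obtain J where J: "?d t1 - ?rmin < real J" using reals_Archimedean2 by blast
      have wI: "w integrable_on {P j..Z j}" for j
        by (rule integrable_subinterval_real[OF w(1)]) (use PZ[of j] pz in auto)
      have wR: "((\<lambda>t. if t \<in> {P j..Z j} then w t else 0) has_integral integral {P j..Z j} w) {p..z}" for j
        using has_integral_restrict[of "{P j..Z j}" "{p..z}" w] integrable_integral[OF wI[of j]] PZ[of j] by auto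
      have "c \<le> integral {p..z} (\<lambda>t. exp (- (?d t / 2)) * w t)" by (rule e(2))
      also have "\<dots> \<le> (\<Sum>j<J. exp (- ((?rmin + real j) / 2)) * integral {P j..Z j} w)"
      proof (rule has_integral_le[OF integrable_integral])
        show "(\<lambda>t. exp (- (?d t / 2)) * w t) integrable_on {p..z}"
          by (rule integrable_subinterval_real[OF e(1)]) (use pz in auto)
        show "((\<lambda>t. \<Sum>j<J. exp (- ((?rmin + real j) / 2)) * (if t \<in> {P j..Z j} then w t else 0)) has_integral
            (\<Sum>j<J. exp (- ((?rmin + real j) / 2)) * integral {P j..Z j} w)) {p..z}"
          by (intro has_integral_sum has_integral_mult_right wR) simp
        fix t assume t: "t \<in> {p..z}"
        \<comment> \<open>The unit layer of depth containing \<open>t\<close>: its lower edge bounds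
          the exponential weight, its upper edge \<open>?r j\<close> puts \<open>t\<close> into the
          window of \<open>j\<close>.\<close>
        define j where "j = nat \<lfloor>?d t - ?rmin\<rfloor>"
        have j: "real j \<le> ?d t - ?rmin" "?d t - ?rmin < real j + 1"
          using t0(2)[OF t] unfolding j_def by linarith+
        have jJ: "j < J" using j(1) t1(2)[OF t] J by linarith
        have tj: "t \<in> {P j..Z j}" using PE(3)[of t j] t j(2) by (auto simp: E_def)
        have w0: "0 \<le> w t" using w(2)[of t] t pz by auto
        have "exp (- (?d t / 2)) * w t \<le> exp (- ((?rmin + real j) / 2)) * (if t \<in> {P j..Z j} then w t else 0)"
          using tj w0 j(1) by (auto intro!: mult_right_mono)
        also have "\<dots> \<le> (\<Sum>j<J. exp (- ((?rmin + real j) / 2)) * (if t \<in> {P j..Z j} then w t else 0))"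
          by (rule member_le_sum) (use jJ w0 in auto)
        finally show "exp (- (?d t / 2)) * w t \<le> \<dots>" .
      qed
      also have "\<dots> \<le> (\<Sum>j<J. 8 * \<kappa> * (exp (- (?rmin / 4)) * exp (- (1/4)) ^ j))"
      proof (rule sum_mono)
        fix j
        let ?y = "?rmin + real j"
        have y: "0 \<le> ?y" using r0 by simp
        \<comment> \<open>Half of the exponent pays for the linear growth of the windows, whence the
          factor 8 = 2 * 4; the other half leaves a geometric series with ratio
          \<open>exp (- (1/4))\<close>.\<close>
        have gen: "x + 1 \<le> 4 * exp (x / 4)" if "0 \<le> x" for x :: real
          using exp_ge_add_one_self[of "x / 4"] that by linarith
        have "?y + 1 \<le> 4 * exp (?y / 4)" by (rule gen[OF y])
        then have "exp (- (?y / 2)) * (2 * \<kappa> * (?y + 1)) \<le> exp (- (?y / 2)) * (2 * \<kappa> * (4 * exp (?y / 4)))"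
          using k by (intro mult_left_mono) auto
        also have "\<dots> = 8 * \<kappa> * (exp (- (?y / 2)) * exp (?y / 4))" by simp
        also have "exp (- (?y / 2)) * exp (?y / 4) = exp (- (?rmin / 4)) * exp (- (1/4)) ^ j"
        proof -
          have "exp (- (?y / 2)) * exp (?y / 4) = exp (- (?rmin / 4) + real j * (- (1/4)))"
            unfolding exp_add[symmetric] by (rule arg_cong[of _ _ exp]) (simp add: field_simps)
          then show ?thesis by (simp only: exp_add exp_of_nat_mult)
        qed
        finally have "exp (- (?y / 2)) * (2 * \<kappa> * (?y + 1)) \<le> 8 * \<kappa> * (exp (- (?rmin / 4)) * exp (- (1/4)) ^ j)" .
        moreover have "exp (- (?y / 2)) * integral {P j..Z j} w \<le> exp (- (?y / 2)) * (2 * \<kappa> * (?y + 1))"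
          using small[of j] by (intro mult_left_mono) auto
        ultimately show "exp (- (?y / 2)) * integral {P j..Z j} w \<le> 8 * \<kappa> * (exp (- (?rmin / 4)) * exp (- (1/4)) ^ j)"
          by linarith
      qed
      also have "\<dots> = 8 * \<kappa> * (exp (- (?rmin / 4)) * (\<Sum>j<J. exp (- (1/4)) ^ j))"
        by (simp add: sum_distrib_left)
      also have "\<dots> \<le> 8 * \<kappa> * (exp (- (?rmin / 4)) * (1 / (1 - exp (- (1/4)))))"
      proof -
        have "(\<Sum>j<J. exp (- (1/4) :: real) ^ j) \<le> 1 / (1 - exp (- (1/4)))"
          using sum_le_suminf[OF summable_geometric[of "exp (- (1/4)) :: real"], of "{..<J}"]
            suminf_geometric[of "exp (- (1/4)) :: real"] by simp
        then show ?thesis using k by (intro mult_left_mono) auto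
      qed
      also have "\<dots> < c" using C(2)[of ?rmin] False by simp
      finally show False by simp
    qed
    then obtain r p' z' where r: "p \<le> p'" "p' \<le> z'" "z' \<le> z" "?d p' \<le> r" "?d z' \<le> r"
      "2 * \<kappa> * r \<le> integral {p'..z'} w" by blast
    have r': "0 \<le> r" using r t0(2)[of p'] r0 by auto
    obtain q where q: "h \<le> a q" "nrm (q - v p') + nrm (v z' - q) \<le> integral {p'..z'} sp"
      using apex_detour[OF _ r(2) _ w(1) ge a r(4,5) r' r(6)] r pz by auto
    have "0 \<le> 2 * \<kappa> * C" using k C(1) by simp
    then have "nrm (q - v p') + nrm (v z' - q) \<le> integral {p'..z'} sp + 2 * \<kappa> * C" using q(2) by linarith
    from detour_extend[OF pz(1) r(1-3) pz(3) this] q(1) show ?thesis by blast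
  qed
qed

text \<open>\<open>T i\<close> is the time of a visit of \<open>P i\<close>; for the other indices, every interval carrying mass at least
  \<open>c\<close> of the density \<open>e i\<close> admits a cheap detour. Serving at each step the index whose visit or
  mass \<open>c\<close> is completed first yields consecutive, hence disjoint, intervals.\<close>

lemma greedy_polygon:
  assumes "finite R" "0 \<le> \<tau>" "\<tau> \<le> 1" and c: "0 < c" and K: "0 \<le> K"
    and visit: "\<And>i. i \<in> R \<Longrightarrow> i \<in> Vis \<Longrightarrow> \<tau> \<le> T i \<and> T i \<le> 1 \<and> P i (v (T i))"
    and mass: "\<And>i. i \<in> R \<Longrightarrow> i \<notin> Vis \<Longrightarrow> e i integrable_on {0..1} \<and> real (card R) * c \<le> integral {\<tau>..1} (e i)"
    and nonneg: "\<And>i t. i \<in> R \<Longrightarrow> i \<notin> Vis \<Longrightarrow> t \<in> {0..1} \<Longrightarrow> 0 \<le> e i t"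
    and detour: "\<And>i p z. i \<in> R \<Longrightarrow> i \<notin> Vis \<Longrightarrow> 0 \<le> p \<Longrightarrow> p \<le> z \<Longrightarrow> z \<le> 1 \<Longrightarrow> c \<le> integral {p..z} (e i) \<Longrightarrow>
      \<exists>q. P i q \<and> nrm (q - v p) + nrm (v z - q) \<le> integral {p..z} sp + K"
  shows "\<exists>ls q. distinct ls \<and> set ls = R \<and> (\<forall>i\<in>R. P i (q i)) \<and>
    plen (v \<tau>) (map q ls) (v 1) \<le> integral {\<tau>..1} sp + real (card R) * K"
  using assms(1-3) visit mass nonneg detour
proof (induction "card R" arbitrary: R \<tau>)
  case 0
  then have "R = {}" by simp
  then show ?case using nrm_chord[of \<tau> 1] 0 by (intro exI[of _ "[]"]) simp
next
  case (Suc m)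
  note prem = Suc.prems
  have ei: "e i integrable_on {p..z}" if "i \<in> R" "i \<notin> Vis" "0 \<le> p" "z \<le> 1" for i p z
    using prem(5)[OF that(1,2)] integrable_subinterval_real[of "e i" 0 1 p z] that by auto
  have ex: "\<exists>t. \<tau> \<le> t \<and> t \<le> 1 \<and> (if i \<in> Vis then t = T i else integral {\<tau>..t} (e i) = c)" if i: "i \<in> R" for i
  proof (cases "i \<in> Vis")
    case True
    then show ?thesis using prem(4)[OF i] by auto
  next
    case False
    have "c \<le> real (card R) * c" using Suc.hyps(2) c by (simp flip: Suc.hyps(2))
    then have "c \<le> integral {\<tau>..1} (e i)" using prem(5)[OF i False] by simp
    then have "\<exists>t\<ge>\<tau>. t \<le> 1 \<and> integral {\<tau>..t} (e i) = c"
      using c prem(2,3) indefinite_integral_continuous_1[OF ei[OF i False prem(2) order_refl]]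
      by (intro IVT') auto
    then show ?thesis using False by auto
  qed
  then obtain S where S: "\<And>i. i \<in> R \<Longrightarrow> \<tau> \<le> S i \<and> S i \<le> 1 \<and> (if i \<in> Vis then S i = T i else integral {\<tau>..S i} (e i) = c)"
    by metis
  have Rne: "R \<noteq> {}" using Suc.hyps(2) by auto
  obtain i where i: "i \<in> R" "\<And>j. j \<in> R \<Longrightarrow> S i \<le> S j"
    using ex_is_arg_min_if_finite[OF prem(1) Rne, of S] unfolding is_arg_min_def by (metis not_le)
  let ?R = "R - {i}" and ?t = "S i"
  have t: "\<tau> \<le> ?t" "?t \<le> 1" "0 \<le> ?t" using S[OF i(1)] prem(2) by auto
  have card: "card ?R = m" using Suc.hyps(2) i(1) prem(1) by simp
  obtain q0 where q0: "P i q0" "nrm (q0 - v \<tau>) + nrm (v ?t - q0) \<le> integral {\<tau>..?t} sp + K"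
  proof (cases "i \<in> Vis")
    case True
    then have "P i (v ?t)" using S[OF i(1)] prem(4)[OF i(1)] by auto
    then show ?thesis using that[of "v ?t"] nrm_chord[OF prem(2) t(1,2)] K by auto
  next
    case False
    then show ?thesis using that prem(7)[OF i(1) False prem(2) t(1,2)] S[OF i(1)] by auto
  qed
  have "\<exists>ls q. distinct ls \<and> set ls = ?R \<and> (\<forall>i\<in>?R. P i (q i)) \<and>
    plen (v ?t) (map q ls) (v 1) \<le> integral {?t..1} sp + real (card ?R) * K"
  proof (rule Suc.hyps(1))
    show "m = card ?R" using card by simp
    show "finite ?R" using prem(1) by simp
    show "0 \<le> ?t" "?t \<le> 1" using t by auto
    fix j assume j: "j \<in> ?R"
    show "?t \<le> T j \<and> T j \<le> 1 \<and> P j (v (T j))" if "j \<in> Vis"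
      using S[of j] i(2)[of j] prem(4)[of j] j that by auto
    show "0 \<le> e j t" if "j \<notin> Vis" "t \<in> {0..1}" for t using prem(6) j that by auto
    show "\<exists>q. P j q \<and> nrm (q - v p) + nrm (v z - q) \<le> integral {p..z} sp + K"
      if "j \<notin> Vis" "0 \<le> p" "p \<le> z" "z \<le> 1" "c \<le> integral {p..z} (e j)" for p z
      using prem(7) j that by auto
    show "e j integrable_on {0..1} \<and> real (card ?R) * c \<le> integral {?t..1} (e j)" if jV: "j \<notin> Vis"
    proof
      have jR: "j \<in> R" using j by simp
      show "e j integrable_on {0..1}" using prem(5)[OF jR jV] by simp
      \<comment> \<open>Index \<open>j\<close> would complete its portion no earlier than
        \<open>?t\<close>, so at most one portion \<open>c\<close> of its mass is lost, matching the
        loss of one index in \<open>card R\<close>.\<close>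
      have "integral {\<tau>..?t} (e j) \<le> integral {\<tau>..S j} (e j)"
        by (rule integral_subset_le) (use i(2)[OF jR] ei[OF jR jV prem(2)] S[OF jR] t prem(2) prem(6)[OF jR jV] in auto)
      also have "\<dots> = c" using S[OF jR] jV by simp
      finally have "integral {\<tau>..?t} (e j) \<le> c" .
      moreover have "integral {\<tau>..?t} (e j) + integral {?t..1} (e j) = integral {\<tau>..1} (e j)"
        by (rule Henstock_Kurzweil_Integration.integral_combine[OF t(1,2) ei[OF jR jV prem(2) order_refl]])
      moreover have "real (card R) * c = real (card ?R) * c + c" unfolding card Suc.hyps(2)[symmetric] by (simp add: algebra_simps)
      ultimately show "real (card ?R) * c \<le> integral {?t..1} (e j)" using prem(5)[OF jR jV] by linarith
    qed
  qed
  then obtain ls q where ls: "distinct ls" "set ls = ?R" "\<And>j. j \<in> ?R \<Longrightarrow> P j (q j)"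
    "plen (v ?t) (map q ls) (v 1) \<le> integral {?t..1} sp + real (card ?R) * K" by blast
  let ?q = "q(i := q0)"
  have mq: "map ?q ls = map q ls" using ls(2) by (intro map_cong) auto
  have "plen (v \<tau>) (map ?q (i # ls)) (v 1) = nrm (q0 - v \<tau>) + plen q0 (map q ls) (v 1)"
    unfolding list.map plen.simps mq by simp
  also have "\<dots> \<le> nrm (q0 - v \<tau>) + (nrm (v ?t - q0) + plen (v ?t) (map q ls) (v 1))"
    using plen_triangle by simp
  also have "\<dots> \<le> integral {\<tau>..?t} sp + K + (integral {?t..1} sp + real (card ?R) * K)"
    using q0(2) ls(4) by linarith
  also have "\<dots> = integral {\<tau>..1} sp + real (card R) * K"
    using Henstock_Kurzweil_Integration.integral_combine[OF t(1,2) sp_int_sub[OF prem(2) order_refl]]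
    unfolding card Suc.hyps(2)[symmetric] by (simp add: algebra_simps)
  finally show ?case
    using ls i(1) q0(1) by (intro exI[of _ "i # ls"] exI[of _ ?q]) auto
qed

end

text \<open>Speeds are controlled off the breakpoints only, where they may jump; measurability and a
  constant bound suffice, since a finite set is negligible.\<close>

lemma bounded_continuous_integrable:
  fixes f :: "real \<Rightarrow> real"
  assumes F: "finite F" and f: "continuous_on ({a..b} - F) f" "bounded (f ` ({a..b} - F))"
  shows "f integrable_on {a..b}"
proof -
  let ?S = "{a..b} - F"
  obtain B where B: "\<And>t. t \<in> ?S \<Longrightarrow> norm (f t) \<le> B" using f(2) unfolding bounded_iff by blast
  have S: "?S \<in> lmeasurable"
    by (rule fmeasurable_Diff) (use F in \<open>auto intro: negligible_imp_sets negligible_finite\<close>)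
  have "f integrable_on ?S"
    by (rule measurable_bounded_by_integrable_imp_integrable[OF continuous_imp_measurable_on_sets_lebesgue[OF f(1)]
          integrable_on_const[OF S, of B]]) (use S B in \<open>auto intro: fmeasurableD\<close>)
  then show ?thesis
    by (rule integrable_spike_set) (use F in \<open>auto intro!: negligible_finite elim: finite_subset[rotated]\<close>)
qed

section \<open>Semidirect decompositions\<close>

context lie_group_atlas
begin

text \<open>\<open>fam_prod\<close> for an arbitrary list of indices, because a box path moves along
  the factors in an order dictated by the path it replaces.\<close>

definition lprod :: "(nat \<Rightarrow> 'g) \<Rightarrow> nat list \<Rightarrow> 'g" where
  "lprod h is = foldr (\<lambda>i x. h i \<otimes> x) is \<one>"

lemma lprod_simps [simp]: "lprod h [] = \<one>" "lprod h (i # is) = h i \<otimes> lprod h is"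
  by (simp_all add: lprod_def)

lemma lprod_cong: "(\<And>i. i \<in> set is \<Longrightarrow> h i = h' i) \<Longrightarrow> lprod h is = lprod h' is"
  by (induction "is") auto

lemma lprod_conj: "x \<otimes> lprod h is \<otimes> inv x = lprod (\<lambda>i. x \<otimes> h i \<otimes> inv x) is"
proof (induction "is")
  case (Cons i "is")
  have "x \<otimes> lprod h (i # is) \<otimes> inv x = (x \<otimes> h i \<otimes> inv x) \<otimes> (x \<otimes> lprod h is \<otimes> inv x)" by (simp add: grp)
  then show ?case using Cons by simp
qed simp

lemma lprod_one: "lprod (\<lambda>i. \<one>) is = \<one>"
  by (induction "is") auto

lemma lprod_single: "distinct is \<Longrightarrow> i \<in> set is \<Longrightarrow> lprod (\<lambda>j. if j = i then x else \<one>) is = x"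
proof (induction "is")
  case (Cons k "is")
  have "i \<notin> set is \<Longrightarrow> lprod (\<lambda>j. if j = i then x else \<one>) is = lprod (\<lambda>i. \<one>) is"
    by (rule lprod_cong) auto
  then show ?case using Cons by (cases "k = i") (auto simp: lprod_one)
qed simp

end

text \<open>What concerns the factors alone, kept apart because two splittings over the same factors
  will be in use at once.\<close>

locale factor_family = lie_group_atlas G A
  for G :: "'g::{t2_space, second_countable_topology} monoid" (structure) and A :: "('g, 'e::euclidean_space) atlas" +
  fixes n :: nat and N :: "nat \<Rightarrow> 'g set"
  assumes N_subgroup: "i < n \<Longrightarrow> subgroup (N i) G"
    and N_commute: "i < n \<Longrightarrow> j < n \<Longrightarrow> i \<noteq> j \<Longrightarrow> x \<in> N i \<Longrightarrow> y \<in> N j \<Longrightarrow> x \<otimes> y = y \<otimes> x"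
begin

lemma fam_prod_lprod: "fam_prod G n h = lprod h [0..<n]"
  by (simp add: fam_prod_def lprod_def)

lemma N_mult: "i < n \<Longrightarrow> x \<in> N i \<Longrightarrow> y \<in> N i \<Longrightarrow> x \<otimes> y \<in> N i"
  and N_inv: "i < n \<Longrightarrow> x \<in> N i \<Longrightarrow> inv x \<in> N i" and N_one: "i < n \<Longrightarrow> \<one> \<in> N i"
  using N_subgroup subgroup.m_closed subgroup.m_inv_closed subgroup.one_closed by metis+

lemma lprod_commute:
  assumes "i < n" "x \<in> N i" "set is \<subseteq> {..<n}" "i \<notin> set is" "\<And>j. j < n \<Longrightarrow> h j \<in> N j"
  shows "x \<otimes> lprod h is = lprod h is \<otimes> x"
  using assms(3,4)
proof (induction "is")
  case (Cons j "is")
  have c: "x \<otimes> h j = h j \<otimes> x" using N_commute[OF assms(1) _ _ assms(2) assms(5), of j] Cons.prems by auto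
  have "x \<otimes> lprod h (j # is) = (x \<otimes> h j) \<otimes> lprod h is" by (simp add: grp)
  also have "\<dots> = h j \<otimes> (x \<otimes> lprod h is)" unfolding c by (simp add: grp)
  also have "\<dots> = lprod h (j # is) \<otimes> x" using Cons by (simp add: grp)
  finally show ?case .
qed simp

lemma lprod_mult:
  assumes "distinct is" "set is \<subseteq> {..<n}" "\<And>j. j < n \<Longrightarrow> h j \<in> N j" "\<And>j. j < n \<Longrightarrow> h' j \<in> N j"
  shows "lprod (\<lambda>i. h i \<otimes> h' i) is = lprod h is \<otimes> lprod h' is"
  using assms(1,2)
proof (induction "is")
  case (Cons j "is")
  have c: "h' j \<otimes> lprod h is = lprod h is \<otimes> h' j"
    by (rule lprod_commute) (use Cons.prems assms in auto)
  have "lprod (\<lambda>i. h i \<otimes> h' i) (j # is) = h j \<otimes> ((h' j \<otimes> lprod h is) \<otimes> lprod h' is)"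
    using Cons by (simp add: grp)
  also have "\<dots> = lprod h (j # is) \<otimes> lprod h' (j # is)" unfolding c by (simp add: grp)
  finally show ?case .
qed simp

lemma lprod_conj_N:
  assumes "i < n" "x \<in> N i" "set is \<subseteq> {..<n}" "\<And>j. j < n \<Longrightarrow> h j \<in> N j"
  shows "lprod h is \<otimes> x \<otimes> inv (lprod h is) \<in> N i"
  using assms(3)
proof (induction "is")
  case (Cons j "is")
  let ?y = "lprod h is \<otimes> x \<otimes> inv (lprod h is)"
  have y: "?y \<in> N i" using Cons by simp
  have "h j \<otimes> ?y \<otimes> inv (h j) \<in> N i"
  proof (cases "j = i")
    case True
    then show ?thesis using y assms(1,4) by (simp add: N_mult N_inv)
  next
    case False
    then have c: "h j \<otimes> ?y = ?y \<otimes> h j" using N_commute[of j i "h j" ?y] y assms(1,4) Cons.prems by simp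
    show ?thesis unfolding c using y by (simp add: grp)
  qed
  then show ?case by (simp add: grp)
qed (use assms in simp)

end

locale semidirect = factor_family G A n N
  for G :: "'g::{t2_space, second_countable_topology} monoid" (structure) and A :: "('g, 'e::euclidean_space) atlas"
    and n :: nat and N :: "nat \<Rightarrow> 'g set" +
  fixes \<sigma> :: "'v::euclidean_space \<Rightarrow> 'g"
  assumes decomposition: "semidirect_decomposition G A n N \<sigma>"
begin

abbreviation "p \<equiv> nil_coord G n N \<sigma>"
abbreviation "q \<equiv> quot_map G n N \<sigma>"

lemma \<sigma>_smooth: "smooth_map_on euclid_atlas A UNIV \<sigma>" and \<sigma>_add: "\<sigma> (v + w) = \<sigma> v \<otimes> \<sigma> w"
  and \<sigma>_normal: "i < n \<Longrightarrow> x \<in> N i \<Longrightarrow> \<sigma> v \<otimes> x \<otimes> inv (\<sigma> v) \<in> N i"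
  and coords_ex1: "\<exists>!c. has_coords G n N \<sigma> z (fst c) (snd c)"
  and p_smooth: "i < n \<Longrightarrow> smooth_map_on A A UNIV (\<lambda>z. p z i)"
  and q_smooth: "smooth_map_on A euclid_atlas UNIV q"
  using decomposition unfolding semidirect_decomposition_def vector_group_hom_def by auto

lemma \<sigma>_0: "\<sigma> 0 = \<one>"
  using \<sigma>_add[of 0 0] l_cancel_one by simp

lemma \<sigma>_minus: "\<sigma> (- v) = inv (\<sigma> v)"
  using \<sigma>_add[of "- v" v] inv_equality[of "\<sigma> (- v)" "\<sigma> v"] by (simp add: \<sigma>_0)

lemma coords: "has_coords G n N \<sigma> z (p z) (q z)"
  and coords_unique: "has_coords G n N \<sigma> z h v \<Longrightarrow> p z = h \<and> q z = v"
proof -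
  obtain c0 where c0: "has_coords G n N \<sigma> z (fst c0) (snd c0)"
    "\<And>c. has_coords G n N \<sigma> z (fst c) (snd c) \<Longrightarrow> c = c0"
    using coords_ex1[of z] by (elim ex1E) metis
  define h0 v0 where "h0 = fst c0" and "v0 = snd c0"
  have c: "has_coords G n N \<sigma> z h0 v0" "has_coords G n N \<sigma> z h v \<Longrightarrow> h = h0 \<and> v = v0" for h v
    using c0(1) c0(2)[of "(h, v)"] by (auto simp: h0_def v0_def)
  have ph: "p z = h0" unfolding nil_coord_def by (rule the_equality) (use c in blast)+
  have qv: "q z = v0" unfolding quot_map_def by (rule the_equality) (use c in blast)+
  show "has_coords G n N \<sigma> z (p z) (q z)" unfolding ph qv by (rule c(1))
  show "has_coords G n N \<sigma> z h v \<Longrightarrow> p z = h \<and> q z = v" unfolding ph qv using c(2) by blast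
qed

lemma p_in: "i < n \<Longrightarrow> p z i \<in> N i"
  using coords[of z] by (auto simp: has_coords_def PiE_iff)

lemma decompose: "z = lprod (p z) [0..<n] \<otimes> \<sigma> (q z)"
  using coords[of z] by (simp add: has_coords_def fam_prod_lprod)

lemma coords_eqI:
  assumes "\<And>i. i < n \<Longrightarrow> h i \<in> N i" "z = lprod h [0..<n] \<otimes> \<sigma> v"
  shows "q z = v" "i < n \<Longrightarrow> p z i = h i"
proof -
  have "lprod h [0..<n] = lprod (restrict h {..<n}) [0..<n]" by (rule lprod_cong) auto
  then have "has_coords G n N \<sigma> z (restrict h {..<n}) v"
    using assms by (simp add: has_coords_def fam_prod_lprod)
  from coords_unique[OF this] show "q z = v" "i < n \<Longrightarrow> p z i = h i" by auto
qed

lemma p_mult: "i < n \<Longrightarrow> p (x \<otimes> y) i = p x i \<otimes> (\<sigma> (q x) \<otimes> p y i \<otimes> inv (\<sigma> (q x)))"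
  and q_mult: "q (x \<otimes> y) = q x + q y"
proof -
  let ?c = "\<lambda>i. \<sigma> (q x) \<otimes> p y i \<otimes> inv (\<sigma> (q x))"
  have "x \<otimes> y = (lprod (p x) [0..<n] \<otimes> \<sigma> (q x)) \<otimes> (lprod (p y) [0..<n] \<otimes> \<sigma> (q y))"
    using decompose[of x] decompose[of y] by simp
  also have "\<dots> = lprod (p x) [0..<n] \<otimes> (\<sigma> (q x) \<otimes> lprod (p y) [0..<n] \<otimes> inv (\<sigma> (q x))) \<otimes> (\<sigma> (q x) \<otimes> \<sigma> (q y))"
    by (simp add: grp)
  also have "\<dots> = lprod (\<lambda>i. p x i \<otimes> ?c i) [0..<n] \<otimes> \<sigma> (q x + q y)"
    unfolding lprod_conj \<sigma>_add by (subst lprod_mult) (auto simp: p_in \<sigma>_normal)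
  finally have "x \<otimes> y = lprod (\<lambda>i. p x i \<otimes> ?c i) [0..<n] \<otimes> \<sigma> (q x + q y)" .
  from coords_eqI[OF _ this] show "i < n \<Longrightarrow> p (x \<otimes> y) i = p x i \<otimes> ?c i" "q (x \<otimes> y) = q x + q y"
    by (auto simp: p_in \<sigma>_normal N_mult)
qed

lemma p_\<sigma>: "i < n \<Longrightarrow> p (\<sigma> v) i = \<one>" and q_\<sigma>: "q (\<sigma> v) = v"
  by (rule coords_eqI[of "\<lambda>i. \<one>"]; simp add: lprod_one N_one)+

lemma p_one: "i < n \<Longrightarrow> p \<one> i = \<one>" and q_one: "q \<one> = 0"
  using p_\<sigma>[of i 0] q_\<sigma>[of 0] by (simp_all add: \<sigma>_0)

lemma q_inv: "q (inv x) = - q x"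
  using q_mult[of "inv x" x] by (simp add: q_one eq_neg_iff_add_eq_0)

lemma
  assumes "i < n" "x \<in> N i"
  shows q_N: "q x = 0" and p_N: "j < n \<Longrightarrow> p x j = (if j = i then x else \<one>)"
proof -
  have "x = lprod (\<lambda>j. if j = i then x else \<one>) [0..<n] \<otimes> \<sigma> 0"
    using assms(1) by (simp add: lprod_single \<sigma>_0)
  from coords_eqI[OF _ this] assms
  show "q x = 0" "j < n \<Longrightarrow> p x j = (if j = i then x else \<one>)" by (auto simp: N_one)
qed

lemma nil_subgroup_kernel: "nil_subgroup G n N = {z. q z = 0}"
proof (rule Set.set_eqI, rule iffI)
  fix z assume "z \<in> nil_subgroup G n N"
  then obtain h where h: "h \<in> (\<Pi>\<^sub>E i\<in>{..<n}. N i)" "z = lprod h [0..<n]"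
    by (auto simp: nil_subgroup_def fam_prod_lprod)
  then have "z = lprod h [0..<n] \<otimes> \<sigma> 0" by (simp add: \<sigma>_0)
  from coords_eqI(1)[OF _ this] h(1) show "z \<in> {z. q z = 0}" by (auto simp: PiE_iff)
next
  fix z assume "z \<in> {z. q z = 0}"
  then have "z = fam_prod G n (p z)" using decompose[of z] by (simp add: \<sigma>_0 fam_prod_lprod)
  then show "z \<in> nil_subgroup G n N"
    using coords[of z] by (auto simp: nil_subgroup_def has_coords_def)
qed

lemma p_q_eqI:
  assumes "q x = q y" "\<And>i. i < n \<Longrightarrow> p x i = p y i" shows "x = y"
  using decompose[of x] decompose[of y] assms lprod_cong[of "[0..<n]" "p x" "p y"] by simp

lemma normal: "i < n \<Longrightarrow> x \<in> N i \<Longrightarrow> z \<otimes> x \<otimes> inv z \<in> N i"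
proof -
  assume i: "i < n" and x: "x \<in> N i"
  define l v where "l = lprod (p z) [0..<n]" and "v = q z"
  have z: "z = l \<otimes> \<sigma> v" using decompose[of z] by (simp add: l_def v_def)
  have "z \<otimes> x \<otimes> inv z = l \<otimes> (\<sigma> v \<otimes> x \<otimes> inv (\<sigma> v)) \<otimes> inv l" unfolding z by (simp add: grp)
  also have "\<dots> \<in> N i" unfolding l_def by (rule lprod_conj_N[OF i \<sigma>_normal[OF i x]]) (auto simp: p_in)
  finally show ?thesis .
qed

text \<open>Both splittings have the same quotient map, so the product of \<open>z\<close> with the
  inverse of \<open>\<sigma>' (q z)\<close> lies in the kernel of \<open>q\<close>. Its old
  coordinates in the factors are the new coordinates of \<open>z\<close>, which yields uniqueness
  and smoothness together.\<close>

lemma other_splitting: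
  assumes hom: "vector_group_hom G A \<sigma>'" and split: "\<And>v. q (\<sigma>' v) = v"
  shows "semidirect_decomposition G A n N \<sigma>'" "quot_map G n N \<sigma>' = q"
proof -
  have hc: "has_coords G n N \<sigma>' z h v \<longleftrightarrow> v = q z \<and> h = p (z \<otimes> inv (\<sigma>' (q z)))" for z h v
  proof
    assume c: "has_coords G n N \<sigma>' z h v"
    then have h: "h \<in> (\<Pi>\<^sub>E i\<in>{..<n}. N i)" and z: "z = fam_prod G n h \<otimes> \<sigma>' v" by (auto simp: has_coords_def)
    have "fam_prod G n h \<in> nil_subgroup G n N" using h by (simp add: nil_subgroup_def)
    then have v: "v = q z" using z by (simp add: nil_subgroup_kernel q_mult split)
    have "has_coords G n N \<sigma> (z \<otimes> inv (\<sigma>' (q z))) h 0"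
    proof -
      have "fam_prod G n h \<otimes> \<sigma>' v \<otimes> inv (\<sigma>' v) = fam_prod G n h" by (simp add: grp)
      then have "z \<otimes> inv (\<sigma>' v) = fam_prod G n h" using z by simp
      then show ?thesis using h unfolding v[symmetric] by (simp add: has_coords_def \<sigma>_0)
    qed
    then show "v = q z \<and> h = p (z \<otimes> inv (\<sigma>' (q z)))" using coords_unique v by auto
  next
    assume "v = q z \<and> h = p (z \<otimes> inv (\<sigma>' (q z)))"
    moreover have "has_coords G n N \<sigma> (z \<otimes> inv (\<sigma>' (q z))) (p (z \<otimes> inv (\<sigma>' (q z)))) 0"
      using coords[of "z \<otimes> inv (\<sigma>' (q z))"] by (simp add: q_mult q_inv split)
    then have "fam_prod G n (p (z \<otimes> inv (\<sigma>' (q z)))) = z \<otimes> inv (\<sigma>' (q z))"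
      by (simp add: has_coords_def \<sigma>_0)
    ultimately show "has_coords G n N \<sigma>' z h v"
      using coords[of "z \<otimes> inv (\<sigma>' (q z))"] by (simp add: has_coords_def grp)
  qed
  show q: "quot_map G n N \<sigma>' = q"
    by (rule ext) (simp add: quot_map_def[of _ _ _ \<sigma>'] hc)
  have p': "nil_coord G n N \<sigma>' z = p (z \<otimes> inv (\<sigma>' (q z)))" for z
    by (simp add: nil_coord_def[of _ _ _ \<sigma>'] hc)
  have sm: "smooth_map_on A A UNIV (\<lambda>z. z \<otimes> inv (\<sigma>' (q z)))"
  proof (rule smooth_mult[OF atlas smooth_map_on_ident[OF atlas] smooth_inv[OF atlas]])
    show "smooth_map_on A A UNIV (\<lambda>z. \<sigma>' (q z))"
      by (rule smooth_map_on_compose[OF atlas smooth_atlas_euclid atlas q_smooth, where T = UNIV])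
        (use hom in \<open>auto simp: vector_group_hom_def\<close>)
  qed
  have ex1: "\<exists>!c. has_coords G n N \<sigma>' z (fst c) (snd c)" for z
    unfolding hc by (rule ex1I[of _ "(p (z \<otimes> inv (\<sigma>' (q z))), q z)"]) (auto simp: prod_eq_iff)
  have sm': "smooth_map_on A A UNIV (\<lambda>z. nil_coord G n N \<sigma>' z i)" if "i < n" for i
    unfolding p' by (rule smooth_map_on_compose[OF atlas atlas atlas sm p_smooth[OF that]]) auto
  note d = decomposition[unfolded semidirect_decomposition_def]
  show "semidirect_decomposition G A n N \<sigma>'"
    unfolding semidirect_decomposition_def q
    by (rule conjI, rule conjunct1[OF d], rule conjI, rule conjunct1[OF conjunct2[OF d]], rule conjI, rule hom,
      rule conjI, intro allI impI ballI, rule normal, assumption+, rule conjI, intro allI, rule ex1,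
      rule conjI, intro allI impI, rule sm', assumption, rule q_smooth)
qed

end

section \<open>Piecewise smooth paths and their lengths\<close>

lemma piecewise_smooth_near:
  assumes "piecewise_smooth A F \<gamma>" "t \<in> {0<..<1} - F"
  shows "smooth_near A \<gamma> t"
proof -
  have "finite (insert 0 (insert 1 F))" using assms by (simp add: piecewise_smooth_def)
  then have "closed (insert 0 (insert 1 F))" by (rule finite_imp_closed)
  then have "open (- insert 0 (insert 1 F))" by (simp only: closed_def)
  then obtain \<epsilon> where e: "\<epsilon> > 0" "ball t \<epsilon> \<subseteq> - insert 0 (insert 1 F)"
    by (rule openE[of _ t]) (use assms(2) in auto)
  define r where "r = min \<epsilon> (min t (1 - t))"
  have r: "0 < r" "r \<le> \<epsilon>" "r \<le> t" "r \<le> 1 - t" using e assms(2) by (auto simp: r_def)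
  have sub: "{t - r<..<t + r} \<subseteq> ball t \<epsilon>" using r by (auto simp: dist_real_def)
  have "smooth_map_on euclid_atlas A {t - r..t + r} \<gamma>"
  proof -
    have "{t - r<..<t + r} \<inter> F = {}" using sub e(2) by auto
    then show ?thesis using assms(1) r unfolding piecewise_smooth_def by auto
  qed
  then have "smooth_map_on euclid_atlas A {t - r<..<t + r} \<gamma>"
    by (rule smooth_map_on_subset) auto
  then show ?thesis by (rule smooth_nearI) (use r in auto)
qed

lemma smooth_map_on_affine:
  fixes \<gamma> :: "real \<Rightarrow> 'g::topological_space"
  assumes A: "smooth_atlas A" and g: "smooth_map_on euclid_atlas A T \<gamma>" "\<And>t. t \<in> S \<Longrightarrow> m * t + c \<in> T"
  shows "smooth_map_on euclid_atlas A S (\<lambda>t. \<gamma> (m * t + c))"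
proof (rule smooth_map_on_compose[OF smooth_atlas_euclid smooth_atlas_euclid A _ g(1)])
  have "smooth_on UNIV (\<lambda>t::real. m * t + c)"
    by (intro smooth_on_add smooth_on_linear smooth_on_const open_UNIV bounded_linear_mult_right)
  from smooth_map_on_subset[OF smooth_map_on_euclidI[OF open_UNIV this]]
  show "smooth_map_on euclid_atlas euclid_atlas S (\<lambda>t. m * t + c)" by auto
qed (use g(2) in auto)

lemma piecewise_smooth_join:
  fixes \<gamma>1 \<gamma>2 :: "real \<Rightarrow> 'g::topological_space"
  assumes A: "smooth_atlas A" and p: "piecewise_smooth A F1 \<gamma>1" "piecewise_smooth A F2 \<gamma>2"
    and e: "pathfinish \<gamma>1 = pathstart \<gamma>2"
  shows "piecewise_smooth A (insert (1/2) ((\<lambda>t. t / 2) ` F1 \<union> (\<lambda>t. (t + 1) / 2) ` F2)) (\<gamma>1 +++ \<gamma>2)"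
  unfolding piecewise_smooth_def
proof (intro conjI allI impI)
  let ?F = "insert (1/2) ((\<lambda>t. t / 2) ` F1 \<union> (\<lambda>t. (t + 1) / 2) ` F2)"
  show "finite ?F" using p by (auto simp: piecewise_smooth_def)
  show "path (\<gamma>1 +++ \<gamma>2)" using p e by (auto simp: piecewise_smooth_def)
  fix a b :: real assume ab: "0 \<le> a \<and> a < b \<and> b \<le> 1 \<and> {a<..<b} \<inter> ?F = {}"
  then have d: "t \<notin> ?F" if "a < t" "t < b" for t using that by (auto simp: disjoint_iff)
  have "b \<le> 1/2 \<or> 1/2 \<le> a" using d[of "1/2"] by (metis insertI1 not_le)
  then show "smooth_map_on euclid_atlas A {a..b} (\<gamma>1 +++ \<gamma>2)"
  proof
    assume b: "b \<le> 1/2"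
    have "t \<notin> F1" if "2 * a < t" "t < 2 * b" for t using d[of "t / 2"] that by auto
    then have "smooth_map_on euclid_atlas A {2 * a..2 * b} \<gamma>1"
      using p(1) ab b unfolding piecewise_smooth_def by (auto simp: disjoint_iff)
    from smooth_map_on_affine[OF A this, of "{a..b}" 2 0]
    have "smooth_map_on euclid_atlas A {a..b} (\<lambda>t. \<gamma>1 (2 * t))" by auto
    then show ?thesis by (rule smooth_map_on_cong) (use b in \<open>auto simp: joinpaths_def\<close>)
  next
    assume a: "1/2 \<le> a"
    have "t \<notin> F2" if "2 * a - 1 < t" "t < 2 * b - 1" for t using d[of "(t + 1) / 2"] that by auto
    then have "smooth_map_on euclid_atlas A {2 * a - 1..2 * b - 1} \<gamma>2"
      using p(2) ab a unfolding piecewise_smooth_def by (auto simp: disjoint_iff)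
    from smooth_map_on_affine[OF A this, of "{a..b}" 2 "- 1"]
    have "smooth_map_on euclid_atlas A {a..b} (\<lambda>t. \<gamma>2 (2 * t - 1))" by auto
    then show ?thesis
    proof (rule smooth_map_on_cong)
      fix t assume "t \<in> {a..b}"
      then have "1/2 < t \<or> t = 1/2" using a by auto
      then show "\<gamma>2 (2 * t - 1) = (\<gamma>1 +++ \<gamma>2) t"
      proof
        assume t: "t = 1/2"
        show ?thesis unfolding t using e by (simp add: joinpaths_def pathfinish_def pathstart_def)
      qed (simp add: joinpaths_def)
    qed
  qed
qed

lemma piecewise_smooth_image:
  fixes \<gamma> :: "real \<Rightarrow> 'g::topological_space"
  assumes A: "smooth_atlas A" and p: "piecewise_smooth A F \<gamma>" and f: "smooth_map_on A A S f"
    and S: "path_image \<gamma> \<subseteq> S"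
  shows "piecewise_smooth A F (\<lambda>t. f (\<gamma> t))"
  unfolding piecewise_smooth_def
proof (intro conjI allI impI)
  have im: "\<gamma> t \<in> S" if "t \<in> {0..1}" for t using S that by (auto simp: path_image_def)
  show "finite F" using p by (simp add: piecewise_smooth_def)
  show "path (\<lambda>t. f (\<gamma> t))"
    unfolding path_def
    by (rule continuous_on_compose2[OF smooth_map_on_continuous[OF A A f]])
      (use p im in \<open>auto simp: piecewise_smooth_def path_def\<close>)
  fix a b :: real assume ab: "0 \<le> a \<and> a < b \<and> b \<le> 1 \<and> {a<..<b} \<inter> F = {}"
  then have "smooth_map_on euclid_atlas A {a..b} \<gamma>" using p by (simp add: piecewise_smooth_def)
  moreover have "\<gamma> ` {a..b} \<subseteq> S" using im ab by auto
  ultimately show "smooth_map_on euclid_atlas A {a..b} (\<lambda>t. f (\<gamma> t))"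
    by (rule smooth_map_on_compose[OF smooth_atlas_euclid A A _ f])
qed

lemma smooth_map_piecewise_smooth:
  fixes \<gamma> :: "real \<Rightarrow> 'g::topological_space"
  assumes A: "smooth_atlas A" and g: "smooth_map_on euclid_atlas A {0..1} \<gamma>"
  shows "piecewise_smooth A {} \<gamma>"
  unfolding piecewise_smooth_def path_def
  using smooth_map_on_continuous[OF smooth_atlas_euclid A g] smooth_map_on_subset[OF g] by auto

text \<open>A free homotopy between two constant loops traces a path between their base
  points.\<close>

lemma simply_connected_imp_connected_space:
  fixes S :: "'a::topological_space set"
  assumes "simply_connected S" shows "connected S"
proof -
  have "path_component S a b" if "a \<in> S" "b \<in> S" for a b
  proof -
    have "path (\<lambda>_. a) \<and> pathfinish (\<lambda>_. a) = pathstart (\<lambda>_. a) \<and> path_image (\<lambda>_. a) \<subseteq> S \<and>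
        path (\<lambda>_. b) \<and> pathfinish (\<lambda>_. b) = pathstart (\<lambda>_. b) \<and> path_image (\<lambda>_. b) \<subseteq> S"
      using that by (auto simp: path_def pathfinish_def pathstart_def path_image_def)
    then have "homotopic_loops S (\<lambda>_. a) (\<lambda>_. b)"
      using assms unfolding simply_connected_def by blast
    from homotopic_loops_imp_path_component_value[OF this, of 0] show ?thesis by simp
  qed
  then show ?thesis by (simp add: path_connected_component path_connected_imp_connected)
qed

lemma bounded_image_local:
  fixes f :: "'a::metric_space \<Rightarrow> 'b::metric_space"
  assumes "compact S" "\<And>x. x \<in> S \<Longrightarrow> \<exists>U. open U \<and> x \<in> U \<and> bounded (f ` (U \<inter> T))"
  shows "bounded (f ` (S \<inter> T))"
proof -
  obtain U where U: "\<And>x. x \<in> S \<Longrightarrow> open (U x) \<and> x \<in> U x \<and> bounded (f ` (U x \<inter> T))" using assms(2) by metis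
  obtain C where C: "C \<subseteq> S" "finite C" "S \<subseteq> (\<Union>c\<in>C. U c)"
    by (rule compactE_image[OF assms(1), of S U]) (use U in auto)
  have "bounded (\<Union>c\<in>C. f ` (U c \<inter> T))" by (rule bounded_Union) (use C U in auto)
  then show ?thesis by (rule bounded_subset) (use C in blast)
qed

context lie_group_atlas
begin

text \<open>At a breakpoint \<open>lvel\<close> need not have a limit, but on either side the path
  agrees with a smooth extension across the point, whose \<open>lvel\<close> is continuous.
  Compactness of the unit interval makes the local bounds global.\<close>

lemma lvel_bounded:
  assumes p: "piecewise_smooth A F \<gamma>"
  shows "bounded (lvel \<gamma> ` ({0<..<1} - F))"
proof -
  have fin: "finite F" using p by (simp add: piecewise_smooth_def)
  have side: "\<exists>U. open U \<and> t \<in> U \<and> bounded (lvel \<gamma> ` (U \<inter> {a<..<b}))"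
    if ab: "0 \<le> a" "a < b" "b \<le> 1" "{a<..<b} \<inter> F = {}" and t: "t \<in> {a..b}" for a b t
  proof -
    have "smooth_map_on euclid_atlas A {a..b} \<gamma>" using p ab by (simp add: piecewise_smooth_def)
    from smooth_map_on_real_extend[OF atlas this t]
    obtain W \<gamma>' where W: "open W" "t \<in> W" "smooth_map_on euclid_atlas A W \<gamma>'" "\<And>s. s \<in> {a..b} \<inter> W \<Longrightarrow> \<gamma>' s = \<gamma> s"
      by blast
    have "isCont (lvel \<gamma>') t"
      using smooth_on_continuous[OF lvel_smooth[OF W(1,3)]] W(1,2) continuous_on_eq_continuous_at by blast
    then obtain \<delta> where d: "\<delta> > 0" "\<And>s. dist s t < \<delta> \<Longrightarrow> dist (lvel \<gamma>' s) (lvel \<gamma>' t) < 1"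
      unfolding continuous_at_eps_delta by (metis zero_less_one)
    let ?U = "ball t \<delta> \<inter> W"
    have "lvel \<gamma> s = lvel \<gamma>' s" if "s \<in> ?U \<inter> {a<..<b}" for s
      by (rule lvel_cong[of "W \<inter> {a<..<b}"]) (use W that in auto)
    then have "lvel \<gamma> ` (?U \<inter> {a<..<b}) \<subseteq> ball (lvel \<gamma>' t) 1"
      using d(2) by (auto simp: dist_commute)
    then have "bounded (lvel \<gamma> ` (?U \<inter> {a<..<b}))" using bounded_ball bounded_subset by blast
    then show ?thesis using W d(1) by (intro exI[of _ ?U]) auto
  qed
  have "bounded (lvel \<gamma> ` ({0..1} \<inter> ({0<..<1} - F)))"
  proof (rule bounded_image_local)
    fix t :: real assume t: "t \<in> {0..1}"
    have "closed (F - {t})" using fin by (intro finite_imp_closed) auto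
    then have "open (- (F - {t}))" by (simp only: closed_def)
    then obtain \<epsilon> where e: "\<epsilon> > 0" "ball t \<epsilon> \<subseteq> - (F - {t})" by (rule openE[of _ t]) auto
    have F: "s \<notin> F" if "\<bar>s - t\<bar> < \<epsilon>" "s \<noteq> t" for s
      using subsetD[OF e(2), of s] that by (auto simp: dist_real_def abs_minus_commute)
    have r: "\<exists>U. open U \<and> t \<in> U \<and> bounded (lvel \<gamma> ` (U \<inter> {t<..<min 1 (t + \<epsilon>)}))"
    proof (cases "t < 1")
      case True
      then show ?thesis using t e(1) F by (intro side) auto
    qed (use open_UNIV in auto)
    have l: "\<exists>U. open U \<and> t \<in> U \<and> bounded (lvel \<gamma> ` (U \<inter> {max 0 (t - \<epsilon>)<..<t}))"
    proof (cases "0 < t")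
      case True
      then show ?thesis using t e(1) F by (intro side) auto
    qed (use open_UNIV in auto)
    obtain U V where U: "open U" "t \<in> U" "bounded (lvel \<gamma> ` (U \<inter> {t<..<min 1 (t + \<epsilon>)}))"
      and V: "open V" "t \<in> V" "bounded (lvel \<gamma> ` (V \<inter> {max 0 (t - \<epsilon>)<..<t}))" using r l by blast
    let ?O = "U \<inter> V \<inter> ball t \<epsilon>"
    have "lvel \<gamma> ` (?O \<inter> ({0<..<1} - F)) \<subseteq> lvel \<gamma> ` (U \<inter> {t<..<min 1 (t + \<epsilon>)}) \<union>
        lvel \<gamma> ` (V \<inter> {max 0 (t - \<epsilon>)<..<t}) \<union> {lvel \<gamma> t}"
    proof
      fix y assume "y \<in> lvel \<gamma> ` (?O \<inter> ({0<..<1} - F))"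
      then obtain s where s: "y = lvel \<gamma> s" "s \<in> U" "s \<in> V" "\<bar>s - t\<bar> < \<epsilon>" "0 < s" "s < 1"
        by (auto simp: dist_real_def abs_minus_commute)
      consider "s < t" | "s = t" | "t < s" by linarith
      then show "y \<in> lvel \<gamma> ` (U \<inter> {t<..<min 1 (t + \<epsilon>)}) \<union> lvel \<gamma> ` (V \<inter> {max 0 (t - \<epsilon>)<..<t}) \<union> {lvel \<gamma> t}"
        using s by cases auto
    qed
    then have "bounded (lvel \<gamma> ` (?O \<inter> ({0<..<1} - F)))"
      by (rule bounded_subset[rotated]) (use U V in auto)
    then show "\<exists>U. open U \<and> t \<in> U \<and> bounded (lvel \<gamma> ` (U \<inter> ({0<..<1} - F)))"
      using U V e(1) by (intro exI[of _ ?O]) auto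
  qed simp
  moreover have "{0..1} \<inter> ({0<..<1} - F) = {0<..<1} - F" by auto
  ultimately show ?thesis by simp
qed

lemma lvel_continuous:
  assumes p: "piecewise_smooth A F \<gamma>"
  shows "continuous_on ({0<..<1} - F) (lvel \<gamma>)"
proof (rule continuous_at_imp_continuous_on, rule ballI)
  fix t assume "t \<in> {0<..<1} - F"
  then obtain W where W: "open W" "t \<in> W" "smooth_map_on euclid_atlas A W \<gamma>"
    using piecewise_smooth_near[OF p] unfolding smooth_near_def by blast
  then show "isCont (lvel \<gamma>) t"
    using smooth_on_continuous[OF lvel_smooth[OF W(1,3)]] continuous_on_eq_continuous_at by blast
qed

lemma lvel_joinpaths:
  assumes p: "piecewise_smooth A F1 \<gamma>1" "piecewise_smooth A F2 \<gamma>2"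
    and t: "t \<in> {0<..<1} - F" and F: "F = insert (1/2) ((\<lambda>t. t / 2) ` F1 \<union> (\<lambda>t. (t + 1) / 2) ` F2)"
  shows "t < 1/2 \<Longrightarrow> 2 * t \<in> {0<..<1} - F1 \<and> lvel (\<gamma>1 +++ \<gamma>2) t = 2 *\<^sub>R lvel \<gamma>1 (2 * t)"
    and "t > 1/2 \<Longrightarrow> 2 * t - 1 \<in> {0<..<1} - F2 \<and> lvel (\<gamma>1 +++ \<gamma>2) t = 2 *\<^sub>R lvel \<gamma>2 (2 * t - 1)"
proof -
  assume l: "t < 1/2"
  have "t \<in> (\<lambda>t. t / 2) ` F1" if "2 * t \<in> F1" using imageI[OF that, of "\<lambda>t. t / 2"] by simp
  then have m: "2 * t \<in> {0<..<1} - F1" using t l unfolding F by auto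
  have "lvel (\<gamma>1 +++ \<gamma>2) t = lvel (\<lambda>s. \<gamma>1 (2 * s)) t"
    by (rule lvel_cong[of "{..<1/2}"]) (use l in \<open>auto simp: joinpaths_def\<close>)
  also have "\<dots> = 2 *\<^sub>R lvel \<gamma>1 (2 * t)"
    by (rule lvel_reparam[where f = "\<lambda>s. 2 * s", OF piecewise_smooth_near[OF p(1) m]]) (auto intro!: derivative_eq_intros)
  finally show "2 * t \<in> {0<..<1} - F1 \<and> lvel (\<gamma>1 +++ \<gamma>2) t = 2 *\<^sub>R lvel \<gamma>1 (2 * t)" using m by blast
next
  assume l: "t > 1/2"
  have "t \<in> (\<lambda>t. (t + 1) / 2) ` F2" if "2 * t - 1 \<in> F2" using imageI[OF that, of "\<lambda>t. (t + 1) / 2"] by simp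
  then have m: "2 * t - 1 \<in> {0<..<1} - F2" using t l unfolding F by auto
  have "lvel (\<gamma>1 +++ \<gamma>2) t = lvel (\<lambda>s. \<gamma>2 (2 * s - 1)) t"
    by (rule lvel_cong[of "{1/2<..}"]) (use l in \<open>auto simp: joinpaths_def\<close>)
  also have "\<dots> = 2 *\<^sub>R lvel \<gamma>2 (2 * t - 1)"
    by (rule lvel_reparam[where f = "\<lambda>s. 2 * s - 1", OF piecewise_smooth_near[OF p(2) m]]) (auto intro!: derivative_eq_intros)
  finally show "2 * t - 1 \<in> {0<..<1} - F2 \<and> lvel (\<gamma>1 +++ \<gamma>2) t = 2 *\<^sub>R lvel \<gamma>2 (2 * t - 1)" using m by blast
qed

section \<open>Paths inside subgroups and uniqueness of automorphisms\<close>

definition ps_path :: "'g set \<Rightarrow> 'g \<Rightarrow> 'g \<Rightarrow> (real \<Rightarrow> 'g) \<Rightarrow> bool" where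
  "ps_path S x y \<gamma> \<longleftrightarrow> (\<exists>F. piecewise_smooth A F \<gamma>) \<and> path_image \<gamma> \<subseteq> S \<and> pathstart \<gamma> = x \<and> pathfinish \<gamma> = y"

lemma ps_path_image:
  "ps_path S x y \<gamma> \<Longrightarrow> smooth_map_on A A S f \<Longrightarrow> f ` S \<subseteq> T \<Longrightarrow> ps_path T (f x) (f y) (\<lambda>t. f (\<gamma> t))"
  unfolding ps_path_def using piecewise_smooth_image[OF atlas]
  by (fastforce simp: path_image_def pathstart_def pathfinish_def)

lemma ps_path_join:
  assumes "ps_path S x y \<gamma>1" "ps_path S y z \<gamma>2" shows "ps_path S x z (\<gamma>1 +++ \<gamma>2)"
proof -
  obtain F1 F2 where "piecewise_smooth A F1 \<gamma>1" "piecewise_smooth A F2 \<gamma>2" using assms by (auto simp: ps_path_def)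
  from piecewise_smooth_join[OF atlas this] show ?thesis
    using assms unfolding ps_path_def by (metis path_image_join Un_least pathfinish_join pathstart_join)
qed

text \<open>The points reachable from the identity are closed under products and inverses. Straight
  segments in a slice chart show that they contain a neighbourhood of the identity in
  \<open>H\<close>; their cosets are then open in \<open>H\<close>, and connectedness leaves only
  one.\<close>

lemma smooth_paths_in_subgroup:
  assumes H: "subgroup H G" "embedded_submanifold A H" "connected H" and h: "h \<in> H"
  shows "\<exists>\<gamma>. ps_path H \<one> h \<gamma>"
proof -
  have H1: "\<one> \<in> H" using subgroup.one_closed[OF H(1)] .
  define R where "R = {h \<in> H. \<exists>\<gamma>. ps_path H \<one> h \<gamma>}"
  have Hm: "x \<otimes> y \<in> H" if "x \<in> H" "y \<in> H" for x y using subgroup.m_closed[OF H(1)] that by blast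
  have Hi: "inv x \<in> H" if "x \<in> H" for x using subgroup.m_inv_closed[OF H(1)] that by blast
  have Rm: "x \<otimes> y \<in> R" if xy: "x \<in> R" "y \<in> R" for x y
  proof -
    obtain a b where "ps_path H \<one> x a" "ps_path H \<one> y b" using xy by (auto simp: R_def)
    moreover from this(2) have "ps_path H (x \<otimes> \<one>) (x \<otimes> y) (\<lambda>t. x \<otimes> b t)"
      by (rule ps_path_image[OF _ smooth_map_on_subset[OF smooth_lmult]]) (use Hm xy in \<open>auto simp: R_def\<close>)
    ultimately show ?thesis using ps_path_join[of H \<one> x a "x \<otimes> y"] Hm xy by (auto simp: R_def)
  qed
  have Ri: "inv x \<in> R" if x: "x \<in> R" for x
  proof -
    obtain a where "ps_path H \<one> x a" using x by (auto simp: R_def)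
    then have "ps_path H (inv \<one>) (inv x) (\<lambda>t. inv (a t))"
      by (rule ps_path_image[OF _ smooth_inv[OF atlas smooth_map_on_ident[OF atlas]]]) (use Hi in auto)
    then show ?thesis using x Hi by (auto simp: R_def)
  qed
  obtain U where U: "open U" "\<one> \<in> U" "U \<inter> H \<subseteq> R"
  proof -
    obtain c W where c: "smooth_atlas (insert c A)" "\<one> \<in> fst c" "subspace W"
      "snd c ` (fst c \<inter> H) = snd c ` fst c \<inter> W"
      using H(2) H1 unfolding embedded_submanifold_def by blast
    have ch: "is_chart c" using smooth_atlas_chart[OF c(1)] by blast
    let ?p = "snd c \<one>"
    have "open (snd c ` fst c)" "?p \<in> snd c ` fst c" using ch c(2) by (auto simp: is_chart_def)
    then obtain r where r: "r > 0" "ball ?p r \<subseteq> snd c ` fst c" by (meson open_contains_ball)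
    have pW: "?p \<in> W" using c(2,4) H1 by blast
    let ?U = "fst c \<inter> snd c -` ball ?p r"
    have oU: "open ?U"
      using ch chart_open[OF ch] by (intro continuous_open_preimage) (auto simp: is_chart_def homeomorphism_def)
    have "y \<in> R" if y: "y \<in> ?U" "y \<in> H" for y
    proof -
      let ?q = "snd c y"
      let ?l = "\<lambda>t. ?p + t *\<^sub>R (?q - ?p)"
      have qW: "?q \<in> W" using y c(4) by blast
      have lW: "?l t \<in> W" for t using pW qW c(3) by (intro subspace_add subspace_scale subspace_diff)
      have lb: "?l t \<in> ball ?p r" if "t \<in> {0..1}" for t
      proof -
        have "norm (t *\<^sub>R (?q - ?p)) \<le> norm (?q - ?p)" using that by (simp add: mult_left_le_one_le)
        then show ?thesis using y(1) by (auto simp: dist_norm norm_minus_commute)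
      qed
      have inH: "chart_inv c (?l t) \<in> H" if "t \<in> {0..1}" for t
      proof -
        have "?l t \<in> snd c ` (fst c \<inter> H)" unfolding c(4) using lb[OF that] r(2) lW by blast
        then show ?thesis using chart_inv_left[OF ch] by auto
      qed
      have "smooth_on UNIV ?l"
        by (rule smooth_on_add[OF open_UNIV smooth_on_const smooth_on_linear[OF bounded_linear_scaleR_left]])
      from smooth_map_on_subset[OF smooth_map_on_euclidI[OF open_UNIV this]]
      have "smooth_map_on euclid_atlas euclid_atlas {0..1} ?l" by auto
      from smooth_map_on_compose[OF smooth_atlas_euclid smooth_atlas_euclid c(1) this smooth_map_on_chart_inv[OF c(1) insertI1]]
      have sm: "smooth_map_on euclid_atlas (insert c A) {0..1} (\<lambda>t. chart_inv c (?l t))" using lb r(2) by blast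
      \<comment> \<open>The slice chart may lie outside \<open>A\<close>, but the atlas enlarged by
        it contains the charts of \<open>A\<close>, in which smoothness can be tested.\<close>
      have "smooth_map_on euclid_atlas A {0..1} (\<lambda>t. chart_inv c (?l t))"
      proof (rule smooth_map_onI[OF smooth_atlas_euclid atlas])
        fix t :: real assume t: "t \<in> {0..1}"
        show "smooth_in (chart_at euclid_atlas t) (chart_at A (chart_inv c (?l t))) {0..1} (\<lambda>t. chart_inv c (?l t)) t"
          by (rule smooth_map_onD[OF sm smooth_atlas_euclid c(1) t])
            (use chart_at_in[OF atlas] chart_at_in[OF smooth_atlas_euclid] in auto)
      qed
      from smooth_map_piecewise_smooth[OF atlas this]
      have "ps_path H \<one> y (\<lambda>t. chart_inv c (?l t))"
        using inH chart_inv_left[OF ch] y(1) c(2)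
        by (auto simp: ps_path_def path_image_def pathstart_def pathfinish_def)
      then show ?thesis using y(2) by (auto simp: R_def)
    qed
    then have "?U \<inter> H \<subseteq> R" by blast
    moreover have "\<one> \<in> ?U" using c(2) r(1) by simp
    ultimately show ?thesis using that[of ?U] oU by blast
  qed
  have cU: "open {y. inv x \<otimes> y \<in> U}" for x
  proof -
    have "continuous_on UNIV (\<lambda>y. inv x \<otimes> y)" by (rule smooth_map_on_continuous[OF atlas atlas smooth_lmult])
    from continuous_open_preimage[OF this open_UNIV U(1)] show ?thesis by (simp add: vimage_def)
  qed
  \<comment> \<open>Translates of \<open>U\<close> by reachable and by unreachable points: open,
    covering \<open>H\<close>, and disjoint inside \<open>H\<close>.\<close>
  let ?O1 = "\<Union>x\<in>R. {y. inv x \<otimes> y \<in> U}" and ?O2 = "\<Union>x\<in>H - R. {y. inv x \<otimes> y \<in> U}"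
  have RH: "R \<subseteq> H" by (auto simp: R_def)
  have UR: "inv x \<otimes> y \<in> R" if "x \<in> H" "y \<in> H" "inv x \<otimes> y \<in> U" for x y using U(3) Hm Hi that by blast
  have "?O1 \<inter> ?O2 \<inter> H = {}"
  proof (rule ccontr)
    assume "?O1 \<inter> ?O2 \<inter> H \<noteq> {}"
    then obtain x x' y where *: "x \<in> R" "inv x \<otimes> y \<in> U" "x' \<in> H" "x' \<notin> R" "inv x' \<otimes> y \<in> U" "y \<in> H" by blast
    have y: "y \<in> R" using Rm[OF *(1) UR[of x y]] * RH by auto
    have "x' = y \<otimes> inv (inv x' \<otimes> y)" by (simp add: grp)
    also have "\<dots> \<in> R" by (intro Rm Ri y UR *)
    finally show False using * by simp
  qed
  moreover have "H \<subseteq> ?O1 \<union> ?O2" using U(2) by force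
  ultimately have "?O1 \<inter> H = {} \<or> ?O2 \<inter> H = {}"
    using connectedD[OF H(3), of ?O1 ?O2] cU by (auto intro!: open_UN)
  moreover have "\<one> \<in> R" using U H1 by auto
  moreover from this have "\<one> \<in> ?O1" using U(2) by (intro UN_I[of \<one>]) auto
  ultimately have "?O2 \<inter> H = {}" using H1 by blast
  then have "H \<subseteq> R" using U(2) by force
  then show ?thesis using h by (auto simp: R_def)
qed

text \<open>Along a path \<open>k\<close> from \<open>\<one>\<close>, the curve \<open>\<phi>(k) \<psi>(k)\<^sup>-\<^sup>1\<close> has zero velocity.\<close>

lemma lie_automorphism_unique:
  assumes H: "subgroup H G" "embedded_submanifold A H" "connected H"
    and a: "lie_automorphism G A H L \<phi>" "lie_automorphism G A H L \<psi>" and h: "h \<in> H"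
  shows "\<phi> h = \<psi> h"
proof -
  obtain k where k: "ps_path H \<one> h k" using smooth_paths_in_subgroup[OF H h] by blast
  then obtain F where F: "piecewise_smooth A F k" unfolding ps_path_def by blast
  have kH: "k t \<in> H" if "t \<in> {0..1}" for t using k that unfolding ps_path_def path_image_def by blast
  have k01: "k 0 = \<one>" "k 1 = h" using k by (auto simp: ps_path_def pathstart_def pathfinish_def)
  have Hm: "x \<otimes> y \<in> H" if "x \<in> H" "y \<in> H" for x y using subgroup.m_closed[OF H(1)] that by blast
  have Hi: "inv x \<in> H" if "x \<in> H" for x using subgroup.m_inv_closed[OF H(1)] that by blast
  have hom: "\<theta> (x \<otimes> y) = \<theta> x \<otimes> \<theta> y" "smooth_map_on A A H \<theta>"
    if "lie_automorphism G A H L \<theta>" "x \<in> H" "y \<in> H" for \<theta> x y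
    using that unfolding lie_automorphism_def iso_def hom_def by auto
  have one: "\<theta> \<one> = \<one>" if "lie_automorphism G A H L \<theta>" for \<theta>
    using hom(1)[OF that, of \<one> \<one>] subgroup.one_closed[OF H(1)] l_cancel_one by simp
  have inv: "\<theta> (inv x) = inv (\<theta> x)" if "lie_automorphism G A H L \<theta>" "x \<in> H" for \<theta> x
    using hom(1)[OF that(1) Hi[OF that(2)] that(2)] one[OF that(1)] inv_equality[of "\<theta> (inv x)" "\<theta> x"] by simp
  let ?m = "\<lambda>t. \<phi> (k t) \<otimes> inv (\<psi> (k t))"
  have "?m 1 = ?m 0"
  proof (rule velocity_zero_imp_constant[OF atlas _ _ _ , of 0 1 ?m F])
    show "finite F" "(0::real) \<le> 1" using F by (auto simp: piecewise_smooth_def)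
    have "smooth_map_on A A H (\<lambda>x. \<phi> x \<otimes> inv (\<psi> x))"
      using hom(2) a H(1) subgroup.one_closed by (intro smooth_mult smooth_inv atlas) blast+
    then have "piecewise_smooth A F ?m"
      using piecewise_smooth_image[OF atlas F, of H "\<lambda>x. \<phi> x \<otimes> inv (\<psi> x)"] kH by (auto simp: path_image_def image_subset_iff)
    then show "continuous_on {0..1} ?m" by (simp add: piecewise_smooth_def path_def)
    fix t assume t: "t \<in> {0<..<1} - F"
    have nk: "smooth_near A k t" by (rule piecewise_smooth_near[OF F t])
    have U: "open {0<..<1::real}" "t \<in> {0<..<1}" "k ` {0<..<1} \<subseteq> H" using t kH by auto
    let ?c = "\<lambda>s. inv (k t) \<otimes> k s"
    have nc: "smooth_near A ?c t" by (rule near_lmult[OF nk])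
    have cH: "?c ` {0<..<1} \<subseteq> H" using U Hm Hi by (auto simp: image_subset_iff)
    have nt: "smooth_near A (\<lambda>s. \<theta> (?c s)) t" "\<theta> (?c t) = \<one>"
        "velocity A (\<lambda>s. \<theta> (?c s)) t = L (velocity A ?c t)" if th: "lie_automorphism G A H L \<theta>" for \<theta>
    proof -
      have sm: "smooth_map_on A A H \<theta>" using hom(2)[OF th] subgroup.one_closed[OF H(1)] by blast
      show n: "smooth_near A (\<lambda>s. \<theta> (?c s)) t" by (rule smooth_near_compose_on[OF atlas atlas sm nc U(1,2) cH])
      show "\<theta> (?c t) = \<one>" using one[OF th] by simp
      \<comment> \<open>\<open>lie_automorphism\<close> prescribes the differential on curves that
        stay in \<open>H\<close> on the whole line, so the local curve \<open>?c\<close> is folded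
        by the sine first.\<close>
      obtain \<epsilon> where e: "\<epsilon> > 0" "curve_in A H (?c t) (\<lambda>s. ?c (t + \<epsilon> * sin (s / \<epsilon>)))"
        by (rule velocity_in_tangent_ex[OF atlas nc U(1,2) cH])
      then have "velocity A (\<theta> \<circ> (\<lambda>s. ?c (t + \<epsilon> * sin (s / \<epsilon>)))) 0 = L (velocity A (\<lambda>s. ?c (t + \<epsilon> * sin (s / \<epsilon>))) 0)"
        using th unfolding lie_automorphism_def by auto
      then show "velocity A (\<lambda>s. \<theta> (?c s)) t = L (velocity A ?c t)"
        using velocity_sin_reparam[OF atlas nc e(1)] velocity_sin_reparam[OF atlas n e(1)] by (simp add: o_def)
    qed
    let ?b = "\<lambda>s. \<phi> (?c s) \<otimes> inv (\<psi> (?c s))"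
    have nb: "smooth_near A ?b t" by (intro near_mult near_inv nt a)
    have vb: "velocity A ?b t = 0"
      using velocity_mult_one[OF nt(1,2)[OF a(1)] near_inv[OF nt(1)[OF a(2)]]] nt(2)[OF a(2)]
        velocity_inv_one[OF nt(1,2)[OF a(2)]] nt(3)[OF a(1)] nt(3)[OF a(2)] by simp
    \<comment> \<open>By the homomorphism property this is \<open>?m\<close> near \<open>t\<close>,
      written as a fixed left and right translate of \<open>?b\<close>; vanishing velocity survives
      translations.\<close>
    let ?e = "\<lambda>s. \<phi> (k t) \<otimes> ?b s \<otimes> inv (\<psi> (k t))"
    have ne: "smooth_near A ?e t" by (intro near_lmult near_rmult nb)
    have ve: "velocity A ?e t = 0"
      using velocity_compose[OF atlas atlas smooth_rmult[of "inv (\<psi> (k t))"] near_lmult[OF nb, of "\<phi> (k t)"]]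
        velocity_compose[OF atlas atlas smooth_lmult[of "\<phi> (k t)"] nb] vb
        linear_0[OF differential_linear[OF atlas atlas smooth_lmult]] linear_0[OF differential_linear[OF atlas atlas smooth_rmult]]
      by simp
    have em: "?e s = ?m s" if "s \<in> {0<..<1}" for s
      using that U(3) t by (simp add: hom[OF a(1)] hom[OF a(2)] inv[OF a(1)] inv[OF a(2)] Hi image_subset_iff grp)
    have "velocity A ?m t = 0" by (rule trans[OF sym[OF velocity_cong[OF U(1,2) em]] ve])
    with smooth_near_cong[OF ne U(1,2) em] show "smooth_near A ?m t \<and> velocity A ?m t = 0" by (rule conjI)
  qed
  then have "\<phi> h \<otimes> inv (\<psi> h) = \<one>" using k01 one[OF a(1)] one[OF a(2)] by simp
  then show ?thesis using inv_equality[of "\<phi> h" "inv (\<psi> h)"] by simp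
qed

end

section \<open>Speed and length for a left-invariant metric\<close>

locale metric_lie_group = lie_group_atlas G A
  for G :: "'g::{t2_space, second_countable_topology} monoid" (structure) and A :: "('g, 'e::euclidean_space) atlas" +
  fixes g :: "'g \<Rightarrow> 'e \<Rightarrow> 'e \<Rightarrow> real"
  assumes left_invariant: "left_invariant_metric G A g"
begin

lemma g_one: "bilinear (g \<one>)" "g \<one> u w = g \<one> w u" "u \<noteq> 0 \<Longrightarrow> 0 < g \<one> u u"
  using left_invariant unfolding left_invariant_metric_def riemannian_metric_def by auto

sublocale gm: psd_form "g \<one>"
proof
  show "bilinear (g \<one>)" "g \<one> x y = g \<one> y x" for x y using g_one by auto
  show "0 \<le> g \<one> x x" for x
    using g_one(3)[of x] bilinear_lzero[OF g_one(1), of 0] by (cases "x = 0") auto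
qed

abbreviation "gn \<equiv> gm.nrm"

lemma gn_velocity:
  assumes "smooth_near A \<gamma> t"
  shows "sqrt (g (\<gamma> t) (velocity A \<gamma> t) (velocity A \<gamma> t)) = gn (lvel \<gamma> t)"
proof -
  have "g (\<gamma> t \<otimes> \<one>) (differential A A (\<lambda>y. \<gamma> t \<otimes> y) \<one> u) (differential A A (\<lambda>y. \<gamma> t \<otimes> y) \<one> w) = g \<one> u w" for u w
    using left_invariant unfolding left_invariant_metric_def by blast
  then show ?thesis by (simp add: velocity_lvel[OF assms] gm.nrm_def)
qed

lemma gn_continuous: "continuous_on UNIV gn"
proof -
  have "bounded_bilinear (g \<one>)" using g_one(1) bilinear_conv_bounded_bilinear by blast
  from bounded_bilinear.continuous_on[OF this continuous_on_id continuous_on_id]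
  show ?thesis unfolding gm.nrm_def by (intro continuous_intros) (simp add: id_def)
qed

lemma gn_upper: "\<exists>K>0. \<forall>X. gn X \<le> K * norm X"
proof -
  have "bounded_bilinear (g \<one>)" using g_one(1) bilinear_conv_bounded_bilinear by blast
  then obtain K where K: "0 < K" "\<And>x y. norm (g \<one> x y) \<le> norm x * norm y * K"
    using bounded_bilinear.pos_bounded by blast
  have "gn X \<le> sqrt K * norm X" for X
  proof -
    have "g \<one> X X \<le> K * (norm X)\<^sup>2" using K(2)[of X X] by (simp add: power2_eq_square mult_ac)
    then have "sqrt (g \<one> X X) \<le> sqrt (K * (norm X)\<^sup>2)" by (rule real_sqrt_le_mono)
    then show ?thesis by (simp add: gm.nrm_def real_sqrt_mult)
  qed
  then show ?thesis using K(1) by (intro exI[of _ "sqrt K"]) auto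
qed

lemma gn_lower: "\<exists>K>0. \<forall>X. norm X \<le> K * gn X"
proof (cases "sphere (0::'e) 1 = {}")
  case False
  obtain x where x: "norm x = 1" "\<And>y. norm y = 1 \<Longrightarrow> gn x \<le> gn y"
    using continuous_attains_inf[OF compact_sphere False continuous_on_subset[OF gn_continuous subset_UNIV]] by auto
  have gx: "0 < gn x" using x(1) g_one(3)[of x] by (cases "x = 0") (auto simp: gm.nrm_def)
  have "norm X \<le> inverse (gn x) * gn X" for X
  proof (cases "X = 0")
    case False
    then have "gn x \<le> gn (inverse (norm X) *\<^sub>R X)" by (intro x(2)) simp
    then show ?thesis using False gx by (simp add: gm.nrm_scale field_simps)
  qed simp
  then show ?thesis using gx by (intro exI[of _ "inverse (gn x)"]) auto
next
  case True
  then have False using vector_choose_size[of 1, where 'a = 'e] by auto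
  then show ?thesis ..
qed

lemma speed_integrable:
  assumes p: "piecewise_smooth A F \<gamma>"
  shows "(\<lambda>t. gn (lvel \<gamma> t)) integrable_on {0..1}"
proof (rule bounded_continuous_integrable[of "insert 0 (insert 1 F)"])
  have S: "{0..1} - insert 0 (insert 1 F) = {0<..<1} - F" by auto
  show "finite (insert 0 (insert 1 F))" using p by (simp add: piecewise_smooth_def)
  show "continuous_on ({0..1} - insert 0 (insert 1 F)) (\<lambda>t. gn (lvel \<gamma> t))"
    unfolding S by (rule continuous_on_compose2[OF gn_continuous lvel_continuous[OF p]]) auto
  obtain B where B: "\<And>t. t \<in> {0<..<1} - F \<Longrightarrow> norm (lvel \<gamma> t) \<le> B"
    using lvel_bounded[OF p] unfolding bounded_iff by blast
  obtain K where K: "0 < K" "\<And>X. gn X \<le> K * norm X" using gn_upper by blast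
  have "norm (gn (lvel \<gamma> t)) \<le> K * B" if "t \<in> {0<..<1} - F" for t
    using order_trans[OF K(2)[of "lvel \<gamma> t"] mult_left_mono[OF B[OF that], of K]] K(1) gm.nrm_nonneg[of "lvel \<gamma> t"] by simp
  then show "bounded ((\<lambda>t. gn (lvel \<gamma> t)) ` ({0..1} - insert 0 (insert 1 F)))"
    unfolding S bounded_iff by blast
qed

lemma curve_length_lvel:
  assumes p: "piecewise_smooth A F \<gamma>"
  shows "curve_length A g \<gamma> = integral {0..1} (\<lambda>t. gn (lvel \<gamma> t))"
  unfolding curve_length_def
  by (rule integral_spike[of "insert 0 (insert 1 F)"])
    (use p in \<open>auto simp: piecewise_smooth_def gn_velocity piecewise_smooth_near[OF p]\<close>)

lemma curve_length_nonneg: "piecewise_smooth A F \<gamma> \<Longrightarrow> 0 \<le> curve_length A g \<gamma>"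
  unfolding curve_length_lvel by (rule integral_nonneg[OF speed_integrable]) (auto simp: gm.nrm_nonneg)

lemma curve_length_lmult:
  assumes p: "piecewise_smooth A F \<gamma>"
  shows "curve_length A g (\<lambda>t. a \<otimes> \<gamma> t) = curve_length A g \<gamma>"
  unfolding curve_length_lvel[OF p] curve_length_lvel[OF piecewise_smooth_image[OF atlas p smooth_lmult subset_UNIV]]
  by (simp add: lvel_lmult)

lemma curve_length_join:
  assumes p: "piecewise_smooth A F1 \<gamma>1" "piecewise_smooth A F2 \<gamma>2" and e: "pathfinish \<gamma>1 = pathstart \<gamma>2"
  shows "curve_length A g (\<gamma>1 +++ \<gamma>2) = curve_length A g \<gamma>1 + curve_length A g \<gamma>2"
proof -
  let ?F = "insert (1/2) ((\<lambda>t. t / 2) ` F1 \<union> (\<lambda>t. (t + 1) / 2) ` F2)"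
  have ps: "piecewise_smooth A ?F (\<gamma>1 +++ \<gamma>2)" by (rule piecewise_smooth_join[OF atlas p e])
  let ?f = "\<lambda>t. gn (lvel (\<gamma>1 +++ \<gamma>2) t)"
  let ?N = "insert 0 (insert 1 ?F)"
  have N: "negligible ?N" using ps by (intro negligible_finite) (simp add: piecewise_smooth_def)
  have "((\<lambda>t. gn (lvel \<gamma>1 t)) has_integral curve_length A g \<gamma>1) (cbox 0 1)"
    unfolding curve_length_lvel[OF p(1)] using speed_integrable[OF p(1)] by (simp add: integrable_integral)
  from has_integral_cmul[OF has_integral_affinity'[OF this, of 2 0], of 2]
  have 1: "((\<lambda>t. 2 * gn (lvel \<gamma>1 (2 * t))) has_integral curve_length A g \<gamma>1) {0..1/2}" by simp
  have "(?f has_integral curve_length A g \<gamma>1) {0..1/2}"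
    by (rule has_integral_spike[OF N _ 1])
      (use lvel_joinpaths(1)[OF p _ refl] in \<open>auto simp: gm.nrm_scale\<close>)
  moreover have "((\<lambda>t. gn (lvel \<gamma>2 t)) has_integral curve_length A g \<gamma>2) (cbox 0 1)"
    unfolding curve_length_lvel[OF p(2)] using speed_integrable[OF p(2)] by (simp add: integrable_integral)
  from has_integral_cmul[OF has_integral_affinity'[OF this, of 2 "- 1"], of 2]
  have 2: "((\<lambda>t. 2 * gn (lvel \<gamma>2 (2 * t - 1))) has_integral curve_length A g \<gamma>2) {1/2..1}" by simp
  have "(?f has_integral curve_length A g \<gamma>2) {1/2..1}"
    by (rule has_integral_spike[OF N _ 2])
      (use lvel_joinpaths(2)[OF p _ refl] in \<open>auto simp: gm.nrm_scale\<close>)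
  ultimately have "(?f has_integral curve_length A g \<gamma>1 + curve_length A g \<gamma>2) {0..1}"
    by (intro has_integral_combine[of 0 "1/2" 1]) auto
  then show ?thesis unfolding curve_length_lvel[OF ps] by (rule integral_unique)
qed

end

section \<open>Adjoint action and derivations\<close>

lemma (in lie_group_atlas) Ad_commuting:
  assumes "\<And>y. y \<in> H \<Longrightarrow> x \<otimes> y = y \<otimes> x" "X \<in> Lie H" shows "Ad G A x X = X"
proof -
  obtain a where a: "velocity A a 0 = X" "smooth_near A a 0" "a 0 = \<one>" "range a \<subseteq> H"
    by (rule lie_algebraE[OF assms(2)])
  have "x \<otimes> a s \<otimes> inv x = a s" for s
    using assms(1)[of "a s"] a(4) by (simp add: grp range_subsetD)
  then show ?thesis using Ad_velocity[OF a(2,3), of x] a(1) by simp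
qed

context semidirect
begin

abbreviation "\<nn> i \<equiv> Lie (N i)"

lemma \<nn>_subspace: "i < n \<Longrightarrow> subspace (\<nn> i)"
  by (rule lie_algebra_subspace[OF N_subgroup])

lemma Ad_\<nn>: "i < n \<Longrightarrow> X \<in> \<nn> i \<Longrightarrow> Ad G A z X \<in> \<nn> i"
  using Ad_lie_algebra[of "N i" z "N i"] normal by blast

lemma \<sigma>_near: "smooth_near A (\<lambda>t. \<sigma> (t *\<^sub>R w)) t"
  by (rule smooth_near_reparam[where f = "\<lambda>t. t *\<^sub>R w", OF atlas smooth_nearI[OF \<sigma>_smooth open_UNIV UNIV_I]
        smooth_on_linear[OF bounded_linear_scaleR_left] open_UNIV UNIV_I])

definition S :: "'v \<Rightarrow> 'e" where "S w = velocity A (\<lambda>t. \<sigma> (t *\<^sub>R w)) 0"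

lemma S_differential: "S w = differential euclid_atlas A \<sigma> 0 w"
proof -
  have n: "smooth_near euclid_atlas (\<lambda>t. t *\<^sub>R w) 0"
    by (rule smooth_nearI[OF smooth_map_on_euclidI[OF open_UNIV smooth_on_linear[OF bounded_linear_scaleR_left]]]) auto
  have "((\<lambda>t. t *\<^sub>R w) has_vector_derivative w) (at 0)" by (auto intro!: derivative_eq_intros)
  then have "velocity euclid_atlas (\<lambda>t. t *\<^sub>R w) 0 = w" unfolding velocity_euclid by (rule vector_derivative_at)
  then show ?thesis using velocity_compose[OF smooth_atlas_euclid atlas \<sigma>_smooth n] by (simp add: S_def)
qed

lemma S_linear: "linear S"
  using differential_linear[OF smooth_atlas_euclid atlas \<sigma>_smooth, of 0] S_differential by presburger

text \<open>Bracketing with \<open>S w\<close>, the generator of the flow of \<open>Ad\<close> along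
  the line spanned by \<open>w\<close>.\<close>

abbreviation "M w \<equiv> lie_bracket G A (S w)"

lemma Ad_\<sigma>_derivative: "((\<lambda>t. Ad G A (\<sigma> (t *\<^sub>R w)) X) has_vector_derivative M w X) (at 0)"
  using Ad_curve_derivative[OF \<sigma>_near[of w 0]] by (simp add: \<sigma>_0 S_def)

lemma flow: "linear_flow (\<lambda>t. Ad G A (\<sigma> (t *\<^sub>R w))) (M w)"
proof (rule linear_flow.intro)
  fix t :: real and X :: 'e
  show "linear (Ad G A (\<sigma> (t *\<^sub>R w)))" by (rule Ad_linear)
  show "linear (M w)" by (rule linearI) (simp_all add: bracket_add_right bracket_scale_right)
  show "Ad G A (\<sigma> (0 *\<^sub>R w)) X = X" by (simp add: \<sigma>_0 Ad_one)
  \<comment> \<open>The image of a line is commutative, so \<open>Ad\<close> fixes its own direction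
    \<open>S w\<close> and hence commutes with the bracket by it.\<close>
  have "\<sigma> (t *\<^sub>R w) \<otimes> \<sigma> (r *\<^sub>R w) = \<sigma> (r *\<^sub>R w) \<otimes> \<sigma> (t *\<^sub>R w)" for r
    by (simp add: \<sigma>_add[symmetric] add.commute)
  then have "\<sigma> (t *\<^sub>R w) \<otimes> \<sigma> (r *\<^sub>R w) \<otimes> inv (\<sigma> (t *\<^sub>R w)) = \<sigma> (r *\<^sub>R w)" for r
    by (simp add: grp)
  then have "Ad G A (\<sigma> (t *\<^sub>R w)) (S w) = S w"
    using Ad_velocity[OF \<sigma>_near[of w 0], of "\<sigma> (t *\<^sub>R w)"] by (simp add: \<sigma>_0 S_def)
  then show BM: "Ad G A (\<sigma> (t *\<^sub>R w)) (M w X) = M w (Ad G A (\<sigma> (t *\<^sub>R w)) X)"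
    by (simp add: Ad_bracket)
  let ?Y = "Ad G A (\<sigma> (t *\<^sub>R w)) X"
  \<comment> \<open>The derivative at time \<open>t\<close> is the derivative at time 0 of the orbit
    of \<open>?Y\<close>, by the group law.\<close>
  have "((\<lambda>s. s - t) has_vector_derivative 1) (at t)" by (auto intro!: derivative_eq_intros)
  moreover have "((\<lambda>s. Ad G A (\<sigma> (s *\<^sub>R w)) ?Y) has_vector_derivative M w ?Y) (at (t - t))"
    using Ad_\<sigma>_derivative[of w ?Y] by simp
  ultimately have "(((\<lambda>s. Ad G A (\<sigma> (s *\<^sub>R w)) ?Y) \<circ> (\<lambda>s. s - t)) has_vector_derivative 1 *\<^sub>R M w ?Y) (at t)"
    by (rule vector_diff_chain_at)
  moreover have "(\<lambda>s. Ad G A (\<sigma> (s *\<^sub>R w)) ?Y) \<circ> (\<lambda>s. s - t) = (\<lambda>s. Ad G A (\<sigma> (s *\<^sub>R w)) X)"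
    by (rule ext) (simp add: Ad_mult[symmetric] \<sigma>_add[symmetric] scaleR_left_diff_distrib)
  ultimately show "((\<lambda>s. Ad G A (\<sigma> (s *\<^sub>R w)) X) has_vector_derivative M w ?Y) (at t)" by simp
qed

lemma exp_op_M: "exp_op t (M w) X = Ad G A (\<sigma> (t *\<^sub>R w)) X"
  by (rule linear_flow.flow_exp_op[OF flow])

lemma M_linear: "linear (M w)"
  by (rule linear_flow.M_linear[OF flow])

lemma M_invariant:
  assumes "subspace U" "\<And>z X. X \<in> U \<Longrightarrow> Ad G A z X \<in> U" "X \<in> U" shows "M w X \<in> U"
  by (rule derivative_in_subspace[OF assms(1) _ Ad_\<sigma>_derivative]) (use assms in auto)

text \<open>The derivative at 0 of the statement that \<open>Ad\<close> along the line preserves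
  brackets.\<close>

lemma M_derivation: "M w (lie_bracket G A X Y) = lie_bracket G A (M w X) Y + lie_bracket G A X (M w Y)"
proof -
  let ?B = "\<lambda>t. Ad G A (\<sigma> (t *\<^sub>R w))"
  have "((\<lambda>t. lie_bracket G A (?B t X) (?B t Y)) has_vector_derivative
      lie_bracket G A (?B 0 X) (M w Y) + lie_bracket G A (M w X) (?B 0 Y)) (at 0)"
    by (rule bounded_bilinear.has_vector_derivative[OF bracket_bilinear Ad_\<sigma>_derivative Ad_\<sigma>_derivative])
  then have "((\<lambda>t. ?B t (lie_bracket G A X Y)) has_vector_derivative
      lie_bracket G A X (M w Y) + lie_bracket G A (M w X) Y) (at 0)"
    by (simp add: Ad_bracket \<sigma>_0 Ad_one)
  from vector_derivative_unique_at[OF Ad_\<sigma>_derivative this] show ?thesis by (simp add: add.commute)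
qed

lemma bracket_\<nn>: "i < n \<Longrightarrow> X \<in> \<nn> i \<Longrightarrow> Y \<in> \<nn> i \<Longrightarrow> lie_bracket G A X Y \<in> \<nn> i"
proof -
  assume i: "i < n" and X: "X \<in> \<nn> i" and Y: "Y \<in> \<nn> i"
  obtain a where a: "velocity A a 0 = X" "smooth_near A a 0" "a 0 = \<one>" "range a \<subseteq> N i"
    by (rule lie_algebraE[OF X])
  show ?thesis
    using derivative_in_subspace[OF \<nn>_subspace[OF i] Ad_\<nn>[OF i Y] Ad_curve_derivative[OF a(2,3)]] a(1) by simp
qed

lemma Ad_lprod:
  assumes "i < n" "X \<in> \<nn> i" "distinct is" "set is \<subseteq> {..<n}" "\<And>j. j < n \<Longrightarrow> h j \<in> N j"
  shows "Ad G A (lprod h is) X = (if i \<in> set is then Ad G A (h i) X else X)"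
  using assms(3,4)
proof (induction "is")
  case Nil
  then show ?case by (simp add: Ad_one)
next
  case (Cons j "is")
  have other: "Ad G A (h j) Y = Y" if "j \<noteq> i" "Y \<in> \<nn> i" for Y
    by (rule Ad_commuting[OF _ that(2)]) (use N_commute[of j i "h j"] assms Cons.prems that in auto)
  show ?case
    using Cons other[OF _ Ad_\<nn>[OF assms(1,2), of "h i"]] other[OF _ assms(2)] by (auto simp: Ad_mult)
qed

text \<open>The factors other than \<open>N i\<close> commute with it, hence act trivially on its
  Lie algebra; only the coordinate in \<open>N i\<close> and the splitting remain.\<close>

lemma Ad_decompose: "i < n \<Longrightarrow> X \<in> \<nn> i \<Longrightarrow> Ad G A z X = Ad G A (p z i) (Ad G A (\<sigma> (q z)) X)"
proof -
  assume i: "i < n" and X: "X \<in> \<nn> i"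
  define l v where "l = lprod (p z) [0..<n]" and "v = q z"
  have z: "z = l \<otimes> \<sigma> v" using decompose[of z] by (simp add: l_def v_def)
  have "Ad G A l (Ad G A (\<sigma> v) X) = Ad G A (p z i) (Ad G A (\<sigma> v) X)"
    unfolding l_def using Ad_lprod[OF i Ad_\<nn>[OF i X], of "[0..<n]" "p z" "\<sigma> v"] i
    by (simp add: p_in lessThan_atLeast0)
  then show ?thesis using z v_def by (metis Ad_mult)
qed

text \<open>Nilpotency of \<open>N i\<close> makes this flag exhaust its Lie algebra, and the derivations belonging to two
  splittings agree on the graded pieces, hence have the same eigenvalues.\<close>

primrec flag :: "nat \<Rightarrow> nat \<Rightarrow> 'e set" where
  "flag i 0 = {0}"
| "flag i (Suc j) = {Y \<in> \<nn> i. \<forall>x\<in>N i. Ad G A x Y - Y \<in> flag i j}"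

lemma flag_subset: "i < n \<Longrightarrow> flag i j \<subseteq> \<nn> i"
  by (cases j) (auto simp: subspace_0[OF \<nn>_subspace])

lemma flag_subspace: "i < n \<Longrightarrow> subspace (flag i j)"
proof (induction j)
  case (Suc j)
  note sj = Suc.IH[OF Suc.prems] and sn = \<nn>_subspace[OF Suc.prems]
  show ?case unfolding subspace_def
  proof (intro conjI ballI allI)
    show "0 \<in> flag i (Suc j)" using subspace_0[OF sj] subspace_0[OF sn] by (simp add: Ad_0)
    fix X Y assume XY: "X \<in> flag i (Suc j)" "Y \<in> flag i (Suc j)"
    have "Ad G A x (X + Y) - (X + Y) \<in> flag i j" if "x \<in> N i" for x
    proof -
      have "Ad G A x (X + Y) - (X + Y) = (Ad G A x X - X) + (Ad G A x Y - Y)" by (simp add: Ad_add)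
      also have "\<dots> \<in> flag i j" using XY that by (intro subspace_add[OF sj]) auto
      finally show ?thesis .
    qed
    then show "X + Y \<in> flag i (Suc j)" using XY subspace_add[OF sn] by simp
  next
    fix r X assume X: "X \<in> flag i (Suc j)"
    have "Ad G A x (r *\<^sub>R X) - r *\<^sub>R X \<in> flag i j" if "x \<in> N i" for x
    proof -
      have "Ad G A x (r *\<^sub>R X) - r *\<^sub>R X = r *\<^sub>R (Ad G A x X - X)"
        by (simp add: Ad_scale scaleR_right_diff_distrib)
      also have "\<dots> \<in> flag i j" using X that by (intro subspace_scale[OF sj]) auto
      finally show ?thesis .
    qed
    then show "r *\<^sub>R X \<in> flag i (Suc j)" using X subspace_scale[OF sn] by simp
  qed
qed (simp add: subspace_def)

text \<open>Moving \<open>z\<close> past \<open>x\<close> replaces \<open>x\<close> by its conjugate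
  under the inverse of \<open>z\<close>, again in \<open>N i\<close>, so the defining condition
  passes from \<open>Y\<close> to its image.\<close>

lemma Ad_flag: "i < n \<Longrightarrow> Y \<in> flag i j \<Longrightarrow> Ad G A z Y \<in> flag i j"
proof (induction j arbitrary: Y)
  case 0
  then show ?case by (simp add: Ad_0)
next
  case (Suc j)
  have "Ad G A x (Ad G A z Y) - Ad G A z Y \<in> flag i j" if x: "x \<in> N i" for x
  proof -
    have "inv z \<otimes> x \<otimes> z \<in> N i" using normal[OF Suc.prems(1) x, of "inv z"] by simp
    then have "Ad G A z (Ad G A (inv z \<otimes> x \<otimes> z) Y - Y) \<in> flag i j"
      using Suc by (intro Suc.IH) auto
    then show ?thesis by (simp add: Ad_diff Ad_mult[symmetric] grp)
  qed
  then show ?case using Suc.prems Ad_\<nn> by auto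
qed

text \<open>Curves in the lower central series, indexed downwards from the trivial term, have
  velocities in the corresponding flag term: the commutator of \<open>x\<close> with the curve lies
  one term deeper and has velocity \<open>Ad G A x X - X\<close>.\<close>

lemma flag_top:
  assumes i: "i < n" and nil: "nilpotent_group (G\<lparr>carrier := N i\<rparr>)"
  shows "\<exists>c. flag i c = \<nn> i"
proof -
  let ?K = "G\<lparr>carrier := N i\<rparr>"
  obtain c where c: "lower_central ?K c = {\<one>}" using nil by (auto simp: nilpotent_group_def)
  have lcN: "lower_central ?K m \<subseteq> N i" for m
  proof (induction m)
    case (Suc m)
    have "generate ?K {x \<otimes>\<^bsub>?K\<^esub> y \<otimes>\<^bsub>?K\<^esub> inv\<^bsub>?K\<^esub> x \<otimes>\<^bsub>?K\<^esub> inv\<^bsub>?K\<^esub> y |x y. x \<in> carrier ?K \<and> y \<in> lower_central ?K m} \<subseteq> carrier ?K"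
    proof (rule group.generate_incl[OF subgroup.subgroup_is_group[OF N_subgroup[OF i] group_axioms]])
      show "{x \<otimes>\<^bsub>?K\<^esub> y \<otimes>\<^bsub>?K\<^esub> inv\<^bsub>?K\<^esub> x \<otimes>\<^bsub>?K\<^esub> inv\<^bsub>?K\<^esub> y |x y. x \<in> carrier ?K \<and> y \<in> lower_central ?K m} \<subseteq> carrier ?K"
        using Suc by (auto simp: m_inv_consistent[OF N_subgroup[OF i]] intro!: N_mult[OF i] N_inv[OF i])
    qed
    then show ?case by simp
  qed simp
  have comm: "x \<otimes> y \<otimes> inv x \<otimes> inv y \<in> lower_central ?K (Suc m)" if "x \<in> N i" "y \<in> lower_central ?K m" for x y m
  proof -
    have "x \<otimes> y \<otimes> inv x \<otimes> inv y = x \<otimes>\<^bsub>?K\<^esub> y \<otimes>\<^bsub>?K\<^esub> inv\<^bsub>?K\<^esub> x \<otimes>\<^bsub>?K\<^esub> inv\<^bsub>?K\<^esub> y"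
      using that lcN[of m] by (auto simp: m_inv_consistent[OF N_subgroup[OF i]])
    then show ?thesis using that by (auto intro!: generate.incl)
  qed
  have *: "velocity A a 0 \<in> flag i j"
    if "j \<le> c" "smooth_near A a 0" "a 0 = \<one>" "range a \<subseteq> lower_central ?K (c - j)" for a j
    using that
  proof (induction j arbitrary: a)
    case 0
    then have "a = (\<lambda>s. \<one>)" using c by auto
    then show ?case by (simp add: velocity_const)
  next
    case (Suc j)
    have "velocity A a 0 \<in> \<nn> i"
      by (rule lie_algebraI[OF Suc.prems(2,3) open_UNIV UNIV_I]) (use Suc.prems lcN in blast)
    moreover have "Ad G A x (velocity A a 0) - velocity A a 0 \<in> flag i j" if x: "x \<in> N i" for x
    proof -
      have n: "smooth_near A (\<lambda>s. x \<otimes> a s \<otimes> inv x) 0" "smooth_near A (\<lambda>s. inv (a s)) 0"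
        using near_conj[OF Suc.prems(2)] near_inv[OF Suc.prems(2)] by auto
      have "velocity A (\<lambda>s. x \<otimes> a s \<otimes> inv x \<otimes> inv (a s)) 0 \<in> flag i j"
      proof (rule Suc.IH)
        have e: "Suc (c - Suc j) = c - j" using Suc.prems(1) by simp
        have "a s \<in> lower_central ?K (c - Suc j)" for s using Suc.prems(4) by blast
        from comm[OF x this, unfolded e]
        show "range (\<lambda>s. x \<otimes> a s \<otimes> inv x \<otimes> inv (a s)) \<subseteq> lower_central ?K (c - j)" by blast
      qed (use Suc.prems n in \<open>auto intro: near_mult\<close>)
      moreover have "velocity A (\<lambda>s. x \<otimes> a s \<otimes> inv x \<otimes> inv (a s)) 0 = Ad G A x (velocity A a 0) - velocity A a 0"
        using velocity_mult_one[OF n(1) _ n(2)] Suc.prems(2,3)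
        by (simp add: Ad_velocity velocity_inv_one)
      ultimately show ?thesis by simp
    qed
    ultimately show ?case by simp
  qed
  have "\<nn> i \<subseteq> flag i c"
  proof
    fix X assume "X \<in> \<nn> i"
    then obtain a where "velocity A a 0 = X" "smooth_near A a 0" "a 0 = \<one>" "range a \<subseteq> N i"
      by (rule lie_algebraE)
    then show "X \<in> flag i c" using *[of c a] by simp
  qed
  then show ?thesis using flag_subset[OF i] by blast
qed

lemma conj_automorphism:
  assumes i: "i < n" and L: "\<And>X. X \<in> \<nn> i \<Longrightarrow> L X = Ad G A z X"
  shows "lie_automorphism G A (N i) L (restrict (\<lambda>x. z \<otimes> x \<otimes> inv z) (N i))"
proof -
  let ?c = "\<lambda>x. z \<otimes> x \<otimes> inv z" and ?d = "\<lambda>x. inv z \<otimes> x \<otimes> z"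
  let ?\<phi> = "restrict ?c (N i)"
  have cN: "?c x \<in> N i" and dN: "?d x \<in> N i" if "x \<in> N i" for x
    using normal[OF i that, of z] normal[OF i that, of "inv z"] by auto
  have inj: "inj_on ?\<phi> (N i)"
    by (rule inj_on_inverseI[of _ ?d]) (simp add: grp)
  have im: "?\<phi> ` N i = N i"
  proof
    show "?\<phi> ` N i \<subseteq> N i" using cN by auto
    show "N i \<subseteq> ?\<phi> ` N i"
    proof
      fix y assume y: "y \<in> N i"
      then have "y = ?\<phi> (?d y)" using dN by (simp add: grp)
      then show "y \<in> ?\<phi> ` N i" using dN[OF y] by blast
    qed
  qed
  have iv: "inv_into (N i) ?\<phi> y = ?d y" if "y \<in> N i" for y
    by (rule inv_into_f_eq[OF inj dN[OF that]]) (use dN[OF that] in \<open>simp add: grp\<close>)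
  have "?\<phi> \<in> iso (G\<lparr>carrier := N i\<rparr>) (G\<lparr>carrier := N i\<rparr>)"
    using inj im cN N_mult[OF i] by (auto simp: iso_def hom_def bij_betw_def grp)
  moreover have "smooth_map_on A A (N i) ?\<phi>"
    by (rule smooth_map_on_mono[OF smooth_conj[of z]]) auto
  moreover have "smooth_map_on A A (N i) (inv_into (N i) ?\<phi>)"
    by (rule smooth_map_on_mono[OF smooth_conj[of "inv z"]]) (auto simp: iv)
  moreover have "velocity A (?\<phi> \<circ> \<gamma>) 0 = L (velocity A \<gamma> 0)" if g: "curve_in A (N i) \<one> \<gamma>" for \<gamma>
  proof -
    have g0: "smooth_near A \<gamma> 0" "\<gamma> 0 = \<one>" "\<gamma> s \<in> N i" for s
      using curve_in_smooth_near[OF g] g by (auto simp: curve_in_def)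
    have "velocity A \<gamma> 0 \<in> \<nn> i" by (rule lie_algebraI[OF g0(1,2) open_UNIV UNIV_I]) (use g0(3) in auto)
    moreover have "?\<phi> \<circ> \<gamma> = (\<lambda>s. ?c (\<gamma> s))" using g0(3) by (simp add: fun_eq_iff)
    ultimately show ?thesis using L Ad_velocity[OF g0(1,2), of z] by simp
  qed
  ultimately show ?thesis unfolding lie_automorphism_def by blast
qed

end

text \<open>From here on the prefix \<open>base\<close> marks coordinates and generators of the
  given splitting \<open>s\<close>; unprefixed names belong to the perpendicular splitting
  \<open>sg\<close>.\<close>

locale sol_split = metric_lie_group G A g
  for G :: "'g::{t2_space, second_countable_topology} monoid" (structure) and A :: "('g, 'e::euclidean_space) atlas"
    and g :: "'g \<Rightarrow> 'e \<Rightarrow> 'e \<Rightarrow> real" +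
  fixes n :: nat and N :: "nat \<Rightarrow> 'g set" and D :: "nat \<Rightarrow> 'e \<Rightarrow> 'e" and \<alpha> :: "nat \<Rightarrow> real^'k \<Rightarrow> real"
    and s sg :: "real^'k \<Rightarrow> 'g"
  assumes sol: "sol_type_group G A n N D \<alpha> s" and perp: "perpendicular_splitting G A n N s g sg"
begin

lemma decomposition_s: "semidirect_decomposition G A n N s"
  using sol unfolding sol_type_group_def by blast

lemma N_lie_subgroup: "i < n \<Longrightarrow> lie_subgroup G A (N i)"
  using decomposition_s unfolding semidirect_decomposition_def by blast

lemma N_is_subgroup: "i < n \<Longrightarrow> subgroup (N i) G"
  using N_lie_subgroup by (simp add: lie_subgroup_def)

lemma N_commuting: "i < n \<Longrightarrow> j < n \<Longrightarrow> i \<noteq> j \<Longrightarrow> x \<in> N i \<Longrightarrow> y \<in> N j \<Longrightarrow> x \<otimes> y = y \<otimes> x"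
  using decomposition_s unfolding semidirect_decomposition_def by metis

sublocale factor_family G A n N
  by (rule factor_family.intro[OF lie_group_atlas_axioms], rule factor_family_axioms.intro)
    (fact N_is_subgroup, fact N_commuting)

sublocale base: semidirect G A n N s
  by unfold_locales (rule decomposition_s)

lemma sg_hom: "vector_group_hom G A sg" and sg_split: "base.q (sg v) = v"
  using perp unfolding perpendicular_splitting_def by auto

sublocale semidirect G A n N sg
  by unfold_locales (rule base.other_splitting(1)[OF sg_hom sg_split])

lemma N_embedded: "i < n \<Longrightarrow> embedded_submanifold A (N i)"
  using N_lie_subgroup by (simp add: lie_subgroup_def)

lemma N_connected: "i < n \<Longrightarrow> connected (N i)"
  using sol unfolding sol_type_group_def by (blast intro: simply_connected_imp_connected_space)

lemma N_nilpotent: "i < n \<Longrightarrow> nilpotent_group (G\<lparr>carrier := N i\<rparr>)"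
  and D_derivation: "i < n \<Longrightarrow> derivation_on G A (\<nn> i) (D i)"
  and D_eigenvalue: "i < n \<Longrightarrow> eigenvalue_on (\<nn> i) (D i) z \<Longrightarrow> 1 \<le> Re z"
  and \<alpha>_linear: "i < n \<Longrightarrow> linear (\<alpha> i)" and \<alpha>_nonzero: "i < n \<Longrightarrow> \<exists>v. \<alpha> i v \<noteq> 0"
  and Ad_s: "i < n \<Longrightarrow> X \<in> \<nn> i \<Longrightarrow> Ad G A (s v) X = exp_op (\<alpha> i v) (D i) X"
  using sol unfolding sol_type_group_def by blast+

section \<open>Contraction along the perpendicular splitting\<close>

definition u :: "nat \<Rightarrow> real^'k" where "u i = (SOME v. \<alpha> i v = 1)"

lemma \<alpha>_u: assumes "i < n" shows "\<alpha> i (u i) = 1"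
proof -
  obtain v where v: "\<alpha> i v \<noteq> 0" using \<alpha>_nonzero[OF assms] by blast
  have "\<alpha> i (inverse (\<alpha> i v) *\<^sub>R v) = 1" using v linear_scale[OF \<alpha>_linear[OF assms]] by simp
  then show ?thesis unfolding u_def by (rule someI)
qed

lemma \<alpha>_scale_u: "i < n \<Longrightarrow> \<alpha> i (t *\<^sub>R u i) = t"
  using linear_scale[OF \<alpha>_linear] \<alpha>_u by simp

text \<open>Along the line spanned by \<open>u i\<close> both maps exponentiate to \<open>Ad\<close>
  of \<open>s\<close>.\<close>

lemma D_eq: assumes i: "i < n" and X: "X \<in> \<nn> i" shows "D i X = base.M (u i) X"
proof (rule exp_op_injective[OF \<nn>_subspace[OF i], of "D i" "base.M (u i)" X])
  show "base.M (u i) Y \<in> \<nn> i" if "Y \<in> \<nn> i" for Y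
    by (rule base.M_invariant[OF \<nn>_subspace[OF i] _ that]) (rule Ad_\<nn>[OF i])
  show "exp_op t (D i) X = exp_op t (base.M (u i)) X" for t
    using Ad_s[OF i X, of "t *\<^sub>R u i"] by (simp add: \<alpha>_scale_u[OF i] base.exp_op_M)
qed (use X D_derivation[OF i] in \<open>auto simp: derivation_on_def bracket_add_right bracket_scale_right\<close>)

text \<open>On the Lie algebra of \<open>N i\<close>, the elements \<open>sg (t *\<^sub>R w)\<close>
  and \<open>s (t *\<^sub>R w)\<close> act alike up to an element of \<open>N i\<close>, which acts
  trivially on the graded pieces of the flag.\<close>

lemma M_diff_flag:
  assumes i: "i < n" and X: "X \<in> flag i (Suc j)"
  shows "M w X - base.M w X \<in> flag i j"
proof (rule derivative_in_subspace[OF flag_subspace[OF i]])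
  show "((\<lambda>t. Ad G A (sg (t *\<^sub>R w)) X - Ad G A (s (t *\<^sub>R w)) X) has_vector_derivative M w X - base.M w X) (at 0)"
    by (intro has_vector_derivative_diff Ad_\<sigma>_derivative base.Ad_\<sigma>_derivative)
  fix t
  let ?Y = "Ad G A (s (t *\<^sub>R w)) X"
  have Xn: "X \<in> \<nn> i" using X by simp
  have Y: "?Y \<in> flag i (Suc j)" by (rule Ad_flag[OF i X])
  have "Ad G A (sg (t *\<^sub>R w)) X = Ad G A (base.p (sg (t *\<^sub>R w)) i) ?Y"
    using base.Ad_decompose[OF i Xn, of "sg (t *\<^sub>R w)"] by (simp add: sg_split)
  then show "Ad G A (sg (t *\<^sub>R w)) X - ?Y \<in> flag i j"
    using Y base.p_in[OF i] by simp
qed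

lemma contraction:
  assumes i: "i < n"
  shows "\<exists>C\<ge>0. \<forall>X\<in>\<nn> i. \<forall>t\<ge>0. norm (Ad G A (sg (- t *\<^sub>R u i)) X) \<le> C * exp (- (t / 2)) * norm X"
proof -
  obtain c where c: "flag i c = \<nn> i" using flag_top[OF i N_nilpotent[OF i]] by blast
  have inv: "M (u i) x \<in> flag i j" "base.M (u i) x \<in> flag i j" if "x \<in> flag i j" for x j
    by (rule M_invariant base.M_invariant, rule flag_subspace[OF i], rule Ad_flag[OF i], assumption, rule that)+
  \<comment> \<open>An eigenvector in a smaller flag term is one in the whole Lie algebra of
    \<open>N i\<close>, where \<open>base.M (u i)\<close> agrees with \<open>D i\<close>.\<close>
  have ev: "1 \<le> Re z" if "eigenvalue_on (flag i j) (base.M (u i)) z" for j z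
  proof -
    have "eigenvalue_on (\<nn> i) (D i) z"
      using that flag_subset[OF i, of j] unfolding eigenvalue_on_def by (metis D_eq[OF i] subsetD)
    then show ?thesis by (rule D_eigenvalue[OF i])
  qed
  have "\<exists>zs. (\<forall>z\<in>set zs. 1 \<le> Re z) \<and> fold (cshift (M (u i))) zs p = 0" if "p \<in> \<nn> i \<times> \<nn> i" for p
    by (rule annihilating_list_flag[where U = "flag i" and j = c, OF base.M_linear M_linear flag_subspace[OF i]])
      (use inv ev M_diff_flag[OF i] that c in auto)
  from linear_flow.flow_decay[OF flow \<nn>_subspace[OF i] this] show ?thesis by simp
qed

text \<open>A fixed vector is also fixed by all powers of the inverse, and high powers shrink the
  norm by a factor below 1.\<close>

lemma expanding_no_fixed_vector:
  assumes i: "i < n" and X: "X \<in> \<nn> i" "Ad G A (sg (u i)) X = X"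
  shows "X = 0"
proof (rule ccontr)
  assume X0: "X \<noteq> 0"
  obtain C where C: "C \<ge> 0" "\<And>t. t \<ge> 0 \<Longrightarrow> norm (Ad G A (sg (- t *\<^sub>R u i)) X) \<le> C * exp (- (t / 2)) * norm X"
    using contraction[OF i] X(1) by blast
  have 1: "Ad G A (sg (- u i)) X = X" using Ad_inv(1)[of "sg (u i)" X] X(2) by (simp add: \<sigma>_minus)
  have fixm: "Ad G A (sg (- real m *\<^sub>R u i)) X = X" for m :: nat
  proof (induction m)
    case (Suc m)
    have "sg (- real (Suc m) *\<^sub>R u i) = sg (- u i) \<otimes> sg (- real m *\<^sub>R u i)"
      by (simp add: \<sigma>_add[symmetric] algebra_simps)
    then show ?case using Suc 1 by (simp add: Ad_mult)
  qed (simp add: \<sigma>_0 Ad_one)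
  obtain m :: nat where "2 * C < real m" using reals_Archimedean2 by blast
  then have "C < exp (real m / 2)" using exp_ge_add_one_self[of "real m / 2"] by linarith
  then have m: "C * exp (- (real m / 2)) < 1" by (simp add: exp_minus field_simps)
  have "norm X \<le> C * exp (- (real m / 2)) * norm X" using C(2)[of "real m"] fixm[of m] by simp
  then show False using m X0 by simp
qed

text \<open>\<open>N i\<close> is connected, so its automorphisms are determined by their
  differentials: elements acting alike on the Lie algebra conjugate alike.\<close>

lemma conj_eq:
  assumes i: "i < n" and x: "x \<in> N i" and eq: "\<And>X. X \<in> \<nn> i \<Longrightarrow> Ad G A z X = Ad G A z' X"
  shows "z \<otimes> x \<otimes> inv z = z' \<otimes> x \<otimes> inv z'"
  using lie_automorphism_unique[OF N_subgroup[OF i] N_embedded[OF i] N_connected[OF i]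
    conj_automorphism[OF i, of "Ad G A z" z] conj_automorphism[OF i, of "Ad G A z" z'] x] eq x by simp

text \<open>For \<open>s\<close> this is part of the hypotheses. The splitting \<open>sg\<close>
  differs from \<open>s\<close> on the line of \<open>v\<close> by a curve \<open>y\<close> in
  \<open>N i\<close>, which is a one-parameter group because \<open>s\<close> acts trivially along
  this line. Its direction is fixed by the expanding element \<open>sg (u i)\<close>, hence zero,
  and \<open>y\<close> is constant.\<close>

lemma kernel_acts_trivially:
  assumes i: "i < n" and v: "\<alpha> i v = 0" and X: "X \<in> \<nn> i"
  shows "Ad G A (sg v) X = X"
proof -
  have Ads: "Ad G A (s (r *\<^sub>R v)) Y = Y" if "Y \<in> \<nn> i" for r Y
  proof -
    have "\<alpha> i (r *\<^sub>R v) = \<alpha> i 0" using v linear_scale[OF \<alpha>_linear[OF i]] linear_0[OF \<alpha>_linear[OF i]] by simp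
    then show ?thesis using Ad_s[OF i that, of "r *\<^sub>R v"] Ad_s[OF i that, of 0] by (simp add: base.\<sigma>_0 Ad_one)
  qed
  have s_triv: "s (r *\<^sub>R v) \<otimes> x \<otimes> inv (s (r *\<^sub>R v)) = x" if "x \<in> N i" for r x
    using conj_eq[OF i that, of "s (r *\<^sub>R v)" \<one>] Ads by (simp add: Ad_one)
  define y where "y r = base.p (sg (r *\<^sub>R v)) i" for r
  have yN: "y r \<in> N i" for r unfolding y_def by (rule base.p_in[OF i])
  have y_sm: "smooth_near A y r" for r
    unfolding y_def by (rule smooth_near_compose[OF atlas atlas base.p_smooth[OF i] \<sigma>_near])
  have y0: "y 0 = \<one>" by (simp add: y_def \<sigma>_0 base.p_one[OF i])
  have y_add: "y (r + r') = y r \<otimes> y r'" for r r'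
    using base.p_mult[OF i, of "sg (r *\<^sub>R v)" "sg (r' *\<^sub>R v)"] s_triv[OF yN]
    by (simp add: y_def scaleR_left_distrib \<sigma>_add sg_split)
  let ?Z = "velocity A y 0"
  have Z: "?Z \<in> \<nn> i" by (rule lie_algebraI[OF y_sm y0 open_UNIV UNIV_I]) (use yN in auto)
  \<comment> \<open>\<open>sg (r *\<^sub>R v)\<close> and \<open>sg (u i)\<close> commute. Comparing
    their products in the \<open>N i\<close>-coordinate of \<open>s\<close> shows that
    \<open>y r\<close> is fixed under conjugation by \<open>?b\<close>, which acts on the Lie
    algebra of \<open>N i\<close> like \<open>sg (u i)\<close>.\<close>
  have "Ad G A (sg (u i)) ?Z = ?Z"
  proof -
    let ?a = "base.p (sg (u i)) i"
    let ?b = "?a \<otimes> s (u i)"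
    have "y r = ?b \<otimes> y r \<otimes> inv ?b" for r
    proof -
      have "sg (r *\<^sub>R v) \<otimes> sg (u i) = sg (u i) \<otimes> sg (r *\<^sub>R v)" by (simp add: \<sigma>_add[symmetric] add.commute)
      then have "base.p (sg (r *\<^sub>R v) \<otimes> sg (u i)) i = base.p (sg (u i) \<otimes> sg (r *\<^sub>R v)) i" by simp
      then have "y r \<otimes> ?a = ?a \<otimes> (s (u i) \<otimes> y r \<otimes> inv (s (u i)))"
        unfolding base.p_mult[OF i] sg_split y_def[symmetric] s_triv[OF base.p_in[OF i]] .
      then have "y r \<otimes> ?a \<otimes> inv ?a = ?a \<otimes> (s (u i) \<otimes> y r \<otimes> inv (s (u i))) \<otimes> inv ?a" by simp
      then show ?thesis by (simp add: grp)
    qed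
    then have "velocity A y 0 = velocity A (\<lambda>r. ?b \<otimes> y r \<otimes> inv ?b) 0" by presburger
    also have "\<dots> = Ad G A ?b ?Z" by (rule Ad_velocity[OF y_sm y0])
    also have "\<dots> = Ad G A (sg (u i)) ?Z"
      using base.Ad_decompose[OF i Z, of "sg (u i)"] by (simp add: Ad_mult sg_split)
    finally show ?thesis by simp
  qed
  then have Z0: "?Z = 0" by (rule expanding_no_fixed_vector[OF i Z])
  have "y 1 = y 0"
  proof (rule lvel_zero_imp_constant[of 0 1 y "{}"])
    show "continuous_on {0..1} y"
    proof (rule smooth_map_on_continuous[OF smooth_atlas_euclid atlas])
      show "smooth_map_on euclid_atlas A {0..1} y"
      proof (rule smooth_map_on_local[OF smooth_atlas_euclid atlas])
        fix t :: real assume "t \<in> {0..1}"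
        from y_sm[of t] show "\<exists>U. open U \<and> t \<in> U \<and> smooth_map_on euclid_atlas A ({0..1} \<inter> U) y"
          unfolding smooth_near_def using smooth_map_on_subset[of euclid_atlas A _ y] by (metis Int_lower2)
      qed
    qed
    fix t :: real
    have "inv (y t) \<otimes> y r = y (r - t)" for r using y_add[of t "r - t"] by simp
    then have "lvel y t = velocity A (\<lambda>r. y (r - t)) t" by (simp add: lvel_def)
    also have "\<dots> = 1 *\<^sub>R velocity A y (t - t)"
      by (rule velocity_reparam[where f = "\<lambda>r. r - t", OF atlas y_sm]) (auto intro!: derivative_eq_intros)
    finally show "smooth_near A y t \<and> lvel y t = 0" using y_sm Z0 by simp
  qed auto
  then have "base.p (sg v) i = \<one>" by (simp add: y_def \<sigma>_0 base.p_one[OF i])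
  then show ?thesis using base.Ad_decompose[OF i X, of "sg v"] Ads[OF X, of 1] by (simp add: sg_split Ad_one)
qed

lemma Ad_sg:
  assumes i: "i < n" and X: "X \<in> \<nn> i"
  shows "Ad G A (sg v) X = Ad G A (sg (\<alpha> i v *\<^sub>R u i)) X"
proof -
  have "\<alpha> i (v - \<alpha> i v *\<^sub>R u i) = 0"
    using linear_diff[OF \<alpha>_linear[OF i]] \<alpha>_scale_u[OF i] by simp
  then have "Ad G A (sg (v - \<alpha> i v *\<^sub>R u i)) (Ad G A (sg (\<alpha> i v *\<^sub>R u i)) X) = Ad G A (sg (\<alpha> i v *\<^sub>R u i)) X"
    by (rule kernel_acts_trivially[OF i _ Ad_\<nn>[OF i X]])
  then show ?thesis by (simp add: Ad_mult[symmetric] \<sigma>_add[symmetric])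
qed

text \<open>The line spanned by \<open>u i\<close> already determines the derivation, by injectivity
  of the exponential. That it fits every \<open>v\<close> rests on the trivial action of the kernel
  of \<open>\<alpha> i\<close>.\<close>

lemma split_derivation_eq:
  assumes i: "i < n"
  shows "split_derivation G A N \<alpha> sg i = restrict (M (u i)) (\<nn> i)"
  unfolding split_derivation_def
proof (rule the_equality)
  have MV: "M (u i) X \<in> \<nn> i" if "X \<in> \<nn> i" for X
    by (rule M_invariant[OF \<nn>_subspace[OF i] _ that]) (rule Ad_\<nn>[OF i])
  let ?D = "restrict (M (u i)) (\<nn> i)"
  have V: "X + Y \<in> \<nn> i" "r *\<^sub>R X \<in> \<nn> i" if "X \<in> \<nn> i" "Y \<in> \<nn> i" for X Y r
    using that \<nn>_subspace[OF i] by (auto intro: subspace_add subspace_scale)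
  have "derivation_on G A (\<nn> i) ?D"
    unfolding derivation_on_def
    by (auto simp: MV V bracket_\<nn>[OF i] bracket_add_right bracket_scale_right M_derivation)
  moreover have "Ad G A (sg v) X = exp_op (\<alpha> i v) ?D X" if X: "X \<in> \<nn> i" for v X
  proof -
    have "exp_op (\<alpha> i v) ?D X = exp_op (\<alpha> i v) (M (u i)) X"
      by (rule exp_op_cong[of "\<nn> i"]) (auto simp: MV X)
    then show ?thesis using Ad_sg[OF i X] by (simp add: exp_op_M)
  qed
  ultimately show "?D \<in> extensional (\<nn> i) \<and> derivation_on G A (\<nn> i) ?D \<and>
      (\<forall>v. \<forall>X\<in>\<nn> i. Ad G A (sg v) X = exp_op (\<alpha> i v) ?D X)" by simp
  fix E assume E: "E \<in> extensional (\<nn> i) \<and> derivation_on G A (\<nn> i) E \<and>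
      (\<forall>v. \<forall>X\<in>\<nn> i. Ad G A (sg v) X = exp_op (\<alpha> i v) E X)"
  show "E = ?D"
  proof (rule extensionalityI[of _ "\<nn> i"])
    fix X assume X: "X \<in> \<nn> i"
    have "E X = M (u i) X"
    proof (rule exp_op_injective[OF \<nn>_subspace[OF i], of E "M (u i)" X])
      show "exp_op t E X = exp_op t (M (u i)) X" for t
      proof -
        have "Ad G A (sg (t *\<^sub>R u i)) X = exp_op (\<alpha> i (t *\<^sub>R u i)) E X" using E X by blast
        then show ?thesis by (simp add: \<alpha>_scale_u[OF i] exp_op_M)
      qed
    qed (use X E MV in \<open>auto simp: derivation_on_def bracket_add_right bracket_scale_right\<close>)
    then show "E X = ?D X" using X by simp
  qed (use E in auto)
qed

text \<open>Makes the automorphism in the definition of heights concrete: as a conjugation inside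
  the group it can be applied to paths.\<close>

lemma aut_of_eq:
  assumes i: "i < n" and x: "x \<in> N i"
  shows "aut_of G A (N i) (exp_op (- H) (split_derivation G A N \<alpha> sg i)) x =
    sg (- H *\<^sub>R u i) \<otimes> x \<otimes> inv (sg (- H *\<^sub>R u i))"
proof -
  let ?L = "exp_op (- H) (split_derivation G A N \<alpha> sg i)" and ?z = "sg (- H *\<^sub>R u i)"
  have L: "?L X = Ad G A ?z X" if X: "X \<in> \<nn> i" for X
  proof -
    have MV: "M (u i) X \<in> \<nn> i" if "X \<in> \<nn> i" for X
      by (rule M_invariant[OF \<nn>_subspace[OF i] _ that]) (rule Ad_\<nn>[OF i])
    have "?L X = exp_op (- H) (M (u i)) X"
      unfolding split_derivation_eq[OF i] by (rule exp_op_cong[of "\<nn> i"]) (auto simp: MV X)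
    then show ?thesis by (simp add: exp_op_M)
  qed
  let ?\<phi> = "restrict (\<lambda>x. ?z \<otimes> x \<otimes> inv ?z) (N i)"
  have a: "lie_automorphism G A (N i) ?L ?\<phi>" by (rule conj_automorphism[OF i L])
  have "aut_of G A (N i) ?L = ?\<phi>"
    unfolding aut_of_def
  proof (rule the_equality)
    show "?\<phi> \<in> extensional (N i) \<and> lie_automorphism G A (N i) ?L ?\<phi>" using a by simp
    fix \<psi> assume psi: "\<psi> \<in> extensional (N i) \<and> lie_automorphism G A (N i) ?L \<psi>"
    show "\<psi> = ?\<phi>"
    proof (rule extensionalityI[of _ "N i"])
      fix y assume "y \<in> N i"
      then show "\<psi> y = ?\<phi> y"
        using lie_automorphism_unique[OF N_subgroup[OF i] N_embedded[OF i] N_connected[OF i] _ a] psi by blast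
    qed (use psi in auto)
  qed
  then show ?thesis using x by simp
qed

end

section \<open>Half-space heights\<close>

text \<open>\<open>LEAST\<close> has a meaning only if the minimum is attained. Closedness from the
  right gives this at the infimum of the admissible real heights; if they are unbounded below, the
  minimum is -\<infinity>.\<close>

lemma least_height:
  fixes f :: "real \<Rightarrow> real"
  assumes ev: "\<And>H. H \<ge> H1 \<Longrightarrow> f H \<le> 1" and closed: "\<And>H. (\<And>H'. H' > H \<Longrightarrow> f H' \<le> 1) \<Longrightarrow> f H \<le> 1"
  defines "m \<equiv> (LEAST H0. H0 < (\<infinity>::ereal) \<and> (\<forall>H::real. H0 \<le> ereal H \<longrightarrow> f H \<le> 1))"
  shows "m < \<infinity>" "m \<le> ereal H \<Longrightarrow> f H \<le> 1" "ereal a < m \<Longrightarrow> \<exists>H\<ge>a. 1 < f H"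
proof -
  let ?P = "\<lambda>H0. H0 < (\<infinity>::ereal) \<and> (\<forall>H::real. H0 \<le> ereal H \<longrightarrow> f H \<le> 1)"
  let ?T = "{H. \<forall>H'\<ge>H. f H' \<le> 1}"
  have T1: "H1 \<in> ?T" using ev by auto
  have "\<exists>l. ?P l \<and> (\<forall>y. ?P y \<longrightarrow> l \<le> y)"
  proof (cases "bdd_below ?T")
    case True
    have "?P (ereal (Inf ?T))"
    proof (intro conjI allI impI)
      fix H assume H: "ereal (Inf ?T) \<le> ereal H"
      have above: "f H' \<le> 1" if "H' > Inf ?T" for H'
      proof -
        obtain r where "r \<in> ?T" "r < H'" using cInf_lessD[OF _ \<open>H' > Inf ?T\<close>] T1 by blast
        then show ?thesis by auto
      qed
      show "f H \<le> 1"
        by (rule closed, rule above) (use H in auto)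
    qed simp
    moreover have "ereal (Inf ?T) \<le> y" if y: "?P y" for y
    proof (rule ccontr)
      assume "\<not> ?thesis"
      then have "y < ereal (Inf ?T)" by (simp only: not_le)
      then obtain r where r: "y < ereal r" "ereal r < ereal (Inf ?T)" using ereal_dense2 by blast
      have "f H' \<le> 1" if "r \<le> H'" for H'
      proof -
        have "y \<le> ereal H'" using r(1) that by (meson ereal_less_eq(3) less_le_trans less_imp_le)
        then show ?thesis using y by blast
      qed
      then have "Inf ?T \<le> r" by (intro cInf_lower[OF _ True]) auto
      then show False using r(2) by simp
    qed
    ultimately show ?thesis by blast
  next
    case False
    have "f H \<le> 1" for H
    proof -
      obtain r where "r \<in> ?T" "r < H" using False unfolding bdd_below_def by (meson not_le)
      then show ?thesis by auto
    qed
    then show ?thesis by (intro exI[of _ "- \<infinity>"]) auto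
  qed
  then obtain l where l: "?P l" "\<And>y. ?P y \<Longrightarrow> l \<le> y" by blast
  have m: "m = l" unfolding m_def by (rule Least_equality[of ?P l]) (fact l)+
  show "m < \<infinity>" "m \<le> ereal H \<Longrightarrow> f H \<le> 1" unfolding m using l(1) by blast+
  show "\<exists>H\<ge>a. 1 < f H" if a: "ereal a < m"
  proof (rule ccontr)
    assume no: "\<not> ?thesis"
    have Pa: "?P (ereal a)"
    proof (intro conjI allI impI)
      fix H assume "ereal a \<le> ereal H"
      then show "f H \<le> 1" using no by (meson ereal_less_eq(3) not_le)
    qed simp
    have "l \<le> ereal a" by (rule l(2)) (fact Pa)
    with a show False unfolding m using leD by blast
  qed
qed

context metric_lie_group
begin

lemma path_dist_le:
  assumes "ps_path K x y \<gamma>" shows "path_dist A g K x y \<le> curve_length A g \<gamma>"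
  unfolding path_dist_def
proof (rule cInf_lower)
  show "curve_length A g \<gamma> \<in> {curve_length A g \<gamma> |\<gamma> F. piecewise_smooth A F \<gamma> \<and> path_image \<gamma> \<subseteq> K \<and> pathstart \<gamma> = x \<and> pathfinish \<gamma> = y}"
    using assms by (auto simp: ps_path_def)
  show "bdd_below {curve_length A g \<gamma> |\<gamma> F. piecewise_smooth A F \<gamma> \<and> path_image \<gamma> \<subseteq> K \<and> pathstart \<gamma> = x \<and> pathfinish \<gamma> = y}"
    by (rule bdd_belowI[of _ 0]) (auto simp: curve_length_nonneg)
qed

lemma path_dist_less:
  assumes "ps_path K x y \<gamma>" "path_dist A g K x y < d"
  obtains \<gamma>' where "ps_path K x y \<gamma>'" "curve_length A g \<gamma>' < d"
proof -
  let ?L = "{curve_length A g \<gamma> |\<gamma> F. piecewise_smooth A F \<gamma> \<and> path_image \<gamma> \<subseteq> K \<and> pathstart \<gamma> = x \<and> pathfinish \<gamma> = y}"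
  have "curve_length A g \<gamma> \<in> ?L" using assms(1) by (auto simp: ps_path_def)
  then have "?L \<noteq> {}" by (rule ex_in_conv[THEN iffD1, OF exI])
  moreover have "Inf ?L < d" using assms(2) by (simp only: path_dist_def)
  ultimately obtain l where l: "l \<in> ?L" "l < d" by (rule cInf_lessD[THEN bexE])
  then obtain \<gamma>' F where g: "l = curve_length A g \<gamma>'" "piecewise_smooth A F \<gamma>'" "path_image \<gamma>' \<subseteq> K"
    "pathstart \<gamma>' = x" "pathfinish \<gamma>' = y" by (elim CollectE exE conjE)
  show ?thesis by (rule that[of \<gamma>']) (use g l(2) in \<open>auto simp: ps_path_def\<close>)
qed

lemma conj_path_length_le:
  assumes k: "piecewise_smooth A F k" and f: "f integrable_on {0..1}"
    and le: "\<And>t. t \<in> {0<..<1} - F \<Longrightarrow> gn (Ad G A z (lvel k t)) \<le> f t"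
  shows "curve_length A g (\<lambda>t. z \<otimes> k t \<otimes> inv z) \<le> integral {0..1} f"
proof -
  have ps: "piecewise_smooth A F (\<lambda>t. z \<otimes> k t \<otimes> inv z)"
    by (rule piecewise_smooth_image[OF atlas k smooth_conj subset_UNIV])
  let ?f = "\<lambda>t. if t \<in> {0<..<1} - F then f t else gn (lvel (\<lambda>t. z \<otimes> k t \<otimes> inv z) t)"
  have N: "negligible (insert 0 (insert 1 F))" using k by (intro negligible_finite) (simp add: piecewise_smooth_def)
  have "?f integrable_on {0..1}" by (rule integrable_spike[OF f N]) auto
  then have "integral {0..1} (\<lambda>t. gn (lvel (\<lambda>t. z \<otimes> k t \<otimes> inv z) t)) \<le> integral {0..1} ?f"
    by (rule integral_le[OF speed_integrable[OF ps]])
      (use le lvel_conj[OF piecewise_smooth_near[OF k]] in auto)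
  also have "\<dots> = integral {0..1} f" by (rule integral_spike[OF N]) auto
  finally show ?thesis by (simp add: curve_length_lvel[OF ps])
qed

end

context sol_split
begin

section \<open>Splitting the speed into its Euclidean and nilpotent parts\<close>

definition bform :: "real^'k \<Rightarrow> real^'k \<Rightarrow> real" where "bform x y = g \<one> (S x) (S y)"

sublocale vm: psd_form bform
proof
  show "bilinear bform"
    unfolding bilinear_def bform_def
    by (auto intro!: linearI simp: linear_add[OF S_linear] linear_scale[OF S_linear] gm.b_simps)
  show "bform x y = bform y x" for x y by (simp add: bform_def gm.b_sym)
  show "0 \<le> bform x x" for x by (simp add: bform_def gm.b_nonneg)
qed

lemma vm_nrm: "vm.nrm x = gn (S x)"
  by (simp add: vm.nrm_def gm.nrm_def bform_def)

definition dP :: "nat \<Rightarrow> 'e \<Rightarrow> 'e" where "dP i = differential A A (\<lambda>z. p z i) \<one>"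
definition dQ :: "'e \<Rightarrow> real^'k" where "dQ = differential A euclid_atlas q \<one>"

lemma dP_linear: "i < n \<Longrightarrow> linear (dP i)"
  unfolding dP_def by (rule differential_linear[OF atlas atlas p_smooth])

lemma dP_velocity: "i < n \<Longrightarrow> smooth_near A a t \<Longrightarrow> a t = \<one> \<Longrightarrow> velocity A (\<lambda>s. p (a s) i) t = dP i (velocity A a t)"
  using velocity_compose[OF atlas atlas p_smooth] by (simp add: dP_def)

lemma dQ_velocity: "smooth_near A a t \<Longrightarrow> a t = \<one> \<Longrightarrow> velocity euclid_atlas (\<lambda>s. q (a s)) t = dQ (velocity A a t)"
  using velocity_compose[OF atlas smooth_atlas_euclid q_smooth] by (simp add: dQ_def)

text \<open>By the multiplication rule of the semidirect product, an increment made at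
  \<open>\<gamma> t\<close> enters the \<open>N i\<close>-coordinate after conjugation by
  \<open>sg (q (\<gamma> t))\<close>. This \<open>Ad\<close> is the source of all exponential
  weights.\<close>

lemma lvel_p:
  assumes i: "i < n" and n: "smooth_near A \<gamma> t"
  shows "lvel (\<lambda>s. p (\<gamma> s) i) t = Ad G A (sg (q (\<gamma> t))) (dP i (lvel \<gamma> t))"
proof -
  let ?c = "\<lambda>s. inv (\<gamma> t) \<otimes> \<gamma> s" and ?z = "sg (q (\<gamma> t))"
  have nc: "smooth_near A ?c t" by (rule near_lmult[OF n])
  have "inv (p (\<gamma> t) i) \<otimes> p (\<gamma> s) i = ?z \<otimes> p (?c s) i \<otimes> inv ?z" for s
    using p_mult[OF i, of "\<gamma> t" "?c s"] by (simp add: grp)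
  then have "lvel (\<lambda>s. p (\<gamma> s) i) t = velocity A (\<lambda>s. ?z \<otimes> p (?c s) i \<otimes> inv ?z) t"
    by (simp add: lvel_def)
  also have "\<dots> = Ad G A ?z (velocity A (\<lambda>s. p (?c s) i) t)"
    by (rule Ad_velocity[OF smooth_near_compose[OF atlas atlas p_smooth[OF i] nc]]) (simp add: p_one[OF i])
  finally show ?thesis using dP_velocity[OF i nc] by (simp add: lvel_def)
qed

lemma q_derivative:
  assumes n: "smooth_near A \<gamma> t"
  shows "((\<lambda>s. q (\<gamma> s)) has_vector_derivative dQ (lvel \<gamma> t)) (at t)"
proof -
  let ?c = "\<lambda>s. inv (\<gamma> t) \<otimes> \<gamma> s"
  have nc: "smooth_near A ?c t" by (rule near_lmult[OF n])
  have "((\<lambda>s. q (?c s)) has_vector_derivative velocity euclid_atlas (\<lambda>s. q (?c s)) t) (at t)"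
    using has_velocity[OF smooth_atlas_euclid smooth_near_compose[OF atlas smooth_atlas_euclid q_smooth nc]]
    by (simp add: chart_at_euclid)
  then have "((\<lambda>s. q (\<gamma> t) + q (?c s)) has_vector_derivative dQ (lvel \<gamma> t)) (at t)"
    using dQ_velocity[OF nc] by (simp add: lvel_def has_vector_derivative_add_const add.commute[of "q (\<gamma> t)"])
  then show ?thesis by (simp add: q_mult[symmetric])
qed

lemma dP_\<nn>: "i < n \<Longrightarrow> dP i X \<in> \<nn> i"
proof -
  assume i: "i < n"
  obtain a where a: "curve_in A UNIV \<one> a" "velocity A a 0 = X" by (rule tangent_vector_ex[OF atlas])
  have a0: "smooth_near A a 0" "a 0 = \<one>" using a(1) curve_in_smooth_near[OF a(1)] by (auto simp: curve_in_def)
  have "velocity A (\<lambda>s. p (a s) i) 0 \<in> \<nn> i"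
    by (rule lie_algebraI[OF smooth_near_compose[OF atlas atlas p_smooth[OF i] a0(1)] _ open_UNIV UNIV_I])
      (use a0 in \<open>auto simp: p_one[OF i] p_in[OF i]\<close>)
  then show ?thesis using dP_velocity[OF i a0] a(2) by simp
qed

text \<open>Perpendicularity of the splitting makes the quotient map a Riemannian submersion.\<close>

lemma speed_splitting:
  "g \<one> X X = bform (dQ X) (dQ X) + g \<one> (X - S (dQ X)) (X - S (dQ X)) \<and> (i < n \<longrightarrow> dP i X = dP i (X - S (dQ X)))"
proof -
  obtain a where a: "curve_in A UNIV \<one> a" "velocity A a 0 = X" by (rule tangent_vector_ex[OF atlas])
  have a0: "smooth_near A a 0" "a 0 = \<one>" using a(1) curve_in_smooth_near[OF a(1)] by (auto simp: curve_in_def)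
  have nq: "smooth_near euclid_atlas (\<lambda>s. q (a s)) 0"
    by (rule smooth_near_compose[OF atlas smooth_atlas_euclid q_smooth a0(1)])
  let ?c = "\<lambda>s. sg (q (a s))"
  have nc: "smooth_near A ?c 0" by (rule smooth_near_compose[OF smooth_atlas_euclid atlas \<sigma>_smooth nq])
  have c0: "?c 0 = \<one>" using a0 by (simp add: q_one \<sigma>_0)
  have vc: "velocity A ?c 0 = S (dQ X)"
    using velocity_compose[OF smooth_atlas_euclid atlas \<sigma>_smooth nq] dQ_velocity[OF a0] a0 a(2)
    by (simp add: q_one S_differential)
  \<comment> \<open>The nilpotent component of the curve: it stays in the kernel of
    \<open>q\<close>, so its velocity \<open>X - S (dQ X)\<close> is orthogonal to the
    splitting.\<close>
  let ?b = "\<lambda>s. a s \<otimes> inv (?c s)"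
  have nb: "smooth_near A ?b 0" by (rule near_mult[OF a0(1) near_inv[OF nc]])
  have b0: "?b 0 = \<one>" using a0 c0 by simp
  have vb: "velocity A ?b 0 = X - S (dQ X)"
    using velocity_mult_one[OF a0 near_inv[OF nc]] velocity_inv_one[OF nc c0] vc c0 a(2) by simp
  have "velocity A ?b 0 \<in> Lie (nil_subgroup G n N)"
    by (rule lie_algebraI[OF nb b0 open_UNIV UNIV_I]) (auto simp: nil_subgroup_kernel q_mult q_inv q_\<sigma>)
  moreover have "S (dQ X) \<in> tangent_space A (range sg) \<one>"
    using velocity_in_tangent[where t = 0 and S = "range sg", OF atlas \<sigma>_near[of "dQ X"] open_UNIV UNIV_I]
    by (auto simp: S_def \<sigma>_0)
  ultimately have o: "g \<one> (S (dQ X)) (X - S (dQ X)) = 0"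
    using perp vb unfolding perpendicular_splitting_def by auto
  have "g \<one> X X = g \<one> (S (dQ X) + (X - S (dQ X))) (S (dQ X) + (X - S (dQ X)))" by simp
  also have "\<dots> = bform (dQ X) (dQ X) + g \<one> (X - S (dQ X)) (X - S (dQ X))"
    using o gm.b_sym[of "X - S (dQ X)" "S (dQ X)"]
    by (simp only: bilinear_ladd[OF gm.b_bilinear] bilinear_radd[OF gm.b_bilinear] bform_def)
  finally have 1: "g \<one> X X = bform (dQ X) (dQ X) + g \<one> (X - S (dQ X)) (X - S (dQ X))" .
  have "dP i X = dP i (X - S (dQ X))" if i: "i < n"
  proof -
    have "p (?b s) i = p (a s) i" for s
      unfolding \<sigma>_minus[symmetric] p_mult[OF i] p_\<sigma>[OF i] by (simp add: \<sigma>_minus)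
    then show ?thesis using dP_velocity[OF i nb b0] dP_velocity[OF i a0] vb a(2) by simp
  qed
  with 1 show ?thesis by blast
qed

text \<open>\<open>dP i\<close> sees only the part of \<open>X\<close> orthogonal to the splitting
  and is bounded on it, so the comparison of norms affects \<open>c\<close> but not the coefficient
  of \<open>bform\<close>.\<close>

lemma speed_lower_bound:
  "\<exists>c>0. \<forall>i<n. \<forall>X. bform (dQ X) (dQ X) + (c * gn (dP i X))\<^sup>2 \<le> (gn X)\<^sup>2"
proof -
  obtain K1 where K1: "K1 > 0" "\<And>X. gn X \<le> K1 * norm X" using gn_upper by blast
  obtain K2 where K2: "K2 > 0" "\<And>X. norm X \<le> K2 * gn X" using gn_lower by blast
  have "\<exists>K>0. \<forall>X. norm (dP i X) \<le> norm X * K" if "i < n" for i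
    using dP_linear[OF that] linear_conv_bounded_linear bounded_linear.pos_bounded by blast
  then obtain K where K: "\<And>i. i < n \<Longrightarrow> K i > 0 \<and> (\<forall>X. norm (dP i X) \<le> norm X * K i)" by metis
  \<comment> \<open>A common bound for all factors; the summand 1 keeps it positive when there are
    none.\<close>
  define K3 where "K3 = 1 + (\<Sum>i<n. K i)"
  have K3: "K3 > 0" "\<And>i. i < n \<Longrightarrow> K i \<le> K3"
    using K sum_nonneg[of "{..<n}" K] member_le_sum[of _ "{..<n}" K] unfolding K3_def
    by (auto simp: less_imp_le add_pos_nonneg) (smt (verit) K finite_lessThan lessThan_iff member_le_sum)
  let ?c = "inverse (K1 * K2 * K3)"
  have c: "?c > 0" using K1 K2 K3 by simp
  have "bform (dQ X) (dQ X) + (?c * gn (dP i X))\<^sup>2 \<le> (gn X)\<^sup>2" if i: "i < n" for i X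
  proof -
    let ?Y = "X - S (dQ X)"
    have "gn (dP i X) = gn (dP i ?Y)" using speed_splitting[of X i] i by simp
    also have "\<dots> \<le> K1 * norm (dP i ?Y)" by (rule K1(2))
    also have "\<dots> \<le> K1 * (norm ?Y * K3)"
    proof (rule mult_left_mono)
      have "norm (dP i ?Y) \<le> norm ?Y * K i" using K[OF i] by blast
      also have "\<dots> \<le> norm ?Y * K3" using K3(2)[OF i] by (intro mult_left_mono) auto
      finally show "norm (dP i ?Y) \<le> norm ?Y * K3" .
    qed (use K1(1) in simp)
    also have "\<dots> \<le> K1 * (K2 * gn ?Y * K3)"
      using K2(2)[of ?Y] K1(1) K3(1) by (intro mult_left_mono mult_right_mono) auto
    finally have "gn (dP i X) \<le> K1 * K2 * K3 * gn ?Y" by (simp add: mult_ac)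
    then have "?c * gn (dP i X) \<le> ?c * (K1 * K2 * K3 * gn ?Y)" using c by (intro mult_left_mono) auto
    also have "\<dots> = gn ?Y" using K1(1) K2(1) K3(1) by (simp add: field_simps)
    finally have "(?c * gn (dP i X))\<^sup>2 \<le> (gn ?Y)\<^sup>2"
      using c gm.nrm_nonneg by (intro power_mono) auto
    then show ?thesis using speed_splitting[of X i] by (simp add: gm.nrm_sq)
  qed
  with c show ?thesis by blast
qed

lemma gn_contraction:
  "\<exists>C>0. \<forall>i<n. \<forall>X\<in>\<nn> i. \<forall>t\<ge>0. gn (Ad G A (sg (- t *\<^sub>R u i)) X) \<le> C * exp (- (t / 2)) * gn X"
proof -
  obtain K1 where K1: "K1 > 0" "\<And>X. gn X \<le> K1 * norm X" using gn_upper by blast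
  obtain K2 where K2: "K2 > 0" "\<And>X. norm X \<le> K2 * gn X" using gn_lower by blast
  obtain C where C: "\<And>i. i < n \<Longrightarrow> C i \<ge> 0 \<and>
      (\<forall>X\<in>\<nn> i. \<forall>t\<ge>0. norm (Ad G A (sg (- t *\<^sub>R u i)) X) \<le> C i * exp (- (t / 2)) * norm X)"
    using contraction by metis
  define C' where "C' = 1 + (\<Sum>i<n. C i)"
  have C': "C' > 0" "\<And>i. i < n \<Longrightarrow> C i \<le> C'"
  proof -
    have s: "0 \<le> (\<Sum>i<n. C i)" using C by (intro sum_nonneg) auto
    then show "C' > 0" by (simp add: C'_def)
    fix i assume "i < n"
    then have "C i \<le> (\<Sum>i<n. C i)" using C by (intro member_le_sum) auto
    then show "C i \<le> C'" by (simp add: C'_def)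
  qed
  have "gn (Ad G A (sg (- t *\<^sub>R u i)) X) \<le> K1 * C' * K2 * exp (- (t / 2)) * gn X"
    if i: "i < n" and X: "X \<in> \<nn> i" and t: "t \<ge> 0" for i X t
  proof -
    have "gn (Ad G A (sg (- t *\<^sub>R u i)) X) \<le> K1 * norm (Ad G A (sg (- t *\<^sub>R u i)) X)" by (rule K1(2))
    also have "\<dots> \<le> K1 * (C i * exp (- (t / 2)) * norm X)"
      using C[OF i] X t K1(1) by (intro mult_left_mono) auto
    also have "\<dots> \<le> K1 * (C' * exp (- (t / 2)) * (K2 * gn X))"
      using C'(2)[OF i] K2(2)[of X] K1(1) C'(1) by (intro mult_left_mono mult_mono) auto
    finally show ?thesis by (simp add: mult_ac)
  qed
  moreover have "K1 * C' * K2 > 0" using K1 K2 C' by simp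
  ultimately show ?thesis by blast
qed

text \<open>The quantity compared with 1 in the half-space height, as a function of the level
  \<open>H\<close>. The contraction holds only up to a constant, so monotonicity in \<open>H\<close>
  is not at hand; eventual smallness and closedness from the right replace it.\<close>

definition fH :: "nat \<Rightarrow> 'g \<Rightarrow> real \<Rightarrow> real" where
  "fH i h H = path_dist A g (N i) \<one> (sg (- H *\<^sub>R u i) \<otimes> h \<otimes> inv (sg (- H *\<^sub>R u i)))"

lemma N_path: "i < n \<Longrightarrow> h \<in> N i \<Longrightarrow> \<exists>k. ps_path (N i) \<one> h k"
  by (rule smooth_paths_in_subgroup[OF N_subgroup N_embedded N_connected])

lemma ps_path_conj:
  assumes "i < n" "ps_path (N i) x y k"
  shows "ps_path (N i) (z \<otimes> x \<otimes> inv z) (z \<otimes> y \<otimes> inv z) (\<lambda>t. z \<otimes> k t \<otimes> inv z)"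
  by (rule ps_path_image[OF assms(2) smooth_map_on_subset[OF smooth_conj]]) (use normal[OF assms(1)] in auto)

lemma ps_path_lvel:
  assumes i: "i < n" and k: "piecewise_smooth A F k" "path_image k \<subseteq> N i" and t: "t \<in> {0<..<1} - F"
  shows "lvel k t \<in> \<nn> i"
  by (rule lvel_in_lie_algebra[OF N_subgroup[OF i] piecewise_smooth_near[OF k(1) t], of "{0<..<1}"])
    (use k(2) t in \<open>auto simp: path_image_def image_subset_iff\<close>)

lemma fH_eventually:
  assumes i: "i < n" and h: "h \<in> N i"
  shows "\<exists>H1. \<forall>H\<ge>H1. fH i h H \<le> 1"
proof -
  obtain C where C: "C > 0" "\<And>X t. X \<in> \<nn> i \<Longrightarrow> t \<ge> 0 \<Longrightarrow> gn (Ad G A (sg (- t *\<^sub>R u i)) X) \<le> C * exp (- (t / 2)) * gn X"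
    using gn_contraction i by blast
  obtain k where k: "ps_path (N i) \<one> h k" using N_path[OF i h] by blast
  then obtain F where F: "piecewise_smooth A F k" "path_image k \<subseteq> N i" by (auto simp: ps_path_def)
  let ?l = "curve_length A g k"
  have l: "0 \<le> ?l" by (rule curve_length_nonneg[OF F(1)])
  have le: "fH i h H \<le> C * exp (- (H / 2)) * ?l" if H: "H \<ge> 0" for H
  proof -
    let ?z = "sg (- H *\<^sub>R u i)"
    have "fH i h H \<le> curve_length A g (\<lambda>t. ?z \<otimes> k t \<otimes> inv ?z)"
      unfolding fH_def by (rule path_dist_le) (use ps_path_conj[OF i k, of ?z] in simp)
    also have "\<dots> \<le> integral {0..1} (\<lambda>t. C * exp (- (H / 2)) * gn (lvel k t))"
      by (rule conj_path_length_le[OF F(1) integrable_on_mult_right[OF speed_integrable[OF F(1)]]])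
        (rule C(2)[OF ps_path_lvel[OF i F] H])
    also have "\<dots> = C * exp (- (H / 2)) * ?l" by (simp add: curve_length_lvel[OF F(1)])
    finally show ?thesis .
  qed
  \<comment> \<open>The threshold comes from \<open>exp (H / 2) \<ge> 1 + H / 2\<close>.\<close>
  have "fH i h H \<le> 1" if H: "H \<ge> 2 * (C * ?l)" for H
  proof -
    have H0: "0 \<le> H" using H C(1) l by (smt (verit) mult_nonneg_nonneg)
    have "C * ?l \<le> exp (H / 2)" using exp_ge_add_one_self[of "H / 2"] H by linarith
    then have "C * exp (- (H / 2)) * ?l \<le> 1" by (simp add: exp_minus field_simps)
    then show ?thesis using le[OF H0] by linarith
  qed
  then show ?thesis by blast
qed

text \<open>Passing from level \<open>H + r\<close> back to \<open>H\<close> conjugates a path by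
  \<open>sg (r *\<^sub>R u i)\<close>, which stretches lengths by a factor tending to 1 with
  \<open>r\<close>. The factor \<open>1 + r\<close> in the estimate is there because the infimum of
  lengths need not be attained.\<close>

lemma fH_right_closed:
  assumes i: "i < n" and h: "h \<in> N i" and gt: "\<And>H'. H' > H \<Longrightarrow> fH i h H' \<le> 1"
  shows "fH i h H \<le> 1"
proof -
  obtain K1 where K1: "K1 > 0" "\<And>X. gn X \<le> K1 * norm X" using gn_upper by blast
  obtain K2 where K2: "K2 > 0" "\<And>X. norm X \<le> K2 * gn X" using gn_lower by blast
  let ?B = "\<lambda>r. Ad G A (sg (r *\<^sub>R u i))"
  \<comment> \<open>The distance of \<open>Ad\<close> from the identity on a basis. It tends to 0,
    whereas the constant of the contraction would not give a factor close to 1.\<close>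
  define \<delta> where "\<delta> r = (\<Sum>b\<in>Basis. norm (?B r b - b))" for r
  have "isCont (\<lambda>r. ?B r b) 0" for b
    using linear_flow.B_continuous[OF flow, of UNIV "u i" b] by (simp add: continuous_on_eq_continuous_at)
  then have "isCont \<delta> 0" unfolding \<delta>_def by (intro continuous_intros)
  moreover have "\<delta> 0 = 0" by (simp add: \<delta>_def \<sigma>_0 Ad_one)
  ultimately have d0: "(\<delta> \<longlongrightarrow> 0) (at 0)" by (metis isContD)
  have B: "gn (?B r X) \<le> (1 + K1 * K2 * \<delta> r) * gn X" for r X
  proof -
    have l: "linear (\<lambda>X. ?B r X - X)" by (intro linear_compose_sub Ad_linear linear_ident)
    have "?B r X - X = (\<Sum>b\<in>Basis. (X \<bullet> b) *\<^sub>R (?B r b - b))"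
    proof -
      have "(\<lambda>X. ?B r X - X) X = (\<lambda>X. ?B r X - X) (\<Sum>b\<in>Basis. (X \<bullet> b) *\<^sub>R b)"
        by (simp add: euclidean_representation)
      then show ?thesis unfolding linear_sum[OF l] linear_scale[OF l] .
    qed
    also have "norm \<dots> \<le> (\<Sum>b\<in>Basis. norm X * norm (?B r b - b))"
      by (rule sum_norm_le) (simp add: mult_right_mono Basis_le_norm)
    finally have "norm (?B r X - X) \<le> norm X * \<delta> r" by (simp add: \<delta>_def sum_distrib_left)
    then have "gn (?B r X - X) \<le> K1 * (norm X * \<delta> r)"
      using K1 by (meson mult_left_mono less_imp_le order_trans)
    also have "\<dots> \<le> K1 * (K2 * gn X * \<delta> r)"
      using K1(1) K2(2)[of X] by (intro mult_left_mono mult_right_mono) (auto simp: \<delta>_def intro: sum_nonneg)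
    finally have "gn (?B r X - X) \<le> K1 * K2 * \<delta> r * gn X" by (simp add: mult_ac)
    then show ?thesis using gm.nrm_triangle[of X "?B r X - X"] by (simp add: algebra_simps)
  qed
  have le: "fH i h H \<le> (1 + K1 * K2 * \<delta> r) * (1 + r)" if r: "r > 0" for r
  proof -
    let ?z = "sg (- (H + r) *\<^sub>R u i)" and ?w = "sg (r *\<^sub>R u i)"
    have zN: "?z \<otimes> h \<otimes> inv ?z \<in> N i" by (rule normal[OF i h])
    obtain k0 where "ps_path (N i) \<one> (?z \<otimes> h \<otimes> inv ?z) k0" using N_path[OF i zN] by blast
    moreover have "path_dist A g (N i) \<one> (?z \<otimes> h \<otimes> inv ?z) < 1 + r" using gt[of "H + r"] r by (simp add: fH_def)
    ultimately obtain k where k: "ps_path (N i) \<one> (?z \<otimes> h \<otimes> inv ?z) k" "curve_length A g k < 1 + r"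
      by (rule path_dist_less)
    then obtain F where F: "piecewise_smooth A F k" by (auto simp: ps_path_def)
    have wz: "?w \<otimes> ?z = sg (- H *\<^sub>R u i)" unfolding \<sigma>_add[symmetric] by (simp add: algebra_simps)
    have "?w \<otimes> (?z \<otimes> h \<otimes> inv ?z) \<otimes> inv ?w = (?w \<otimes> ?z) \<otimes> h \<otimes> inv (?w \<otimes> ?z)" by (simp add: grp)
    then have e: "?w \<otimes> (?z \<otimes> h \<otimes> inv ?z) \<otimes> inv ?w = sg (- H *\<^sub>R u i) \<otimes> h \<otimes> inv (sg (- H *\<^sub>R u i))" unfolding wz .
    have "ps_path (N i) \<one> (sg (- H *\<^sub>R u i) \<otimes> h \<otimes> inv (sg (- H *\<^sub>R u i))) (\<lambda>t. ?w \<otimes> k t \<otimes> inv ?w)"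
      using ps_path_conj[OF i k(1), of ?w] unfolding e by simp
    then have "fH i h H \<le> curve_length A g (\<lambda>t. ?w \<otimes> k t \<otimes> inv ?w)" unfolding fH_def by (rule path_dist_le)
    also have "\<dots> \<le> integral {0..1} (\<lambda>t. (1 + K1 * K2 * \<delta> r) * gn (lvel k t))"
      by (rule conj_path_length_le[OF F integrable_on_mult_right[OF speed_integrable[OF F]] B])
    also have "\<dots> = (1 + K1 * K2 * \<delta> r) * curve_length A g k" by (simp add: curve_length_lvel[OF F])
    also have "\<dots> \<le> (1 + K1 * K2 * \<delta> r) * (1 + r)"
      using k(2) K1(1) K2(1) by (intro mult_left_mono) (auto simp: \<delta>_def intro!: add_nonneg_nonneg mult_nonneg_nonneg sum_nonneg)
    finally show ?thesis .
  qed
  have "((\<lambda>r. (1 + K1 * K2 * \<delta> r) * (1 + r)) \<longlongrightarrow> (1 + K1 * K2 * 0) * (1 + 0)) (at_right 0)"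
    by (intro tendsto_intros tendsto_within_subset[OF d0]) auto
  moreover have "eventually (\<lambda>r. fH i h H \<le> (1 + K1 * K2 * \<delta> r) * (1 + r)) (at_right 0)"
    using le by (simp add: eventually_at_filter)
  ultimately show ?thesis using tendsto_lowerbound[of _ "(1 + K1 * K2 * 0) * (1 + 0)" "at_right (0::real)"] by fastforce
qed

abbreviation "height i x y \<equiv> half_space_height G A n N \<alpha> g sg i x y"

lemma height:
  assumes i: "i < n"
  shows "height i x y < \<infinity>" "height i x y \<le> ereal H \<Longrightarrow> fH i (p (inv x \<otimes> y) i) H \<le> 1"
    "ereal a < height i x y \<Longrightarrow> \<exists>H\<ge>a. 1 < fH i (p (inv x \<otimes> y) i) H"
proof -
  let ?h = "p (inv x \<otimes> y) i"
  have h: "?h \<in> N i" by (rule p_in[OF i])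
  have e: "height i x y = (LEAST H0. H0 < \<infinity> \<and> (\<forall>H::real. H0 \<le> ereal H \<longrightarrow> fH i ?h H \<le> 1))"
    unfolding half_space_height_def aut_of_eq[OF i h] fH_def ..
  obtain H1 where H1: "\<And>H. H \<ge> H1 \<Longrightarrow> fH i ?h H \<le> 1" using fH_eventually[OF i h] by blast
  show "height i x y < \<infinity>" "height i x y \<le> ereal H \<Longrightarrow> fH i ?h H \<le> 1"
    "ereal a < height i x y \<Longrightarrow> \<exists>H\<ge>a. 1 < fH i ?h H"
    unfolding e
    using least_height(1)[of H1 "fH i ?h", OF H1 fH_right_closed[OF i h]]
      least_height(2)[of H1 "fH i ?h" H, OF H1 fH_right_closed[OF i h]]
      least_height(3)[of H1 "fH i ?h" a, OF H1 fH_right_closed[OF i h]] by auto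
qed

end

section \<open>Box paths\<close>

lemma (in semidirect) p_q_lprod:
  assumes "distinct is" "set is \<subseteq> {..<n}" "\<And>j. j < n \<Longrightarrow> h j \<in> N j"
  shows "q (lprod h is) = 0 \<and> (\<forall>i<n. p (lprod h is) i = (if i \<in> set is then h i else \<one>))"
  using assms(1,2)
proof (induction "is")
  case (Cons j "is")
  have j: "j < n" "h j \<in> N j" using Cons.prems assms(3) by auto
  show ?case
    using Cons q_N[OF j] p_N[OF j] by (auto simp: p_mult q_mult \<sigma>_0)
qed (simp add: q_one p_one)

lemma (in semidirect) lprod_reorder:
  assumes "distinct is" "set is = {..<n}" "\<And>j. j < n \<Longrightarrow> h j \<in> N j"
  shows "lprod h is = lprod h [0..<n]"
proof -
  have 1: "q (lprod h is) = 0 \<and> (\<forall>i<n. p (lprod h is) i = (if i \<in> set is then h i else \<one>))"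
    by (rule p_q_lprod[OF assms(1) _ assms(3)]) (simp add: assms(2))
  have 2: "q (lprod h [0..<n]) = 0 \<and> (\<forall>i<n. p (lprod h [0..<n]) i = (if i \<in> set [0..<n] then h i else \<one>))"
    by (rule p_q_lprod[OF _ _ assms(3)]) auto
  show ?thesis by (rule p_q_eqI) (use 1 2 assms(2) in simp_all)
qed

context sol_split
begin

text \<open>Tangency to a coset in integrated form: locally the path stays in it. This implies the
  velocity condition of \<open>box_path\<close> and is plainly stable under translation,
  reparametrization and joining.\<close>

definition near_coset :: "'g set \<Rightarrow> (real \<Rightarrow> 'g) \<Rightarrow> real \<Rightarrow> bool" where
  "near_coset K \<gamma> t \<longleftrightarrow> (\<exists>U. open U \<and> t \<in> U \<and> (\<forall>r\<in>U. inv (\<gamma> t) \<otimes> \<gamma> r \<in> K))"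

lemma near_coset_velocity:
  assumes "smooth_near A \<gamma> t" "near_coset K \<gamma> t"
  shows "velocity A \<gamma> t \<in> tangent_space A (\<gamma> t <# K) (\<gamma> t)"
proof -
  obtain U where U: "open U" "t \<in> U" "\<And>r. r \<in> U \<Longrightarrow> inv (\<gamma> t) \<otimes> \<gamma> r \<in> K"
    using assms(2) unfolding near_coset_def by blast
  have "\<gamma> r \<in> \<gamma> t <# K" if "r \<in> U" for r
    unfolding l_coset_def using U(3)[OF that] by (intro UN_I[of "inv (\<gamma> t) \<otimes> \<gamma> r"]) auto
  then show ?thesis by (intro velocity_in_tangent[OF atlas assms(1) U(1,2)]) auto
qed

lemma near_coset_reparam:
  assumes "near_coset K \<gamma> (m * t + c)" "open V" "t \<in> V" "\<And>r. r \<in> V \<Longrightarrow> \<gamma>' r = \<gamma> (m * r + c)"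
  shows "near_coset K \<gamma>' t"
proof -
  obtain U where U: "open U" "m * t + c \<in> U" "\<And>r. r \<in> U \<Longrightarrow> inv (\<gamma> (m * t + c)) \<otimes> \<gamma> r \<in> K"
    using assms(1) unfolding near_coset_def by blast
  have "open ((\<lambda>r. m * r + c) -` U)" by (rule open_vimage[OF U(1)]) (intro continuous_intros)
  then have "open (V \<inter> (\<lambda>r. m * r + c) -` U)" using assms(2) by blast
  then show ?thesis unfolding near_coset_def
    by (intro exI[of _ "V \<inter> (\<lambda>r. m * r + c) -` U"]) (use U assms(3,4) in auto)
qed

lemma near_coset_lmult: "near_coset K (\<lambda>t. a \<otimes> \<gamma> t) t \<longleftrightarrow> near_coset K \<gamma> t"
  by (simp add: near_coset_def grp)

text \<open>The label of an exceptional interval is the index of the factor along which the path moves there.\<close>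

definition labelled_box :: "real set \<Rightarrow> (nat \<Rightarrow> real set) \<Rightarrow> nat set \<Rightarrow> (real \<Rightarrow> 'g) \<Rightarrow> bool" where
  "labelled_box F J I \<gamma> \<longleftrightarrow> piecewise_smooth A F \<gamma> \<and>
     (\<forall>j\<in>I. is_interval (J j) \<and> J j \<subseteq> {0..1} \<and> (\<forall>t\<in>J j \<inter> {0<..<1} - F. near_coset (N j) \<gamma> t)) \<and>
     (\<forall>t\<in>{0<..<1} - F - (\<Union>j\<in>I. J j). near_coset (range sg) \<gamma> t)"

lemma labelled_box_smooth: "labelled_box F J I \<gamma> \<Longrightarrow> piecewise_smooth A F \<gamma>"
  by (simp add: labelled_box_def)

lemma labelled_box_path:
  assumes "labelled_box F J I \<gamma>" "I \<subseteq> {..<n}" shows "box_path G A n N sg \<gamma>"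
  unfolding box_path_def
proof (intro exI conjI)
  note b = assms(1)[unfolded labelled_box_def]
  note sm = piecewise_smooth_near[OF labelled_box_smooth[OF assms(1)]]
  \<comment> \<open>One exceptional interval per factor, labelled by the identity map; an absent
    label receives the empty interval.\<close>
  let ?J = "\<lambda>j. if j \<in> I then J j else {}"
  show "piecewise_smooth A F \<gamma>" "n \<le> n + 1" "inj_on (\<lambda>j. j) {..<n}" using b by auto
  show "\<forall>j<n. is_interval (?J j) \<and> ?J j \<subseteq> {0..1} \<and> j < n \<and>
      (\<forall>t\<in>?J j \<inter> {0<..<1} - F. velocity A \<gamma> t \<in> tangent_space A (\<gamma> t <# N j) (\<gamma> t))"
    using b near_coset_velocity[OF sm] by auto
  have "(\<Union>j<n. ?J j) = (\<Union>j\<in>I. J j)" using assms(2) by (auto split: if_splits)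
  then show "\<forall>t\<in>{0<..<1} - F - (\<Union>j<n. ?J j). velocity A \<gamma> t \<in> tangent_space A (\<gamma> t <# range sg) (\<gamma> t)"
    using b near_coset_velocity[OF sm] by auto
qed

lemma labelled_box_lmult: "labelled_box F J I \<gamma> \<Longrightarrow> labelled_box F J I (\<lambda>t. a \<otimes> \<gamma> t)"
  using piecewise_smooth_image[OF atlas _ smooth_lmult subset_UNIV] by (simp add: labelled_box_def near_coset_lmult)

text \<open>The label sets have to be disjoint because each label owns a single interval.\<close>

lemma labelled_box_join:
  assumes b: "labelled_box F1 J1 I1 \<gamma>1" "labelled_box F2 J2 I2 \<gamma>2" and I: "I1 \<inter> I2 = {}"
    and e: "pathfinish \<gamma>1 = pathstart \<gamma>2"
  shows "\<exists>F J. labelled_box F J (I1 \<union> I2) (\<gamma>1 +++ \<gamma>2)"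
proof -
  let ?F = "insert (1/2) ((\<lambda>t. t / 2) ` F1 \<union> (\<lambda>t. (t + 1) / 2) ` F2)"
  let ?J = "\<lambda>j. if j \<in> I1 then (\<lambda>t. t / 2) ` J1 j else (\<lambda>t. (t + 1) / 2) ` J2 j"
  let ?\<gamma> = "\<gamma>1 +++ \<gamma>2"
  note b1 = b(1)[unfolded labelled_box_def] and b2 = b(2)[unfolded labelled_box_def]
  have left: "near_coset K ?\<gamma> t" if "t < 1/2" "near_coset K \<gamma>1 (2 * t)" for K t
    using near_coset_reparam[of K \<gamma>1 2 t 0 "{..<1/2}" ?\<gamma>] that by (auto simp: joinpaths_def)
  have right: "near_coset K ?\<gamma> t" if "t > 1/2" "near_coset K \<gamma>2 (2 * t - 1)" for K t
    using near_coset_reparam[of K \<gamma>2 2 t "- 1" "{1/2<..}" ?\<gamma>] that by (auto simp: joinpaths_def)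
  have half1: "t \<in> (\<lambda>t. t / 2) ` X" if "2 * t \<in> X" for t :: real and X using imageI[OF that, of "\<lambda>t. t / 2"] by simp
  have half2: "t \<in> (\<lambda>t. (t + 1) / 2) ` X" if "2 * t - 1 \<in> X" for t :: real and X
    using imageI[OF that, of "\<lambda>t. (t + 1) / 2"] by simp
  have F1: "2 * t \<notin> F1" if "t \<notin> ?F" for t using half1[of t F1] that by blast
  have F2: "2 * t - 1 \<notin> F2" if "t \<notin> ?F" for t using half2[of t F2] that by blast
  have "labelled_box ?F ?J (I1 \<union> I2) ?\<gamma>"
    unfolding labelled_box_def
  proof (intro conjI ballI)
    show "piecewise_smooth A ?F ?\<gamma>" by (rule piecewise_smooth_join[OF atlas _ _ e]) (use b1 b2 in auto)
  next
    fix j assume j: "j \<in> I1 \<union> I2"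
    have "connected (J1 j)" if "j \<in> I1" using b1 that by (simp add: is_interval_connected_1)
    moreover have "connected (J2 j)" if "j \<in> I2" using b2 that by (simp add: is_interval_connected_1)
    ultimately show "is_interval (?J j)"
      using j by (auto simp: is_interval_connected_1 intro!: connected_continuous_image continuous_intros)
    show "?J j \<subseteq> {0..1}"
    proof (cases "j \<in> I1")
      case True
      then have "J1 j \<subseteq> {0..1}" using b1 by blast
      then show ?thesis using True by (auto simp: image_subset_iff subset_iff)
    next
      case False
      then have "J2 j \<subseteq> {0..1}" using b2 j by blast
      then show ?thesis using False by (auto simp: image_subset_iff subset_iff)
    qed
    fix t assume t: "t \<in> ?J j \<inter> {0<..<1} - ?F"
    show "near_coset (N j) ?\<gamma> t"
    proof (cases "j \<in> I1")
      case True
      then obtain r where r: "r \<in> J1 j" "t = r / 2" using t by auto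
      have "J1 j \<subseteq> {0..1}" using b1 True by blast
      then have r01: "0 \<le> r" "r \<le> 1" using r(1) by auto
      have tr: "2 * t = r" "t \<noteq> 1/2" "0 < t" using r(2) t by auto
      then have "r \<in> {0<..<1} - F1" using r01 F1[of t] t by (auto simp: less_le)
      then have "near_coset (N j) \<gamma>1 r" using b1 True r(1) by blast
      moreover have "t < 1/2" using tr r01 by linarith
      ultimately show ?thesis using left[of t "N j"] tr(1) by simp
    next
      case False
      then obtain r where r: "r \<in> J2 j" "t = (r + 1) / 2" using t by auto
      have j2: "j \<in> I2" using False j by simp
      have "J2 j \<subseteq> {0..1}" using b2 j2 by blast
      then have r01: "0 \<le> r" "r \<le> 1" using r(1) by auto
      have tr: "2 * t - 1 = r" "t \<noteq> 1/2" "t < 1" using r(2) t by auto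
      then have "r \<in> {0<..<1} - F2" using r01 F2[of t] t by (auto simp: less_le)
      then have "near_coset (N j) \<gamma>2 r" using b2 j2 r(1) by blast
      moreover have "t > 1/2" using tr r01 by linarith
      ultimately show ?thesis using right[of t "N j"] tr(1) by simp
    qed
  next
    fix t assume t: "t \<in> {0<..<1} - ?F - (\<Union>j\<in>I1 \<union> I2. ?J j)"
    then have nJ: "t \<notin> ?J j" if "j \<in> I1 \<union> I2" for j using that by blast
    consider "t < 1/2" | "t > 1/2" using t by fastforce
    then show "near_coset (range sg) ?\<gamma> t"
    proof cases
      case 1
      have "2 * t \<notin> J1 j" if "j \<in> I1" for j using nJ[of j] half1[of t "J1 j"] that by auto
      then show ?thesis using 1 left[OF 1] b1 t F1[of t] by auto
    next
      case 2
      have "2 * t - 1 \<notin> J2 j" if "j \<in> I2" for j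
      proof -
        have "j \<notin> I1" using that I by blast
        then have "t \<notin> (\<lambda>t. (t + 1) / 2) ` J2 j" using nJ[of j] that by simp
        then show ?thesis using half2[of t "J2 j"] by blast
      qed
      then show ?thesis using 2 right[OF 2] b2 t F2[of t] by auto
    qed
  qed
  then show ?thesis by blast
qed

lemma line_box:
  obtains \<gamma> where "labelled_box {} J {} \<gamma>" "pathstart \<gamma> = sg w" "pathfinish \<gamma> = sg e"
    "curve_length A g \<gamma> = vm.nrm (e - w)"
proof -
  let ?l = "\<lambda>t. w + t *\<^sub>R (e - w)"
  let ?\<gamma> = "\<lambda>t. sg (?l t)"
  have "smooth_on UNIV ?l"
    by (rule smooth_on_add[OF open_UNIV smooth_on_const smooth_on_linear[OF bounded_linear_scaleR_left]])
  from smooth_map_on_compose[OF smooth_atlas_euclid smooth_atlas_euclid atlas smooth_map_on_euclidI[OF open_UNIV this] \<sigma>_smooth]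
  have sm: "smooth_map_on euclid_atlas A UNIV ?\<gamma>" by simp
  have ps: "piecewise_smooth A {} ?\<gamma>"
    by (rule smooth_map_piecewise_smooth[OF atlas smooth_map_on_subset[OF sm subset_UNIV]])
  have d: "inv (?\<gamma> t) \<otimes> ?\<gamma> r = sg ((r - t) *\<^sub>R (e - w))" for t r
    by (simp add: \<sigma>_minus[symmetric] \<sigma>_add[symmetric] scaleR_left_diff_distrib)
  have "labelled_box {} J {} ?\<gamma>"
    unfolding labelled_box_def near_coset_def d using ps by (auto intro: open_UNIV)
  moreover have "lvel ?\<gamma> t = S (e - w)" for t
  proof -
    have "lvel ?\<gamma> t = velocity A (\<lambda>r. sg ((r - t) *\<^sub>R (e - w))) t" unfolding lvel_def d ..
    also have "\<dots> = 1 *\<^sub>R velocity A (\<lambda>r. sg (r *\<^sub>R (e - w))) (t - t)"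
      by (rule velocity_reparam[where f = "\<lambda>r. r - t" and \<gamma> = "\<lambda>r. sg (r *\<^sub>R (e - w))", OF atlas \<sigma>_near])
        (auto intro!: derivative_eq_intros)
    finally show ?thesis by (simp add: S_def)
  qed
  then have "curve_length A g ?\<gamma> = vm.nrm (e - w)"
    by (simp add: curve_length_lvel[OF ps] vm_nrm)
  ultimately show ?thesis by (intro that[of ?\<gamma>]) (auto simp: pathstart_def pathfinish_def)
qed

text \<open>At position \<open>v\<close> the missing displacement in \<open>N i\<close> looks like
  its conjugate by \<open>sg (- v)\<close>, which depends on \<open>\<alpha> i v\<close> only. The
  strict bound 2 in place of 1 allows for an infimum that is not attained.\<close>

lemma fH_path:
  assumes i: "i < n" and h: "h \<in> N i" and le: "fH i h (\<alpha> i v) \<le> 1"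
  obtains k where "ps_path (N i) \<one> (sg (- v) \<otimes> h \<otimes> inv (sg (- v))) k" "curve_length A g k < 2"
proof -
  have "sg (- \<alpha> i v *\<^sub>R u i) \<otimes> h \<otimes> inv (sg (- \<alpha> i v *\<^sub>R u i)) = sg (- v) \<otimes> h \<otimes> inv (sg (- v))"
    by (rule conj_eq[OF i h]) (simp add: Ad_sg[OF i, of _ "- v"] linear_neg[OF \<alpha>_linear[OF i]])
  then have "path_dist A g (N i) \<one> (sg (- v) \<otimes> h \<otimes> inv (sg (- v))) < 2" using le by (simp add: fH_def)
  moreover obtain k where "ps_path (N i) \<one> (sg (- v) \<otimes> h \<otimes> inv (sg (- v))) k"
    using N_path[OF i normal[OF i h]] by blast
  ultimately show ?thesis using path_dist_less that by blast
qed

text \<open>A straight line to the first point, the move along its factor, then the remaining path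
  translated by \<open>h j\<close>. This translation changes neither projections nor coset
  conditions nor lengths.\<close>

lemma box_through_points:
  assumes "distinct is" "set is \<subseteq> {..<n}" "\<And>j. j < n \<Longrightarrow> h j \<in> N j"
    and "\<And>j. j \<in> set is \<Longrightarrow> fH j (h j) (\<alpha> j (a j)) \<le> 1"
  shows "\<exists>\<gamma> F J. labelled_box F J (set is) \<gamma> \<and> pathstart \<gamma> = sg w \<and> pathfinish \<gamma> = lprod h is \<otimes> sg e \<and>
    curve_length A g \<gamma> \<le> vm.plen w (map a is) e + 2 * real (length is) \<and> (\<forall>j\<in>set is. a j \<in> q ` path_image \<gamma>)"
  using assms(1,2,4)
proof (induction "is" arbitrary: w)
  case Nil
  obtain \<gamma> where "labelled_box {} (\<lambda>_. {}) {} \<gamma>" "pathstart \<gamma> = sg w" "pathfinish \<gamma> = sg e"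
    "curve_length A g \<gamma> = vm.nrm (e - w)" by (rule line_box)
  then show ?case by (intro exI[of _ \<gamma>] exI[of _ "{}"] exI[of _ "\<lambda>_. {}"]) simp
next
  case (Cons j "is")
  have j: "j < n" "h j \<in> N j" using Cons.prems assms(3) by auto
  obtain \<gamma>1 where g1: "labelled_box {} (\<lambda>_. {}) {} \<gamma>1" "pathstart \<gamma>1 = sg w" "pathfinish \<gamma>1 = sg (a j)"
    "curve_length A g \<gamma>1 = vm.nrm (a j - w)" by (rule line_box)
  obtain k where k: "ps_path (N j) \<one> (sg (- a j) \<otimes> h j \<otimes> inv (sg (- a j))) k" "curve_length A g k < 2"
    by (rule fH_path[OF j]) (use Cons.prems in auto)
  obtain F where F: "piecewise_smooth A F k" using k(1) by (auto simp: ps_path_def)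
  have kN: "inv (k t) \<otimes> k r \<in> N j" if "t \<in> {0<..<1}" "r \<in> {0<..<1}" for t r
  proof -
    have "k t \<in> N j" "k r \<in> N j" using k(1) that unfolding ps_path_def path_image_def by fastforce+
    then show ?thesis by (intro N_mult[OF j(1)] N_inv[OF j(1)])
  qed
  let ?k = "\<lambda>t. sg (a j) \<otimes> k t"
  have "near_coset (N j) k t" if "t \<in> {0<..<1}" for t
    unfolding near_coset_def by (intro exI[of _ "{0<..<1}"]) (use kN that in auto)
  then have "labelled_box F (\<lambda>_. {0..1}) {j} k"
    unfolding labelled_box_def using F by (auto simp: is_interval_cc)
  from labelled_box_lmult[OF this] have g2: "labelled_box F (\<lambda>_. {0..1}) {j} ?k" .
  \<comment> \<open>The conjugation in the endpoint of \<open>k\<close> is undone by the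
    translation: the move carries \<open>sg (a j)\<close> to
    \<open>h j \<otimes> sg (a j)\<close>.\<close>
  have e2: "pathstart ?k = sg (a j)" "pathfinish ?k = h j \<otimes> sg (a j)"
    using k(1) by (simp_all add: ps_path_def pathstart_def pathfinish_def \<sigma>_minus grp)
  have l2: "curve_length A g ?k < 2" using k(2) by (simp add: curve_length_lmult[OF F])
  obtain \<gamma>3 F3 J3 where g3: "labelled_box F3 J3 (set is) \<gamma>3" "pathstart \<gamma>3 = sg (a j)"
    "pathfinish \<gamma>3 = lprod h is \<otimes> sg e"
    "curve_length A g \<gamma>3 \<le> vm.plen (a j) (map a is) e + 2 * real (length is)"
    "\<And>i. i \<in> set is \<Longrightarrow> a i \<in> q ` path_image \<gamma>3"
    using Cons.IH[of "a j"] Cons.prems by auto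
  let ?g = "\<lambda>t. h j \<otimes> \<gamma>3 t"
  have g3': "labelled_box F3 J3 (set is) ?g" by (rule labelled_box_lmult[OF g3(1)])
  have e3: "pathstart ?g = h j \<otimes> sg (a j)" "pathfinish ?g = lprod h (j # is) \<otimes> sg e"
    using g3(2,3) by (simp_all add: pathstart_def pathfinish_def grp)
  have c23: "pathfinish ?k = pathstart ?g" using e2 e3 by simp
  have c12: "pathfinish \<gamma>1 = pathstart (?k +++ ?g)" using g1 e2 by simp
  obtain F4 J4 where g4: "labelled_box F4 J4 ({j} \<union> set is) (?k +++ ?g)"
    using labelled_box_join[OF g2 g3' _ c23] Cons.prems(1) by auto
  obtain F5 J5 where g5: "labelled_box F5 J5 ({} \<union> ({j} \<union> set is)) (\<gamma>1 +++ (?k +++ ?g))"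
    using labelled_box_join[OF g1(1) g4 _ c12] by auto
  have len: "curve_length A g (\<gamma>1 +++ (?k +++ ?g)) = curve_length A g \<gamma>1 + (curve_length A g ?k + curve_length A g \<gamma>3)"
    unfolding curve_length_join[OF labelled_box_smooth[OF g1(1)] labelled_box_smooth[OF g4] c12]
      curve_length_join[OF labelled_box_smooth[OF g2] labelled_box_smooth[OF g3'] c23]
      curve_length_lmult[OF labelled_box_smooth[OF g3(1)]] ..
  have im: "path_image (\<gamma>1 +++ (?k +++ ?g)) = path_image \<gamma>1 \<union> (path_image ?k \<union> path_image ?g)"
    by (simp add: path_image_join c12 c23)
  have "a j \<in> q ` path_image \<gamma>1"
    using pathfinish_in_path_image[of \<gamma>1] g1(3) q_\<sigma>[of "a j"] by (metis imageI)
  moreover have "a i \<in> q ` path_image ?g" if i: "i \<in> set is" for i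
  proof -
    obtain t where t: "t \<in> {0..1}" "a i = q (\<gamma>3 t)" using g3(5)[OF i] by (auto simp: path_image_def)
    then have "a i = q (?g t)" using q_N[OF j] by (simp add: q_mult)
    then show ?thesis unfolding path_image_def using t(1) by blast
  qed
  ultimately have "\<forall>i\<in>set (j # is). a i \<in> q ` path_image (\<gamma>1 +++ (?k +++ ?g))"
    unfolding im by auto
  moreover have "curve_length A g (\<gamma>1 +++ (?k +++ ?g)) \<le> vm.plen w (map a (j # is)) e + 2 * real (length (j # is))"
    using len g1(4) l2 g3(4) by simp
  moreover have "labelled_box F5 J5 (set (j # is)) (\<gamma>1 +++ (?k +++ ?g))" using g5 by simp
  moreover have "pathstart (\<gamma>1 +++ (?k +++ ?g)) = sg w" "pathfinish (\<gamma>1 +++ (?k +++ ?g)) = lprod h (j # is) \<otimes> sg e"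
    using g1(2) e3(2) by simp_all
  ultimately show ?case by blast
qed

section \<open>From arbitrary paths to half-space visiting box paths\<close>

abbreviation "admissible x y \<gamma> \<equiv> box_path G A n N sg \<gamma> \<and> pathstart \<gamma> = x \<and> pathfinish \<gamma> = y \<and>
  half_space_visiting G A n N \<alpha> g sg x y \<gamma>"

text \<open>The order of the factors is free: they commute, so the displacements along them multiply
  to the same element.\<close>

lemma admissible_through_points:
  assumes "distinct is" "set is = {..<n}" "\<And>i. i < n \<Longrightarrow> height i x y \<le> ereal (\<alpha> i (a i))"
  shows "\<exists>\<gamma>. admissible x y \<gamma> \<and> curve_length A g \<gamma> \<le> vm.plen 0 (map a is) (q (inv x \<otimes> y)) + 2 * real n"
proof -
  let ?z = "inv x \<otimes> y"
  obtain \<gamma> F J where g: "labelled_box F J (set is) \<gamma>" "pathstart \<gamma> = sg 0" "pathfinish \<gamma> = lprod (p ?z) is \<otimes> sg (q ?z)"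
    "curve_length A g \<gamma> \<le> vm.plen 0 (map a is) (q ?z) + 2 * real (length is)" "\<And>j. j \<in> set is \<Longrightarrow> a j \<in> q ` path_image \<gamma>"
    using box_through_points[of "is" "p ?z" a 0 "q ?z"] assms height(2) p_in by auto
  have "lprod (p ?z) is \<otimes> sg (q ?z) = ?z"
    using lprod_reorder[OF assms(1,2), of "p ?z"] decompose[of ?z] by (simp add: p_in)
  then have e: "pathstart \<gamma> = \<one>" "pathfinish \<gamma> = ?z" using g(2,3) by (simp_all add: \<sigma>_0)
  let ?g = "\<lambda>t. x \<otimes> \<gamma> t"
  have "box_path G A n N sg ?g" by (rule labelled_box_path[OF labelled_box_lmult[OF g(1)]]) (use assms(2) in simp)
  moreover have "pathstart ?g = x" "pathfinish ?g = y" using e by (simp_all add: pathstart_def pathfinish_def)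
  moreover have "half_space_visiting G A n N \<alpha> g sg x y ?g"
    unfolding half_space_visiting_def half_space_def
  proof (intro allI impI)
    fix i assume i: "i < n"
    then obtain t where "t \<in> {0..1}" "a i = q (\<gamma> t)" using g(5)[of i] assms(2) by (auto simp: path_image_def)
    then show "\<exists>t\<in>{0..1}. q (inv x \<otimes> (x \<otimes> \<gamma> t)) \<in> {v. height i x y \<le> ereal (\<alpha> i v)}"
      using assms(3)[OF i] by auto
  qed
  moreover have "length is = n" using assms(1,2) distinct_card by fastforce
  then have "curve_length A g ?g \<le> vm.plen 0 (map a is) (q ?z) + 2 * real n"
    using g(4) by (simp add: curve_length_lmult[OF labelled_box_smooth[OF g(1)]])
  ultimately show ?thesis by blast
qed

lemma admissible_exists: "\<exists>\<gamma>. admissible x y \<gamma>"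
proof -
  have "\<exists>r. height i x y \<le> ereal r" if "i < n" for i
    using height(1)[OF that, of x y] by (cases "height i x y") auto
  then obtain r where r: "\<And>i. i < n \<Longrightarrow> height i x y \<le> ereal (r i)" by metis
  have "height i x y \<le> ereal (\<alpha> i (r i *\<^sub>R u i))" if "i < n" for i using r[OF that] \<alpha>_scale_u[OF that] by simp
  then show ?thesis
    using admissible_through_points[of "[0..<n]" x y "\<lambda>i. r i *\<^sub>R u i"] by (auto simp: lessThan_atLeast0)
qed

lemma admissible_ps_path: "admissible x y \<gamma> \<Longrightarrow> ps_path UNIV x y \<gamma>"
  by (auto simp: ps_path_def box_path_def)

text \<open>By minimality of the height, some level \<open>H\<close> above the whole path but not
  below \<open>h - 1\<close> has \<open>fH\<close> larger than 1. The \<open>N i\<close>-coordinate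
  of the path, conjugated to that level, is therefore longer than 1, while its speed is contracted
  by the distance from \<open>\<alpha> i (q (\<gamma> t))\<close> up to \<open>H\<close>. Measuring
  from \<open>h\<close> instead costs \<open>exp (1/2)\<close>.\<close>

lemma missed_half_space_mass:
  assumes i: "i < n" and ps: "piecewise_smooth A F \<gamma>" "\<gamma> 0 = \<one>" "\<gamma> 1 = inv x \<otimes> y"
    and C: "C > 0" "\<And>X t. X \<in> \<nn> i \<Longrightarrow> t \<ge> 0 \<Longrightarrow> gn (Ad G A (sg (- t *\<^sub>R u i)) X) \<le> C * exp (- (t / 2)) * gn X"
    and h: "height i x y = ereal h" and miss: "\<And>t. t \<in> {0..1} \<Longrightarrow> \<alpha> i (q (\<gamma> t)) < h"
    and w: "\<And>t. t \<in> {0<..<1} - F \<Longrightarrow> w t = gn (dP i (lvel \<gamma> t))"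
    and int: "(\<lambda>t. exp (- ((h - \<alpha> i (q (\<gamma> t))) / 2)) * w t) integrable_on {0..1}"
  shows "1 \<le> C * exp (1/2) * integral {0..1} (\<lambda>t. exp (- ((h - \<alpha> i (q (\<gamma> t))) / 2)) * w t)"
proof -
  let ?v = "\<lambda>t. q (\<gamma> t)"
  let ?h = "p (inv x \<otimes> y) i"
  have bl: "bounded_linear (\<alpha> i)" using \<alpha>_linear[OF i] linear_conv_bounded_linear by blast
  have cq: "continuous_on UNIV q" by (rule smooth_map_on_continuous[OF atlas smooth_atlas_euclid q_smooth])
  have c\<gamma>: "continuous_on {0..1} \<gamma>" using ps(1) by (simp add: piecewise_smooth_def path_def)
  have "continuous_on {0..1} (\<lambda>t. \<alpha> i (?v t))"
    by (intro bounded_linear.continuous_on[OF bl] continuous_on_compose2[OF cq c\<gamma>]) auto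
  from continuous_attains_sup[OF compact_Icc _ this]
  obtain t1 where t1: "t1 \<in> {0..1}" "\<And>t. t \<in> {0..1} \<Longrightarrow> \<alpha> i (?v t) \<le> \<alpha> i (?v t1)" by auto
  \<comment> \<open>Below \<open>h\<close>, so that minimality applies; at least the maximum along
    the path, so that the contraction times are nonnegative; at least \<open>h - 1\<close>, which
    produces the factor \<open>exp (1/2)\<close>.\<close>
  define a where "a = max (\<alpha> i (?v t1)) (h - 1)"
  have "ereal a < height i x y" using miss[OF t1(1)] by (simp add: h a_def)
  from height(3)[OF i this] obtain H where H: "a \<le> H" "1 < fH i ?h H" by blast
  have le: "\<alpha> i (?v t) \<le> H" if "t \<in> {0..1}" for t using t1(2)[OF that] H(1) by (simp add: a_def)
  have Hh: "h - 1 \<le> H" using H(1) by (simp add: a_def)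
  let ?z = "sg (- H *\<^sub>R u i)" and ?k = "\<lambda>t. p (\<gamma> t) i"
  have pk: "piecewise_smooth A F ?k" by (rule piecewise_smooth_image[OF atlas ps(1) p_smooth[OF i]]) simp
  have "ps_path (N i) \<one> ?h ?k"
    unfolding ps_path_def using pk ps(2,3) p_in[OF i] p_one[OF i]
    by (auto simp: path_image_def pathstart_def pathfinish_def)
  from ps_path_conj[OF i this, of ?z]
  have "ps_path (N i) \<one> (?z \<otimes> ?h \<otimes> inv ?z) (\<lambda>t. ?z \<otimes> ?k t \<otimes> inv ?z)" by simp
  then have "fH i ?h H \<le> curve_length A g (\<lambda>t. ?z \<otimes> ?k t \<otimes> inv ?z)" unfolding fH_def by (rule path_dist_le)
  also have "\<dots> \<le> integral {0..1} (\<lambda>t. C * exp (1/2) * (exp (- ((h - \<alpha> i (?v t)) / 2)) * w t))"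
  proof (rule conj_path_length_le[OF pk integrable_on_mult_right[OF int]])
    fix t assume t: "t \<in> {0<..<1} - F"
    let ?X = "dP i (lvel \<gamma> t)" and ?r = "H - \<alpha> i (?v t)"
    have X: "?X \<in> \<nn> i" by (rule dP_\<nn>[OF i])
    have r0: "0 \<le> ?r" using le[of t] t by simp
    have "lvel ?k t = Ad G A (sg (?v t)) ?X" by (rule lvel_p[OF i piecewise_smooth_near[OF ps(1) t]])
    then have "Ad G A ?z (lvel ?k t) = Ad G A (sg (- H *\<^sub>R u i + ?v t)) ?X" by (simp only: Ad_mult \<sigma>_add)
    also have "\<dots> = Ad G A (sg (- ?r *\<^sub>R u i)) ?X"
    proof -
      have "\<alpha> i (- H *\<^sub>R u i + ?v t) = - ?r"
        unfolding linear_add[OF \<alpha>_linear[OF i]] \<alpha>_scale_u[OF i] by simp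
      then show ?thesis using Ad_sg[OF i X, of "- H *\<^sub>R u i + ?v t"] by (simp only:)
    qed
    finally have "gn (Ad G A ?z (lvel ?k t)) \<le> C * exp (- (?r / 2)) * gn ?X" using C(2)[OF X r0] by simp
    also have "\<dots> \<le> C * (exp (1/2) * exp (- ((h - \<alpha> i (?v t)) / 2))) * gn ?X"
    proof -
      have "- (?r / 2) \<le> 1/2 + - ((h - \<alpha> i (?v t)) / 2)" using Hh by (simp add: field_simps)
      then show ?thesis
        unfolding exp_add[symmetric] using C(1) gm.nrm_nonneg by (intro mult_right_mono mult_left_mono) simp_all
    qed
    finally show "gn (Ad G A ?z (lvel ?k t)) \<le> C * exp (1/2) * (exp (- ((h - \<alpha> i (?v t)) / 2)) * w t)"
      by (simp add: w[OF t] mult_ac)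
  qed
  also have "\<dots> = C * exp (1/2) * integral {0..1} (\<lambda>t. exp (- ((h - \<alpha> i (?v t)) / 2)) * w t)" by simp
  finally show ?thesis using H(2) by linarith
qed

lemma admissible_upper_bound:
  "\<exists>K. \<forall>x y \<gamma>. ps_path UNIV x y \<gamma> \<longrightarrow> (\<exists>\<gamma>'. admissible x y \<gamma>' \<and> curve_length A g \<gamma>' \<le> curve_length A g \<gamma> + K)"
proof -
  obtain c where c: "c > 0" "\<And>i X. i < n \<Longrightarrow> bform (dQ X) (dQ X) + (c * gn (dP i X))\<^sup>2 \<le> (gn X)\<^sup>2"
    using speed_lower_bound by blast
  obtain C where C: "C > 0" "\<And>i X t. i < n \<Longrightarrow> X \<in> \<nn> i \<Longrightarrow> t \<ge> 0 \<Longrightarrow>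
      gn (Ad G A (sg (- t *\<^sub>R u i)) X) \<le> C * exp (- (t / 2)) * gn X"
    using gn_contraction by blast
  define \<kappa> where "\<kappa> = (\<Sum>i<n. vm.nrm (u i))"
  have \<kappa>: "\<kappa> \<ge> 0" "\<And>i. i < n \<Longrightarrow> vm.nrm (u i) \<le> \<kappa>"
    unfolding \<kappa>_def by (auto intro!: sum_nonneg vm.nrm_nonneg member_le_sum)
  \<comment> \<open>A missed half-space forces mass at least \<open>c / (C * exp (1/2))\<close>.
    Division by \<open>n + 1\<close> rather than \<open>n\<close> leaves more than \<open>n\<close>
    portions and makes sense for \<open>n = 0\<close>.\<close>
  define m where "m = c / (C * exp (1/2) * (real n + 1))"
  have m: "m > 0" using c C by (simp add: m_def)
  obtain R where R: "R \<ge> 0" "\<And>r. r \<ge> R \<Longrightarrow> 8 * \<kappa> * (exp (- (r / 4)) / (1 - exp (- (1/4)))) < m"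
    using exp_threshold[OF m \<kappa>(1)] by blast
  define K where "K = 2 * \<kappa> * R"
  have K: "K \<ge> 0" using \<kappa>(1) R(1) by (simp add: K_def)
  \<comment> \<open>At most \<open>K\<close> for each detour, and 2 for the move inserted along each
    factor.\<close>
  have "\<exists>\<gamma>'. admissible x y \<gamma>' \<and> curve_length A g \<gamma>' \<le> curve_length A g \<gamma> + (real n * K + 2 * real n)"
    if path: "ps_path UNIV x y \<gamma>" for x y \<gamma>
  proof -
    let ?\<gamma> = "\<lambda>t. inv x \<otimes> \<gamma> t"
    obtain F where F: "piecewise_smooth A F \<gamma>" using path by (auto simp: ps_path_def)
    have ps: "piecewise_smooth A F ?\<gamma>" by (rule piecewise_smooth_image[OF atlas F smooth_lmult subset_UNIV])
    have fin: "finite F" using F by (simp add: piecewise_smooth_def)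
    have ends: "?\<gamma> 0 = \<one>" "?\<gamma> 1 = inv x \<otimes> y" using path by (auto simp: ps_path_def pathstart_def pathfinish_def)
    define v where "v t = q (?\<gamma> t)" for t
    define \<xi> where "\<xi> t = (if t \<in> {0<..<1} - F then lvel ?\<gamma> t else 0)" for t
    let ?N = "insert 0 (insert 1 F)"
    have off: "{0..1} - ?N = {0<..<1} - F" by auto
    have c\<gamma>: "continuous_on {0..1} ?\<gamma>" using ps by (simp add: piecewise_smooth_def path_def)
    have cv: "continuous_on {0..1} v"
      unfolding v_def
      by (rule continuous_on_compose2[OF smooth_map_on_continuous[OF atlas smooth_atlas_euclid q_smooth] c\<gamma>]) auto
    have len: "curve_length A g \<gamma> = integral {0..1} (\<lambda>t. gn (\<xi> t))"
    proof -
      have "integral {0..1} (\<lambda>t. gn (\<xi> t)) = integral {0..1} (\<lambda>t. gn (lvel \<gamma> t))"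
        by (rule integral_spike[of ?N]) (use fin in \<open>auto simp: \<xi>_def lvel_lmult intro: negligible_finite\<close>)
      then show ?thesis by (simp add: curve_length_lvel[OF F])
    qed
    have sp_int: "(\<lambda>t. gn (\<xi> t)) integrable_on {0..1}"
      by (rule integrable_spike[OF speed_integrable[OF ps], of ?N]) (use fin in \<open>auto simp: \<xi>_def intro: negligible_finite\<close>)
    interpret P: speed_path bform F v "\<lambda>t. dQ (\<xi> t)" "\<lambda>t. gn (\<xi> t)"
    proof unfold_locales
      fix t assume t: "t \<in> {0<..<1} - F"
      from q_derivative[OF piecewise_smooth_near[OF ps t]]
      show "(v has_vector_derivative dQ (\<xi> t)) (at t)" using t by (simp add: v_def[abs_def] \<xi>_def)
    next
      fix t :: real
      have "(vm.nrm (dQ (\<xi> t)))\<^sup>2 \<le> (gn (\<xi> t))\<^sup>2"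
        using speed_splitting[of "\<xi> t" 0] gm.b_nonneg[of "\<xi> t - S (dQ (\<xi> t))"] by (simp add: vm.nrm_sq gm.nrm_sq)
      then show "vm.nrm (dQ (\<xi> t)) \<le> gn (\<xi> t)" by (rule power2_le_imp_le) (rule gm.nrm_nonneg)
    qed (fact fin cv sp_int)+
    \<comment> \<open>The factor \<open>c\<close> makes \<open>w i\<close> the transverse speed that
      \<open>minkowski\<close> tolerates next to the full speed of \<open>v\<close>.\<close>
    define w where "w i t = c * gn (dP i (\<xi> t))" for i t
    have w0: "0 \<le> w i t" for i t using c(1) gm.nrm_nonneg by (simp add: w_def)
    have weight_int: "(\<lambda>t. f t * w i t) integrable_on {0..1}"
      if i: "i < n" and f: "continuous_on {0..1} f" for f i
    proof -
      have cP: "continuous_on UNIV (\<lambda>X. c * gn (dP i X))"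
        using dP_linear[OF i] linear_conv_bounded_linear
        by (intro continuous_intros continuous_on_compose2[OF gn_continuous] linear_continuous_on) auto
      have w_eq: "w i t = c * gn (dP i (lvel ?\<gamma> t))" if "t \<in> {0<..<1} - F" for t using that by (simp add: w_def \<xi>_def)
      have "continuous_on ({0<..<1} - F) (\<lambda>t. c * gn (dP i (lvel ?\<gamma> t)))"
        by (rule continuous_on_compose2[OF cP lvel_continuous[OF ps]]) auto
      then have cw: "continuous_on ({0..1} - ?N) (w i)"
        unfolding off by (rule continuous_on_eq) (simp add: w_eq)
      have "compact (closure (lvel ?\<gamma> ` ({0<..<1} - F)))" using lvel_bounded[OF ps] by simp
      from compact_imp_bounded[OF compact_continuous_image[OF continuous_on_subset[OF cP subset_UNIV] this]]
      have "bounded ((\<lambda>X. c * gn (dP i X)) ` lvel ?\<gamma> ` ({0<..<1} - F))"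
        by (rule bounded_subset) (intro image_mono closure_subset)
      moreover have "w i ` ({0..1} - ?N) = (\<lambda>X. c * gn (dP i X)) ` lvel ?\<gamma> ` ({0<..<1} - F)"
        unfolding off image_image by (rule image_cong) (simp_all add: w_eq)
      ultimately have bw: "bounded (w i ` ({0..1} - ?N))" by simp
      have bf: "bounded (f ` {0..1})" by (rule compact_imp_bounded[OF compact_continuous_image[OF f compact_Icc]])
      obtain B1 where B1: "\<And>t. t \<in> {0..1} - ?N \<Longrightarrow> norm (w i t) \<le> B1" using bw unfolding bounded_iff by blast
      obtain B2 where B2: "\<And>t. t \<in> {0..1} \<Longrightarrow> norm (f t) \<le> B2" using bf unfolding bounded_iff by blast
      show ?thesis
      proof (rule bounded_continuous_integrable[of ?N])
        show "finite ?N" using fin by simp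
        show "continuous_on ({0..1} - ?N) (\<lambda>t. f t * w i t)"
          by (rule continuous_on_mult[OF continuous_on_subset[OF f] cw]) auto
        have "norm (f t * w i t) \<le> B2 * B1" if "t \<in> {0..1} - ?N" for t
          unfolding norm_mult using B1[OF that] B2[of t] that by (intro mult_mono) (auto intro: order_trans[OF norm_ge_zero])
        then show "bounded ((\<lambda>t. f t * w i t) ` ({0..1} - ?N))" unfolding bounded_iff by blast
      qed
    qed
    have w_int: "w i integrable_on {0..1}" if "i < n" for i
      using weight_int[OF that, of "\<lambda>_. 1"] by simp
    have c\<alpha>: "continuous_on {0..1} (\<lambda>t. \<alpha> i (v t))" if "i < n" for i
      by (rule bounded_linear.continuous_on[OF _ cv]) (use \<alpha>_linear[OF that] linear_conv_bounded_linear in blast)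
    define visits where "visits i t \<longleftrightarrow> t \<in> {0..1} \<and> height i x y \<le> ereal (\<alpha> i (v t))" for i t
    define Vis where "Vis = {i. \<exists>t. visits i t}"
    define T where "T i = (SOME t. visits i t)" for i
    have T: "visits i (T i)" if "i \<in> Vis" for i using that unfolding Vis_def T_def by (auto intro: someI)
    \<comment> \<open>The value matters for missed half-spaces only, where the height is finite: a
      half-space of height -\<infinity> is everything and would be visited at once.\<close>
    define h where "h i = real_of_ereal (height i x y)" for i
    have h: "height i x y = ereal (h i)" "t \<in> {0..1} \<Longrightarrow> \<alpha> i (v t) < h i" if i: "i < n" "i \<notin> Vis" for i t
    proof -
      have miss: "ereal (\<alpha> i (v t)) < height i x y" if "t \<in> {0..1}" for t
      proof (rule ccontr)
        assume "\<not> ?thesis"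
        then have "visits i t" using that by (simp add: visits_def not_less)
        then show False using i(2) by (auto simp: Vis_def)
      qed
      have "height i x y \<noteq> - \<infinity>" using miss[of 0] by auto
      moreover have "height i x y \<noteq> \<infinity>" using height(1)[OF i(1), of x y] by auto
      ultimately show e: "height i x y = ereal (h i)" unfolding h_def by (cases "height i x y") auto
      show "\<alpha> i (v t) < h i" if "t \<in> {0..1}" using miss[OF that] e by simp
    qed
    define e where "e i t = exp (- ((h i - \<alpha> i (v t)) / 2)) * w i t" for i t
    have e_int: "e i integrable_on {0..1}" if "i < n" for i
      unfolding e_def[abs_def] by (rule weight_int[OF that]) (auto intro!: continuous_intros c\<alpha>[OF that])
    have mass: "real n * m \<le> integral {0..1} (e i)" if i: "i < n" "i \<notin> Vis" for i
    proof -
      \<comment> \<open>Dividing by \<open>c\<close> turns \<open>w i\<close> back into the norm of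
        the \<open>N i\<close>-component, in which the mass estimate is stated.\<close>
      have e': "(\<lambda>t. exp (- ((h i - \<alpha> i (q (?\<gamma> t))) / 2)) * (inverse c * w i t)) = (\<lambda>t. inverse c * e i t)"
        by (simp add: e_def v_def fun_eq_iff)
      have "1 \<le> C * exp (1/2) * integral {0..1} (\<lambda>t. exp (- ((h i - \<alpha> i (q (?\<gamma> t))) / 2)) * (inverse c * w i t))"
      proof (rule missed_half_space_mass[OF i(1) ps ends C(1) C(2)[OF i(1)] h(1)[OF i]])
        show "\<alpha> i (q (?\<gamma> t)) < h i" if "t \<in> {0..1}" for t using h(2)[OF i that] by (simp add: v_def)
        show "inverse c * w i t = gn (dP i (lvel ?\<gamma> t))" if "t \<in> {0<..<1} - F" for t
          using that c(1) by (simp add: w_def \<xi>_def)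
        show "(\<lambda>t. exp (- ((h i - \<alpha> i (q (?\<gamma> t))) / 2)) * (inverse c * w i t)) integrable_on {0..1}"
          unfolding e' by (rule integrable_on_mult_right[OF e_int[OF i(1)]])
      qed
      then have "1 \<le> C * exp (1/2) * (inverse c * integral {0..1} (e i))" unfolding e' by simp
      then have "c / (C * exp (1/2)) \<le> integral {0..1} (e i)" using c(1) C(1) by (simp add: field_simps)
      moreover have "real n * m \<le> c / (C * exp (1/2))"
      proof -
        have "real n * m = c / (C * exp (1/2)) * (real n / (real n + 1))" by (simp add: m_def)
        also have "\<dots> \<le> c / (C * exp (1/2)) * 1" using c(1) C(1) by (intro mult_left_mono) auto
        finally show ?thesis by simp
      qed
      ultimately show ?thesis by linarith
    qed
    have "\<exists>ls a. distinct ls \<and> set ls = {..<n} \<and> (\<forall>i\<in>{..<n}. height i x y \<le> ereal (\<alpha> i (a i))) \<and>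
      vm.plen (v 0) (map a ls) (v 1) \<le> integral {0..1} (\<lambda>t. gn (\<xi> t)) + real (card {..<n}) * K"
    proof (rule P.greedy_polygon[where c = m and e = e and Vis = Vis and T = T])
      show "finite {..<n}" "(0::real) \<le> 0" "(0::real) \<le> 1" "0 < m" "0 \<le> K" using m K by auto
      fix i assume i0: "i \<in> {..<n}"
      then have i: "i < n" by simp
      show "0 \<le> T i \<and> T i \<le> 1 \<and> height i x y \<le> ereal (\<alpha> i (v (T i)))" if "i \<in> Vis"
        using T[OF that] by (auto simp: visits_def)
      show "e i integrable_on {0..1} \<and> real (card {..<n}) * m \<le> integral {0..1} (e i)" if "i \<notin> Vis"
        using e_int[OF i] mass[OF i that] by simp
      show "0 \<le> e i t" for t using w0 by (simp add: e_def)
      fix a z assume iV: "i \<notin> Vis" and az: "0 \<le> a" "a \<le> z" "z \<le> 1" "m \<le> integral {a..z} (e i)"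
      have "\<exists>b. h i \<le> \<alpha> i b \<and> vm.nrm (b - v a) + vm.nrm (v z - b) \<le> integral {a..z} (\<lambda>t. gn (\<xi> t)) + 2 * \<kappa> * R"
      proof (rule P.segment_detour[OF az(1-3) w_int[OF i] w0 _ \<alpha>_linear[OF i] \<alpha>_u[OF i] \<kappa>(2)[OF i] h(2)[OF i iV]])
        show "bform (dQ (\<xi> t)) (dQ (\<xi> t)) + (w i t)\<^sup>2 \<le> (gn (\<xi> t))\<^sup>2" for t
          using c(2)[OF i, of "\<xi> t"] by (simp add: w_def)
        show "(\<lambda>t. exp (- ((h i - \<alpha> i (v t)) / 2)) * w i t) integrable_on {0..1}"
          using e_int[OF i] by (simp add: e_def[abs_def])
        show "m \<le> integral {a..z} (\<lambda>t. exp (- ((h i - \<alpha> i (v t)) / 2)) * w i t)"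
          using az(4) by (simp add: e_def[abs_def])
      qed (use R in auto)
      then show "\<exists>b. height i x y \<le> ereal (\<alpha> i b) \<and> vm.nrm (b - v a) + vm.nrm (v z - b) \<le> integral {a..z} (\<lambda>t. gn (\<xi> t)) + K"
        by (simp add: h(1)[OF i iV] K_def)
    qed
    then obtain ls a where ls: "distinct ls" "set ls = {..<n}" "\<And>i. i < n \<Longrightarrow> height i x y \<le> ereal (\<alpha> i (a i))"
      "vm.plen (v 0) (map a ls) (v 1) \<le> curve_length A g \<gamma> + real n * K"
      unfolding len by auto
    have "v 0 = 0" "v 1 = q (inv x \<otimes> y)" unfolding v_def ends by (simp_all add: q_one)
    then show ?thesis using admissible_through_points[OF ls(1-3)] ls(4) by fastforce
  qed
  then show ?thesis by blast
qed

lemma riem_box_dist_bound: "\<exists>K. \<forall>x y. \<bar>riem_dist A g x y - box_geodesic_dist G A n N \<alpha> g sg x y\<bar> \<le> K"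
proof -
  obtain K where K: "\<And>x y \<gamma>. ps_path UNIV x y \<gamma> \<Longrightarrow> \<exists>\<gamma>'. admissible x y \<gamma>' \<and> curve_length A g \<gamma>' \<le> curve_length A g \<gamma> + K"
    using admissible_upper_bound by blast
  \<comment> \<open>The 1 pays for a nearly shortest path, since a shortest one need not exist; the
    maximum is taken because the sign of \<open>K\<close> is not known.\<close>
  have "\<bar>riem_dist A g x y - box_geodesic_dist G A n N \<alpha> g sg x y\<bar> \<le> max 0 (K + 1)" for x y
  proof -
    let ?B = "{curve_length A g \<gamma> |\<gamma>. admissible x y \<gamma>}"
    have ne: "?B \<noteq> {}" using admissible_exists[of x y] by blast
    have bdd: "bdd_below ?B"
    proof (rule bdd_belowI[of _ 0])
      fix l assume "l \<in> ?B"
      then obtain \<gamma> where "l = curve_length A g \<gamma>" "ps_path UNIV x y \<gamma>" using admissible_ps_path by blast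
      then show "0 \<le> l" unfolding ps_path_def using curve_length_nonneg by blast
    qed
    have box: "box_geodesic_dist G A n N \<alpha> g sg x y = Inf ?B" by (simp add: box_geodesic_dist_def)
    have "path_dist A g UNIV x y \<le> Inf ?B"
    proof (rule cInf_greatest[OF ne])
      fix l assume "l \<in> ?B"
      then show "path_dist A g UNIV x y \<le> l" using path_dist_le[OF admissible_ps_path] by blast
    qed
    moreover have "Inf ?B \<le> path_dist A g UNIV x y + (K + 1)"
    proof -
      obtain \<gamma>0 where "ps_path UNIV x y \<gamma>0" using admissible_exists admissible_ps_path by blast
      moreover have "path_dist A g UNIV x y < path_dist A g UNIV x y + 1" by simp
      ultimately obtain \<gamma> where g: "ps_path UNIV x y \<gamma>" "curve_length A g \<gamma> < path_dist A g UNIV x y + 1"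
        by (rule path_dist_less)
      from K[OF g(1)] obtain \<gamma>' where g': "admissible x y \<gamma>'" "curve_length A g \<gamma>' \<le> curve_length A g \<gamma> + K" by blast
      have "Inf ?B \<le> curve_length A g \<gamma>'" by (rule cInf_lower[OF _ bdd]) (use g'(1) in blast)
      then show ?thesis using g(2) g'(2) by linarith
    qed
    ultimately show ?thesis unfolding box riem_dist_def by linarith
  qed
  then show ?thesis by blast
qed

end

theorem theorem5p2:
  fixes G :: "'g::{t2_space, second_countable_topology} monoid"
    and A :: "('g, 'e::euclidean_space) atlas"
    and n :: nat
    and N :: "nat \<Rightarrow> 'g set"
    and D :: "nat \<Rightarrow> 'e \<Rightarrow> 'e"
    and \<alpha> :: "nat \<Rightarrow> real^'k \<Rightarrow> real"
    and s sg :: "real^'k \<Rightarrow> 'g"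
    and g :: "'g \<Rightarrow> 'e \<Rightarrow> 'e \<Rightarrow> real"
  assumes "sol_type_group G A n N D \<alpha> s"
    and "left_invariant_metric G A g"
    and "perpendicular_splitting G A n N s g sg"
  shows "\<exists>C. \<forall>x y. \<bar>riem_dist A g x y - box_geodesic_dist G A n N \<alpha> g sg x y\<bar> \<le> C"
proof -
  have "lie_group G A" using assms(1) by (simp add: sol_type_group_def)
  then interpret sol_split G A g n N D \<alpha> s sg
    using assms by unfold_locales
  show ?thesis by (rule riem_box_dist_bound)
qed

end
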